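(* Let $k\ge 0$ be an integer and $r=k+1$. Let $u$ be the solution of the Burgers problem $u_t+uu_x-\nu u_{xx}=0$ in $I\times J$, $u(x,0)=g(x)$ for $x\in I$, $u(0,t)=u(1,t)=0$ for $t\in J$, and assume $u\in H^1(0,T;H^{1+r}(I))$. For a partition $I_h$ of $I$ with mesh size $h$, let $u_h(t)\in S_h^0$ be a solution of the semi-discrete weak Galerkin problem $$\big((u_h^0)_t,v^0\big)_h+\nu(d_{w,r}u_h,d_{w,r}v)_h+\tfrac13(u_h^0\,d_{w,r}u_h,v^0)_h-\tfrac13(u_h^0u_h^0,d_{w,r}v)_h=0,\quad \forall v\in S_h^0,\ t\in J,$$ with initial value $u_h(\cdot,0)=g_h=Q_hg$. Then there exists a constant $C$, independent of the partition $I_h$ (in particular of $h$) and of $t$, such that for all $t\in J$ $$\|u(t)-u_h^0(t)\|_h^2+\nu\int_0^t\|u_x(s)-d_{w,r}u_h(s)\|_h^2\,ds\le Ch^{2(k+1)}\Big(\|u(t)\|_{k+2-1}^2+\int_0^t\|u(s)\|_{k+2}^2\,ds\Big),$$ where $\|\cdot\|_{k+2-1}=\|\cdot\|_{k+1}$.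
   Context: $I=(0,1)$, $J=(0,T]$ with $0<T<\infty$, and $\nu>0$ is a constant (inverse Reynolds number). $\|\cdot\|_s$ is the norm of the Sobolev space $H^s(I)$. $H^l(0,T;H^s(I))$ is the usual space of functions of $t\in(0,T)$ with values in $H^s(I)$ whose time derivatives up to order $l$ are square integrable in time with values in $H^s(I)$. Partition: $I_h:\ 0=x_1<x_2<\dots<x_N=1$, $I_i=(x_i,x_{i+1})$, $h_i=x_{i+1}-x_i$, $h=\max_i h_i$. $P_m(I_i)$ denotes polynomials of degree at most $m$ on $I_i$. Weak functions: $S_h$ is the space of $v$ consisting of an interior part $v^0$ with $v^0|_{I_i}\in P_k(I_i)$ for each $i=1,\dots,N-1$ (no continuity between elements required), together with one real nodal value $v^i$ at each node $x_i$, $i=1,\dots,N$ (not necessarily related to traces of $v^0$). $S_h^0=\{v\in S_h: v^1=v^N=0\}$. Discrete weak derivative: for $v\in S_h$, $d_{w,r}v$ is the piecewise polynomial with $d_{w,r}v|_{I_i}\in P_r(I_i)$ determined on each element by $\int_{I_i}(d_{w,r}v)\,q\,dx=-\int_{I_i}v^0q'\,dx+v^{i+1}q(x_{i+1})-v^iq(x_i)$ for all $q\in P_r(I_i)$. Discrete inner product: $(u,v)_h=\sum_{i=1}^{N-1}\int_{I_i}uv\,dx$, $\|u\|_h^2=(u,u)_h$. Projection: for $w\in H^1(I)$, $Q_hw\in S_h$ has interior part $Q_h^0w$ equal on each $I_i$ to the $L^2(I_i)$-orthogonal projection of $w$ onto $P_k(I_i)$, and nodal values $(Q_hw)^i=w(x_i)$.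 For a solution $u_h$ of the semi-discrete problem, the interior part $u_h^0$ is understood to be continuous in time on $[0,T]$ and continuously differentiable in time on $J$. The constant $C$ may depend on $u$, $\nu$, $T$, $k$. *)

theory Defs
  imports "HOL-Analysis.Analysis" "HOL-Computational_Algebra.Polynomial"
begin

section \<open>Sobolev spaces on the unit interval\<close>

abbreviation unit_I :: "real set" where
  "unit_I \<equiv> {0<..<1}"

definition test_functions :: "real \<Rightarrow> real \<Rightarrow> (real \<Rightarrow> real) set" where
  "test_functions a b =
     {\<phi>. (\<forall>n y. (deriv ^^ n) \<phi> field_differentiable at y) \<and>
          (\<exists>K. compact K \<and> K \<subseteq> {a<..<b} \<and> (\<forall>y. y \<notin> K \<longrightarrow> \<phi> y = 0))}"

definition L2_I :: "(real \<Rightarrow> real) set" where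
  "L2_I = {f. f \<in> borel_measurable (lebesgue_on unit_I) \<and>
              integrable (lebesgue_on unit_I) (\<lambda>y. (f y)\<^sup>2)}"

definition has_weak_deriv :: "nat \<Rightarrow> (real \<Rightarrow> real) \<Rightarrow> (real \<Rightarrow> real) \<Rightarrow> bool" where
  "has_weak_deriv j f g \<longleftrightarrow> f \<in> L2_I \<and> g \<in> L2_I \<and>
     (\<forall>\<phi> \<in> test_functions 0 1.
        (LINT y|lebesgue_on unit_I. f y * (deriv ^^ j) \<phi> y)
          = (-1) ^ j * (LINT y|lebesgue_on unit_I. g y * \<phi> y))"

text \<open>Functions are used as representatives of their almost-everywhere classes; a weak derivative
  is unique only up to null sets, so the choice below matters only up to null sets.\<close>

definition weak_deriv :: "nat \<Rightarrow> (real \<Rightarrow> real) \<Rightarrow> real \<Rightarrow> real" where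
  "weak_deriv j f = (SOME g. has_weak_deriv j f g)"

definition sobolev :: "nat \<Rightarrow> (real \<Rightarrow> real) set" where
  "sobolev s = {f \<in> L2_I. \<forall>j\<le>s. \<exists>g. has_weak_deriv j f g}"

definition sobolev_norm :: "nat \<Rightarrow> (real \<Rightarrow> real) \<Rightarrow> real" where
  "sobolev_norm s f = sqrt (\<Sum>j\<le>s. LINT y|lebesgue_on unit_I. (weak_deriv j f y)\<^sup>2)"


section \<open>Sobolev-space-valued functions of time\<close>

text \<open>The spaces \<open>sobolev s\<close> are not types, so the library's Bochner integral does not apply to
  functions with values in them. The definitions below follow the library's
  \<open>has_bochner_integral\<close>, with the norm replaced by \<open>sobolev_norm s\<close>.\<close>

definition sobolev_simple :: "real \<Rightarrow> nat \<Rightarrow> (real \<Rightarrow> real \<Rightarrow> real) \<Rightarrow> bool" where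
  "sobolev_simple T s \<sigma> \<longleftrightarrow>
     simple_function (lebesgue_on {0<..<T}) \<sigma> \<and> (\<forall>t\<in>{0<..<T}. \<sigma> t \<in> sobolev s)"

definition strongly_measurable :: "real \<Rightarrow> nat \<Rightarrow> (real \<Rightarrow> real \<Rightarrow> real) \<Rightarrow> bool" where
  "strongly_measurable T s u \<longleftrightarrow>
     (\<exists>\<sigma>. (\<forall>n. sobolev_simple T s (\<sigma> n)) \<and>
          (AE t in lebesgue_on {0<..<T}. u t \<in> sobolev s \<and>
             (\<lambda>n. sobolev_norm s (\<lambda>y. u t y - \<sigma> n t y)) \<longlonglongrightarrow> 0))"

text \<open>For a simple function \<open>\<sigma> n\<close>, the pointwise time integral below is the finite sum
  defining its elementary integral.\<close>

definition has_sobolev_integral ::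
    "real \<Rightarrow> nat \<Rightarrow> (real \<Rightarrow> real \<Rightarrow> real) \<Rightarrow> (real \<Rightarrow> real) \<Rightarrow> bool" where
  "has_sobolev_integral T s u w \<longleftrightarrow> strongly_measurable T s u \<and> w \<in> sobolev s \<and>
     (\<exists>\<sigma>. (\<forall>n. sobolev_simple T s (\<sigma> n)) \<and>
          (\<lambda>n. \<integral>\<^sup>+ t. ennreal (sobolev_norm s (\<lambda>y. u t y - \<sigma> n t y))
                 \<partial>lebesgue_on {0<..<T}) \<longlonglongrightarrow> 0 \<and>
          (\<lambda>n. sobolev_norm s (\<lambda>y. (LINT t|lebesgue_on {0<..<T}. \<sigma> n t y) - w y))
             \<longlonglongrightarrow> 0)"

definition L2_sobolev :: "real \<Rightarrow> nat \<Rightarrow> (real \<Rightarrow> real \<Rightarrow> real) set" where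
  "L2_sobolev T s = {u. strongly_measurable T s u \<and>
     integrable (lebesgue_on {0<..<T}) (\<lambda>t. (sobolev_norm s (u t))\<^sup>2)}"

definition has_weak_time_deriv ::
    "real \<Rightarrow> nat \<Rightarrow> nat \<Rightarrow> (real \<Rightarrow> real \<Rightarrow> real) \<Rightarrow> (real \<Rightarrow> real \<Rightarrow> real) \<Rightarrow> bool" where
  "has_weak_time_deriv T s j u v \<longleftrightarrow> u \<in> L2_sobolev T s \<and> v \<in> L2_sobolev T s \<and>
     (\<forall>\<phi> \<in> test_functions 0 T. \<exists>w.
        has_sobolev_integral T s (\<lambda>t y. (deriv ^^ j) \<phi> t * u t y) w \<and>
        has_sobolev_integral T s (\<lambda>t y. (-1) ^ j * \<phi> t * v t y) w)"

text \<open>The space $H^l(0,T;H^s(I))$.\<close>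

definition H_sobolev :: "real \<Rightarrow> nat \<Rightarrow> nat \<Rightarrow> (real \<Rightarrow> real \<Rightarrow> real) set" where
  "H_sobolev T l s = {u. \<forall>j\<le>l. \<exists>v. has_weak_time_deriv T s j u v}"


section \<open>The Burgers problem\<close>

text \<open>Strong solutions: the equation holds almost everywhere, with weak derivatives in time and
  space. Joint continuity selects the representative for which the initial and boundary conditions
  and the value at each single time are meaningful; a solution in $H^1(0,T;H^2(I))$ has one.\<close>

definition burgers_solution ::
    "real \<Rightarrow> real \<Rightarrow> (real \<Rightarrow> real) \<Rightarrow> (real \<Rightarrow> real \<Rightarrow> real) \<Rightarrow> bool" where
  "burgers_solution \<nu> T g u \<longleftrightarrow>
     continuous_on ({0..T} \<times> {0..1}) (\<lambda>(t, y). u t y) \<and>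
     (\<exists>ut. has_weak_time_deriv T 0 1 u ut \<and>
        (AE t in lebesgue_on {0<..<T}. u t \<in> sobolev 2 \<and>
           (AE y in lebesgue_on unit_I.
              ut t y + u t y * weak_deriv 1 (u t) y - \<nu> * weak_deriv 2 (u t) y = 0))) \<and>
     (\<forall>y\<in>unit_I. u 0 y = g y) \<and>
     (\<forall>t\<in>{0<..T}. u t 0 = 0 \<and> u t 1 = 0)"


section \<open>Partitions and weak functions\<close>

definition is_partition :: "nat \<Rightarrow> (nat \<Rightarrow> real) \<Rightarrow> bool" where
  "is_partition N x \<longleftrightarrow> 2 \<le> N \<and> x 1 = 0 \<and> x N = 1 \<and> (\<forall>i\<in>{1..<N}. x i < x (i + 1))"

definition mesh_size :: "nat \<Rightarrow> (nat \<Rightarrow> real) \<Rightarrow> real" where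
  "mesh_size N x = Max ((\<lambda>i. x (i + 1) - x i) ` {1..<N})"

abbreviation elem :: "(nat \<Rightarrow> real) \<Rightarrow> nat \<Rightarrow> real set" where
  "elem x i \<equiv> {x i<..<x (i + 1)}"

text \<open>Only the values of \<open>interior_part v\<close> on the open elements and of \<open>nodal_value v i\<close> for
  \<open>i \<in> {1..N}\<close> are meaningful; \<open>weak_fun_eq\<close> is the corresponding equality.\<close>

datatype weak_fun = Weak_Fun (interior_part: "real \<Rightarrow> real") (nodal_value: "nat \<Rightarrow> real")

definition weak_fun_eq :: "nat \<Rightarrow> (nat \<Rightarrow> real) \<Rightarrow> weak_fun \<Rightarrow> weak_fun \<Rightarrow> bool" where
  "weak_fun_eq N x v w \<longleftrightarrow>
     (\<forall>i\<in>{1..<N}. \<forall>y\<in>elem x i. interior_part v y = interior_part w y) \<and>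
     (\<forall>i\<in>{1..N}. nodal_value v i = nodal_value w i)"

definition weak_space :: "nat \<Rightarrow> (nat \<Rightarrow> real) \<Rightarrow> nat \<Rightarrow> weak_fun set" where
  "weak_space N x k =
     {v. \<forall>i\<in>{1..<N}. \<exists>p. degree p \<le> k \<and> (\<forall>y\<in>elem x i. interior_part v y = poly p y)}"

definition weak_space0 :: "nat \<Rightarrow> (nat \<Rightarrow> real) \<Rightarrow> nat \<Rightarrow> weak_fun set" where
  "weak_space0 N x k = {v \<in> weak_space N x k. nodal_value v 1 = 0 \<and> nodal_value v N = 0}"

definition glue :: "nat \<Rightarrow> (nat \<Rightarrow> real) \<Rightarrow> (nat \<Rightarrow> real poly) \<Rightarrow> real \<Rightarrow> real" where
  "glue N x p y = (\<Sum>i\<in>{1..<N}. indicator (elem x i) y * poly (p i) y)"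

definition discrete_weak_deriv ::
    "nat \<Rightarrow> (nat \<Rightarrow> real) \<Rightarrow> nat \<Rightarrow> weak_fun \<Rightarrow> real \<Rightarrow> real" where
  "discrete_weak_deriv N x r v = glue N x (\<lambda>i. THE p. degree p \<le> r \<and>
     (\<forall>q. degree q \<le> r \<longrightarrow>
        (LINT y|lebesgue_on (elem x i). poly p y * poly q y)
          = - (LINT y|lebesgue_on (elem x i). interior_part v y * poly (pderiv q) y)
            + nodal_value v (i + 1) * poly q (x (i + 1)) - nodal_value v i * poly q (x i)))"

definition inner_h ::
    "nat \<Rightarrow> (nat \<Rightarrow> real) \<Rightarrow> (real \<Rightarrow> real) \<Rightarrow> (real \<Rightarrow> real) \<Rightarrow> real" where
  "inner_h N x f g = (\<Sum>i\<in>{1..<N}. LINT y|lebesgue_on (elem x i). f y * g y)"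

definition norm_h :: "nat \<Rightarrow> (nat \<Rightarrow> real) \<Rightarrow> (real \<Rightarrow> real) \<Rightarrow> real" where
  "norm_h N x f = sqrt (inner_h N x f f)"

definition proj_h :: "nat \<Rightarrow> (nat \<Rightarrow> real) \<Rightarrow> nat \<Rightarrow> (real \<Rightarrow> real) \<Rightarrow> weak_fun" where
  "proj_h N x k w = Weak_Fun
     (glue N x (\<lambda>i. THE p. degree p \<le> k \<and>
        (\<forall>q. degree q \<le> k \<longrightarrow>
           (LINT y|lebesgue_on (elem x i). (w y - poly p y) * poly q y) = 0)))
     (\<lambda>i. w (x i))"


section \<open>The semi-discrete weak Galerkin problem\<close>

text \<open>The derivative at \<open>t = T\<close> is one-sided. Regularity in time is imposed pointwise in space,
  which for piecewise polynomials of bounded degree is the same as in norm.\<close>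

definition time_deriv :: "real \<Rightarrow> (real \<Rightarrow> real \<Rightarrow> real) \<Rightarrow> real \<Rightarrow> real \<Rightarrow> real" where
  "time_deriv T w t y = vector_derivative (\<lambda>s. w s y) (at t within {0<..T})"

definition time_regular :: "nat \<Rightarrow> (nat \<Rightarrow> real) \<Rightarrow> real \<Rightarrow> (real \<Rightarrow> real \<Rightarrow> real) \<Rightarrow> bool" where
  "time_regular N x T w \<longleftrightarrow> (\<forall>i\<in>{1..<N}. \<forall>y\<in>elem x i.
     continuous_on {0..T} (\<lambda>t. w t y) \<and>
     (\<lambda>t. w t y) differentiable_on {0<..T} \<and>
     continuous_on {0<..T} (\<lambda>t. time_deriv T w t y))"

definition semidiscrete_solution ::
    "nat \<Rightarrow> (nat \<Rightarrow> real) \<Rightarrow> nat \<Rightarrow> nat \<Rightarrow> real \<Rightarrow> real \<Rightarrow> (real \<Rightarrow> real) \<Rightarrow> (real \<Rightarrow> weak_fun) \<Rightarrow> bool"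
where
  "semidiscrete_solution N x k r \<nu> T g uh \<longleftrightarrow>
     (\<forall>t\<in>{0..T}. uh t \<in> weak_space0 N x k) \<and>
     time_regular N x T (\<lambda>t. interior_part (uh t)) \<and>
     weak_fun_eq N x (uh 0) (proj_h N x k g) \<and>
     (\<forall>t\<in>{0<..T}. \<forall>v\<in>weak_space0 N x k.
        inner_h N x (time_deriv T (\<lambda>s. interior_part (uh s)) t) (interior_part v)
        + \<nu> * inner_h N x (discrete_weak_deriv N x r (uh t)) (discrete_weak_deriv N x r v)
        + 1 / 3 * inner_h N x (\<lambda>y. interior_part (uh t) y * discrete_weak_deriv N x r (uh t) y)
                    (interior_part v)
        - 1 / 3 * inner_h N x (\<lambda>y. interior_part (uh t) y * interior_part (uh t) y)
                    (discrete_weak_deriv N x r v) = 0)"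

end

theory Submission
  imports Defs
begin

text \<open>Let \<open>e = Q\<^sub>h u - u\<^sub>h\<close> and \<open>d = d\<^sub>w e\<close>. Since \<open>d\<^sub>w (Q\<^sub>h u)\<close> is the
  \<open>L\<^sup>2\<close> projection of \<open>u\<^sub>x\<close> and the cubic terms cancel, testing the error equation with \<open>e\<close> gives an
  energy inequality once the consistency error is controlled. For this the flux
  \<open>F = - \<nu> u\<^sub>x + u\<^sup>2 / 3\<close> is replaced by the continuous piecewise polynomial \<open>\<rho>\<close> that agrees with \<open>F\<close> at
  the nodes and whose derivative is the projection of \<open>F\<^sub>x\<close>: for test functions \<open>v\<close> vanishing at the
  boundary the nodal terms telescope, so that \<open>(\<rho>, d\<^sub>w v) = - (F\<^sub>x, v)\<close> exactly. By the equation,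
  \<open>F\<^sub>x = - (\<nu> / 3) u\<^sub>x\<^sub>x - (2 / 3) u\<^sub>t\<close> is linear in \<open>u\<close>, hence no Sobolev estimates of products are
  needed. Gronwall's inequality bounds both error terms by a multiple of \<open>h\<^bsup>2 (k + 1)\<^esup>\<close> that depends on
  \<open>u\<close>. The bracket on the right of the theorem is bounded below in \<open>t\<close> if \<open>u\<close> does not vanish
  initially. If it does, then zero is a discrete solution on every mesh, so \<open>u = 0\<close> by refinement,
  and the same estimate with vanishing data shows that the error is zero.\<close>

text \<open>No a priori bound on the discrete solution is at hand, so the nonlinear terms are
  expanded around the projections of u and u_x. These are bounded uniformly in the mesh by an
  inverse inequality, and each remaining product of \<open>e\<close> and \<open>d\<close> has such a
  bounded factor. The square of the bound on u_x is only integrable in time, hence the form of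
  Gronwall's inequality. The consistency error involves u_t, which the bracket of the theorem does
  not contain; this is why the bracket enters only at the end, through its lower bound. Two kinds of
  times need care. At a single time only continuity of u(t) is known, Sobolev regularity holding for
  almost every time, so the projection error at t is found by duality. At time 0 the discrete
  solution is continuous but not assumed differentiable, so the energy argument runs on
  [\<delta>, T] and \<delta> tends to 0. Sobolev-valued functions of time are accessed through their
  pairings with bounded functions of space, which are scalar and absolutely continuous.\<close>

abbreviation Leb :: "real \<Rightarrow> real \<Rightarrow> real measure" where
  "Leb a b \<equiv> lebesgue_on {a<..<b}"

section \<open>Lebesgue measure on bounded open intervals\<close>

lemma Leb_integrable_iff:
  "integrable (Leb a b) f \<longleftrightarrow> set_integrable lebesgue {a<..<b} (f :: real \<Rightarrow> real)"
  unfolding set_integrable_def by (simp add: integrable_restrict_space)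

lemma Leb_integral_eq:
  "integral\<^sup>L (Leb a b) f = (LINT y:{a<..<b}|lebesgue. (f y :: real))"
  unfolding set_lebesgue_integral_def by (simp add: integral_restrict_space)

lemma finite_measure_Leb [simp]: "finite_measure (Leb a b)"
  by (rule finite_measureI) (cases "a \<le> b"; simp add: emeasure_restrict_space)

lemma measure_Leb: "a \<le> b \<Longrightarrow> measure (Leb a b) (space (Leb a b)) = b - a"
  by (simp add: measure_restrict_space)

lemma Leb_const [simp]: "integrable (Leb a b) (\<lambda>y. c :: real)"
  using finite_measure.integrable_const[OF finite_measure_Leb] .

lemma Leb_integral_const: "a \<le> b \<Longrightarrow> (LINT y|Leb a b. c :: real) = (b - a) * c"
  using measure_Leb[of a b] by simp

lemma Leb_integrable_subset:
  fixes f :: "real \<Rightarrow> real"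
  assumes "integrable (Leb a b) f" "{c<..<d} \<subseteq> {a<..<b}"
  shows "integrable (Leb c d) f"
  using assms unfolding Leb_integrable_iff by (rule_tac set_integrable_subset) auto

lemma Leb_measurable_subset:
  assumes "f \<in> borel_measurable (Leb a b)" "{c<..<d} \<subseteq> {a<..<b}"
  shows "f \<in> borel_measurable (Leb c d)"
  using assms measurable_restrict_mono by blast

lemma AE_Leb_iff:
  "(AE y in Leb a b. P y) \<longleftrightarrow> (AE y in lebesgue. y \<in> {a<..<b} \<longrightarrow> P y)"
  by (subst AE_restrict_space_iff) auto

lemma AE_Leb_subset:
  assumes "AE y in Leb a b. P y" "{c<..<d} \<subseteq> {a<..<b}"
  shows "AE y in Leb c d. P y"
  using assms unfolding AE_Leb_iff by (auto elim!: eventually_mono)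

lemma AE_LebI: "(\<And>y. a < y \<Longrightarrow> y < b \<Longrightarrow> P y) \<Longrightarrow> AE y in Leb a b. P y"
  unfolding AE_Leb_iff by auto

lemma Leb_integral_empty: "b \<le> a \<Longrightarrow> integral\<^sup>L (Leb a b) f = (0::real)"
  by (simp add: Leb_integral_eq set_lebesgue_integral_def)

lemma Leb_integral_split:
  fixes f :: "real \<Rightarrow> real"
  assumes "integrable (Leb a b) f" "a \<le> c" "c \<le> b"
  shows "integral\<^sup>L (Leb a b) f = integral\<^sup>L (Leb a c) f + integral\<^sup>L (Leb c b) f"
proof (cases "c = a \<or> c = b")
  case True
  then show ?thesis by (auto simp: Leb_integral_empty)
next
  case False
  then have c: "a < c" "c < b" using assms by auto
  have *: "set_integrable lebesgue {a<..<c} f" "set_integrable lebesgue {c<..<b} f"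
    using assms(1) c unfolding Leb_integrable_iff by (auto intro: set_integrable_subset)
  have "(LINT y:{a<..<c} \<union> {c<..<b}|lebesgue. f y) = (LINT y:{a<..<b}|lebesgue. f y)"
  proof (rule set_integral_cong_set)
    show "set_borel_measurable lebesgue {a<..<b} f"
      using assms(1) unfolding Leb_integrable_iff set_borel_measurable_def set_integrable_def by auto
    show "set_borel_measurable lebesgue ({a<..<c} \<union> {c<..<b}) f"
      using set_integrable_Un[OF *] unfolding set_borel_measurable_def set_integrable_def by auto
    \<comment> \<open>The two open pieces miss only the point \<open>c\<close>, a null set.\<close>
    have "AE y in lebesgue. y \<noteq> c"
      by (rule AE_not_in[of "{c}", simplified]) auto
    then show "AE x in lebesgue. (x \<in> {a<..<b}) = (x \<in> {a<..<c} \<union> {c<..<b})"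
      by eventually_elim (use c in auto)
  qed
  moreover have "(LINT y:{a<..<c} \<union> {c<..<b}|lebesgue. f y)
      = (LINT y:{a<..<c}|lebesgue. f y) + (LINT y:{c<..<b}|lebesgue. f y)"
    by (rule set_integral_Un) (use * in auto)
  ultimately show ?thesis by (simp add: Leb_integral_eq)
qed

lemma continuous_imp_Leb_measurable:
  fixes f :: "real \<Rightarrow> real"
  assumes "continuous_on {a..b} f"
  shows "f \<in> borel_measurable (Leb a b)"
proof -
  have "f \<in> borel_measurable (lebesgue_on {a..b})"
    by (rule continuous_imp_measurable_on_sets_lebesgue[OF assms]) auto
  then show ?thesis by (rule measurable_restrict_mono) auto
qed

lemma Leb_integrable_bounded:
  fixes f :: "real \<Rightarrow> real"
  assumes "f \<in> borel_measurable (Leb a b)" "AE y in Leb a b. \<bar>f y\<bar> \<le> M"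
  shows "integrable (Leb a b) f"
  by (rule Bochner_Integration.integrable_bound[of _ "\<lambda>y. M"])
     (use assms in \<open>auto elim!: eventually_mono\<close>)

lemma continuous_imp_Leb_integrable:
  fixes f :: "real \<Rightarrow> real"
  assumes "continuous_on {a..b} f"
  shows "integrable (Leb a b) f"
proof -
  have "bounded (f ` {a..b})" by (intro compact_imp_bounded compact_continuous_image assms) auto
  then obtain M where "\<forall>y\<in>{a..b}. \<bar>f y\<bar> \<le> M"
    unfolding bounded_iff by auto
  then show ?thesis
    by (intro Leb_integrable_bounded[of _ _ _ M] continuous_imp_Leb_measurable assms AE_LebI) auto
qed

lemma Leb_integrable_mult_bounded:
  fixes f g :: "real \<Rightarrow> real"
  assumes "integrable (Leb a b) f" "g \<in> borel_measurable (Leb a b)" "AE y in Leb a b. \<bar>g y\<bar> \<le> M"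
  shows "integrable (Leb a b) (\<lambda>y. f y * g y)"
proof (rule Bochner_Integration.integrable_bound[of _ "\<lambda>y. M * f y"])
  show "integrable (Leb a b) (\<lambda>y. M * f y)" using assms by auto
  show "(\<lambda>y. f y * g y) \<in> borel_measurable (Leb a b)" using assms by auto
  show "AE y in Leb a b. norm (f y * g y) \<le> norm (M * f y)"
    using assms(3) 
  proof eventually_elim
    case (elim y)
    then have "\<bar>f y\<bar> * \<bar>g y\<bar> \<le> \<bar>f y\<bar> * \<bar>M\<bar>" by (intro mult_left_mono) auto
    then show ?case by (simp add: abs_mult mult.commute)
  qed
qed

lemma Leb_integrable_mult_continuous:
  fixes f g :: "real \<Rightarrow> real"
  assumes "integrable (Leb a b) f" "continuous_on {a..b} g"
  shows "integrable (Leb a b) (\<lambda>y. f y * g y)"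
proof -
  have "bounded (g ` {a..b})" by (intro compact_imp_bounded compact_continuous_image assms) auto
  then obtain M where "\<forall>y\<in>{a..b}. \<bar>g y\<bar> \<le> M"
    unfolding bounded_iff by auto
  then show ?thesis
    by (intro Leb_integrable_mult_bounded[of _ _ _ _ M] continuous_imp_Leb_measurable assms AE_LebI) auto
qed

section \<open>Square integrable functions\<close>

text \<open>Measurability is demanded separately because it does not follow from integrability of
  the square. The interval is a parameter: the same notion serves on elements, on the unit interval
  and on time intervals.\<close>

definition sq_integrable :: "real \<Rightarrow> real \<Rightarrow> (real \<Rightarrow> real) \<Rightarrow> bool" where
  "sq_integrable a b f \<longleftrightarrow> f \<in> borel_measurable (Leb a b) \<and> integrable (Leb a b) (\<lambda>y. (f y)\<^sup>2)"

lemma L2_I_iff: "f \<in> L2_I \<longleftrightarrow> sq_integrable 0 1 f"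
  by (auto simp: L2_I_def sq_integrable_def)

lemma sq_integrable_mult:
  assumes "sq_integrable a b f" "sq_integrable a b g"
  shows "integrable (Leb a b) (\<lambda>y. f y * g y)"
proof (rule Bochner_Integration.integrable_bound[of _ "\<lambda>y. (f y)\<^sup>2 + (g y)\<^sup>2"])
  show "AE y in Leb a b. norm (f y * g y) \<le> norm ((f y)\<^sup>2 + (g y)\<^sup>2)"
  proof (intro AE_LebI)
    fix y
    have "2 * (\<bar>f y\<bar> * \<bar>g y\<bar>) \<le> (f y)\<^sup>2 + (g y)\<^sup>2"
      using sum_squares_bound[of "\<bar>f y\<bar>" "\<bar>g y\<bar>"] by simp
    moreover have "0 \<le> \<bar>f y\<bar> * \<bar>g y\<bar>" by simp
    ultimately show "norm (f y * g y) \<le> norm ((f y)\<^sup>2 + (g y)\<^sup>2)"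
      unfolding real_norm_def abs_mult by linarith
  qed
qed (use assms in \<open>auto simp: sq_integrable_def\<close>)

lemma sq_integrable_const [simp]: "sq_integrable a b (\<lambda>y. c)"
  by (simp add: sq_integrable_def)

lemma sq_integrable_imp_integrable: "sq_integrable a b f \<Longrightarrow> integrable (Leb a b) f"
  using sq_integrable_mult[of a b f "\<lambda>y. 1"] by simp

lemma sq_integrable_cmult [simp]: "sq_integrable a b f \<Longrightarrow> sq_integrable a b (\<lambda>y. c * f y)"
  by (auto simp: sq_integrable_def power_mult_distrib)

lemma sq_integrable_add [simp]:
  assumes "sq_integrable a b f" "sq_integrable a b g"
  shows "sq_integrable a b (\<lambda>y. f y + g y)"
proof -
  have "integrable (Leb a b) (\<lambda>y. (f y)\<^sup>2 + (g y)\<^sup>2 + 2 * (f y * g y))"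
    using assms sq_integrable_mult[OF assms] by (auto simp: sq_integrable_def)
  then show ?thesis using assms unfolding sq_integrable_def power2_sum by (auto simp: mult.assoc)
qed

lemma sq_integrable_diff [simp]:
  assumes "sq_integrable a b f" "sq_integrable a b g"
  shows "sq_integrable a b (\<lambda>y. f y - g y)"
  using sq_integrable_add[OF assms(1) sq_integrable_cmult[OF assms(2), of "-1"]] by simp

lemma sq_integrable_mult_bounded:
  assumes "sq_integrable a b f" "g \<in> borel_measurable (Leb a b)" "AE y in Leb a b. \<bar>g y\<bar> \<le> M"
  shows "sq_integrable a b (\<lambda>y. f y * g y)"
proof -
  have "AE y in Leb a b. \<bar>(g y)\<^sup>2\<bar> \<le> M\<^sup>2"
    using assms(3) by eventually_elim (simp add: abs_le_square_iff[symmetric])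
  then have "integrable (Leb a b) (\<lambda>y. (f y)\<^sup>2 * (g y)\<^sup>2)"
    using assms by (intro Leb_integrable_mult_bounded[of _ _ _ _ "M\<^sup>2"]) (auto simp: sq_integrable_def)
  then show ?thesis using assms by (auto simp: sq_integrable_def power_mult_distrib)
qed

lemma sq_integrable_subset:
  assumes "sq_integrable a b f" "{c<..<d} \<subseteq> {a<..<b}"
  shows "sq_integrable c d f"
  using assms Leb_integrable_subset[of a b "\<lambda>y. (f y)\<^sup>2" c d] Leb_measurable_subset[of f a b c d]
  unfolding sq_integrable_def by blast

lemma sq_integrable_bounded:
  assumes "f \<in> borel_measurable (Leb a b)" "AE y in Leb a b. \<bar>f y\<bar> \<le> M"
  shows "sq_integrable a b f"
  using sq_integrable_mult_bounded[of a b "\<lambda>y. 1" f M] assms by simp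

lemma continuous_imp_sq_integrable:
  assumes "continuous_on {a..b} f"
  shows "sq_integrable a b f"
  using assms continuous_imp_Leb_integrable[of a b "\<lambda>y. (f y)\<^sup>2"] continuous_imp_Leb_measurable[of a b f]
  by (auto simp: sq_integrable_def intro!: continuous_intros)

text \<open>The integral of \<open>(s * f y - r * g y)\<^sup>2\<close> is a nonnegative quadratic
  form in \<open>s\<close> and \<open>r\<close>. Taking \<open>s = B\<close> and
  \<open>r = A\<close> gives \<open>A * (A * C - B\<^sup>2)\<close>, which settles the case where
  \<open>A\<close> is positive.\<close>

lemma integral_Cauchy_Schwarz:
  assumes "sq_integrable a b f" "sq_integrable a b g"
  shows "(LINT y|Leb a b. f y * g y)\<^sup>2 \<le> (LINT y|Leb a b. (f y)\<^sup>2) * (LINT y|Leb a b. (g y)\<^sup>2)"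
proof -
  define A B C where "A = (LINT y|Leb a b. (f y)\<^sup>2)" and "B = (LINT y|Leb a b. f y * g y)"
    and "C = (LINT y|Leb a b. (g y)\<^sup>2)"
  have int: "integrable (Leb a b) (\<lambda>y. (f y)\<^sup>2)" "integrable (Leb a b) (\<lambda>y. (g y)\<^sup>2)"
      "integrable (Leb a b) (\<lambda>y. f y * g y)"
    using assms sq_integrable_mult[OF assms] unfolding sq_integrable_def by blast+
  have nn: "0 \<le> s\<^sup>2 * A - 2 * s * r * B + r\<^sup>2 * C" for s r
  proof -
    have "0 \<le> (LINT y|Leb a b. (s * f y - r * g y)\<^sup>2)" by simp
    also have "(\<lambda>y. (s * f y - r * g y)\<^sup>2) = (\<lambda>y. s\<^sup>2 * (f y)\<^sup>2 - 2 * s * r * (f y * g y) + r\<^sup>2 * (g y)\<^sup>2)"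
      by (auto simp: power2_eq_square algebra_simps)
    also have "(LINT y|Leb a b. s\<^sup>2 * (f y)\<^sup>2 - 2 * s * r * (f y * g y) + r\<^sup>2 * (g y)\<^sup>2)
        = s\<^sup>2 * A - 2 * s * r * B + r\<^sup>2 * C"
      unfolding A_def B_def C_def using int by simp
    finally show ?thesis .
  qed
  have "0 \<le> A" "0 \<le> C" unfolding A_def C_def by auto
  have "B\<^sup>2 \<le> A * C"
  proof (cases "A = 0")
    case False
    then have "0 \<le> A * (A * C - B\<^sup>2)" using nn[of B A]
      by (simp add: power2_eq_square algebra_simps)
    with False \<open>0 \<le> A\<close> show ?thesis by (simp add: zero_le_mult_iff)
  next
    case True
    have "B = 0"
    proof (rule ccontr)
      assume "B \<noteq> 0"
      \<comment> \<open>With \<open>A = 0\<close> and \<open>r = 1\<close> the form is affine in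
        \<open>s\<close>; this choice of \<open>s\<close> gives it the value -1.\<close>
      then show False using nn[of "(C + 1) / (2 * B)" 1] True by (simp add: field_simps)
    qed
    then show ?thesis using True by simp
  qed
  then show ?thesis by (simp add: A_def B_def C_def)
qed

lemma integral_squared_le:
  assumes "sq_integrable a b f" "a \<le> b"
  shows "(LINT y|Leb a b. f y)\<^sup>2 \<le> (b - a) * (LINT y|Leb a b. (f y)\<^sup>2)"
  using integral_Cauchy_Schwarz[OF assms(1), of "\<lambda>y. 1"] assms(2) measure_Leb[of a b]
  by (simp add: mult.commute)

section \<open>Primitives\<close>

text \<open>This is absolute continuity of \<open>F\<close> on [a, b] with density \<open>f\<close>,
  stated through the integral so that \<open>f\<close> matters only up to null sets. One calculus
  thereby covers weak derivatives in space, weak derivatives in time and classical derivatives of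
  the discrete solution.\<close>

definition primitive_on :: "real \<Rightarrow> real \<Rightarrow> (real \<Rightarrow> real) \<Rightarrow> (real \<Rightarrow> real) \<Rightarrow> bool" where
  "primitive_on a b F f \<longleftrightarrow> a \<le> b \<and> integrable (Leb a b) f \<and>
     (\<forall>y\<in>{a..b}. F y = F a + integral\<^sup>L (Leb a y) f)"

lemma primitive_onD:
  assumes "primitive_on a b F f"
  shows "a \<le> b" "integrable (Leb a b) f"
    "a \<le> y \<Longrightarrow> y \<le> b \<Longrightarrow> F y = F a + integral\<^sup>L (Leb a y) f"
proof -
  show "a \<le> b" "integrable (Leb a b) f" using assms unfolding primitive_on_def by blast+
  show "a \<le> y \<Longrightarrow> y \<le> b \<Longrightarrow> F y = F a + integral\<^sup>L (Leb a y) f"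
    using assms[unfolded primitive_on_def, THEN conjunct2, THEN conjunct2, rule_format, of y]
    by (metis atLeastAtMost_iff)
qed

lemma primitive_on_diff:
  assumes "primitive_on a b F f" "a \<le> c" "c \<le> d" "d \<le> b"
  shows "F d - F c = integral\<^sup>L (Leb c d) f"
proof -
  have "integrable (Leb a d) f" using assms
    by (auto dest: primitive_onD(2) intro: Leb_integrable_subset)
  then show ?thesis
    using assms Leb_integral_split[of a d f c] primitive_onD(3)[OF assms(1), of d]
      primitive_onD(3)[OF assms(1), of c] by linarith
qed

lemma primitive_onI:
  assumes "a \<le> b" "integrable (Leb a b) f"
    "\<And>y. a \<le> y \<Longrightarrow> y \<le> b \<Longrightarrow> F y = c + integral\<^sup>L (Leb a y) f"
  shows "primitive_on a b F f"
  using assms assms(3)[of a] unfolding primitive_on_def by (metis Leb_integral_empty add.right_neutral atLeastAtMost_iff order.refl)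

lemma primitive_on_subset:
  assumes "primitive_on a b F f" "a \<le> c" "c \<le> d" "d \<le> b"
  shows "primitive_on c d F f"
proof (rule primitive_onI[where c = "F c"])
  show "integrable (Leb c d) f"
    using assms by (auto dest: primitive_onD(2) intro: Leb_integrable_subset)
  show "F y = F c + integral\<^sup>L (Leb c y) f" if "c \<le> y" "y \<le> d" for y
    using primitive_on_diff[OF assms(1,2) that(1)] that assms by simp
qed (use assms in auto)

text \<open>A bridge to the gauge integral, from which continuity of indefinite integrals and the
  fundamental theorem of calculus are imported.\<close>

lemma Leb_integral_HK:
  fixes f :: "real \<Rightarrow> real"
  assumes "integrable (Leb a b) f"
  shows "integral\<^sup>L (Leb a b) f = integral {a..b} f" "f integrable_on {a..b}"
proof -
  have *: "(f has_integral integral\<^sup>L (Leb a b) f) {a<..<b}"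
    by (rule has_integral_integral_lebesgue_on[OF assms]) auto
  then have "(f has_integral integral\<^sup>L (Leb a b) f) {a..b}"
    using has_integral_Icc_iff_Ioo by blast
  then show "integral\<^sup>L (Leb a b) f = integral {a..b} f" "f integrable_on {a..b}"
    by (auto simp: integral_unique integrable_on_def)
qed

lemma primitive_on_continuous:
  assumes "primitive_on a b F f"
  shows "continuous_on {a..b} F"
proof -
  have "continuous_on {a..b} (\<lambda>y. F a + integral {a..y} f)"
    using assms Leb_integral_HK(2)[of a b f]
    by (intro continuous_intros indefinite_integral_continuous_1) (auto dest: primitive_onD(2))
  moreover have "F y = F a + integral {a..y} f" if "y \<in> {a..b}" for y
  proof -
    have "integrable (Leb a y) f"
      using assms that by (auto dest: primitive_onD(2) intro: Leb_integrable_subset)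
    then show ?thesis
      using that Leb_integral_HK(1)[of a y f] primitive_onD(3)[OF assms, of y] by simp
  qed
  ultimately show ?thesis
    using continuous_on_cong[of "{a..b}" "{a..b}" F "\<lambda>y. F a + integral {a..y} f"] by blast
qed

lemma primitive_on_exists:
  assumes "integrable (Leb a b) f" "a \<le> b"
  shows "primitive_on a b (\<lambda>y. c + integral\<^sup>L (Leb a y) f) f"
  by (rule primitive_onI) (use assms in auto)

lemma primitive_on_const: "a \<le> b \<Longrightarrow> primitive_on a b (\<lambda>y. c) (\<lambda>y. 0)"
  by (rule primitive_onI) auto

lemma primitive_on_add:
  assumes "primitive_on a b F f" "primitive_on a b G g"
  shows "primitive_on a b (\<lambda>y. F y + G y) (\<lambda>y. f y + g y)"
proof (rule primitive_onI[where c = "F a + G a"])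
  fix y assume y: "a \<le> y" "y \<le> b"
  then have "integrable (Leb a y) f" "integrable (Leb a y) g"
    using assms by (auto dest: primitive_onD(2) intro: Leb_integrable_subset)
  then show "F y + G y = F a + G a + (LINT y|Leb a y. f y + g y)"
    using primitive_onD(3)[OF assms(1) y] primitive_onD(3)[OF assms(2) y] by simp
qed (use assms in \<open>auto dest: primitive_onD\<close>)

lemma primitive_on_cmult:
  assumes "primitive_on a b F f"
  shows "primitive_on a b (\<lambda>y. c * F y) (\<lambda>y. c * f y)"
proof (rule primitive_onI[where c = "c * F a"])
  show "c * F y = c * F a + (LINT y|Leb a y. c * f y)" if "a \<le> y" "y \<le> b" for y
    using primitive_onD(3)[OF assms that] by (simp add: algebra_simps)
qed (use assms in \<open>auto dest: primitive_onD\<close>)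

lemma primitive_on_sum:
  assumes "a \<le> b" "\<And>i. i \<in> S \<Longrightarrow> primitive_on a b (F i) (f i)"
  shows "primitive_on a b (\<lambda>y. \<Sum>i\<in>S. F i y) (\<lambda>y. \<Sum>i\<in>S. f i y)"
  using assms(2)
proof (induction S rule: infinite_finite_induct)
  case (insert x S)
  then show ?case using primitive_on_add[of a b "F x" "f x"] by simp
qed (use assms(1) in \<open>simp_all add: primitive_on_const\<close>)

lemma primitive_on_cong:
  assumes "primitive_on a b F f" "\<And>y. a \<le> y \<Longrightarrow> y \<le> b \<Longrightarrow> F y = G y" 
  shows "primitive_on a b G f"
proof (rule primitive_onI[where c = "F a"])
  show "G y = F a + integral\<^sup>L (Leb a y) f" if "a \<le> y" "y \<le> b" for y
    using primitive_onD(3)[OF assms(1) that] assms(2)[OF that] by simp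
qed (use assms in \<open>auto dest: primitive_onD\<close>)

lemma primitive_on_deriv:
  assumes "a \<le> b" "\<And>y. a \<le> y \<Longrightarrow> y \<le> b \<Longrightarrow> (F has_real_derivative f y) (at y within {a..b})"
    "continuous_on {a..b} f"
  shows "primitive_on a b F f"
proof (rule primitive_onI[where c = "F a"])
  show "integrable (Leb a b) f" by (rule continuous_imp_Leb_integrable) fact
  show "F y = F a + integral\<^sup>L (Leb a y) f" if "a \<le> y" "y \<le> b" for y
  proof -
    have "integrable (Leb a y) f"
      by (rule continuous_imp_Leb_integrable) (use that assms in \<open>auto intro: continuous_on_subset\<close>)
    moreover have "(f has_integral F y - F a) {a..y}"
      by (rule fundamental_theorem_of_calculus)
         (use that in \<open>auto simp: has_real_derivative_iff_has_vector_derivative[symmetric]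
            intro!: has_field_derivative_subset[OF assms(2)]\<close>)
    ultimately show ?thesis using Leb_integral_HK[of a y f] by (simp add: integral_unique)
  qed
qed (use assms in auto)

text \<open>Both sides are integrals of \<open>f s * g t\<close> over the square, which is cut along its diagonal.\<close>

lemma primitive_on_mult_aux:
  fixes f g :: "real \<Rightarrow> real"
  assumes f: "integrable (Leb a b) f" and g: "integrable (Leb a b) g"
  shows "integral\<^sup>L (Leb a b) f * integral\<^sup>L (Leb a b) g =
    (LINT t|Leb a b. f t * integral\<^sup>L (Leb a t) g) + (LINT t|Leb a b. g t * integral\<^sup>L (Leb a t) f)"
proof -
  interpret finite_measure "Leb a b" by simp
  interpret pair_sigma_finite "Leb a b" "Leb a b" ..
  have [measurable]: "f \<in> borel_measurable (Leb a b)" "g \<in> borel_measurable (Leb a b)" 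
      "(\<lambda>y. y) \<in> borel_measurable (Leb a b)"
    using f g by (auto intro!: continuous_imp_Leb_measurable)
  have prod: "integrable (Leb a b \<Otimes>\<^sub>M Leb a b) (\<lambda>(s, t). f s * g t)"
  proof (rule Fubini_integrable)
    show "integrable (Leb a b) (\<lambda>x. LINT y|Leb a b. norm (case (x, y) of (s, t) \<Rightarrow> f s * g t))"
      using f g by (simp add: abs_mult)
  qed (use f g in auto)
  \<comment> \<open>The diagonal belongs to \<open>K1\<close> alone, so \<open>K1\<close> and
    \<open>K2\<close> add up to the product at every point of the square.\<close>
  define K1 where "K1 = (\<lambda>(s, t). if t \<le> s then f s * g t else 0)"
  define K2 where "K2 = (\<lambda>(s, t). if s < t then f s * g t else 0)"
  have K1: "integrable (Leb a b \<Otimes>\<^sub>M Leb a b) K1"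
    by (rule Bochner_Integration.integrable_bound[OF prod]) (auto simp: K1_def)
  have K2: "integrable (Leb a b \<Otimes>\<^sub>M Leb a b) K2"
    by (rule Bochner_Integration.integrable_bound[OF prod]) (auto simp: K2_def)
  have "integral\<^sup>L (Leb a b) f * integral\<^sup>L (Leb a b) g
      = (LINT s|Leb a b. LINT t|Leb a b. f s * g t)"
    by simp
  also have "\<dots> = integral\<^sup>L (Leb a b \<Otimes>\<^sub>M Leb a b) (\<lambda>(s, t). f s * g t)"
    using integral_fst'[OF prod] by simp
  also have "(\<lambda>(s, t). f s * g t) = (\<lambda>p. K1 p + K2 p)"
    by (auto simp: K1_def K2_def)
  also have "integral\<^sup>L (Leb a b \<Otimes>\<^sub>M Leb a b) \<dots> = integral\<^sup>L (Leb a b \<Otimes>\<^sub>M Leb a b) K1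
      + integral\<^sup>L (Leb a b \<Otimes>\<^sub>M Leb a b) K2"
    using K1 K2 by simp
  also have "integral\<^sup>L (Leb a b \<Otimes>\<^sub>M Leb a b) K1 = (LINT s|Leb a b. LINT t|Leb a b. K1 (s, t))"
    by (rule integral_fst'[OF K1, symmetric])
  also have "\<dots> = (LINT s|Leb a b. f s * integral\<^sup>L (Leb a s) g)"
  proof (rule Bochner_Integration.integral_cong[OF refl])
    fix s assume "s \<in> space (Leb a b)"
    then have s: "a < s" "s < b" by auto
    have "(LINT t|Leb a b. K1 (s, t)) = (LINT t|Leb a s. K1 (s, t)) + (LINT t|Leb s b. K1 (s, t))"
    proof (rule Leb_integral_split)
      show "integrable (Leb a b) (\<lambda>t. K1 (s, t))"
        by (rule Bochner_Integration.integrable_bound[of _ "\<lambda>t. f s * g t"]) (use g in \<open>auto simp: K1_def\<close>)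
    qed (use s in auto)
    also have "(LINT t|Leb a s. K1 (s, t)) = (LINT t|Leb a s. f s * g t)"
      by (rule Bochner_Integration.integral_cong) (auto simp: K1_def)
    also have "(LINT t|Leb s b. K1 (s, t)) = (LINT t|Leb s b. 0)"
      by (rule Bochner_Integration.integral_cong) (auto simp: K1_def)
    finally show "(LINT t|Leb a b. K1 (s, t)) = f s * integral\<^sup>L (Leb a s) g" by simp
  qed
  also have "integral\<^sup>L (Leb a b \<Otimes>\<^sub>M Leb a b) K2 = (LINT t|Leb a b. LINT s|Leb a b. K2 (s, t))"
    using K2 by (subst integral_snd) (auto simp: case_prod_eta)
  also have "\<dots> = (LINT t|Leb a b. g t * integral\<^sup>L (Leb a t) f)"
  proof (rule Bochner_Integration.integral_cong[OF refl])
    fix t assume "t \<in> space (Leb a b)"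
    then have t: "a < t" "t < b" by auto
    have "(LINT s|Leb a b. K2 (s, t)) = (LINT s|Leb a t. K2 (s, t)) + (LINT s|Leb t b. K2 (s, t))"
    proof (rule Leb_integral_split)
      show "integrable (Leb a b) (\<lambda>s. K2 (s, t))"
        by (rule Bochner_Integration.integrable_bound[of _ "\<lambda>s. f s * g t"]) (use f in \<open>auto simp: K2_def\<close>)
    qed (use t in auto)
    also have "(LINT s|Leb a t. K2 (s, t)) = (LINT s|Leb a t. g t * f s)"
      by (rule Bochner_Integration.integral_cong) (auto simp: K2_def)
    also have "(LINT s|Leb t b. K2 (s, t)) = (LINT s|Leb t b. 0)"
      by (rule Bochner_Integration.integral_cong) (auto simp: K2_def)
    finally show "(LINT s|Leb a b. K2 (s, t)) = g t * integral\<^sup>L (Leb a t) f" by simp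
  qed
  finally show ?thesis .
qed

text \<open>Writing \<open>F\<close> and \<open>G\<close> as initial value plus a primitive
  vanishing at \<open>a\<close>, the product of the two primitives is handled by
  \<open>primitive_on_mult_aux\<close>; \<open>e1\<close> and \<open>e2\<close> split off the terms
  that contain an initial value.\<close>

lemma primitive_on_mult:
  assumes F: "primitive_on a b F f" and G: "primitive_on a b G g"
  shows "primitive_on a b (\<lambda>y. F y * G y) (\<lambda>y. f y * G y + g y * F y)"
proof (rule primitive_onI[where c = "F a * G a"])
  have ab: "a \<le> b" using F by (simp add: primitive_on_def)
  have cont: "continuous_on {a..b} F" "continuous_on {a..b} G"
    using F G by (auto intro: primitive_on_continuous)
  have int: "integrable (Leb a b) f" "integrable (Leb a b) g" using F G by (auto dest: primitive_onD)
  show "integrable (Leb a b) (\<lambda>y. f y * G y + g y * F y)"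
    using int cont by (intro Bochner_Integration.integrable_add Leb_integrable_mult_continuous)
  fix y assume y: "a \<le> y" "y \<le> b"
  have inty: "integrable (Leb a y) f" "integrable (Leb a y) g"
    by (rule Leb_integrable_subset[OF int(1)] Leb_integrable_subset[OF int(2)]; use y in force)+
  have "continuous_on {a..y} F" "continuous_on {a..y} G"
    using cont y by (auto intro: continuous_on_subset)
  then have int2: "integrable (Leb a y) (\<lambda>t. f t * G t)" "integrable (Leb a y) (\<lambda>t. g t * F t)"
    using inty by (auto intro: Leb_integrable_mult_continuous)
  define FF GG where "FF = (\<lambda>t. integral\<^sup>L (Leb a t) f)" and "GG = (\<lambda>t. integral\<^sup>L (Leb a t) g)"
  have FG: "F t = F a + FF t" "G t = G a + GG t" if "a \<le> t" "t \<le> y" for t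
    using primitive_onD(3)[OF F, of t] primitive_onD(3)[OF G, of t] that y by (auto simp: FF_def GG_def)
  have e1: "(LINT t|Leb a y. f t * G t) = G a * FF y + (LINT t|Leb a y. f t * GG t)"
  proof -
    have "(LINT t|Leb a y. f t * GG t) = (LINT t|Leb a y. f t * G t - G a * f t)"
    proof (rule Bochner_Integration.integral_cong[OF refl])
      fix t assume "t \<in> space (Leb a y)"
      then have "a \<le> t" "t \<le> y" by auto
      from FG(2)[OF this] show "f t * GG t = f t * G t - G a * f t"
        by (simp add: distrib_left mult.commute)
    qed
    also have "\<dots> = (LINT t|Leb a y. f t * G t) - G a * FF y"
      using int2 inty by (simp add: FF_def)
    finally show ?thesis by simp
  qed
  have e2: "(LINT t|Leb a y. g t * F t) = F a * GG y + (LINT t|Leb a y. g t * FF t)"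
  proof -
    have "(LINT t|Leb a y. g t * FF t) = (LINT t|Leb a y. g t * F t - F a * g t)"
    proof (rule Bochner_Integration.integral_cong[OF refl])
      fix t assume "t \<in> space (Leb a y)"
      then have "a \<le> t" "t \<le> y" by auto
      from FG(1)[OF this] show "g t * FF t = g t * F t - F a * g t"
        by (simp add: distrib_left mult.commute)
    qed
    also have "\<dots> = (LINT t|Leb a y. g t * F t) - F a * GG y"
      using int2 inty by (simp add: GG_def)
    finally show ?thesis by simp
  qed
  have "FF y * GG y = (LINT t|Leb a y. f t * GG t) + (LINT t|Leb a y. g t * FF t)"
    unfolding FF_def GG_def by (rule primitive_on_mult_aux[OF inty])
  then have "F y * G y = F a * G a + ((LINT t|Leb a y. f t * G t) + (LINT t|Leb a y. g t * F t))"
    using e1 e2 FG[of y] y by (simp add: algebra_simps)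
  then show "F y * G y = F a * G a + (LINT t|Leb a y. f t * G t + g t * F t)"
    using int2 by simp
qed (use F in \<open>simp add: primitive_on_def\<close>)

text \<open>The sets on which the integral vanishes form a Dynkin system containing all half-lines.\<close>

lemma AE_zero_if_integrals_zero:
  fixes f :: "real \<Rightarrow> real"
  assumes f: "integrable (Leb a b) f"
    and zero: "\<And>y. a < y \<Longrightarrow> y < b \<Longrightarrow> integral\<^sup>L (Leb a y) f = 0"
  shows "AE y in Leb a b. f y = 0"
proof (cases "a < b")
  case False
  then show ?thesis by (auto intro: AE_LebI)
next
  case ab: True
  define h where "h y = indicator {a<..<b} y * f y" for y
  have h: "integrable lebesgue h"
    using f unfolding Leb_integrable_iff set_integrable_def h_def by simp
  have prim: "primitive_on a b (\<lambda>y. integral\<^sup>L (Leb a y) f) f"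
    using primitive_on_exists[of a b f 0] f ab by simp
  \<comment> \<open>The hypothesis stops short of \<open>y = b\<close>; the value there is the limit
    from the left.\<close>
  have b0: "integral\<^sup>L (Leb a b) f = 0"
  proof -
    have "((\<lambda>y. integral\<^sup>L (Leb a y) f) \<longlongrightarrow> integral\<^sup>L (Leb a b) f) (at b within {a..b})"
      using primitive_on_continuous[OF prim] ab by (auto simp: continuous_on_def)
    then have "((\<lambda>y. integral\<^sup>L (Leb a y) f) \<longlongrightarrow> integral\<^sup>L (Leb a b) f) (at_left b)"
      using ab by (simp add: at_within_Icc_at_left)
    moreover have "eventually (\<lambda>y. integral\<^sup>L (Leb a y) f = 0) (at_left b)"
      unfolding eventually_at_left[OF ab] using zero ab by blast
    ultimately show ?thesis
      using tendsto_cong[of "\<lambda>y. integral\<^sup>L (Leb a y) f" "\<lambda>_. 0"] 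
      by (metis tendsto_unique tendsto_const trivial_limit_at_left_real)
  qed
  have half: "(LINT y:{..c}|lebesgue. h y) = 0" for c
  proof -
    have "(LINT y:{..c}|lebesgue. h y) = (LINT y:{a<..<min b c}|lebesgue. f y)"
      unfolding set_lebesgue_integral_def
    proof (rule integral_cong_AE)
      have "AE y in lebesgue. y \<noteq> c"
        by (rule AE_not_in[of "{c}", simplified]) auto
      then show "AE y in lebesgue. indicat_real {..c} y *\<^sub>R h y = indicat_real {a<..<min b c} y *\<^sub>R f y"
        by eventually_elim (auto simp: h_def indicator_def)
      show "(\<lambda>x. indicat_real {..c} x *\<^sub>R h x) \<in> borel_measurable lebesgue"
        using h by (intro borel_measurable_scaleR borel_measurable_indicator) auto
      have "{a<..<min b c} \<subseteq> {a<..<b}" by auto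
      then have "set_integrable lebesgue {a<..<min b c} f"
        using f Leb_integrable_subset[of a b f a "min b c"] unfolding Leb_integrable_iff by blast
      then show "(\<lambda>x. indicat_real {a<..<min b c} x *\<^sub>R f x) \<in> borel_measurable lebesgue"
        unfolding set_integrable_def by auto
    qed
    also have "\<dots> = integral\<^sup>L (Leb a (min b c)) f" by (simp add: Leb_integral_eq)
    also have "\<dots> = 0"
      using zero[of "min b c"] b0 Leb_integral_empty[of "min b c" a f]
      by (cases "c \<le> a") (auto simp: min_def)
    finally show ?thesis .
  qed
  have tot: "integral\<^sup>L lebesgue h = 0"
    using b0 unfolding Leb_integral_eq set_lebesgue_integral_def h_def by simp
  have all: "(LINT y:A|lebesgue. h y) = 0" if "A \<in> sets borel" for A
  proof -
    have "Int_stable (range (\<lambda>c. {..c::real}))" "range (\<lambda>c. {..c::real}) \<subseteq> Pow UNIV"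
      by (auto simp: Int_stable_def)
    moreover have "A \<in> sigma_sets UNIV (range (\<lambda>c. {..c::real}))"
      using that by (simp add: borel_eq_atMost)
    ultimately show ?thesis
    proof (induct rule: sigma_sets_induct_disjoint)
      case (basic A)
      then show ?case using half by auto
    next
      case empty
      then show ?case by (simp add: set_lebesgue_integral_def)
    next
      case (compl A)
      then have A: "A \<in> sets borel" by (simp add: borel_eq_atMost)
      have "set_integrable lebesgue A h" "set_integrable lebesgue (UNIV - A) h"
        using h A by (auto simp: set_integrable_def intro!: integrable_mult_indicator[where 'b=real, simplified])
      then have "(LINT y:A \<union> (UNIV - A)|lebesgue. h y)
          = (LINT y:A|lebesgue. h y) + (LINT y:UNIV - A|lebesgue. h y)"
        by (intro set_integral_Un) auto
      moreover have "A \<union> (UNIV - A) = UNIV" by auto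
      ultimately show ?case using compl tot by (simp add: set_lebesgue_integral_def)
    next
      case (union A)
      then have A: "A i \<in> sets borel" for i by (auto simp: borel_eq_atMost)
      then have "(LINT y:(\<Union>i. A i)|lebesgue. h y) = (\<Sum>i. (LINT y:A i|lebesgue. h y))"
        using union h
        by (intro lebesgue_integral_countable_add)
           (auto simp: disjoint_family_on_def set_integrable_def intro!: integrable_mult_indicator[where 'b=real, simplified])
      then show ?case using union by simp
    qed
  qed
  \<comment> \<open>Uniqueness of densities is applied over the Borel sets, so \<open>h\<close>,
    which is only Lebesgue measurable, is exchanged for a Borel function equal to it almost
    everywhere.\<close>
  obtain h' where h': "h' \<in> borel_measurable lborel" "AE y in lborel. h y = h' y"
    using completion_ex_borel_measurable_real[of h lborel] h by auto
  have AEh: "AE y in lebesgue. h y = h' y" using h'(2) by (rule AE_completion)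
  have h'leb: "h' \<in> borel_measurable lebesgue" using h'(1) by (rule measurable_completion)
  have "integrable lebesgue h'"
    using integrable_cong_AE[of h lebesgue h'] h AEh h'leb by auto
  then have int': "integrable lborel h'"
    using h'(1) by (simp add: integrable_completion)
  have "AE y in lborel. h' y = 0"
  proof (rule density_unique_real[OF int'])
    fix A :: "real set" assume "A \<in> sets lborel"
    then have A: "A \<in> sets borel" by simp
    have "(LINT y:A|lborel. h' y) = (LINT y:A|lebesgue. h' y)"
      unfolding set_lebesgue_integral_def
      by (rule integral_completion[symmetric]) (use h' A in auto)
    also have "\<dots> = (LINT y:A|lebesgue. h y)"
      unfolding set_lebesgue_integral_def
      by (rule integral_cong_AE)
         (use h h'leb A AEh in \<open>auto intro!: borel_measurable_times borel_measurable_indicator elim!: eventually_mono\<close>)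
    finally show "(LINT x:A|lborel. h' x) = (LINT x:A|lborel. 0)"
      using all[OF A] by (simp add: set_lebesgue_integral_def)
  qed auto
  then have "AE y in lebesgue. h' y = 0" by (rule AE_completion)
  then show ?thesis unfolding AE_Leb_iff
    using AEh by eventually_elim (auto simp: h_def)
qed

text \<open>The set where the functions agree is closed and has full measure in the open interval,
  so it contains that interval; continuity adds the end points.\<close>

lemma continuous_AE_eq_imp_eq:
  fixes f g :: "real \<Rightarrow> real"
  assumes "a < b" "continuous_on {a..b} f" "continuous_on {a..b} g" "AE y in Leb a b. f y = g y"
    "y \<in> {a..b}"
  shows "f y = g y"
proof -
  have open_eq: "f y = g y" if y: "y \<in> {a<..<b}" for y
  proof -
    define S where "S = {y\<in>{a..b}. f y - g y = 0}"
    have "closed S" unfolding S_def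
      by (intro continuous_closed_preimage_constant continuous_intros assms closed_atLeastAtMost)
    moreover have "AE y in lebesgue. y \<in> {a<..<b} \<longrightarrow> y \<in> S"
      using assms(4) unfolding AE_Leb_iff by eventually_elim (auto simp: S_def)
    ultimately have "y \<in> S"
      using y by (intro mem_closed_if_AE_lebesgue_open[of "{a<..<b}" S]) simp_all
    then show ?thesis by (simp add: S_def)
  qed
  have "continuous_on (closure {a<..<b}) (\<lambda>y. f y - g y)"
    using assms by (auto intro!: continuous_intros)
  then have "f y - g y = 0"
    by (rule continuous_constant_on_closure) (use assms open_eq in auto)
  then show ?thesis by simp
qed

section \<open>Test functions\<close>

definition smooth :: "(real \<Rightarrow> real) \<Rightarrow> bool" where
  "smooth f \<longleftrightarrow> (\<forall>n y. (deriv ^^ n) f field_differentiable at y)"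

text \<open>All iterated derivatives of \<open>f\<close> stay in \<open>S\<close> and are therefore
  differentiable. This replaces explicit formulas for higher derivatives by closure under a single
  differentiation.\<close>

lemma smooth_if_in_derivation_closed:
  assumes "\<And>f. f \<in> S \<Longrightarrow> \<exists>f'\<in>S. \<forall>y. (f has_field_derivative f' y) (at y)" "f \<in> S"
  shows "smooth f"
proof -
  have "(deriv ^^ n) f \<in> S" for n
  proof (induction n)
    case (Suc n)
    then obtain f' where f': "f' \<in> S" "\<forall>y. ((deriv ^^ n) f has_field_derivative f' y) (at y)"
      using assms(1) by blast
    then have "deriv ((deriv ^^ n) f) = f'" by (auto intro: DERIV_imp_deriv)
    then show ?case using f' by simp
  qed (use assms in simp)
  then show ?thesis unfolding smooth_def field_differentiable_def using assms(1) by blast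
qed

lemma smooth_deriv:
  assumes "smooth f"
  shows "smooth (deriv f)" "(f has_field_derivative deriv f y) (at y)"
proof -
  show "smooth (deriv f)" unfolding smooth_def
  proof (intro allI)
    fix n y
    show "(deriv ^^ n) (deriv f) field_differentiable at y"
      using assms[unfolded smooth_def, rule_format, of "Suc n" y] by (simp only: funpow_Suc_right o_def)
  qed
  show "(f has_field_derivative deriv f y) (at y)"
    using assms[unfolded smooth_def, rule_format, of 0 y] by (simp add: DERIV_deriv_iff_field_differentiable)
qed

lemma smooth_imp_continuous: "smooth f \<Longrightarrow> continuous_on S f"
  using smooth_deriv(2) by (meson DERIV_continuous continuous_at_imp_continuous_on)

lemma smooth_lincomb:
  assumes "smooth f" "smooth g"
  shows "smooth (\<lambda>y. f y - c * g y)"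
proof (rule smooth_if_in_derivation_closed[where S = "{h. \<exists>f g. smooth f \<and> smooth g \<and> h = (\<lambda>y. f y - c * g y)}"])
  fix h assume "h \<in> {h. \<exists>f g. smooth f \<and> smooth g \<and> h = (\<lambda>y. f y - c * g y)}"
  then obtain f g where h: "smooth f" "smooth g" "h = (\<lambda>y. f y - c * g y)" by auto
  then have "\<forall>y. (h has_field_derivative (deriv f y - c * deriv g y)) (at y)"
    by (auto intro!: derivative_eq_intros smooth_deriv)
  then show "\<exists>f'\<in>{h. \<exists>f g. smooth f \<and> smooth g \<and> h = (\<lambda>y. f y - c * g y)}.
        \<forall>y. (h has_field_derivative f' y) (at y)"
    using h smooth_deriv(1)
    by (intro bexI[of _ "\<lambda>y. deriv f y - c * deriv g y"] CollectI exI[of _ "deriv f"] exI[of _ "deriv g"]) auto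
qed (use assms in blast)

lemma smooth_antiderivative:
  assumes "smooth g" "\<And>y. (f has_field_derivative g y) (at y)"
  shows "smooth f"
  unfolding smooth_def
proof (intro allI)
  fix n y
  have d: "deriv f = g" using assms(2) by (auto intro: DERIV_imp_deriv)
  show "(deriv ^^ n) f field_differentiable at y"
  proof (cases n)
    case 0
    then show ?thesis using assms(2) by (auto simp: field_differentiable_def)
  next
    case (Suc m)
    then show ?thesis
      using assms(1) unfolding smooth_def Suc funpow_Suc_right o_def d by blast
  qed
qed

text \<open>For \<open>p = 1\<close> this is the classical smooth function that vanishes to infinite
  order at 0. The factor p(1/y) makes the family closed under differentiation.\<close>

definition flat_exp :: "real poly \<Rightarrow> real \<Rightarrow> real" where
  "flat_exp p y = (if y > 0 then poly p (1 / y) * exp (- 1 / y) else 0)"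

lemma poly_times_exp_tendsto_0: "((\<lambda>s. poly p s * exp (- s)) \<longlongrightarrow> 0) (at_top :: real filter)"
proof -
  have "((\<lambda>s. \<Sum>i\<le>degree p. coeff p i * (s ^ i / exp s)) \<longlongrightarrow> (\<Sum>i\<le>degree p. coeff p i * 0)) at_top"
    by (intro tendsto_intros tendsto_power_div_exp_0)
  moreover have "(\<lambda>s. \<Sum>i\<le>degree p. coeff p i * (s ^ i / exp s)) = (\<lambda>s. poly p s * exp (- s))"
    by (auto simp: poly_altdef sum_distrib_right exp_minus divide_inverse mult.assoc)
  ultimately show ?thesis by simp
qed

text \<open>With s = 1/y one has ds/dy = -s^2, so the derivative of p(s) exp(-s) is s^2 (p - p')(s)
  exp(-s). At 0 the difference quotient from the right is s p(s) exp(-s), which tends to 0 as s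
  grows.\<close>

lemma flat_exp_deriv:
  "(flat_exp p has_field_derivative flat_exp ([:0, 0, 1:] * (p - pderiv p)) y) (at y)"
proof -
  consider "y > 0" | "y < 0" | "y = 0" by linarith
  then show ?thesis
  proof cases
    case 1
    have "((\<lambda>y. poly p (1 / y) * exp (- 1 / y)) has_field_derivative
        flat_exp ([:0, 0, 1:] * (p - pderiv p)) y) (at y)"
      using 1 by (auto intro!: derivative_eq_intros poly_DERIV[THEN DERIV_chain2]
        simp: flat_exp_def field_simps power2_eq_square)
    moreover have "eventually (\<lambda>z. flat_exp p z = poly p (1 / z) * exp (- 1 / z)) (nhds y)"
      using eventually_nhds_in_open[of "{0<..}" y] 1 by (auto elim!: eventually_mono simp: flat_exp_def)
    ultimately show ?thesis by (subst DERIV_cong_ev[OF refl _ refl]) auto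
  next
    case 2
    have "eventually (\<lambda>z. flat_exp p z = 0) (nhds y)"
      using eventually_nhds_in_open[of "{..<0}" y] 2 by (auto elim!: eventually_mono simp: flat_exp_def)
    then show ?thesis using 2 by (subst DERIV_cong_ev[OF refl _ refl]) (auto simp: flat_exp_def)
  next
    case 3
    have "((\<lambda>h. flat_exp p h / h) \<longlongrightarrow> 0) (at_right 0)"
    proof -
      have "((\<lambda>h. poly ([:0, 1:] * p) (inverse h) * exp (- inverse h)) \<longlongrightarrow> 0) (at_right (0::real))"
        by (rule filterlim_compose[OF poly_times_exp_tendsto_0 filterlim_inverse_at_top_right])
      moreover have "eventually (\<lambda>h. poly ([:0, 1:] * p) (inverse h) * exp (- inverse h) = flat_exp p h / h) (at_right 0)"
        by (rule eventually_at_right_less[THEN eventually_mono]) (auto simp: flat_exp_def field_simps)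
      ultimately show ?thesis using tendsto_cong by fast
    qed
    moreover have "((\<lambda>h. flat_exp p h / h) \<longlongrightarrow> 0) (at_left 0)"
    proof -
      have "eventually (\<lambda>h. flat_exp p h / h = 0) (at_left (0::real))"
        by (auto simp: eventually_at_filter flat_exp_def)
      then show ?thesis by (rule tendsto_eventually)
    qed
    ultimately have "((\<lambda>h. flat_exp p h / h) \<longlongrightarrow> 0) (at 0)"
      using filterlim_split_at by blast
    moreover have "flat_exp p 0 = 0" "flat_exp ([:0, 0, 1:] * (p - pderiv p)) 0 = 0"
      by (simp_all add: flat_exp_def)
    ultimately show ?thesis using 3 by (simp add: DERIV_def)
  qed
qed

text \<open>An algebra of smooth functions that is closed under differentiation and contains bumps.\<close>

inductive_set cutoffs :: "real \<Rightarrow> real \<Rightarrow> (real \<Rightarrow> real) set" for a b where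
  const: "(\<lambda>y. c) \<in> cutoffs a b"
| left: "(\<lambda>y. flat_exp p (y - a)) \<in> cutoffs a b"
| right: "(\<lambda>y. flat_exp p (b - y)) \<in> cutoffs a b"
| add: "f \<in> cutoffs a b \<Longrightarrow> g \<in> cutoffs a b \<Longrightarrow> (\<lambda>y. f y + g y) \<in> cutoffs a b"
| mult: "f \<in> cutoffs a b \<Longrightarrow> g \<in> cutoffs a b \<Longrightarrow> (\<lambda>y. f y * g y) \<in> cutoffs a b"

lemma cutoffs_deriv:
  assumes "f \<in> cutoffs a b"
  shows "\<exists>f'\<in>cutoffs a b. \<forall>y. (f has_field_derivative f' y) (at y)"
  using assms
proof induction
  case (const c)
  then show ?case by (auto intro!: bexI[OF _ cutoffs.const[of 0]])
next
  case (left p)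
  have "((\<lambda>y. flat_exp p (y - a)) has_field_derivative flat_exp ([:0, 0, 1:] * (p - pderiv p)) (y - a)) (at y)" for y
    using DERIV_chain2[OF flat_exp_deriv[of p] DERIV_diff[OF DERIV_ident DERIV_const[of a]]] by simp
  then show ?case by (intro bexI[OF _ cutoffs.left] allI)
next
  case (right p)
  have "((\<lambda>y. flat_exp p (b - y)) has_field_derivative
      (-1) * flat_exp ([:0, 0, 1:] * (p - pderiv p)) (b - y)) (at y)" for y
    using DERIV_chain2[OF flat_exp_deriv[of p] DERIV_diff[OF DERIV_const[of b] DERIV_ident]] by simp
  then show ?case by (intro bexI[OF _ cutoffs.mult[OF cutoffs.const[of "-1"] cutoffs.right]] allI)
next
  case (add f g)
  then obtain f' g' where "f' \<in> cutoffs a b" "g' \<in> cutoffs a b"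
    "\<forall>y. (f has_field_derivative f' y) (at y)" "\<forall>y. (g has_field_derivative g' y) (at y)" by blast
  then show ?case
    by (intro bexI[OF _ cutoffs.add[of f' a b g']]) (auto intro!: derivative_eq_intros)
next
  case (mult f g)
  then obtain f' g' where "f' \<in> cutoffs a b" "g' \<in> cutoffs a b"
    "\<forall>y. (f has_field_derivative f' y) (at y)" "\<forall>y. (g has_field_derivative g' y) (at y)" by blast
  then show ?case using mult
    by (intro bexI[OF _ cutoffs.add[OF cutoffs.mult[of f' a b g] cutoffs.mult[of g' a b f]]])
       (auto intro!: derivative_eq_intros)
qed

lemma cutoffs_smooth: "f \<in> cutoffs a b \<Longrightarrow> smooth f"
  using smooth_if_in_derivation_closed[of "cutoffs a b"] cutoffs_deriv by blast

lemma test_functions_iff: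
  "\<phi> \<in> test_functions a b \<longleftrightarrow>
     smooth \<phi> \<and> (\<exists>c d. a < c \<and> c < d \<and> d < b \<and> (\<forall>y. y \<notin> {c..d} \<longrightarrow> \<phi> y = 0))" if "a < b"
proof
  assume "\<phi> \<in> test_functions a b"
  then obtain K where K: "smooth \<phi>" "compact K" "K \<subseteq> {a<..<b}" "\<forall>y. y \<notin> K \<longrightarrow> \<phi> y = 0"
    by (auto simp: test_functions_def smooth_def)
  show "smooth \<phi> \<and> (\<exists>c d. a < c \<and> c < d \<and> d < b \<and> (\<forall>y. y \<notin> {c..d} \<longrightarrow> \<phi> y = 0))"
  proof (cases "K = {}")
    case True
    then have "\<forall>y. \<phi> y = 0" using K by auto
    moreover have "a < (2 * a + b) / 3" "(2 * a + b) / 3 < (a + 2 * b) / 3" "(a + 2 * b) / 3 < b"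
      using that by auto
    ultimately show ?thesis using K(1) by blast
  next
    case False
    obtain c where c: "c \<in> K" "\<forall>y\<in>K. c \<le> y" using compact_attains_inf[OF K(2) False] by auto
    obtain d where d: "d \<in> K" "\<forall>y\<in>K. y \<le> d" using compact_attains_sup[OF K(2) False] by auto
    \<comment> \<open>The left end is moved from \<open>c\<close> to the midpoint of
      \<open>a\<close> and \<open>c\<close>, since \<open>K\<close> may be a single point and the
      interval has to be nondegenerate.\<close>
    have "a < (a + c) / 2" "(a + c) / 2 < d" "d < b" using subsetD[OF K(3) c(1)] subsetD[OF K(3) d(1)] d(2)[rule_format, OF c(1)]
      by auto
    moreover have "\<forall>y. y \<notin> {(a + c) / 2..d} \<longrightarrow> \<phi> y = 0"
    proof (intro allI impI)
      fix y assume y: "y \<notin> {(a + c) / 2..d}"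
      have "a < c" using c K by auto
      then have "y < c \<or> d < y" using y by auto
      then have "y \<notin> K" using c(2) d(2) by force
      then show "\<phi> y = 0" using K by auto
    qed
    ultimately show ?thesis using K(1) by blast
  qed
next
  assume "smooth \<phi> \<and> (\<exists>c d. a < c \<and> c < d \<and> d < b \<and> (\<forall>y. y \<notin> {c..d} \<longrightarrow> \<phi> y = 0))"
  then obtain c d where *: "smooth \<phi>" "a < c" "c < d" "d < b" "\<forall>y. y \<notin> {c..d} \<longrightarrow> \<phi> y = 0" by blast
  then have "compact {c..d} \<and> {c..d} \<subseteq> {a<..<b} \<and> (\<forall>y. y \<notin> {c..d} \<longrightarrow> \<phi> y = 0)" by auto
  then show "\<phi> \<in> test_functions a b"
    using * unfolding test_functions_def smooth_def by blast
qed

lemma test_functions_deriv: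
  assumes "\<phi> \<in> test_functions a b" "a < b"
  shows "deriv \<phi> \<in> test_functions a b"
proof -
  obtain c d where *: "smooth \<phi>" "a < c" "c < d" "d < b" "\<forall>y. y \<notin> {c..d} \<longrightarrow> \<phi> y = 0"
    using assms test_functions_iff[OF assms(2)] by blast
  have "\<forall>y. y \<notin> {c..d} \<longrightarrow> deriv \<phi> y = 0"
  proof (intro allI impI)
    fix y assume "y \<notin> {c..d}"
    then have "eventually (\<lambda>z. \<phi> z = 0) (nhds y)"
      using eventually_nhds_in_open[of "- {c..d}" y, OF open_Compl[OF closed_atLeastAtMost]] *(5)
      by (simp add: eventually_mono)
    then have "deriv \<phi> y = deriv (\<lambda>z. 0) y" by (intro deriv_cong_ev) auto
    then show "deriv \<phi> y = 0" by simp
  qed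
  then show ?thesis using * smooth_deriv(1) unfolding test_functions_iff[OF assms(2)] by blast
qed

lemma test_functionsD:
  assumes "\<phi> \<in> test_functions a b" "a < b"
  shows "smooth \<phi>" "\<phi> a = 0" "\<phi> b = 0" "continuous_on S \<phi>"
  using assms smooth_imp_continuous[of \<phi> S] unfolding test_functions_iff[OF assms(2)] by auto

lemma flat_exp_1_bounds: "0 \<le> flat_exp 1 y" "flat_exp 1 y \<le> 1" "flat_exp 1 y > 0 \<longleftrightarrow> y > 0"
  by (auto simp: flat_exp_def)

text \<open>Approximations \<open>1 - (1 - \<theta>)^n\<close> of the indicator of an interval by powers of a bump \<open>\<theta>\<close>.\<close>

lemma test_functions_indicator_approx:
  assumes "a < \<alpha>" "\<alpha> < \<beta>" "\<beta> < b"
  shows "\<exists>\<psi>. (\<forall>n. \<psi> n \<in> test_functions a b) \<and> (\<forall>n y. 0 \<le> \<psi> n y \<and> \<psi> n y \<le> 1) \<and>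
    (\<forall>y. (\<lambda>n. \<psi> n y) \<longlonglongrightarrow> indicator {\<alpha><..<\<beta>} y)"
proof -
  define \<theta> where "\<theta> y = flat_exp 1 (y - \<alpha>) * flat_exp 1 (\<beta> - y)" for y
  have \<theta>: "0 \<le> \<theta> y" "\<theta> y \<le> 1" "\<theta> y > 0 \<longleftrightarrow> y \<in> {\<alpha><..<\<beta>}" for y
  proof -
    show "0 \<le> \<theta> y" "\<theta> y \<le> 1"
      using flat_exp_1_bounds by (auto simp: \<theta>_def intro!: mult_le_one)
    show "\<theta> y > 0 \<longleftrightarrow> y \<in> {\<alpha><..<\<beta>}"
      using flat_exp_1_bounds(1,3)[of "y - \<alpha>"] flat_exp_1_bounds(1,3)[of "\<beta> - y"]
      by (auto simp: \<theta>_def zero_less_mult_iff)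
  qed
  \<comment> \<open>Subtraction is written as multiplication by -1, matching the closure rules of
    \<open>cutoffs\<close>.\<close>
  define \<psi> where "\<psi> n y = 1 + (-1) * (1 + (-1) * \<theta> y) ^ n" for n :: nat and y
  have \<theta>_in: "\<theta> \<in> cutoffs \<alpha> \<beta>" unfolding \<theta>_def by (intro cutoffs.intros)
  have pow: "(\<lambda>y. (1 + (-1) * \<theta> y) ^ n) \<in> cutoffs \<alpha> \<beta>" for n
  proof (induction n)
    case (Suc n)
    have "(\<lambda>y. (1 + (-1) * \<theta> y) * (1 + (-1) * \<theta> y) ^ n) \<in> cutoffs \<alpha> \<beta>"
      by (intro cutoffs.mult[OF _ Suc] cutoffs.add cutoffs.mult cutoffs.const \<theta>_in)
    then show ?case by simp
  qed (simp add: cutoffs.const)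
  have \<psi>_in: "\<psi> n \<in> cutoffs \<alpha> \<beta>" for n
    unfolding \<psi>_def by (intro cutoffs.add cutoffs.mult cutoffs.const pow)
  have zero: "\<theta> y = 0" if "y \<notin> {\<alpha><..<\<beta>}" for y
    using \<theta>(1,3)[of y] that by linarith
  have "\<psi> n \<in> test_functions a b" for n
    unfolding test_functions_iff[OF less_trans[OF less_trans[OF assms(1,2)] assms(3)]]
  proof (intro conjI exI)
    show "smooth (\<psi> n)" using cutoffs_smooth[OF \<psi>_in] .
    show "\<forall>y. y \<notin> {\<alpha>..\<beta>} \<longrightarrow> \<psi> n y = 0" using zero by (auto simp: \<psi>_def)
  qed (use assms in auto)
  moreover have "0 \<le> \<psi> n y \<and> \<psi> n y \<le> 1" for n y
    using \<theta>(1,2)[of y] power_le_one[of "1 - \<theta> y" n] by (auto simp: \<psi>_def)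
  moreover have "(\<lambda>n. \<psi> n y) \<longlonglongrightarrow> indicator {\<alpha><..<\<beta>} y" for y
  proof (cases "y \<in> {\<alpha><..<\<beta>}")
    case True
    have "norm (1 + (-1) * \<theta> y) < 1"
      using \<theta>(2)[of y] \<theta>(3)[THEN iffD2, OF True] by auto
    then have "(\<lambda>n. (1 + (-1) * \<theta> y) ^ n) \<longlonglongrightarrow> 0" by (rule LIMSEQ_power_zero)
    then have "(\<lambda>n. 1 + (-1) * (1 + (-1) * \<theta> y) ^ n) \<longlonglongrightarrow> 1 + (-1) * 0"
      by (rule tendsto_add[OF tendsto_const tendsto_mult[OF tendsto_const]])
    then show ?thesis using True by (simp add: \<psi>_def)
  next
    case False
    then show ?thesis using zero by (simp add: \<psi>_def)
  qed
  ultimately show ?thesis by blast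
qed

text \<open>Fundamental lemma of the calculus of variations. Dominated convergence replaces test
  functions by indicators of subintervals, so the primitive of \<open>f\<close> is constant in the
  open interval and, by continuity, equal to its value 0 at \<open>a\<close>.\<close>

lemma AE_zero_if_test_integrals_zero:
  fixes f :: "real \<Rightarrow> real"
  assumes ab: "a < b" and f: "integrable (Leb a b) f"
    and zero: "\<And>\<psi>. \<psi> \<in> test_functions a b \<Longrightarrow> (LINT y|Leb a b. f y * \<psi> y) = 0"
  shows "AE y in Leb a b. f y = 0"
proof (rule AE_zero_if_integrals_zero[OF f])
  define F where "F y = integral\<^sup>L (Leb a y) f" for y
  have prim: "primitive_on a b F f"
    using primitive_on_exists[of a b f 0] f ab by (simp add: F_def[abs_def])
  have sub: "F \<beta> = F \<alpha>" if \<alpha>\<beta>: "a < \<alpha>" "\<alpha> < \<beta>" "\<beta> < b" for \<alpha> \<beta>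
  proof -
    obtain \<psi> where \<psi>: "\<And>n. \<psi> n \<in> test_functions a b" "\<And>n y. 0 \<le> \<psi> n y" "\<And>n y. \<psi> n y \<le> 1"
      "\<And>y. (\<lambda>n. \<psi> n y) \<longlonglongrightarrow> indicator {\<alpha><..<\<beta>} y"
      using test_functions_indicator_approx[OF \<alpha>\<beta>] by blast
    have "(\<lambda>n. LINT y|Leb a b. f y * \<psi> n y) \<longlonglongrightarrow> (LINT y|Leb a b. f y * indicator {\<alpha><..<\<beta>} y)"
    proof (rule integral_dominated_convergence[where w = "\<lambda>y. \<bar>f y\<bar>"])
      have [measurable]: "f \<in> borel_measurable (Leb a b)" using f by auto
      show "(\<lambda>y. f y * indicator {\<alpha><..<\<beta>} y) \<in> borel_measurable (Leb a b)"
      proof (intro borel_measurable_times borel_measurable_indicator)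
        have "{\<alpha><..<\<beta>} \<subseteq> {a<..<b}" using \<alpha>\<beta> by auto
        then show "{\<alpha><..<\<beta>} \<in> sets (Leb a b)" by (subst sets_restrict_space_iff) auto
      qed simp
      show "(\<lambda>y. f y * \<psi> n y) \<in> borel_measurable (Leb a b)" for n
        using test_functionsD(4)[OF \<psi>(1) ab, of "{a..b}" n]
        by (intro borel_measurable_times continuous_imp_Leb_measurable[of _ _ "\<psi> n"]) auto
      show "AE y in Leb a b. norm (f y * \<psi> n y) \<le> \<bar>f y\<bar>" for n
        using \<psi>(2,3)[of n] by (intro AE_LebI) (simp add: abs_mult mult_left_le)
      show "AE y in Leb a b. (\<lambda>n. f y * \<psi> n y) \<longlonglongrightarrow> f y * indicator {\<alpha><..<\<beta>} y"
        by (intro AE_LebI tendsto_intros \<psi>)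
    qed (use f in auto)
    then have "(LINT y|Leb a b. f y * indicator {\<alpha><..<\<beta>} y) = 0"
      using zero[OF \<psi>(1)] by (simp add: LIMSEQ_const_iff)
    moreover have "(LINT y|Leb a b. f y * indicator {\<alpha><..<\<beta>} y) = integral\<^sup>L (Leb \<alpha> \<beta>) f"
      unfolding Leb_integral_eq set_lebesgue_integral_def
      by (rule Bochner_Integration.integral_cong) (use \<alpha>\<beta> in \<open>auto simp: indicator_def\<close>)
    ultimately show ?thesis using primitive_on_diff[OF prim, of \<alpha> \<beta>] \<alpha>\<beta> by simp
  qed
  fix y assume y: "a < y" "y < b"
  have "F a = F y"
  proof (rule continuous_constant_on_closure[of "{a<..<b}" F])
    show "continuous_on (closure {a<..<b}) F" using primitive_on_continuous[OF prim] ab by simp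
    show "F z = F y" if "z \<in> {a<..<b}" for z
      using sub[of z y] sub[of y z] that y by (cases z y rule: linorder_cases) auto
  qed (use ab in auto)
  then show "integral\<^sup>L (Leb a y) f = 0" by (simp add: F_def Leb_integral_empty)
qed

text \<open>Integrated from the left, \<open>\<psi>\<close> gives 0 before its support; the zero
  mean brings the integral back to 0 after the support, so the antiderivative has compact support as
  well.\<close>

lemma test_function_antiderivative:
  assumes ab: "a < b" and \<psi>: "\<psi> \<in> test_functions a b" and zero: "(LINT y|Leb a b. \<psi> y) = 0"
  shows "\<exists>\<phi>\<in>test_functions a b. deriv \<phi> = \<psi>"
proof -
  obtain c d where *: "smooth \<psi>" "a < c" "c < d" "d < b" "\<forall>y. y \<notin> {c..d} \<longrightarrow> \<psi> y = 0"
    using \<psi> test_functions_iff[OF ab] by blast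
  have cont: "continuous_on S \<psi>" for S using smooth_imp_continuous[OF *(1)] .
  then have int: "\<psi> integrable_on {p..q}" for p q by (intro integrable_continuous_interval)
  define \<phi> where "\<phi> y = integral {a - 1..y} \<psi>" for y
  have left: "\<phi> y = 0" if "y < c" for y
  proof -
    have "integral {a - 1..y} \<psi> = integral {a - 1..y} (\<lambda>_. 0)"
      by (rule Henstock_Kurzweil_Integration.integral_cong) (use * that in auto)
    then show ?thesis by (simp add: \<phi>_def)
  qed
  have right: "\<phi> y = 0" if "y > d" for y
  proof -
    have "\<phi> y = integral {a - 1..a} \<psi> + integral {a..y} \<psi>"
      unfolding \<phi>_def
      by (rule Henstock_Kurzweil_Integration.integral_combine[symmetric]) (use * that int in auto)
    also have "integral {a - 1..a} \<psi> = 0" using left[of a] * by (simp add: \<phi>_def)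
    also have "integral {a..y} \<psi> = integral {a..d} \<psi> + integral {d..y} \<psi>"
      by (rule Henstock_Kurzweil_Integration.integral_combine[symmetric]) (use * that int in auto)
    also have "integral {d..y} \<psi> = integral {d..y} (\<lambda>_. 0)"
      by (rule integral_spike[of "{d}"]) (use * in auto)
    also have "integral {a..d} \<psi> = integral {a..b} \<psi> - integral {d..b} \<psi>"
      using Henstock_Kurzweil_Integration.integral_combine[of a d b \<psi>] * int by simp
    also have "integral {d..b} \<psi> = integral {d..b} (\<lambda>_. 0)"
      by (rule integral_spike[of "{d}"]) (use * in auto)
    also have "integral {a..b} \<psi> = 0"
      using zero Leb_integral_HK(1)[of a b \<psi>] continuous_imp_Leb_integrable[OF cont] by simp
    finally show ?thesis by simp
  qed
  have deriv: "(\<phi> has_field_derivative \<psi> y) (at y)" for y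
  proof (cases "y < c")
    case True
    then have "eventually (\<lambda>z. \<phi> z = 0) (nhds y)"
      using eventually_nhds_in_open[of "{..<c}" y] left by (auto elim!: eventually_mono)
    then show ?thesis using * True by (subst DERIV_cong_ev[OF refl _ refl]) auto
  next
    case False
    have "((\<lambda>x. integral {a - 1..x} \<psi>) has_real_derivative \<psi> y) (at y within {a - 1..y + 1})"
      by (rule integral_has_real_derivative[OF cont]) (use False * in auto)
    moreover have "y \<in> interior {a - 1..y + 1}" using False * by (simp add: interior_atLeastAtMost_real)
    ultimately show ?thesis unfolding \<phi>_def by (metis at_within_interior)
  qed
  have "\<phi> \<in> test_functions a b"
    unfolding test_functions_iff[OF ab]
    using smooth_antiderivative[OF *(1) deriv] *(2-4) left right by (metis atLeastAtMost_iff not_le)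
  moreover have "deriv \<phi> = \<psi>" using deriv by (auto intro: DERIV_imp_deriv)
  ultimately show ?thesis by blast
qed

text \<open>If mass 1 were never attained, rescaling would force every test function to have mass 0,
  and the fundamental lemma applied to the constant 1 would give 1 = 0 almost everywhere.\<close>

lemma test_function_unit_mass:
  assumes "a < b"
  shows "\<exists>\<eta>\<in>test_functions a b. (LINT y|Leb a b. \<eta> y) = 1"
proof (rule ccontr)
  assume no: "\<not> ?thesis"
  have "(LINT y|Leb a b. \<psi> y) = 0" if \<psi>: "\<psi> \<in> test_functions a b" for \<psi>
  proof (rule ccontr)
    assume nz: "(LINT y|Leb a b. \<psi> y) \<noteq> 0"
    \<comment> \<open>This constant writes \<open>\<psi>\<close> divided by its mass in the form
      \<open>\<psi> y - c * \<psi> y\<close> covered by \<open>smooth_lincomb\<close>.\<close>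
    define c where "c = 1 - 1 / (LINT y|Leb a b. \<psi> y)"
    have "(\<lambda>y. \<psi> y - c * \<psi> y) \<in> test_functions a b"
      using \<psi> smooth_lincomb[of \<psi> \<psi> c] unfolding test_functions_iff[OF assms] by fastforce
    moreover have "(LINT y|Leb a b. \<psi> y - c * \<psi> y) = 1"
    proof -
      have "(\<lambda>y. \<psi> y - c * \<psi> y) = (\<lambda>y. (1 / (LINT y|Leb a b. \<psi> y)) * \<psi> y)"
        by (auto simp: c_def algebra_simps)
      then show ?thesis using nz by simp
    qed
    ultimately show False using no by blast
  qed
  then have "AE y in Leb a b. (1::real) = 0"
    by (intro AE_zero_if_test_integrals_zero[OF assms]) auto
  then have "AE y in Leb a b. indicat_real {} y = 1" by simp
  then have "(LINT y|Leb a b. (1::real)) = (LINT y|Leb a b. 0)"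
    by (intro integral_cong_AE) auto
  then show False using assms measure_Leb[of a b] by simp
qed

text \<open>Subtracting from a test function its mass times a fixed \<open>\<eta>\<close> of mass 1
  leaves mean zero, hence the derivative of a test function. So the pairing of \<open>f\<close> with
  \<open>\<psi>\<close> is the mass of \<open>\<psi>\<close> times the pairing of \<open>f\<close>
  with \<open>\<eta>\<close>, and the latter is the constant.\<close>

lemma du_Bois_Reymond:
  fixes f :: "real \<Rightarrow> real"
  assumes ab: "a < b" and f: "integrable (Leb a b) f"
    and zero: "\<And>\<phi>. \<phi> \<in> test_functions a b \<Longrightarrow> (LINT y|Leb a b. f y * deriv \<phi> y) = 0"
  shows "\<exists>c. AE y in Leb a b. f y = c"
proof -
  obtain \<eta> where \<eta>: "\<eta> \<in> test_functions a b" "(LINT y|Leb a b. \<eta> y) = 1"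
    using test_function_unit_mass[OF ab] by blast
  define c where "c = (LINT y|Leb a b. f y * \<eta> y)"
  have "AE y in Leb a b. f y - c = 0"
  proof (rule AE_zero_if_test_integrals_zero[OF ab])
    fix \<psi> assume \<psi>: "\<psi> \<in> test_functions a b"
    define m where "m = (LINT y|Leb a b. \<psi> y)"
    have int: "integrable (Leb a b) \<psi>" "integrable (Leb a b) \<eta>"
      "integrable (Leb a b) (\<lambda>y. f y * \<psi> y)" "integrable (Leb a b) (\<lambda>y. f y * \<eta> y)"
      using test_functionsD(4)[OF \<psi> ab] test_functionsD(4)[OF \<eta>(1) ab] f
      by (auto intro: continuous_imp_Leb_integrable Leb_integrable_mult_continuous)
    obtain p q where p: "a < p" "p < q" "q < b" "\<forall>y. y \<notin> {p..q} \<longrightarrow> \<psi> y = 0"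
      using \<psi> test_functions_iff[OF ab] by blast
    obtain p' q' where p': "a < p'" "p' < q'" "q' < b" "\<forall>y. y \<notin> {p'..q'} \<longrightarrow> \<eta> y = 0"
      using \<eta> test_functions_iff[OF ab] by blast
    have "(\<lambda>y. \<psi> y - m * \<eta> y) \<in> test_functions a b"
      unfolding test_functions_iff[OF ab]
    proof (intro conjI exI)
      show "smooth (\<lambda>y. \<psi> y - m * \<eta> y)" using \<psi> \<eta> test_functionsD(1)[OF _ ab] smooth_lincomb by blast
      show "\<forall>y. y \<notin> {min p p'..max q q'} \<longrightarrow> \<psi> y - m * \<eta> y = 0"
      proof (intro allI impI)
        fix y assume "y \<notin> {min p p'..max q q'}"
        then have "y \<notin> {p..q}" "y \<notin> {p'..q'}" by auto
        then show "\<psi> y - m * \<eta> y = 0" using p(4) p'(4) by simp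
      qed
    qed (use p p' in auto)
    moreover have "(LINT y|Leb a b. \<psi> y - m * \<eta> y) = 0"
      using int \<eta>(2) by (simp add: m_def)
    ultimately obtain \<phi> where "\<phi> \<in> test_functions a b" "deriv \<phi> = (\<lambda>y. \<psi> y - m * \<eta> y)"
      using test_function_antiderivative[OF ab] by blast
    then have "(LINT y|Leb a b. f y * (\<psi> y - m * \<eta> y)) = 0" using zero by metis
    also have "(\<lambda>y. f y * (\<psi> y - m * \<eta> y)) = (\<lambda>y. f y * \<psi> y - m * (f y * \<eta> y))"
      by (auto simp: algebra_simps)
    finally have "(LINT y|Leb a b. f y * \<psi> y) = m * c"
      using int by (simp add: c_def)
    moreover have "(\<lambda>y. (f y - c) * \<psi> y) = (\<lambda>y. f y * \<psi> y - c * \<psi> y)"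
      by (auto simp: algebra_simps)
    ultimately show "(LINT y|Leb a b. (f y - c) * \<psi> y) = 0"
      using int by (simp add: m_def)
  qed (use f in auto)
  then show ?thesis by (auto intro: exI[of _ c])
qed

lemma primitive_on_test_function:
  assumes F: "primitive_on a b F f" and \<phi>: "\<phi> \<in> test_functions a b" and ab: "a < b"
  shows "(LINT y|Leb a b. F y * deriv \<phi> y) = - (LINT y|Leb a b. f y * \<phi> y)"
proof -
  have d: "deriv \<phi> \<in> test_functions a b" by (rule test_functions_deriv[OF \<phi> ab])
  have "primitive_on a b \<phi> (deriv \<phi>)"
    by (rule primitive_on_deriv)
       (use ab smooth_deriv(2)[OF test_functionsD(1)[OF \<phi> ab]] test_functionsD(4)[OF d ab]
        in \<open>auto intro: has_field_derivative_at_within\<close>)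
  from primitive_on_mult[OF F this]
  have "F b * \<phi> b - F a * \<phi> a = (LINT y|Leb a b. f y * \<phi> y + deriv \<phi> y * F y)"
    using primitive_on_diff[of a b _ _ a b] ab by simp
  moreover have "integrable (Leb a b) (\<lambda>y. f y * \<phi> y)" 
    using primitive_onD(2)[OF F] test_functionsD(4)[OF \<phi> ab] by (rule Leb_integrable_mult_continuous)
  moreover have "integrable (Leb a b) (\<lambda>y. deriv \<phi> y * F y)"
    using test_functionsD(4)[OF d ab] primitive_on_continuous[OF F]
    by (intro Leb_integrable_mult_continuous continuous_imp_Leb_integrable)
  ultimately show ?thesis using test_functionsD(2,3)[OF \<phi> ab] by (simp add: mult.commute)
qed

text \<open>The difference between \<open>f\<close> and a primitive of \<open>g\<close> has zero
  weak derivative, so it is constant. This is applied in space to Sobolev functions and in time to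
  pairings of the solution.\<close>

lemma weak_derivative_imp_primitive:
  fixes f g :: "real \<Rightarrow> real"
  assumes ab: "a < b" and f: "integrable (Leb a b) f" and g: "integrable (Leb a b) g"
    and weak: "\<And>\<phi>. \<phi> \<in> test_functions a b \<Longrightarrow>
      (LINT y|Leb a b. f y * deriv \<phi> y) = - (LINT y|Leb a b. g y * \<phi> y)"
  shows "\<exists>F. primitive_on a b F g \<and> (AE y in Leb a b. f y = F y)"
proof -
  define G where "G y = integral\<^sup>L (Leb a y) g" for y
  have G: "primitive_on a b G g"
    using primitive_on_exists[OF g, of 0] ab by (simp add: G_def[abs_def])
  have Gi: "integrable (Leb a b) G"
    by (rule continuous_imp_Leb_integrable[OF primitive_on_continuous[OF G]])
  have "\<exists>c. AE y in Leb a b. f y - G y = c"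
  proof (rule du_Bois_Reymond[OF ab])
    fix \<phi> assume \<phi>: "\<phi> \<in> test_functions a b"
    have d: "continuous_on {a..b} (deriv \<phi>)"
      using test_functionsD(4)[OF test_functions_deriv[OF \<phi> ab] ab] .
    have "(LINT y|Leb a b. (f y - G y) * deriv \<phi> y)
        = (LINT y|Leb a b. f y * deriv \<phi> y) - (LINT y|Leb a b. G y * deriv \<phi> y)"
      using Leb_integrable_mult_continuous[OF f d] Leb_integrable_mult_continuous[OF Gi d]
      by (simp add: left_diff_distrib)
    then show "(LINT y|Leb a b. (f y - G y) * deriv \<phi> y) = 0"
      using weak[OF \<phi>] primitive_on_test_function[OF G \<phi> ab] by simp
  qed (use f Gi in auto)
  then obtain c where "AE y in Leb a b. f y - G y = c" ..
  then have "AE y in Leb a b. f y = c + G y" by eventually_elim auto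
  moreover have "primitive_on a b (\<lambda>y. c + G y) g"
    using primitive_on_exists[OF g, of c] ab by (simp add: G_def)
  ultimately show ?thesis by blast
qed

section \<open>Weak derivatives on the unit interval\<close>

lemma has_weak_deriv_iff:
  "has_weak_deriv j f g \<longleftrightarrow> sq_integrable 0 1 f \<and> sq_integrable 0 1 g \<and>
     (\<forall>\<phi> \<in> test_functions 0 1.
        (LINT y|Leb 0 1. f y * (deriv ^^ j) \<phi> y) = (-1) ^ j * (LINT y|Leb 0 1. g y * \<phi> y))"
  by (simp add: has_weak_deriv_def L2_I_iff)

lemma has_weak_deriv_unique:
  assumes "has_weak_deriv j f g" "has_weak_deriv j f h"
  shows "AE y in Leb 0 1. g y = h y"
proof -
  have int: "integrable (Leb 0 1) g" "integrable (Leb 0 1) h"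
    using assms by (auto simp: has_weak_deriv_iff intro: sq_integrable_imp_integrable)
  have "AE y in Leb 0 1. g y - h y = 0"
  proof (rule AE_zero_if_test_integrals_zero)
    fix \<phi> assume \<phi>: "\<phi> \<in> test_functions 0 1"
    have c: "continuous_on {0..1} \<phi>" using test_functionsD(4)[OF \<phi>] by simp
    have "(-1) ^ j * (LINT y|Leb 0 1. g y * \<phi> y) = (-1) ^ j * (LINT y|Leb 0 1. h y * \<phi> y)"
      using bspec[OF assms(1)[unfolded has_weak_deriv_iff, THEN conjunct2, THEN conjunct2] \<phi>]
        bspec[OF assms(2)[unfolded has_weak_deriv_iff, THEN conjunct2, THEN conjunct2] \<phi>] by simp
    then have "(LINT y|Leb 0 1. g y * \<phi> y) = (LINT y|Leb 0 1. h y * \<phi> y)" by simp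
    then show "(LINT y|Leb 0 1. (g y - h y) * \<phi> y) = 0"
      using Leb_integrable_mult_continuous[OF int(1) c] Leb_integrable_mult_continuous[OF int(2) c]
      by (simp add: left_diff_distrib)
  qed (use int in auto)
  then show ?thesis by eventually_elim simp
qed

lemma has_weak_deriv_0: "sq_integrable 0 1 f \<Longrightarrow> has_weak_deriv 0 f f"
  by (simp add: has_weak_deriv_iff)

lemma has_weak_deriv_weak_deriv: "has_weak_deriv j f g \<Longrightarrow> has_weak_deriv j f (weak_deriv j f)"
  unfolding weak_deriv_def by (rule someI[of "has_weak_deriv j f"])

lemma weak_deriv_AE: "has_weak_deriv j f g \<Longrightarrow> AE y in Leb 0 1. weak_deriv j f y = g y"
  using has_weak_deriv_unique has_weak_deriv_weak_deriv by blast

lemma sobolev_has_weak_deriv: "f \<in> sobolev m \<Longrightarrow> j \<le> m \<Longrightarrow> has_weak_deriv j f (weak_deriv j f)"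
  by (auto simp: sobolev_def intro: has_weak_deriv_weak_deriv)

text \<open>Both hypotheses concern derivatives of \<open>f\<close>. Testing the one of order
  \<open>j\<close> with the derivative of \<open>\<phi>\<close> makes the same integral of
  \<open>f\<close> appear in both, so \<open>h\<close> is the first weak derivative of
  \<open>g\<close>.\<close>

lemma has_weak_deriv_Suc_imp_primitive:
  assumes "has_weak_deriv j f g" "has_weak_deriv (Suc j) f h"
  shows "\<exists>G. primitive_on 0 1 G h \<and> (AE y in Leb 0 1. g y = G y)"
proof (rule weak_derivative_imp_primitive)
  fix \<phi> assume \<phi>: "\<phi> \<in> test_functions 0 1"
  have d: "deriv \<phi> \<in> test_functions 0 1" by (rule test_functions_deriv[OF \<phi>]) simp
  have "(LINT y|Leb 0 1. f y * (deriv ^^ Suc j) \<phi> y) = (-1) ^ j * (LINT y|Leb 0 1. g y * deriv \<phi> y)"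
    using assms(1) d unfolding has_weak_deriv_iff funpow_Suc_right o_def by blast
  moreover have "(LINT y|Leb 0 1. f y * (deriv ^^ Suc j) \<phi> y) = (-1) ^ Suc j * (LINT y|Leb 0 1. h y * \<phi> y)"
    using assms(2) \<phi> unfolding has_weak_deriv_iff by blast
  ultimately have "(-1) ^ j * (LINT y|Leb 0 1. g y * deriv \<phi> y) = (-1) ^ j * (- (LINT y|Leb 0 1. h y * \<phi> y))"
    by simp
  then show "(LINT y|Leb 0 1. g y * deriv \<phi> y) = - (LINT y|Leb 0 1. h y * \<phi> y)"
    by (subst (asm) mult_cancel_left) simp
qed (use assms in \<open>auto simp: has_weak_deriv_iff intro: sq_integrable_imp_integrable\<close>)

lemma sobolev_norm_squared: "(sobolev_norm s f)\<^sup>2 = (\<Sum>j\<le>s. LINT y|Leb 0 1. (weak_deriv j f y)\<^sup>2)"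
  by (simp add: sobolev_norm_def sum_nonneg)

lemma weak_deriv_le_sobolev_norm:
  "j \<le> s \<Longrightarrow> (LINT y|Leb 0 1. (weak_deriv j f y)\<^sup>2) \<le> (sobolev_norm s f)\<^sup>2"
  unfolding sobolev_norm_squared by (rule member_le_sum) auto

text \<open>The weak derivative of order 0 exists for every square integrable \<open>f\<close>, and
  the other summands are integrals of squares. The bound is therefore available also at times where
  Sobolev regularity of the solution is unknown.\<close>

lemma L2_le_sobolev_norm:
  assumes "sq_integrable 0 1 f"
  shows "(LINT y|Leb 0 1. (f y)\<^sup>2) \<le> (sobolev_norm s f)\<^sup>2"
proof -
  have w: "has_weak_deriv 0 f (weak_deriv 0 f)"
    using has_weak_deriv_weak_deriv[OF has_weak_deriv_0[OF assms]] .
  have "(LINT y|Leb 0 1. (f y)\<^sup>2) = (LINT y|Leb 0 1. (weak_deriv 0 f y)\<^sup>2)"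
  proof (rule integral_cong_AE)
    show "AE y in Leb 0 1. (f y)\<^sup>2 = (weak_deriv 0 f y)\<^sup>2"
      using weak_deriv_AE[OF has_weak_deriv_0[OF assms]] by eventually_elim simp
  qed (use w in \<open>auto simp: has_weak_deriv_iff sq_integrable_def\<close>)
  then show ?thesis using weak_deriv_le_sobolev_norm[of 0 s f] by simp
qed

text \<open>\<open>W j\<close> plays the role of the \<open>j\<close>-th weak derivative of \<open>W 0\<close>, up to null sets.\<close>

definition sobolev_chain :: "nat \<Rightarrow> (nat \<Rightarrow> real \<Rightarrow> real) \<Rightarrow> bool" where
  "sobolev_chain m W \<longleftrightarrow> (\<forall>j\<le>m. sq_integrable 0 1 (W j)) \<and>
     (\<forall>j<m. \<exists>F. primitive_on 0 1 F (W (Suc j)) \<and> (AE y in Leb 0 1. W j y = F y))"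

lemma sobolev_imp_chain: "f \<in> sobolev m \<Longrightarrow> sobolev_chain m (\<lambda>j. weak_deriv j f)"
  unfolding sobolev_chain_def
proof (intro conjI allI impI)
  assume f: "f \<in> sobolev m"
  show "sq_integrable 0 1 (weak_deriv j f)" if "j \<le> m" for j
    using sobolev_has_weak_deriv[OF f that] by (simp add: has_weak_deriv_iff)
  show "\<exists>F. primitive_on 0 1 F (weak_deriv (Suc j) f) \<and> (AE y in Leb 0 1. weak_deriv j f y = F y)"
    if "j < m" for j
    using has_weak_deriv_Suc_imp_primitive[OF sobolev_has_weak_deriv[OF f, of j]
        sobolev_has_weak_deriv[OF f, of "Suc j"]] that by simp
qed

lemma sobolev_imp_sq_integrable: "f \<in> sobolev m \<Longrightarrow> sq_integrable 0 1 f"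
  by (simp add: sobolev_def L2_I_iff)

text \<open>Cauchy-Schwarz on each (a, y). The factor \<open>(b - a)\<^sup>2\<close> is the source
  of the powers of the mesh size: repeated use gives the order of approximation by
  polynomials.\<close>

lemma Poincare:
  assumes F: "primitive_on a b F f" "F a = 0" and f: "sq_integrable a b f"
  shows "(LINT y|Leb a b. (F y)\<^sup>2) \<le> (b - a)\<^sup>2 * (LINT y|Leb a b. (f y)\<^sup>2)"
proof -
  have ab: "a \<le> b" using primitive_onD(1)[OF F(1)] .
  have int: "integrable (Leb a b) (\<lambda>y. (f y)\<^sup>2)" using f by (simp add: sq_integrable_def)
  have bound: "(F y)\<^sup>2 \<le> (b - a) * (LINT y|Leb a b. (f y)\<^sup>2)" if y: "a \<le> y" "y \<le> b" for y
  proof -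
    have "(F y)\<^sup>2 = (LINT s|Leb a y. f s)\<^sup>2"
      using primitive_onD(3)[OF F(1) y] F(2) by simp
    also have "\<dots> \<le> (y - a) * (LINT s|Leb a y. (f s)\<^sup>2)"
      by (rule integral_squared_le[OF sq_integrable_subset[OF f] y(1)]) (use y in auto)
    also have "\<dots> \<le> (b - a) * (LINT s|Leb a b. (f s)\<^sup>2)"
    proof (rule mult_mono)
      have "(LINT s|Leb a b. (f s)\<^sup>2) = (LINT s|Leb a y. (f s)\<^sup>2) + (LINT s|Leb y b. (f s)\<^sup>2)"
        by (rule Leb_integral_split[OF int y])
      then show "(LINT s|Leb a y. (f s)\<^sup>2) \<le> (LINT s|Leb a b. (f s)\<^sup>2)"
        by (simp add: integral_nonneg_AE)
    qed (use y in \<open>auto intro!: integral_nonneg_AE\<close>)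
    finally show ?thesis .
  qed
  have "(LINT y|Leb a b. (F y)\<^sup>2) \<le> (LINT y|Leb a b. (b - a) * (LINT y|Leb a b. (f y)\<^sup>2))"
  proof (rule integral_mono_AE)
    show "integrable (Leb a b) (\<lambda>y. (F y)\<^sup>2)"
      using primitive_on_continuous[OF F(1)] by (intro continuous_imp_Leb_integrable continuous_intros)
    show "AE y in Leb a b. (F y)\<^sup>2 \<le> (b - a) * (LINT y|Leb a b. (f y)\<^sup>2)"
      by (rule AE_LebI) (use bound in auto)
  qed simp
  also have "\<dots> = (b - a)\<^sup>2 * (LINT y|Leb a b. (f y)\<^sup>2)"
    unfolding Leb_integral_const[OF ab] by (simp add: power2_eq_square)
  finally show ?thesis .
qed

text \<open>One-dimensional Sobolev embedding: F(y)^2 is at most 2 F(s)^2 plus twice the integral of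
  f^2, and this is averaged over s.\<close>

lemma sup_bound_by_H1:
  assumes F: "primitive_on 0 1 F f" and f: "sq_integrable 0 1 f" and y: "0 \<le> y" "y \<le> 1"
  shows "(F y)\<^sup>2 \<le> 2 * (LINT s|Leb 0 1. (F s)\<^sup>2) + 2 * (LINT s|Leb 0 1. (f s)\<^sup>2)"
proof -
  have int: "integrable (Leb 0 1) (\<lambda>y. (f y)\<^sup>2)" using f by (simp add: sq_integrable_def)
  define A where "A = (LINT s|Leb 0 1. (f s)\<^sup>2)"
  have diff: "(F d - F c)\<^sup>2 \<le> A" if cd: "0 \<le> c" "c \<le> d" "d \<le> 1" for c d
  proof -
    have "(F d - F c)\<^sup>2 = (LINT s|Leb c d. f s)\<^sup>2" using primitive_on_diff[OF F cd] by simp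
    also have "\<dots> \<le> (d - c) * (LINT s|Leb c d. (f s)\<^sup>2)"
      by (rule integral_squared_le[OF sq_integrable_subset[OF f] cd(2)]) (use cd in auto)
    also have "\<dots> \<le> 1 * (LINT s|Leb c d. (f s)\<^sup>2)"
      by (rule mult_right_mono) (use cd in \<open>auto intro!: integral_nonneg_AE\<close>)
    also have "(LINT s|Leb c d. (f s)\<^sup>2) \<le> A"
    proof -
      have "A = (LINT s|Leb 0 c. (f s)\<^sup>2) + (LINT s|Leb c 1. (f s)\<^sup>2)"
        unfolding A_def by (rule Leb_integral_split[OF int]) (use cd in auto)
      also have "(LINT s|Leb c 1. (f s)\<^sup>2) = (LINT s|Leb c d. (f s)\<^sup>2) + (LINT s|Leb d 1. (f s)\<^sup>2)"
        by (rule Leb_integral_split) (use cd in \<open>auto intro: Leb_integrable_subset[OF int]\<close>)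
      finally show ?thesis by (simp add: add_nonneg_nonneg)
    qed
    finally show ?thesis by simp
  qed
  have "(F y)\<^sup>2 \<le> 2 * (F s)\<^sup>2 + 2 * A" if "0 \<le> s" "s \<le> 1" for s
  proof -
    have "(F y - F s)\<^sup>2 \<le> A"
      using diff[of s y] diff[of y s] that y by (cases "s \<le> y") (auto simp: power2_commute)
    moreover have "(F y)\<^sup>2 \<le> 2 * (F s)\<^sup>2 + 2 * (F y - F s)\<^sup>2"
      using zero_le_power2[of "F y - 2 * F s"] by (simp add: power2_eq_square algebra_simps)
    ultimately show ?thesis by simp
  qed
  moreover have iF: "integrable (Leb 0 1) (\<lambda>y. (F y)\<^sup>2)"
    using primitive_on_continuous[OF F] by (intro continuous_imp_Leb_integrable continuous_intros)
  ultimately have "(LINT s|Leb 0 1. (F y)\<^sup>2) \<le> (LINT s|Leb 0 1. 2 * (F s)\<^sup>2 + 2 * A)"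
    by (intro integral_mono_AE AE_LebI) auto
  also have "\<dots> = 2 * (LINT s|Leb 0 1. (F s)\<^sup>2) + 2 * A"
    using iF measure_Leb[of 0 1] by simp
  finally show ?thesis using measure_Leb[of 0 1] by (simp add: A_def)
qed

section \<open>Polynomials on an interval\<close>

text \<open>The clause for \<open>p = 0\<close> keeps degrees sharp. The zero polynomial has degree
  0, so the general bound would allow degree 1 for its antiderivative, which is constant.\<close>

lemma poly_antiderivative:
  fixes p :: "real poly"
  shows "\<exists>P. pderiv P = p \<and> degree P \<le> Suc (degree p) \<and> (p = 0 \<longrightarrow> degree P = 0) \<and> poly P a = c"
proof -
  define P where "P = (\<Sum>i\<le>degree p. monom (coeff p i / real (Suc i)) (Suc i))"
  have P: "pderiv P = p"
  proof -
    have "pderiv (\<Sum>i\<le>n. monom (coeff p i / real (Suc i)) (Suc i)) = (\<Sum>i\<le>n. monom (coeff p i) i)" for n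
      by (induction n) (simp_all add: pderiv_add pderiv_monom)
    then show ?thesis unfolding P_def by (simp add: poly_as_sum_of_monoms)
  qed
  have "degree P \<le> Suc (degree p)"
    unfolding P_def by (rule degree_sum_le) (auto intro: order.trans[OF degree_monom_le])
  moreover have "P = 0" if "p = 0" using that by (simp add: P_def)
  ultimately show ?thesis using P
    by (intro exI[of _ "P + [:c - poly P a:]"]) (auto simp: pderiv_add pderiv_pCons intro: degree_add_le)
qed

lemma primitive_on_poly: "a \<le> b \<Longrightarrow> primitive_on a b (poly P) (poly (pderiv P))"
  by (rule primitive_on_deriv) (auto intro: poly_DERIV has_field_derivative_at_within continuous_intros)

lemma poly_sq_integrable [simp]: "sq_integrable a b (poly p)"
  by (intro continuous_imp_sq_integrable continuous_intros)

lemma poly_Leb_integrable [simp]: "integrable (Leb a b) (poly p)"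
  by (intro continuous_imp_Leb_integrable continuous_intros)

text \<open>A Taylor-like construction: an approximation of \<open>W (Suc j)\<close> is integrated,
  starting from the value at \<open>a\<close> of the continuous representative of
  \<open>W j\<close>, and Poincare's inequality gains the next power. In \<open>l - 1\<close> the
  subtraction is truncated, so the case \<open>l = 0\<close> is stated separately as
  \<open>p = 0\<close>.\<close>

lemma sobolev_chain_poly_approx:
  assumes W: "sobolev_chain m W" and ab: "0 \<le> a" "a \<le> b" "b \<le> 1"
  shows "j + l \<le> m \<Longrightarrow> \<exists>p. degree p \<le> l - 1 \<and> (l = 0 \<longrightarrow> p = 0) \<and>
    (LINT y|Leb a b. (W j y - poly p y)\<^sup>2) \<le> (b - a) ^ (2 * l) * (LINT y|Leb a b. (W (j + l) y)\<^sup>2)"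
proof (induction l arbitrary: j)
  case 0
  then show ?case by (intro exI[of _ 0]) auto
next
  case (Suc l)
  have sub: "{a<..<b} \<subseteq> {0<..<1}" using ab by auto
  have sq: "sq_integrable a b (W i)" if "i \<le> m" for i
    using W that sq_integrable_subset[OF _ sub] by (simp add: sobolev_chain_def)
  obtain p where p: "degree p \<le> l - 1" "l = 0 \<longrightarrow> p = 0"
    "(LINT y|Leb a b. (W (Suc j) y - poly p y)\<^sup>2) \<le> (b - a) ^ (2 * l) * (LINT y|Leb a b. (W (Suc j + l) y)\<^sup>2)"
    using Suc.IH[of "Suc j"] Suc.prems by auto
  obtain F where F: "primitive_on 0 1 F (W (Suc j))" "AE y in Leb 0 1. W j y = F y"
    using W Suc.prems unfolding sobolev_chain_def by (metis Suc_le_eq add_Suc_right le_add1 order.strict_trans2 less_Suc_eq_le)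
  obtain P where P: "pderiv P = p" "degree P \<le> Suc (degree p)" "p = 0 \<longrightarrow> degree P = 0" "poly P a = F a"
    using poly_antiderivative[of p a "F a"] by blast
  have "primitive_on a b (\<lambda>y. F y + (-1) * poly P y) (\<lambda>y. W (Suc j) y + (-1) * poly p y)"
    using primitive_on_poly[OF ab(2), of P] P(1) primitive_on_subset[OF F(1) ab]
    by (intro primitive_on_add primitive_on_cmult) simp_all
  then have prim: "primitive_on a b (\<lambda>y. F y - poly P y) (\<lambda>y. W (Suc j) y - poly p y)" by simp
  have "(LINT y|Leb a b. (W j y - poly P y)\<^sup>2) = (LINT y|Leb a b. (F y - poly P y)\<^sup>2)"
  proof (rule integral_cong_AE)
    show "AE y in Leb a b. (W j y - poly P y)\<^sup>2 = (F y - poly P y)\<^sup>2"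
      using AE_Leb_subset[OF F(2) sub] by eventually_elim simp
    show "(\<lambda>y. (W j y - poly P y)\<^sup>2) \<in> borel_measurable (Leb a b)"
      using sq_integrable_diff[OF sq[of j] poly_sq_integrable[of a b P]] Suc.prems by (auto simp: sq_integrable_def)
    show "(\<lambda>y. (F y - poly P y)\<^sup>2) \<in> borel_measurable (Leb a b)"
      using continuous_on_power[OF primitive_on_continuous[OF prim]] by (rule continuous_imp_Leb_measurable)
  qed
  also have "\<dots> \<le> (b - a)\<^sup>2 * (LINT y|Leb a b. (W (Suc j) y - poly p y)\<^sup>2)"
    by (rule Poincare[OF prim]) (use P(4) sq[of "Suc j"] Suc.prems in auto)
  also have "\<dots> \<le> (b - a)\<^sup>2 * ((b - a) ^ (2 * l) * (LINT y|Leb a b. (W (Suc j + l) y)\<^sup>2))"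
    by (rule mult_left_mono[OF p(3)]) simp
  finally have "(LINT y|Leb a b. (W j y - poly P y)\<^sup>2)
      \<le> (b - a) ^ (2 * Suc l) * (LINT y|Leb a b. (W (j + Suc l) y)\<^sup>2)"
    by (simp add: power_add power2_eq_square mult_ac)
  moreover have "degree P \<le> Suc l - 1"
    using P(2,3) p(1,2) by (cases l) auto
  ultimately show ?case by blast
qed

lemma poly_mult_Leb_integrable [simp]: "integrable (Leb a b) (\<lambda>y. poly p y * poly q y)"
  by (intro continuous_imp_Leb_integrable continuous_intros)

lemma integral_poly_mult_zero:
  assumes "a < b" "(LINT y|Leb a b. poly p y * poly p y) = 0"
  shows "p = 0"
proof (rule ccontr)
  assume "p \<noteq> 0"
  then have fin: "finite {y. poly p y = 0}" by (rule poly_roots_finite)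
  have "AE y in Leb a b. poly p y * poly p y = 0"
    using assms(2)
    by (subst (asm) integral_nonneg_eq_0_iff_AE) simp_all
  then have "AE y in Leb a b. poly p y = 0" by simp
  then have "poly p y = 0" if "y \<in> {a..b}" for y
    by (intro continuous_AE_eq_imp_eq[OF assms(1) _ _ _ that, of "poly p" "\<lambda>_. 0"] continuous_intros)
  then have "{a..b} \<subseteq> {y. poly p y = 0}" by auto
  then show False using fin infinite_Icc[OF assms(1)] finite_subset by blast
qed

definition linear_on_polys :: "(real poly \<Rightarrow> real) \<Rightarrow> bool" where
  "linear_on_polys L \<longleftrightarrow> (\<forall>p q. L (p + q) = L p + L q) \<and> (\<forall>c p. L (smult c p) = c * L p)"

text \<open>Riesz representation by induction on the degree. The new monomial is made orthogonal to
  all lower degrees, and the representer found so far is corrected by a multiple of the resulting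
  \<open>\<pi>\<close>, fixed by the value of \<open>L\<close> there.\<close>

lemma poly_Riesz_exists:
  assumes ab: "a < b" and L: "linear_on_polys L"
  shows "\<exists>p. degree p \<le> m \<and> (\<forall>q. degree q \<le> m \<longrightarrow> (LINT y|Leb a b. poly p y * poly q y) = L q)"
  using L
proof (induction m arbitrary: L)
  case 0
  have "(LINT y|Leb a b. poly [:L 1 / (b - a):] y * poly q y) = L q" if dq: "degree q \<le> 0" for q
  proof -
    obtain c where q: "q = [:c:]" using dq by (auto elim: degree_eq_zeroE)
    have "L q = c * L 1" using 0[unfolded linear_on_polys_def] q by (metis smult_one)
    then show ?thesis using ab measure_Leb[of a b] q by simp
  qed
  then show ?case by (intro exI[of _ "[:L 1 / (b - a):]"]) auto
next
  case (Suc m)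
  define X where "X = monom (1::real) (Suc m)"
  have "linear_on_polys (\<lambda>q. LINT y|Leb a b. poly X y * poly q y)"
    unfolding linear_on_polys_def by (simp add: distrib_left mult.left_commute)
  then obtain r where r: "degree r \<le> m"
    "\<And>q. degree q \<le> m \<Longrightarrow> (LINT y|Leb a b. poly r y * poly q y) = (LINT y|Leb a b. poly X y * poly q y)"
    using Suc.IH by blast
  define \<pi> where "\<pi> = X - r"
  have deg\<pi>: "degree \<pi> = Suc m" "coeff \<pi> (Suc m) = 1"
    using r(1) coeff_eq_0[of r "Suc m"] degree_monom_eq[of "1::real" "Suc m"]
      degree_add_eq_left[of "- r" X] unfolding \<pi>_def X_def by auto
  have orth: "(LINT y|Leb a b. poly \<pi> y * poly q y) = 0" if "degree q \<le> m" for q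
    using r(2)[OF that] by (simp add: \<pi>_def left_diff_distrib)
  define n where "n = (LINT y|Leb a b. poly \<pi> y * poly \<pi> y)"
  have n: "n \<noteq> 0" using integral_poly_mult_zero[OF ab, of \<pi>] deg\<pi> unfolding n_def by auto
  obtain p where p: "degree p \<le> m" "\<And>q. degree q \<le> m \<Longrightarrow> (LINT y|Leb a b. poly p y * poly q y) = L q"
    using Suc.IH[OF Suc.prems] by blast
  define P where "P = p + smult (L \<pi> / n) \<pi>"
  have "(LINT y|Leb a b. poly P y * poly q y) = L q" if q: "degree q \<le> Suc m" for q
  proof -
    define c where "c = coeff q (Suc m)"
    define q0 where "q0 = q - smult c \<pi>"
    have "degree q0 \<le> m"
    proof (rule degree_le, intro allI impI)
      fix i assume "m < i"
      then consider "i = Suc m" | "i > Suc m" by linarith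
      then show "coeff q0 i = 0"
        by cases (use q deg\<pi> in \<open>auto simp: q0_def c_def coeff_eq_0\<close>)
    qed
    have qe: "q = q0 + smult c \<pi>" by (simp add: q0_def)
    have "(LINT y|Leb a b. poly P y * poly q y)
      = (LINT y|Leb a b. poly p y * poly q0 y + c * (poly \<pi> y * poly p y)
          + (L \<pi> / n) * (poly \<pi> y * poly q0 y) + (L \<pi> / n) * c * (poly \<pi> y * poly \<pi> y))"
      by (rule Bochner_Integration.integral_cong) (simp_all add: P_def qe algebra_simps)
    also have "\<dots> = (LINT y|Leb a b. poly p y * poly q0 y) + c * (LINT y|Leb a b. poly \<pi> y * poly p y)
        + (L \<pi> / n) * (LINT y|Leb a b. poly \<pi> y * poly q0 y) + (L \<pi> / n) * c * n"
      by (simp add: n_def)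
    also have "\<dots> = L q0 + c * L \<pi>"
      using p(2)[OF \<open>degree q0 \<le> m\<close>] orth[OF \<open>degree q0 \<le> m\<close>] orth[OF p(1)] n by simp
    also have "\<dots> = L q" using Suc.prems unfolding linear_on_polys_def qe by metis
    finally show ?thesis .
  qed
  moreover have "degree P \<le> Suc m" unfolding P_def
    by (rule degree_add_le) (use p(1) deg\<pi>(1) degree_smult_le[of "L \<pi> / n" \<pi>] in auto)
  ultimately show ?case by blast
qed

lemma poly_eq_if_integrals_eq:
  assumes "a < b" "degree p \<le> m" "degree p' \<le> m"
    "\<And>q. degree q \<le> m \<Longrightarrow> (LINT y|Leb a b. poly p y * poly q y) = (LINT y|Leb a b. poly p' y * poly q y)"
  shows "p = p'"
proof -
  have "degree (p - p') \<le> m" using assms by (intro degree_diff_le)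
  from assms(4)[OF this] have "(LINT y|Leb a b. poly (p - p') y * poly (p - p') y) = 0"
    using Bochner_Integration.integral_diff[OF poly_mult_Leb_integrable[of a b p "p - p'"] poly_mult_Leb_integrable[of a b p' "p - p'"]]
    unfolding left_diff_distrib[symmetric] poly_diff by simp
  then have "p - p' = 0" by (rule integral_poly_mult_zero[OF assms(1)])
  then show ?thesis by simp
qed

section \<open>L2 projection onto polynomials\<close>

definition proj :: "real \<Rightarrow> real \<Rightarrow> nat \<Rightarrow> (real \<Rightarrow> real) \<Rightarrow> real poly" where
  "proj a b m f = (THE p. degree p \<le> m \<and>
     (\<forall>q. degree q \<le> m \<longrightarrow> (LINT y|Leb a b. poly p y * poly q y) = (LINT y|Leb a b. f y * poly q y)))"

lemma integrable_mult_poly [simp]: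
  "integrable (Leb a b) f \<Longrightarrow> integrable (Leb a b) (\<lambda>y. f y * poly q y)"
  by (rule Leb_integrable_mult_continuous) (auto intro: continuous_intros)

lemma proj:
  assumes "a < b" "integrable (Leb a b) f"
  shows "degree (proj a b m f) \<le> m"
    "degree q \<le> m \<Longrightarrow> (LINT y|Leb a b. poly (proj a b m f) y * poly q y) = (LINT y|Leb a b. f y * poly q y)"
proof -
  have "linear_on_polys (\<lambda>q. LINT y|Leb a b. f y * poly q y)"
    unfolding linear_on_polys_def using assms by (simp add: distrib_left mult.left_commute)
  then have "\<exists>p. degree p \<le> m \<and>
     (\<forall>q. degree q \<le> m \<longrightarrow> (LINT y|Leb a b. poly p y * poly q y) = (LINT y|Leb a b. f y * poly q y))"
    by (rule poly_Riesz_exists[OF assms(1)])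
  then have "\<exists>!p. degree p \<le> m \<and>
     (\<forall>q. degree q \<le> m \<longrightarrow> (LINT y|Leb a b. poly p y * poly q y) = (LINT y|Leb a b. f y * poly q y))"
    by (rule ex_ex1I) (rule poly_eq_if_integrals_eq[OF assms(1), of _ m], auto)
  from theI'[OF this, folded proj_def]
  show "degree (proj a b m f) \<le> m"
    "degree q \<le> m \<Longrightarrow> (LINT y|Leb a b. poly (proj a b m f) y * poly q y) = (LINT y|Leb a b. f y * poly q y)"
    by auto
qed

text \<open>Best approximation and stability in L2 (the case \<open>q = 0\<close>) are both read off
  from this identity.\<close>

lemma proj_Pythagoras:
  assumes ab: "a < b" and f: "sq_integrable a b f" and q: "degree q \<le> m"
  shows "(LINT y|Leb a b. (f y - poly q y)\<^sup>2) = (LINT y|Leb a b. (f y - poly (proj a b m f) y)\<^sup>2)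
    + (LINT y|Leb a b. (poly (proj a b m f - q) y)\<^sup>2)"
proof -
  define P where "P = proj a b m f"
  have fi: "integrable (Leb a b) f" using f by (rule sq_integrable_imp_integrable)
  note pr = proj[OF ab fi, where m = m, folded P_def]
  define d where "d = P - q"
  have d: "degree d \<le> m" unfolding d_def using pr(1) q by (rule degree_diff_le)
  have sq: "integrable (Leb a b) (\<lambda>y. (f y - poly P y)\<^sup>2)"
    using sq_integrable_diff[OF f poly_sq_integrable] by (simp add: sq_integrable_def)
  have sqd: "integrable (Leb a b) (\<lambda>y. (poly d y)\<^sup>2)"
    using poly_sq_integrable[of a b d] by (simp only: sq_integrable_def)
  have "(LINT y|Leb a b. (f y - poly q y)\<^sup>2)
      = (LINT y|Leb a b. (f y - poly P y)\<^sup>2 + 2 * (f y * poly d y - poly P y * poly d y) + (poly d y)\<^sup>2)"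
    by (rule Bochner_Integration.integral_cong) (simp_all add: d_def power2_eq_square algebra_simps)
  also have "\<dots> = (LINT y|Leb a b. (f y - poly P y)\<^sup>2) + 2 * ((LINT y|Leb a b. f y * poly d y)
        - (LINT y|Leb a b. poly P y * poly d y)) + (LINT y|Leb a b. (poly d y)\<^sup>2)"
    using sq sqd fi by simp
  also have "\<dots> = (LINT y|Leb a b. (f y - poly P y)\<^sup>2) + (LINT y|Leb a b. (poly d y)\<^sup>2)"
    using pr(2)[OF d] by simp
  finally show ?thesis by (simp add: P_def d_def)
qed

lemma proj_best_approx:
  assumes "a < b" "sq_integrable a b f" "degree q \<le> m"
  shows "(LINT y|Leb a b. (f y - poly (proj a b m f) y)\<^sup>2) \<le> (LINT y|Leb a b. (f y - poly q y)\<^sup>2)"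
  unfolding proj_Pythagoras[OF assms] by simp

lemma proj_norm_le:
  assumes "a < b" "sq_integrable a b f"
  shows "(LINT y|Leb a b. (poly (proj a b m f) y)\<^sup>2) \<le> (LINT y|Leb a b. (f y)\<^sup>2)"
  using proj_Pythagoras[OF assms, of 0 m] by simp

section \<open>Inverse inequality for polynomials and interpolation\<close>

lemma Leb_integral_poly:
  assumes "a \<le> b"
  shows "(LINT y|Leb a b. poly (pderiv P) y) = poly P b - poly P a"
  using primitive_on_diff[OF primitive_on_poly[OF assms, of P], of a b] assms by simp

lemma Leb_integral_poly_scale:
  assumes "a < b"
  shows "(LINT y|Leb 0 1. poly (pcompose p [:a, b - a:]) y) = (LINT y|Leb a b. poly p y) / (b - a)"
proof -
  obtain P where P: "pderiv P = p" using poly_antiderivative by blast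
  define Q where "Q = smult (1 / (b - a)) (pcompose P [:a, b - a:])"
  have "pderiv Q = pcompose p [:a, b - a:]"
    using assms by (simp add: Q_def pderiv_smult pderiv_pcompose P pderiv_pCons)
  then have "(LINT y|Leb 0 1. poly (pcompose p [:a, b - a:]) y) = poly Q 1 - poly Q 0"
    using Leb_integral_poly[of 0 1 Q] by simp
  also have "\<dots> = (poly P b - poly P a) / (b - a)"
    by (simp add: Q_def poly_pcompose diff_divide_distrib)
  finally show ?thesis using Leb_integral_poly[of a b P] assms P by simp
qed

text \<open>Each coefficient is a linear functional on polynomials of degree at most
  \<open>m\<close>, represented by some \<open>q j\<close>, and Cauchy-Schwarz bounds it by the L2
  norm. On [0, 1] the powers of y are at most 1.\<close>

lemma poly_sup_bound_unit:
  "\<exists>C. \<forall>p. degree p \<le> m \<longrightarrow> (\<forall>y\<in>{0..1}. (poly p y)\<^sup>2 \<le> C * (LINT y|Leb 0 1. (poly p y)\<^sup>2))"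
proof -
  have "\<exists>q. \<forall>p. degree p \<le> m \<longrightarrow> (LINT y|Leb 0 1. poly q y * poly p y) = coeff p j" for j
    using poly_Riesz_exists[of 0 1 "\<lambda>p. coeff p j" m] unfolding linear_on_polys_def by auto
  then obtain q where q: "\<And>j p. degree p \<le> m \<Longrightarrow> (LINT y|Leb 0 1. poly (q j) y * poly p y) = coeff p j"
    by metis
  define A where "A = (\<Sum>j\<le>m. LINT y|Leb 0 1. (poly (q j) y)\<^sup>2)"
  have "(poly p y)\<^sup>2 \<le> (real (Suc m) * A) * (LINT y|Leb 0 1. (poly p y)\<^sup>2)"
    if p: "degree p \<le> m" and y: "y \<in> {0..1}" for p y
  proof -
    define I where "I = (LINT y|Leb 0 1. (poly p y)\<^sup>2)"
    have c: "(coeff p j)\<^sup>2 \<le> (LINT y|Leb 0 1. (poly (q j) y)\<^sup>2) * I" for j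
      using integral_Cauchy_Schwarz[OF poly_sq_integrable[of 0 1 "q j"] poly_sq_integrable[of 0 1 p]]
      by (simp add: q[OF p] I_def)
    have "poly p y = (\<Sum>j\<le>m. coeff p j * y ^ j)"
      unfolding poly_altdef by (rule sum.mono_neutral_left) (use p in \<open>auto intro: le_degree\<close>)
    also have "\<dots>\<^sup>2 \<le> (\<Sum>j\<le>m. (coeff p j)\<^sup>2) * (\<Sum>j\<le>m. (y ^ j)\<^sup>2)"
      by (rule Cauchy_Schwarz_ineq_sum)
    also have "\<dots> \<le> (A * I) * real (Suc m)"
    proof (rule mult_mono)
      show "(\<Sum>j\<le>m. (coeff p j)\<^sup>2) \<le> A * I"
        unfolding A_def sum_distrib_right by (rule sum_mono) (rule c)
      have "(y ^ j)\<^sup>2 \<le> 1" for j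
        using y by (simp add: power_le_one power_mult[symmetric])
      then have "(\<Sum>j\<le>m. (y ^ j)\<^sup>2) \<le> (\<Sum>j\<le>m. 1)" by (intro sum_mono)
      then show "(\<Sum>j\<le>m. (y ^ j)\<^sup>2) \<le> real (Suc m)" by simp
      show "0 \<le> A * I" unfolding A_def I_def by (intro mult_nonneg_nonneg sum_nonneg) auto
    qed (auto intro: sum_nonneg)
    finally show ?thesis by (simp add: I_def mult_ac)
  qed
  then show ?thesis by blast
qed

text \<open>The constant does not depend on the interval: the ratio of both sides is invariant under
  affine changes of variables.\<close>

lemma poly_sup_bound:
  "\<exists>C\<ge>1. \<forall>a b p. a < b \<longrightarrow> degree p \<le> m \<longrightarrow>
     (\<forall>y\<in>{a..b}. (b - a) * (poly p y)\<^sup>2 \<le> C * (LINT y|Leb a b. (poly p y)\<^sup>2))"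
proof -
  obtain C where C: "\<And>p y. degree p \<le> m \<Longrightarrow> y \<in> {0..1} \<Longrightarrow>
      (poly p y)\<^sup>2 \<le> C * (LINT y|Leb 0 1. (poly p y)\<^sup>2)"
    using poly_sup_bound_unit[of m] by blast
  \<comment> \<open>The maximum with 1 yields \<open>C \<ge> 1\<close>; later
    \<open>sqrt C * M\<close> then bounds both the solution and its projection.\<close>
  have "(b - a) * (poly p y)\<^sup>2 \<le> max 1 C * (LINT y|Leb a b. (poly p y)\<^sup>2)"
    if ab: "a < b" and p: "degree p \<le> m" and y: "y \<in> {a..b}" for a b p y
  proof -
    define p' where "p' = pcompose p [:a, b - a:]"
    have "degree p' \<le> m" using p ab by (simp add: p'_def degree_pcompose)
    moreover have "(y - a) / (b - a) \<in> {0..1}" using y ab by auto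
    ultimately have "(poly p' ((y - a) / (b - a)))\<^sup>2 \<le> C * (LINT y|Leb 0 1. (poly p' y)\<^sup>2)" by (rule C)
    moreover have "poly p' ((y - a) / (b - a)) = poly p y"
      using ab by (simp add: p'_def poly_pcompose)
    moreover have "(LINT y|Leb 0 1. (poly p' y)\<^sup>2) = (LINT y|Leb a b. (poly p y)\<^sup>2) / (b - a)"
      using Leb_integral_poly_scale[OF ab, of "p * p"] by (simp add: p'_def pcompose_mult power2_eq_square)
    ultimately have "(poly p y)\<^sup>2 \<le> C * ((LINT y|Leb a b. (poly p y)\<^sup>2) / (b - a))" by simp
    then have "(b - a) * (poly p y)\<^sup>2 \<le> (b - a) * (C * ((LINT y|Leb a b. (poly p y)\<^sup>2) / (b - a)))"
      using ab by (intro mult_left_mono) auto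
    also have "\<dots> = C * (LINT y|Leb a b. (poly p y)\<^sup>2)"
      using ab by simp
    also have "\<dots> \<le> max 1 C * (LINT y|Leb a b. (poly p y)\<^sup>2)"
      by (rule mult_right_mono) auto
    finally show ?thesis .
  qed
  then show ?thesis by (intro exI[of _ "max 1 C"]) auto
qed

text \<open>Stability of the L2 projection in the maximum norm. The inverse inequality costs a
  factor b - a, which integrating the bound \<open>M\<close> over the interval gives back, so the
  constant does not see the mesh.\<close>

lemma proj_sup_bound:
  assumes C: "\<forall>a b p. a < b \<longrightarrow> degree p \<le> m \<longrightarrow>
     (\<forall>y\<in>{a..b}. (b - a) * (poly p y)\<^sup>2 \<le> C * (LINT y|Leb a b. (poly p y)\<^sup>2))" "C \<ge> 0"
    and ab: "a < b" and f: "sq_integrable a b f" and M: "AE y in Leb a b. (f y)\<^sup>2 \<le> M"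
    and y: "y \<in> {a..b}"
  shows "(poly (proj a b m f) y)\<^sup>2 \<le> C * M"
proof -
  have int: "integrable (Leb a b) (\<lambda>y. (f y)\<^sup>2)" using f by (simp add: sq_integrable_def)
  have deg: "degree (proj a b m f) \<le> m"
    by (rule proj(1)[OF ab sq_integrable_imp_integrable[OF f]])
  have "(b - a) * (poly (proj a b m f) y)\<^sup>2 \<le> C * (LINT y|Leb a b. (poly (proj a b m f) y)\<^sup>2)"
    using C(1) ab deg y by blast
  also have "\<dots> \<le> C * (LINT y|Leb a b. (f y)\<^sup>2)"
    by (rule mult_left_mono[OF proj_norm_le[OF ab f] C(2)])
  also have "\<dots> \<le> C * (LINT y|Leb a b. M)"
    by (rule mult_left_mono[OF integral_mono_AE[OF int _ M] C(2)]) simp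
  also have "\<dots> = (b - a) * (C * M)" using ab measure_Leb[of a b] by simp
  finally show ?thesis using ab by simp
qed

text \<open>Serves to transfer regularity in time, known pointwise in space, to the coefficients of
  a time dependent polynomial: finitely many points suffice.\<close>

lemma Lagrange_interpolation:
  assumes "a < b"
  shows "\<exists>ys L. (\<forall>j\<le>m. ys j \<in> {a<..<b}) \<and> (\<forall>j\<le>m. degree (L j) \<le> m) \<and>
    (\<forall>p::real poly. degree p \<le> m \<longrightarrow> p = (\<Sum>j\<le>m. smult (poly p (ys j)) (L j)))"
proof -
  \<comment> \<open>The nodes lie strictly inside the interval, because interior parts of weak
    functions are meaningful only on open elements.\<close>
  define ys where "ys j = a + (b - a) * (real (Suc j) / real (m + 2))" for j
  have inj: "ys i = ys j \<longleftrightarrow> i = j" for i j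
    using assms by (simp add: ys_def)
  have ys: "ys j \<in> {a<..<b}" if "j \<le> m" for j
  proof -
    have *: "0 < real (Suc j) / real (m + 2)" "real (Suc j) / real (m + 2) < 1" using that by auto
    have "0 < (b - a) * (real (Suc j) / real (m + 2))" "(b - a) * (real (Suc j) / real (m + 2)) < (b - a) * 1"
      by (rule mult_pos_pos[OF _ *(1)], use assms in simp)
         (rule mult_strict_left_mono[OF *(2)], use assms in simp)
    then show ?thesis unfolding ys_def by (simp del: of_nat_Suc of_nat_add)
  qed
  define L where "L j = (\<Prod>i\<in>{..m} - {j}. smult (1 / (ys j - ys i)) [:- ys i, 1:])" for j
  have L: "poly (L j) (ys i) = (if i = j then 1 else 0)" if "i \<le> m" "j \<le> m" for i j
  proof (cases "i = j")
    case True
    have "(\<Prod>l\<in>{..m} - {j}. poly (smult (1 / (ys j - ys l)) [:- ys l, 1:]) (ys j)) = (\<Prod>l\<in>{..m} - {j}. 1)"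
    proof (rule prod.cong[OF refl])
      fix l assume "l \<in> {..m} - {j}"
      then have "ys j - ys l \<noteq> 0" using inj by auto
      then show "poly (smult (1 / (ys j - ys l)) [:- ys l, 1:]) (ys j) = 1"
        by (simp add: diff_divide_distrib[symmetric])
    qed
    then show ?thesis using True by (simp add: L_def poly_prod)
  next
    case False
    have "(\<Prod>l\<in>{..m} - {j}. poly (smult (1 / (ys j - ys l)) [:- ys l, 1:]) (ys i)) = 0"
      by (rule prod_zero) (use that False in \<open>auto intro!: bexI[of _ i]\<close>)
    then show ?thesis using False by (simp add: L_def poly_prod)
  qed
  have deg: "degree (L j) \<le> m" if "j \<le> m" for j
  proof -
    have "degree (L j) \<le> (\<Sum>i\<in>{..m} - {j}. degree (smult (1 / (ys j - ys i)) [:- ys i, 1:]))"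
      unfolding L_def by (rule order.trans[OF degree_prod_sum_le]) (auto simp: o_def)
    also have "\<dots> \<le> (\<Sum>i\<in>{..m} - {j}. 1)" by (rule sum_mono) auto
    also have "\<dots> \<le> m" using that by simp
    finally show ?thesis .
  qed
  have "p = (\<Sum>j\<le>m. smult (poly p (ys j)) (L j))" if p: "degree p \<le> m" for p
  proof (rule ccontr)
    define d where "d = p - (\<Sum>j\<le>m. smult (poly p (ys j)) (L j))"
    assume "\<not> ?thesis"
    then have d0: "d \<noteq> 0" by (simp add: d_def)
    have dd: "degree d \<le> m"
      unfolding d_def
      by (intro degree_diff_le p degree_sum_le) (auto simp: deg)
    have "poly d (ys i) = 0" if "i \<le> m" for i
    proof -
      have "(\<Sum>j\<le>m. poly p (ys j) * poly (L j) (ys i)) = (\<Sum>j\<le>m. if j = i then poly p (ys j) else 0)"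
        by (rule sum.cong) (use L that in auto)
      then show ?thesis using that by (simp add: d_def poly_sum)
    qed
    then have "ys ` {..m} \<subseteq> {y. poly d y = 0}" by auto
    then have "card (ys ` {..m}) \<le> card {y. poly d y = 0}"
      by (intro card_mono poly_roots_finite d0)
    also have "\<dots> \<le> degree d" by (rule card_poly_roots_bound[OF d0])
    finally show False using dd inj by (simp add: card_image inj_on_def)
  qed
  then show ?thesis using ys deg by blast
qed

section \<open>Partitions and the discrete weak derivative\<close>

lemma partition_less: "is_partition N x \<Longrightarrow> i \<in> {1..<N} \<Longrightarrow> x i < x (Suc i)"
  by (simp add: is_partition_def)

lemma partition_mono:
  assumes "is_partition N x" "1 \<le> i" "i \<le> j" "j \<le> N"
  shows "x i \<le> x j"
  using assms(3,4)
proof (induction j rule: dec_induct)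
  case (step n)
  then show ?case using partition_less[OF assms(1), of n] assms(2) by auto
qed simp

lemma partition_bounds:
  assumes "is_partition N x" "i \<in> {1..N}"
  shows "0 \<le> x i" "x i \<le> 1"
  using partition_mono[OF assms(1), of 1 i] partition_mono[OF assms(1), of i N] assms
  by (auto simp: is_partition_def)

lemma partition_elem_subset:
  assumes "is_partition N x" "i \<in> {1..<N}"
  shows "0 \<le> x i" "x i < x (Suc i)" "x (Suc i) \<le> 1" "{x i<..<x (Suc i)} \<subseteq> {0<..<1}"
  using partition_bounds[OF assms(1), of i] partition_bounds[OF assms(1), of "Suc i"]
    partition_less[OF assms] assms(2) by auto

lemma partition_elem_disjoint:
  assumes "is_partition N x" "i \<in> {1..<N}" "j \<in> {1..<N}" "y \<in> elem x i" "y \<in> elem x j"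
  shows "i = j"
proof (rule ccontr)
  assume "i \<noteq> j"
  then consider "Suc i \<le> j" | "Suc j \<le> i" by linarith
  then show False
    using partition_mono[OF assms(1), of "Suc i" j] partition_mono[OF assms(1), of "Suc j" i] assms(2-5)
    by cases auto
qed

lemma glue_eq:
  assumes "is_partition N x" "i \<in> {1..<N}" "y \<in> elem x i"
  shows "glue N x p y = poly (p i) y"
proof -
  have "glue N x p y = (\<Sum>j\<in>{1..<N}. if j = i then poly (p i) y else 0)"
    unfolding glue_def
  proof (rule sum.cong[OF refl])
    fix j assume j: "j \<in> {1..<N}"
    show "indicat_real (elem x j) y * poly (p j) y = (if j = i then poly (p i) y else 0)"
      using partition_elem_disjoint[OF assms(1) j assms(2) _ assms(3)] assms(3) by (cases "j = i") (auto simp: indicator_def)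
  qed
  then show ?thesis using assms(2) by simp
qed

lemma partition_integral:
  fixes f :: "real \<Rightarrow> real"
  assumes P: "is_partition N x" and f: "integrable (Leb 0 1) f"
  shows "(LINT y|Leb 0 1. f y) = (\<Sum>i\<in>{1..<N}. LINT y|Leb (x i) (x (Suc i)). f y)"
proof -
  have N: "1 \<le> N" "x 1 = 0" "x N = 1" using P by (auto simp: is_partition_def)
  have "(LINT y|Leb 0 (x n). f y) = (\<Sum>i\<in>{1..<n}. LINT y|Leb (x i) (x (Suc i)). f y)" if "1 \<le> n" "n \<le> N" for n
    using that
  proof (induction n rule: dec_induct)
    case base
    then show ?case using N Leb_integral_empty[of 0 0 f] by simp
  next
    case (step n)
    have n: "n \<in> {1..<N}" using step by auto
    note sub = partition_elem_subset[OF P n]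
    have "(LINT y|Leb 0 (x (Suc n)). f y) = (LINT y|Leb 0 (x n). f y) + (LINT y|Leb (x n) (x (Suc n)). f y)"
      by (rule Leb_integral_split) (use sub in \<open>auto intro: Leb_integrable_subset[OF f]\<close>)
    then show ?case using step by simp
  qed
  from this[of N] show ?thesis using N by simp
qed

lemma mesh_size_ge: "i \<in> {1..<N} \<Longrightarrow> x (Suc i) - x i \<le> mesh_size N x"
  unfolding mesh_size_def by (rule Max_ge) auto

lemma mesh_size_pos: "is_partition N x \<Longrightarrow> mesh_size N x > 0"
  using mesh_size_ge[of 1 N x] partition_less[of N x 1] by (force simp: is_partition_def)

text \<open>Existence by Riesz representation and uniqueness by nondegeneracy of the L2 product turn
  the definite description in \<open>discrete_weak_deriv\<close> into usable equations. The
  polynomial \<open>p\<close> takes the place of the interior part under the integral.\<close>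

lemma discrete_weak_deriv_poly:
  assumes P: "is_partition N x" and i: "i \<in> {1..<N}" and p: "\<And>y. y \<in> elem x i \<Longrightarrow> interior_part v y = poly p y"
  shows "\<exists>D. degree D \<le> r \<and> (\<forall>y\<in>elem x i. discrete_weak_deriv N x r v y = poly D y) \<and>
    (\<forall>q. degree q \<le> r \<longrightarrow> (LINT y|Leb (x i) (x (Suc i)). poly D y * poly q y)
          = - (LINT y|Leb (x i) (x (Suc i)). poly p y * poly (pderiv q) y)
            + nodal_value v (Suc i) * poly q (x (Suc i)) - nodal_value v i * poly q (x i))"
proof -
  define L where "L q = - (LINT y|Leb (x i) (x (Suc i)). interior_part v y * poly (pderiv q) y)
            + nodal_value v (Suc i) * poly q (x (Suc i)) - nodal_value v i * poly q (x i)" for q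
  note xi = partition_less[OF P i]
  have Lp: "L q = - (LINT y|Leb (x i) (x (Suc i)). poly p y * poly (pderiv q) y)
            + nodal_value v (Suc i) * poly q (x (Suc i)) - nodal_value v i * poly q (x i)" for q
  proof -
    have "(LINT y|Leb (x i) (x (Suc i)). interior_part v y * poly (pderiv q) y)
        = (LINT y|Leb (x i) (x (Suc i)). poly p y * poly (pderiv q) y)"
      by (rule Bochner_Integration.integral_cong) (use p in auto)
    then show ?thesis by (simp add: L_def)
  qed
  have "linear_on_polys L"
    unfolding linear_on_polys_def Lp
    by (simp add: pderiv_add pderiv_smult distrib_left mult.left_commute algebra_simps)
  then have ex: "\<exists>D. degree D \<le> r \<and> (\<forall>q. degree q \<le> r \<longrightarrow> (LINT y|Leb (x i) (x (Suc i)). poly D y * poly q y) = L q)"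
    by (rule poly_Riesz_exists[OF xi])
  have "\<exists>!D. degree D \<le> r \<and> (\<forall>q. degree q \<le> r \<longrightarrow> (LINT y|Leb (x i) (x (Suc i)). poly D y * poly q y) = L q)"
    using ex by (rule ex_ex1I) (rule poly_eq_if_integrals_eq[OF xi, of _ r], auto)
  from theI'[OF this]
  have "degree (THE D. degree D \<le> r \<and> (\<forall>q. degree q \<le> r \<longrightarrow> (LINT y|Leb (x i) (x (Suc i)). poly D y * poly q y) = L q)) \<le> r"
    "\<And>q. degree q \<le> r \<Longrightarrow> (LINT y|Leb (x i) (x (Suc i)). poly (THE D. degree D \<le> r \<and> (\<forall>q. degree q \<le> r \<longrightarrow> (LINT y|Leb (x i) (x (Suc i)). poly D y * poly q y) = L q)) y * poly q y) = L q"
    by blast+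
  moreover have "discrete_weak_deriv N x r v y = poly (THE D. degree D \<le> r \<and> (\<forall>q. degree q \<le> r \<longrightarrow> (LINT y|Leb (x i) (x (Suc i)). poly D y * poly q y) = L q)) y"
    if "y \<in> elem x i" for y
    unfolding discrete_weak_deriv_def glue_eq[OF P i that] by (simp add: L_def)
  ultimately show ?thesis unfolding Lp by blast
qed

text \<open>\<open>proj_h\<close> is described by orthogonality of the error; for integrable
  \<open>w\<close> this splits into the equation that defines \<open>proj\<close>.\<close>

lemma proj_h_interior:
  assumes P: "is_partition N x" and i: "i \<in> {1..<N}" and w: "integrable (Leb (x i) (x (Suc i))) w"
    and y: "y \<in> elem x i"
  shows "interior_part (proj_h N x k w) y = poly (proj (x i) (x (Suc i)) k w) y"
proof -
  have "(LINT y|Leb (x i) (x (Suc i)). (w y - poly p y) * poly q y) = 0 \<longleftrightarrow>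
    (LINT y|Leb (x i) (x (Suc i)). poly p y * poly q y) = (LINT y|Leb (x i) (x (Suc i)). w y * poly q y)" for p q
    using w by (auto simp: left_diff_distrib)
  then show ?thesis
    unfolding proj_h_def weak_fun.sel glue_eq[OF P i y] proj_def by simp
qed

section \<open>The error equation at a fixed time\<close>

lemma weighted_AM_GM:
  assumes "\<nu> > (0::real)"
  shows "a * d \<le> \<nu> / 8 * d\<^sup>2 + 2 / \<nu> * a\<^sup>2"
proof -
  have "\<nu> / 8 * d\<^sup>2 + 2 / \<nu> * a\<^sup>2 - a * d = (\<nu> * d - 4 * a)\<^sup>2 / (8 * \<nu>)"
    using assms by (simp add: power2_eq_square field_simps)
  moreover have "\<dots> \<ge> 0" using assms by simp
  ultimately show ?thesis by linarith
qed

text \<open>This is the integrand of the error equation, with the discrete quantities written as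
  \<open>U - e\<close> and \<open>D - d\<close>. The two terms containing
  \<open>e\<^sup>2 * d\<close> cancel, which is the effect of the two thirds in the scheme. Every
  other nonlinear product has a factor controlled by \<open>M\<close> or \<open>\<mu>\<close>, and
  the three terms linear in \<open>d\<close> are absorbed with weight \<nu>/8 each.\<close>

lemma error_terms_pointwise:
  fixes \<nu> M \<mu> w U e d D W1 \<rho> F :: real
  assumes \<nu>: "\<nu> > 0" and w: "\<bar>w\<bar> \<le> M" and U: "\<bar>U\<bar> \<le> M" and W1: "W1\<^sup>2 \<le> \<mu>" and D: "D\<^sup>2 \<le> \<mu>"
  shows "(\<rho> - F) * d + 1 / 3 * (w\<^sup>2 - (U - e)\<^sup>2) * d - 1 / 3 * (w * W1 - (U - e) * (D - d)) * e
    \<le> \<nu> / 2 * d\<^sup>2 + (M\<^sup>2 / \<nu> + 1 + \<mu>) * e\<^sup>2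
      + (2 / \<nu> + M\<^sup>2 + M\<^sup>2 / \<nu> + 1) * ((\<rho> - F)\<^sup>2 + (w - U)\<^sup>2 + (W1 - D)\<^sup>2)"
proof -
  have \<mu>: "0 \<le> \<mu>" using W1 by (meson order.trans zero_le_power2)
  have U2: "U\<^sup>2 \<le> M\<^sup>2" using U by (simp add: abs_le_square_iff[symmetric])
  have wU: "(w + U)\<^sup>2 \<le> 4 * M\<^sup>2"
  proof -
    have "\<bar>w + U\<bar> \<le> 2 * M" using w U by linarith
    from power_mono[OF this abs_ge_zero, of 2] show ?thesis by (simp add: power_mult_distrib)
  qed
  have t1: "(\<rho> - F) * d \<le> \<nu> / 8 * d\<^sup>2 + 2 / \<nu> * (\<rho> - F)\<^sup>2"
    by (rule weighted_AM_GM[OF \<nu>])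
  have t2: "(1 / 3 * (w + U) * (w - U)) * d \<le> \<nu> / 8 * d\<^sup>2 + M\<^sup>2 / \<nu> * (w - U)\<^sup>2"
  proof -
    have "(1 / 3 * (w + U) * (w - U)) * d \<le> \<nu> / 8 * d\<^sup>2 + 2 / \<nu> * (1 / 3 * (w + U) * (w - U))\<^sup>2"
      by (rule weighted_AM_GM[OF \<nu>])
    also have "2 / \<nu> * (1 / 3 * (w + U) * (w - U))\<^sup>2 = (2 / 9 * (w + U)\<^sup>2) * ((w - U)\<^sup>2 / \<nu>)"
      by (simp add: power_mult_distrib power_divide)
    also have "\<dots> \<le> M\<^sup>2 * ((w - U)\<^sup>2 / \<nu>)"
    proof (rule mult_right_mono)
      show "2 / 9 * (w + U)\<^sup>2 \<le> M\<^sup>2" using wU zero_le_power2[of M] by linarith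
    qed (use \<nu> in simp)
    finally show ?thesis by simp
  qed
  have t3: "(1 / 3 * U * e) * d \<le> \<nu> / 8 * d\<^sup>2 + M\<^sup>2 / \<nu> * e\<^sup>2"
  proof -
    have "(1 / 3 * U * e) * d \<le> \<nu> / 8 * d\<^sup>2 + 2 / \<nu> * (1 / 3 * U * e)\<^sup>2"
      by (rule weighted_AM_GM[OF \<nu>])
    also have "2 / \<nu> * (1 / 3 * U * e)\<^sup>2 = (2 / 9 * U\<^sup>2) * (e\<^sup>2 / \<nu>)"
      by (simp add: power_mult_distrib power_divide)
    also have "\<dots> \<le> M\<^sup>2 * (e\<^sup>2 / \<nu>)"
    proof (rule mult_right_mono)
      show "2 / 9 * U\<^sup>2 \<le> M\<^sup>2" using U2 zero_le_power2[of U] by linarith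
    qed (use \<nu> in simp)
    finally show ?thesis by simp
  qed
  have AG: "- (a * b) \<le> (a\<^sup>2 + b\<^sup>2) / 2" for a b :: real
    using zero_le_power2[of "a + b"] by (simp add: power2_eq_square algebra_simps)
  have t4: "- (1 / 3 * (w - U) * W1 * e) \<le> 1 / 6 * (w - U)\<^sup>2 + 1 / 6 * \<mu> * e\<^sup>2"
  proof -
    have "- ((w - U) * (W1 * e)) \<le> ((w - U)\<^sup>2 + W1\<^sup>2 * e\<^sup>2) / 2"
      using AG[of "w - U" "W1 * e"] by (simp add: power_mult_distrib)
    moreover have "W1\<^sup>2 * e\<^sup>2 \<le> \<mu> * e\<^sup>2" by (rule mult_right_mono[OF W1]) simp
    ultimately show ?thesis by simp
  qed
  have t5: "- (1 / 3 * U * (W1 - D) * e) \<le> 1 / 6 * (M\<^sup>2 * (W1 - D)\<^sup>2) + 1 / 6 * e\<^sup>2"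
  proof -
    have "- ((U * (W1 - D)) * e) \<le> (U\<^sup>2 * (W1 - D)\<^sup>2 + e\<^sup>2) / 2"
      using AG[of "U * (W1 - D)" e] by (simp add: power_mult_distrib)
    moreover have "U\<^sup>2 * (W1 - D)\<^sup>2 \<le> M\<^sup>2 * (W1 - D)\<^sup>2" by (rule mult_right_mono[OF U2]) simp
    ultimately show ?thesis by simp
  qed
  have t6: "- (1 / 3 * D * e\<^sup>2) \<le> 1 / 6 * e\<^sup>2 + 1 / 6 * (\<mu> * e\<^sup>2)"
  proof -
    have "- (D * 1) \<le> (D\<^sup>2 + 1) / 2" using AG[of D 1] by simp
    then have "- D \<le> (\<mu> + 1) / 2" using D by simp
    then have "(- D) * e\<^sup>2 \<le> (\<mu> + 1) / 2 * e\<^sup>2" by (rule mult_right_mono) simp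
    then show ?thesis by (simp add: algebra_simps)
  qed
  have "(\<rho> - F) * d + 1 / 3 * (w\<^sup>2 - (U - e)\<^sup>2) * d - 1 / 3 * (w * W1 - (U - e) * (D - d)) * e
    = (\<rho> - F) * d + (1 / 3 * (w + U) * (w - U)) * d + (1 / 3 * U * e) * d
      + - (1 / 3 * (w - U) * W1 * e) + - (1 / 3 * U * (W1 - D) * e) + - (1 / 3 * D * e\<^sup>2)"
    by (simp add: power2_eq_square field_simps)
  also have "\<dots> \<le> 3 * (\<nu> / 8 * d\<^sup>2) + (M\<^sup>2 / \<nu> + 1 / 3 + \<mu> / 3) * e\<^sup>2 + 2 / \<nu> * (\<rho> - F)\<^sup>2
      + (M\<^sup>2 / \<nu> + 1 / 6) * (w - U)\<^sup>2 + M\<^sup>2 / 6 * (W1 - D)\<^sup>2"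
  proof -
    have "(M\<^sup>2 / \<nu> + 1 / 3 + \<mu> / 3) * e\<^sup>2 = M\<^sup>2 / \<nu> * e\<^sup>2 + 1 / 3 * e\<^sup>2 + 1 / 3 * (\<mu> * e\<^sup>2)"
      "(M\<^sup>2 / \<nu> + 1 / 6) * (w - U)\<^sup>2 = M\<^sup>2 / \<nu> * (w - U)\<^sup>2 + 1 / 6 * (w - U)\<^sup>2"
      "M\<^sup>2 / 6 * (W1 - D)\<^sup>2 = 1 / 6 * (M\<^sup>2 * (W1 - D)\<^sup>2)" "1 / 6 * \<mu> * e\<^sup>2 = 1 / 6 * (\<mu> * e\<^sup>2)"
      by (simp_all add: distrib_right)
    then show ?thesis using t1 t2 t3 t4 t5 t6 by linarith
  qed
  also have "\<dots> \<le> \<nu> / 2 * d\<^sup>2 + (M\<^sup>2 / \<nu> + 1 + \<mu>) * e\<^sup>2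
      + ((2 / \<nu> + M\<^sup>2 + M\<^sup>2 / \<nu> + 1) * (\<rho> - F)\<^sup>2 + (2 / \<nu> + M\<^sup>2 + M\<^sup>2 / \<nu> + 1) * (w - U)\<^sup>2
      + (2 / \<nu> + M\<^sup>2 + M\<^sup>2 / \<nu> + 1) * (W1 - D)\<^sup>2)"
  proof -
    have nn: "0 \<le> 2 / \<nu>" "0 \<le> M\<^sup>2 / \<nu>" "0 \<le> M\<^sup>2" using \<nu> by auto
    have "3 * (\<nu> / 8 * d\<^sup>2) \<le> \<nu> / 2 * d\<^sup>2" using \<nu> by simp
    moreover have "(M\<^sup>2 / \<nu> + 1 / 3 + \<mu> / 3) * e\<^sup>2 \<le> (M\<^sup>2 / \<nu> + 1 + \<mu>) * e\<^sup>2"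
      by (rule mult_right_mono) (use \<mu> in auto)
    moreover have "2 / \<nu> * (\<rho> - F)\<^sup>2 \<le> (2 / \<nu> + M\<^sup>2 + M\<^sup>2 / \<nu> + 1) * (\<rho> - F)\<^sup>2"
      by (rule mult_right_mono) (use nn in auto)
    moreover have "(M\<^sup>2 / \<nu> + 1 / 6) * (w - U)\<^sup>2 \<le> (2 / \<nu> + M\<^sup>2 + M\<^sup>2 / \<nu> + 1) * (w - U)\<^sup>2"
      by (rule mult_right_mono) (use nn in linarith, simp)
    moreover have "M\<^sup>2 / 6 * (W1 - D)\<^sup>2 \<le> (2 / \<nu> + M\<^sup>2 + M\<^sup>2 / \<nu> + 1) * (W1 - D)\<^sup>2"
      by (rule mult_right_mono) (use nn in linarith, simp)
    ultimately show ?thesis by linarith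
  qed
  finally show ?thesis by (simp add: distrib_left)
qed

lemma telescope_partition:
  fixes N :: nat
  assumes "1 \<le> N"
  shows "(\<Sum>i\<in>{1..<N}. g (Suc i) - g i) = g N - (g 1 :: real)"
  using sum_Suc_diff'[of 1 N g] assms by simp

text \<open>At one time, \<open>W\<close> and \<open>Z\<close> stand for the space derivatives of u
  and u_t; \<open>up\<close>, \<open>dh\<close> and \<open>R\<close> are the pieces of the discrete
  solution, of its weak derivative and of its time derivative. In the first conclusion the sum with
  \<open>Z 0\<close> and \<open>R\<close> will become half the time derivative of the squared norm
  of \<open>e\<close>; half of the dissipation is kept, the other half absorbs error terms. The
  second conclusion bounds u_x minus its projection, which is \<open>dh i + d i\<close>.\<close>

lemma spatial_estimate:
  fixes W Z :: "nat \<Rightarrow> real \<Rightarrow> real" and up dh R e d :: "nat \<Rightarrow> real poly"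
  assumes P: "is_partition N x" and \<nu>: "\<nu> > 0"
    and W: "sobolev_chain (k + 2) W" and Z: "sobolev_chain k Z"
    and w: "continuous_on {0..1} w" "AE y in Leb 0 1. w y = W 0 y" "w 0 = 0" "w 1 = 0"
      "\<And>y. y \<in> {0..1} \<Longrightarrow> \<bar>w y\<bar> \<le> M"
    and eq: "AE y in Leb 0 1. Z 0 y + w y * W 1 y - \<nu> * W 2 y = 0"
    and \<beta>: "\<And>j. j \<le> k + 2 \<Longrightarrow> (LINT y|Leb 0 1. (W j y)\<^sup>2) \<le> \<beta>"
      "\<And>j. j \<le> k \<Longrightarrow> (LINT y|Leb 0 1. (Z j y)\<^sup>2) \<le> \<beta>"
    and C: "\<forall>a b p. a < b \<longrightarrow> degree p \<le> k + 1 \<longrightarrow>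
       (\<forall>y\<in>{a..b}. (b - a) * (poly p y)\<^sup>2 \<le> C * (LINT y|Leb a b. (poly p y)\<^sup>2))" "C \<ge> 1"
    and deg: "\<And>i. i \<in> {1..<N} \<Longrightarrow> degree (up i) \<le> k" "\<And>i. i \<in> {1..<N} \<Longrightarrow> degree (dh i) \<le> k + 1"
    and dh: "\<And>i q. i \<in> {1..<N} \<Longrightarrow> degree q \<le> k + 1 \<Longrightarrow>
        (LINT y|Leb (x i) (x (Suc i)). poly (dh i) y * poly q y)
          = - (LINT y|Leb (x i) (x (Suc i)). poly (up i) y * poly (pderiv q) y)
            + vn (Suc i) * poly q (x (Suc i)) - vn i * poly q (x i)"
    and vn: "vn 1 = 0" "vn N = 0"
    and e: "\<And>i. e i = proj (x i) (x (Suc i)) k w - up i"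
    and d: "\<And>i. i \<in> {1..<N} \<Longrightarrow> degree (d i) \<le> k + 1"
      "\<And>i q. i \<in> {1..<N} \<Longrightarrow> degree q \<le> k + 1 \<Longrightarrow>
        (LINT y|Leb (x i) (x (Suc i)). poly (d i) y * poly q y)
          = - (LINT y|Leb (x i) (x (Suc i)). poly (e i) y * poly (pderiv q) y)
            + (w (x (Suc i)) - vn (Suc i)) * poly q (x (Suc i)) - (w (x i) - vn i) * poly q (x i)"
    and discrete: "(\<Sum>i\<in>{1..<N}. (LINT y|Leb (x i) (x (Suc i)). poly (R i) y * poly (e i) y)
        + \<nu> * (LINT y|Leb (x i) (x (Suc i)). poly (dh i) y * poly (d i) y)
        + 1 / 3 * (LINT y|Leb (x i) (x (Suc i)). (poly (up i) y * poly (dh i) y) * poly (e i) y)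
        - 1 / 3 * (LINT y|Leb (x i) (x (Suc i)). (poly (up i) y * poly (up i) y) * poly (d i) y)) = 0"
  shows "(\<Sum>i\<in>{1..<N}. LINT y|Leb (x i) (x (Suc i)). (Z 0 y - poly (R i) y) * poly (e i) y)
      + \<nu> / 2 * (\<Sum>i\<in>{1..<N}. LINT y|Leb (x i) (x (Suc i)). (poly (d i) y)\<^sup>2)
    \<le> (C * M\<^sup>2 / \<nu> + 1 + C * (4 * \<beta>)) * (\<Sum>i\<in>{1..<N}. LINT y|Leb (x i) (x (Suc i)). (poly (e i) y)\<^sup>2)
      + (2 / \<nu> + C * M\<^sup>2 + C * M\<^sup>2 / \<nu> + 1) * (2 * \<nu>\<^sup>2 + 4) * mesh_size N x ^ (2 * (k + 1)) * \<beta>"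
    and "(\<Sum>i\<in>{1..<N}. LINT y|Leb (x i) (x (Suc i)). (W 1 y - poly (dh i + d i) y)\<^sup>2)
      \<le> mesh_size N x ^ (2 * (k + 1)) * \<beta>"
proof -
  define h where "h = mesh_size N x"
  define U where "U i = proj (x i) (x (Suc i)) k w" for i
  define D where "D i = proj (x i) (x (Suc i)) (k + 1) (W 1)" for i
  define J where "J i = (\<lambda>f :: real \<Rightarrow> real. LINT y|Leb (x i) (x (Suc i)). f y)" for i
  define b where "b i = w (x i) - vn i" for i
  have N: "1 \<le> N" using P by (simp add: is_partition_def)
  have sqW: "sq_integrable 0 1 (W j)" if "j \<le> k + 2" for j using W that by (simp add: sobolev_chain_def)
  have sqZ: "sq_integrable 0 1 (Z j)" if "j \<le> k" for j using Z that by (simp add: sobolev_chain_def)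
  have sqw: "sq_integrable 0 1 w" by (rule continuous_imp_sq_integrable[OF w(1)])
  have \<beta>0: "0 \<le> \<beta>" 
  proof -
    have "0 \<le> (LINT y|Leb 0 1. (W 0 y)\<^sup>2)" by simp
    also have "\<dots> \<le> \<beta>" by (rule \<beta>(1)) simp
    finally show ?thesis .
  qed
  have wM: "\<bar>w y\<bar> \<le> M" if "y \<in> {0..1}" for y using w(5)[OF that] .
  have M0: "0 \<le> M" using wM[of 0] by simp

  \<comment> \<open>Continuous representatives and the flux\<close>
  have wp: "primitive_on 0 1 w (W 1)"
  proof -
    obtain G where G: "primitive_on 0 1 G (W 1)" "AE y in Leb 0 1. W 0 y = G y"
      using W by (auto simp: sobolev_chain_def dest: spec[of _ 0])
    have "AE y in Leb 0 1. w y = G y" using w(2) G(2) by eventually_elim simp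
    then have "w y = G y" if "y \<in> {0..1}" for y
      using continuous_AE_eq_imp_eq[OF _ w(1) primitive_on_continuous[OF G(1)] _ that] by simp
    then show ?thesis using primitive_on_cong[OF G(1), of w] by simp
  qed
  obtain G where G: "primitive_on 0 1 G (W 2)" "AE y in Leb 0 1. W 1 y = G y"
    using W by (auto simp: sobolev_chain_def numeral_2_eq_2 dest: spec[of _ 1])
  \<comment> \<open>\<open>G\<close> enters rather than \<open>W 1\<close>, because the flux is
    evaluated at nodes and the continuous representative has meaningful values there.\<close>
  define F where "F y = (-\<nu>) * G y + 1 / 3 * (w y * w y)" for y
  define f where "f y = (-\<nu>) * W 2 y + 1 / 3 * (W 1 y * w y + W 1 y * w y)" for y
  have Fp: "primitive_on 0 1 F f"
    unfolding F_def[abs_def] f_def[abs_def] by (intro primitive_on_add primitive_on_cmult G primitive_on_mult wp)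
  have sqf: "sq_integrable 0 1 f"
  proof -
    have "sq_integrable 0 1 (\<lambda>y. W 1 y * w y)"
      using wM by (intro sq_integrable_mult_bounded[where M = M] sqW AE_LebI continuous_imp_Leb_measurable w) auto
    then show ?thesis unfolding f_def[abs_def] using sqW[of 2]
      by (intro sq_integrable_add sq_integrable_cmult) auto
  qed
  have Feq: "AE y in Leb 0 1. \<nu> * W 1 y = 1 / 3 * (w y)\<^sup>2 - F y"
    using G(2) by eventually_elim (simp add: F_def power2_eq_square)
  have feq: "AE y in Leb 0 1. f y = (-\<nu> / 3) * W 2 y + (-2 / 3) * Z 0 y"
    using eq
  proof eventually_elim
    case (elim y)
    then have "w y * W 1 y = \<nu> * W 2 y - Z 0 y" by simp
    then show ?case by (simp add: f_def mult.commute field_simps)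
  qed
  have Zeq: "AE y in Leb 0 1. Z 0 y = - f y - 1 / 3 * (w y * W 1 y)"
    using eq by eventually_elim (simp add: f_def)
  \<comment> \<open>The value 4 \<beta> comes from the embedding: twice the squared norm of u_x plus
    twice that of u_xx.\<close>
  have W1b: "AE y in Leb 0 1. (W 1 y)\<^sup>2 \<le> 4 * \<beta>"
  proof -
    have "(LINT s|Leb 0 1. (G s)\<^sup>2) = (LINT s|Leb 0 1. (W 1 s)\<^sup>2)"
    proof (rule integral_cong_AE)
      show "AE y in Leb 0 1. (G y)\<^sup>2 = (W 1 y)\<^sup>2" using G(2) by eventually_elim simp
      show "(\<lambda>y. (G y)\<^sup>2) \<in> borel_measurable (Leb 0 1)"
        using continuous_on_power[OF primitive_on_continuous[OF G(1)]] by (rule continuous_imp_Leb_measurable)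
    qed (use sqW[of 1] in \<open>auto simp: sq_integrable_def\<close>)
    then have "(G y)\<^sup>2 \<le> 4 * \<beta>" if "0 \<le> y" "y \<le> 1" for y
      using sup_bound_by_H1[OF G(1) sqW that] \<beta>(1)[of 1] \<beta>(1)[of 2] by simp
    then have "AE y in Leb 0 1. (G y)\<^sup>2 \<le> 4 * \<beta>" by (intro AE_LebI) auto
    with G(2) show ?thesis by eventually_elim simp
  qed

  define \<rho> where "\<rho> i = (SOME Q. pderiv Q = proj (x i) (x (Suc i)) k f \<and> degree Q \<le> k + 1 \<and> poly Q (x i) = F (x i))" for i
  \<comment> \<open>Three facts on one element under short names: \<open>A\<close> combines the
    error identity with the pointwise bound, \<open>B\<close> is the approximation of the flux,
    \<open>E\<close> holds the projection errors together with
    \<open>dh i + d i = D i\<close>.\<close>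
  have elem: "A i \<and> B i \<and> E i" if i: "i \<in> {1..<N}"
    and AB: "A = (\<lambda>i. J i (\<lambda>y. (Z 0 y - poly (R i) y) * poly (e i) y) + \<nu> * J i (\<lambda>y. (poly (d i) y)\<^sup>2)
        + (J i (\<lambda>y. poly (R i) y * poly (e i) y) + \<nu> * J i (\<lambda>y. poly (dh i) y * poly (d i) y)
           + 1 / 3 * J i (\<lambda>y. (poly (up i) y * poly (dh i) y) * poly (e i) y)
           - 1 / 3 * J i (\<lambda>y. (poly (up i) y * poly (up i) y) * poly (d i) y))
        + (b (Suc i) * F (x (Suc i)) - b i * F (x i))
        \<le> \<nu> / 2 * J i (\<lambda>y. (poly (d i) y)\<^sup>2) + (C * M\<^sup>2 / \<nu> + 1 + C * (4 * \<beta>)) * J i (\<lambda>y. (poly (e i) y)\<^sup>2)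
          + (2 / \<nu> + C * M\<^sup>2 + C * M\<^sup>2 / \<nu> + 1) * (J i (\<lambda>y. (poly (\<rho> i) y - F y)\<^sup>2)
            + J i (\<lambda>y. (w y - poly (U i) y)\<^sup>2) + J i (\<lambda>y. (W 1 y - poly (D i) y)\<^sup>2)))"
      "B = (\<lambda>i. J i (\<lambda>y. (poly (\<rho> i) y - F y)\<^sup>2)
          \<le> h ^ (2 * (k + 1)) * ((\<nu>\<^sup>2 + 1) * (J i (\<lambda>y. (W (k + 2) y)\<^sup>2) + J i (\<lambda>y. (Z k y)\<^sup>2))))"
      "E = (\<lambda>i. J i (\<lambda>y. (w y - poly (U i) y)\<^sup>2) \<le> h ^ (2 * (k + 1)) * J i (\<lambda>y. (W (k + 1) y)\<^sup>2) \<and>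
          J i (\<lambda>y. (W 1 y - poly (D i) y)\<^sup>2) \<le> h ^ (2 * (k + 1)) * J i (\<lambda>y. (W (k + 2) y)\<^sup>2) \<and> dh i + d i = D i)"
    for i A B E
  proof -
    note el = partition_elem_subset[OF P i]
    define xl where "xl = x i" define xr where "xr = x (Suc i)"
    note el' = el[folded xl_def xr_def]
    have lr: "xl \<le> xr" using el' by simp
    have h: "xr - xl \<le> h" "0 \<le> xr - xl"
      using mesh_size_ge[OF i, of x] el' by (auto simp: h_def xl_def xr_def)
    have hp: "(xr - xl) ^ n \<le> h ^ n" for n by (rule power_mono[OF h])
    have sub: "sq_integrable xl xr g" if "sq_integrable 0 1 g" for g
      by (rule sq_integrable_subset[OF that el'(4)])
    note AEsub = AE_Leb_subset[OF _ el'(4)]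
    have wpe: "primitive_on xl xr w (W 1)" and Fpe: "primitive_on xl xr F f"
      using primitive_on_subset[OF wp el'(1) lr el'(3)] primitive_on_subset[OF Fp el'(1) lr el'(3)] by auto
    have sq: "sq_integrable xl xr w" "sq_integrable xl xr (W 1)" "sq_integrable xl xr (W 2)"
      "sq_integrable xl xr (Z 0)" "sq_integrable xl xr f" "sq_integrable xl xr F"
      using sub sqw sqW[of 1] sqW[of 2] sqZ[of 0] sqf continuous_imp_sq_integrable[OF primitive_on_continuous[OF Fpe]] by auto
    have int: "integrable (Leb xl xr) w" "integrable (Leb xl xr) (W 1)"
      "integrable (Leb xl xr) (Z 0)" "integrable (Leb xl xr) f" "integrable (Leb xl xr) F"
      "integrable (Leb xl xr) (\<lambda>y. w y * W 1 y)" "integrable (Leb xl xr) (\<lambda>y. w y * w y)"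
      using sq by (auto intro: sq_integrable_imp_integrable sq_integrable_mult)
    have Ue: "U i = proj xl xr k w" and De: "D i = proj xl xr (k + 1) (W 1)"
      by (simp_all add: U_def D_def xl_def xr_def)
    have ee: "e i = U i - up i" by (simp add: U_def e)
    have Je: "J i g = (LINT y|Leb xl xr. g y)" for g by (simp add: J_def xl_def xr_def)
    have degU: "degree (U i) \<le> k" unfolding Ue by (rule proj(1)[OF el'(2) int(1)])
    have degD: "degree (D i) \<le> k + 1" unfolding De by (rule proj(1)[OF el'(2) int(2)])
    have dege: "degree (e i) \<le> k" unfolding ee using degU deg(1)[OF i] by (rule degree_diff_le)
    have degd: "degree (d i) \<le> k + 1" using d(1)[OF i] .
    have dchar: "(LINT y|Leb xl xr. poly (d i) y * poly q y)
        = - (LINT y|Leb xl xr. poly (e i) y * poly (pderiv q) y) + b (Suc i) * poly q xr - b i * poly q xl"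
      if "degree q \<le> k + 1" for q
      using d(2)[OF i that] by (simp add: xl_def xr_def b_def)
    \<comment> \<open>For \<open>q\<close> of degree at most k + 1 the derivative has degree at most
      k, so \<open>w\<close> may be replaced by its projection of degree k. This matching of degrees
      makes weak derivative and projection commute.\<close>
    have Dchar: "(LINT y|Leb xl xr. poly (D i - dh i) y * poly q y)
        = - (LINT y|Leb xl xr. poly (e i) y * poly (pderiv q) y) + b (Suc i) * poly q xr - b i * poly q xl"
      if q: "degree q \<le> k + 1" for q
    proof -
      have q': "degree (pderiv q) \<le> k" using q by (simp add: degree_pderiv)
      have "primitive_on xl xr (\<lambda>y. w y * poly q y) (\<lambda>y. W 1 y * poly q y + poly (pderiv q) y * w y)"
        by (rule primitive_on_mult[OF wpe primitive_on_poly[OF lr]])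
      then have "w xr * poly q xr - w xl * poly q xl = (LINT y|Leb xl xr. W 1 y * poly q y + w y * poly (pderiv q) y)"
        using primitive_on_diff[of xl xr _ _ xl xr] lr by (simp add: mult.commute)
      also have "\<dots> = (LINT y|Leb xl xr. W 1 y * poly q y) + (LINT y|Leb xl xr. w y * poly (pderiv q) y)"
        using int by simp
      also have "(LINT y|Leb xl xr. W 1 y * poly q y) = (LINT y|Leb xl xr. poly (D i) y * poly q y)"
        unfolding De by (rule proj(2)[OF el'(2) int(2) q, symmetric])
      also have "(LINT y|Leb xl xr. w y * poly (pderiv q) y) = (LINT y|Leb xl xr. poly (U i) y * poly (pderiv q) y)"
        unfolding Ue by (rule proj(2)[OF el'(2) int(1) q', symmetric])
      finally show ?thesis
        using dh[OF i q] by (simp add: ee b_def left_diff_distrib xl_def xr_def)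
    qed
    have dd: "d i = D i - dh i"
      by (rule poly_eq_if_integrals_eq[OF el'(2) degd degree_diff_le[OF degD deg(2)[OF i]]]) (simp only: dchar Dchar)
    have Dd: "dh i + d i = D i" using dd by simp
    have \<rho>: "pderiv (\<rho> i) = proj xl xr k f" "degree (\<rho> i) \<le> k + 1" "poly (\<rho> i) xl = F xl"
    proof -
      obtain Q where Q: "pderiv Q = proj xl xr k f" "degree Q \<le> Suc (degree (proj xl xr k f))" "poly Q xl = F xl"
        using poly_antiderivative by blast
      have "degree (proj xl xr k f) \<le> k" by (rule proj(1)[OF el'(2) int(4)])
      then have "\<exists>Q. pderiv Q = proj xl xr k f \<and> degree Q \<le> k + 1 \<and> poly Q xl = F xl"
        using Q by (intro exI[of _ Q]) auto
      from someI_ex[OF this] show "pderiv (\<rho> i) = proj xl xr k f" "degree (\<rho> i) \<le> k + 1" "poly (\<rho> i) xl = F xl"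
        by (simp_all add: \<rho>_def xl_def xr_def)
    qed
    \<comment> \<open>Only the left value was prescribed; the right one agrees because the
      projection, tested with the constant 1, preserves the integral.\<close>
    have \<rho>r: "poly (\<rho> i) xr = F xr"
    proof -
      have "poly (\<rho> i) xr - poly (\<rho> i) xl = (LINT y|Leb xl xr. poly (proj xl xr k f) y)"
        using Leb_integral_poly[OF lr, of "\<rho> i"] \<rho> by simp
      also have "\<dots> = (LINT y|Leb xl xr. f y)"
        using proj(2)[OF el'(2) int(4), of 1 k] by simp
      also have "\<dots> = F xr - F xl" using primitive_on_diff[OF Fpe, of xl xr] lr by simp
      finally show ?thesis using \<rho> by simp
    qed
    have rd: "(LINT y|Leb xl xr. poly (\<rho> i) y * poly (d i) y)
        = - (LINT y|Leb xl xr. f y * poly (e i) y) + b (Suc i) * F xr - b i * F xl"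
    proof -
      have "(LINT y|Leb xl xr. poly (e i) y * poly (pderiv (\<rho> i)) y) = (LINT y|Leb xl xr. f y * poly (e i) y)"
        using proj(2)[OF el'(2) int(4) dege] \<rho>(1) by (simp add: mult.commute)
      then show ?thesis using dchar[OF \<rho>(2)] \<rho>r \<rho>(3) by (simp add: mult.commute)
    qed

    \<comment> \<open>\<open>expr'\<close> is what the equations produce on the element,
      \<open>expr\<close> the form required by \<open>error_terms_pointwise\<close>; they agree
      almost everywhere because \<nu> u_x = u^2/3 - F.\<close>
    define expr where "expr y = (poly (\<rho> i) y - F y) * poly (d i) y
      + 1 / 3 * ((w y)\<^sup>2 - (poly (U i) y - poly (e i) y)\<^sup>2) * poly (d i) y
      - 1 / 3 * (w y * W 1 y - (poly (U i) y - poly (e i) y) * (poly (D i) y - poly (d i) y)) * poly (e i) y" for y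
    define expr' where "expr' y = poly (\<rho> i) y * poly (d i) y + \<nu> * (W 1 y * poly (d i) y)
      - 1 / 3 * ((poly (up i) y * poly (up i) y) * poly (d i) y) - 1 / 3 * ((w y * W 1 y) * poly (e i) y)
      + 1 / 3 * ((poly (up i) y * poly (dh i) y) * poly (e i) y)" for y
    have ints: "integrable (Leb xl xr) (\<lambda>y. W 1 y * poly (d i) y)"
      "integrable (Leb xl xr) (\<lambda>y. (w y * W 1 y) * poly (e i) y)"
      "integrable (Leb xl xr) (\<lambda>y. (poly (up i) y * poly (up i) y) * poly (d i) y)"
      "integrable (Leb xl xr) (\<lambda>y. (poly (up i) y * poly (dh i) y) * poly (e i) y)"
      using int by (auto intro!: integrable_mult_poly)
    have AEexpr: "AE y in Leb xl xr. expr' y = expr y"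
      using AEsub[OF Feq]
    proof eventually_elim
      case (elim y)
      have "expr' y = poly (\<rho> i) y * poly (d i) y + (\<nu> * W 1 y) * poly (d i) y
        - 1 / 3 * ((poly (up i) y * poly (up i) y) * poly (d i) y) - 1 / 3 * ((w y * W 1 y) * poly (e i) y)
        + 1 / 3 * ((poly (up i) y * poly (dh i) y) * poly (e i) y)"
        unfolding expr'_def by (simp add: mult_ac)
      moreover have ud: "poly (up i) y = poly (U i) y - poly (e i) y" "poly (dh i) y = poly (D i) y - poly (d i) y"
        by (simp_all add: ee dd)
      ultimately show ?case unfolding elim expr_def ud by (simp add: power2_eq_square field_simps)
    qed
    have inte': "integrable (Leb xl xr) expr'"
      unfolding expr'_def[abs_def] using ints by (intro Bochner_Integration.integrable_add
        Bochner_Integration.integrable_diff integrable_mult_right poly_mult_Leb_integrable) auto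
    have Iexpr: "integral\<^sup>L (Leb xl xr) expr' = J i (\<lambda>y. (Z 0 y - poly (R i) y) * poly (e i) y) + \<nu> * J i (\<lambda>y. (poly (d i) y)\<^sup>2)
        + (J i (\<lambda>y. poly (R i) y * poly (e i) y) + \<nu> * J i (\<lambda>y. poly (dh i) y * poly (d i) y)
           + 1 / 3 * J i (\<lambda>y. (poly (up i) y * poly (dh i) y) * poly (e i) y)
           - 1 / 3 * J i (\<lambda>y. (poly (up i) y * poly (up i) y) * poly (d i) y))
        + (b (Suc i) * F (x (Suc i)) - b i * F (x i))"
    proof -
      have "integral\<^sup>L (Leb xl xr) expr' = (LINT y|Leb xl xr. poly (\<rho> i) y * poly (d i) y) + \<nu> * (LINT y|Leb xl xr. W 1 y * poly (d i) y)
        - 1 / 3 * (LINT y|Leb xl xr. (poly (up i) y * poly (up i) y) * poly (d i) y)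
        - 1 / 3 * (LINT y|Leb xl xr. (w y * W 1 y) * poly (e i) y)
        + 1 / 3 * (LINT y|Leb xl xr. (poly (up i) y * poly (dh i) y) * poly (e i) y)"
        unfolding expr'_def[abs_def] using ints by simp
      moreover have "(LINT y|Leb xl xr. W 1 y * poly (d i) y)
          = (LINT y|Leb xl xr. (poly (d i) y)\<^sup>2) + (LINT y|Leb xl xr. poly (dh i) y * poly (d i) y)"
      proof -
        have "(LINT y|Leb xl xr. W 1 y * poly (d i) y) = (LINT y|Leb xl xr. poly (D i) y * poly (d i) y)"
          unfolding De by (rule proj(2)[OF el'(2) int(2) degd, symmetric])
        also have "\<dots> = (LINT y|Leb xl xr. poly (d i) y * poly (d i) y + poly (dh i) y * poly (d i) y)"
          by (rule Bochner_Integration.integral_cong) (simp_all add: dd algebra_simps)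
        also have "\<dots> = (LINT y|Leb xl xr. poly (d i) y * poly (d i) y) + (LINT y|Leb xl xr. poly (dh i) y * poly (d i) y)"
          by (rule Bochner_Integration.integral_add) simp_all
        finally show ?thesis by (simp add: power2_eq_square)
      qed
      moreover have "(LINT y|Leb xl xr. (Z 0 y - poly (R i) y) * poly (e i) y)
          = - (LINT y|Leb xl xr. f y * poly (e i) y) - 1 / 3 * (LINT y|Leb xl xr. (w y * W 1 y) * poly (e i) y)
            - (LINT y|Leb xl xr. poly (R i) y * poly (e i) y)"
      proof -
        have "(LINT y|Leb xl xr. (Z 0 y - poly (R i) y) * poly (e i) y)
          = (LINT y|Leb xl xr. Z 0 y * poly (e i) y) - (LINT y|Leb xl xr. poly (R i) y * poly (e i) y)"
          unfolding left_diff_distrib using int by simp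
        also have "(LINT y|Leb xl xr. Z 0 y * poly (e i) y)
          = (LINT y|Leb xl xr. - (f y * poly (e i) y) - 1 / 3 * ((w y * W 1 y) * poly (e i) y))"
        proof (rule integral_cong_AE)
          show "AE y in Leb xl xr. Z 0 y * poly (e i) y = - (f y * poly (e i) y) - 1 / 3 * ((w y * W 1 y) * poly (e i) y)"
            using AEsub[OF Zeq]
          proof eventually_elim
            case (elim y)
            show ?case unfolding elim by (simp add: algebra_simps)
          qed
          have "integrable (Leb xl xr) (\<lambda>y. Z 0 y * poly (e i) y)" using int by simp
          then show "(\<lambda>y. Z 0 y * poly (e i) y) \<in> borel_measurable (Leb xl xr)" by simp
          have "integrable (Leb xl xr) (\<lambda>y. - (f y * poly (e i) y) - 1 / 3 * ((w y * W 1 y) * poly (e i) y))"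
            using int ints by simp
          then show "(\<lambda>y. - (f y * poly (e i) y) - 1 / 3 * ((w y * W 1 y) * poly (e i) y)) \<in> borel_measurable (Leb xl xr)"
            by (rule borel_measurable_integrable)
        qed
        also have "\<dots> = - (LINT y|Leb xl xr. f y * poly (e i) y) - 1 / 3 * (LINT y|Leb xl xr. (w y * W 1 y) * poly (e i) y)"
          using int ints by simp
        finally show ?thesis .
      qed
      ultimately show ?thesis using rd unfolding Je xl_def[symmetric] xr_def[symmetric] by (simp add: algebra_simps)
    qed

    \<comment> \<open>Bounds are stated with \<open>sqrt C * M\<close> so that the square in the
      pointwise estimate becomes \<open>C * M\<^sup>2\<close>.\<close>
    have CM: "(sqrt C * M)\<^sup>2 = C * M\<^sup>2" using C(2) by (simp add: power_mult_distrib)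
    have bU: "\<bar>poly (U i) y\<bar> \<le> sqrt C * M" if y: "y \<in> {xl..xr}" for y
    proof -
      have "(poly (U i) y)\<^sup>2 \<le> C * M\<^sup>2"
        unfolding Ue
      proof (rule proj_sup_bound[OF _ _ el'(2) sq(1) _ y])
        show "AE y in Leb xl xr. (w y)\<^sup>2 \<le> M\<^sup>2"
          using wM M0 el' by (intro AE_LebI) (auto simp: abs_le_square_iff[symmetric])
        show "\<forall>a b p. a < b \<longrightarrow> degree p \<le> k \<longrightarrow>
          (\<forall>y\<in>{a..b}. (b - a) * (poly p y)\<^sup>2 \<le> C * (LINT y|Leb a b. (poly p y)\<^sup>2))"
          by (intro allI impI ballI C(1)[rule_format]) auto
      qed (use C(2) in simp)
      then have "\<bar>poly (U i) y\<bar> \<le> \<bar>sqrt C * M\<bar>" unfolding abs_le_square_iff CM .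
      then show ?thesis using C(2) M0 by simp
    qed
    have bw: "\<bar>w y\<bar> \<le> sqrt C * M" if y: "y \<in> {xl..xr}" for y
    proof -
      have "\<bar>w y\<bar> \<le> M" using wM y el' by simp
      also have "M \<le> sqrt C * M" using C(2) M0 mult_right_mono[of 1 "sqrt C" M] by simp
      finally show ?thesis .
    qed
    have bD: "(poly (D i) y)\<^sup>2 \<le> C * (4 * \<beta>)" if y: "y \<in> {xl..xr}" for y
      unfolding De by (rule proj_sup_bound[OF C(1) _ el'(2) sq(2) AEsub[OF W1b] y]) (use C(2) in simp)
    have "A i"
    proof -
      have sqs: "integrable (Leb xl xr) (\<lambda>y. (poly (d i) y)\<^sup>2)" "integrable (Leb xl xr) (\<lambda>y. (poly (e i) y)\<^sup>2)"
        "integrable (Leb xl xr) (\<lambda>y. (poly (\<rho> i) y - F y)\<^sup>2)" "integrable (Leb xl xr) (\<lambda>y. (w y - poly (U i) y)\<^sup>2)"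
        "integrable (Leb xl xr) (\<lambda>y. (W 1 y - poly (D i) y)\<^sup>2)"
        using poly_sq_integrable[of xl xr "d i"] poly_sq_integrable[of xl xr "e i"]
          sq_integrable_diff[OF poly_sq_integrable sq(6), of "\<rho> i"]
          sq_integrable_diff[OF sq(1) poly_sq_integrable, of "U i"] sq_integrable_diff[OF sq(2) poly_sq_integrable, of "D i"]
        unfolding sq_integrable_def by blast+
      have "integral\<^sup>L (Leb xl xr) expr' \<le> (LINT y|Leb xl xr. \<nu> / 2 * (poly (d i) y)\<^sup>2
          + (C * M\<^sup>2 / \<nu> + 1 + C * (4 * \<beta>)) * (poly (e i) y)\<^sup>2
          + (2 / \<nu> + C * M\<^sup>2 + C * M\<^sup>2 / \<nu> + 1) * ((poly (\<rho> i) y - F y)\<^sup>2 + (w y - poly (U i) y)\<^sup>2 + (W 1 y - poly (D i) y)\<^sup>2))"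
      proof (rule integral_mono_AE[OF inte'])
        have bnd: "AE y in Leb xl xr. y \<in> {xl..xr}" by (rule AE_LebI) simp
        show "AE y in Leb xl xr. expr' y \<le> \<nu> / 2 * (poly (d i) y)\<^sup>2
          + (C * M\<^sup>2 / \<nu> + 1 + C * (4 * \<beta>)) * (poly (e i) y)\<^sup>2
          + (2 / \<nu> + C * M\<^sup>2 + C * M\<^sup>2 / \<nu> + 1) * ((poly (\<rho> i) y - F y)\<^sup>2 + (w y - poly (U i) y)\<^sup>2 + (W 1 y - poly (D i) y)\<^sup>2)"
          using AEexpr bnd AEsub[OF W1b]
        proof eventually_elim
          case (elim y)
          have "1 * (4 * \<beta>) \<le> C * (4 * \<beta>)" by (rule mult_right_mono) (use C(2) \<beta>0 in auto)
          then have "(W 1 y)\<^sup>2 \<le> C * (4 * \<beta>)" using elim(3) by simp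
          from error_terms_pointwise[OF \<nu> bw[OF elim(2)] bU[OF elim(2)] this bD[OF elim(2)], unfolded CM]
          show ?case unfolding elim(1) expr_def .
        qed
        show "integrable (Leb xl xr) (\<lambda>y. \<nu> / 2 * (poly (d i) y)\<^sup>2
          + (C * M\<^sup>2 / \<nu> + 1 + C * (4 * \<beta>)) * (poly (e i) y)\<^sup>2
          + (2 / \<nu> + C * M\<^sup>2 + C * M\<^sup>2 / \<nu> + 1) * ((poly (\<rho> i) y - F y)\<^sup>2 + (w y - poly (U i) y)\<^sup>2 + (W 1 y - poly (D i) y)\<^sup>2))"
          using sqs by (intro Bochner_Integration.integrable_add integrable_mult_right) auto
      qed
      also have "\<dots> = \<nu> / 2 * J i (\<lambda>y. (poly (d i) y)\<^sup>2) + (C * M\<^sup>2 / \<nu> + 1 + C * (4 * \<beta>)) * J i (\<lambda>y. (poly (e i) y)\<^sup>2)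
          + (2 / \<nu> + C * M\<^sup>2 + C * M\<^sup>2 / \<nu> + 1) * (J i (\<lambda>y. (poly (\<rho> i) y - F y)\<^sup>2)
            + J i (\<lambda>y. (w y - poly (U i) y)\<^sup>2) + J i (\<lambda>y. (W 1 y - poly (D i) y)\<^sup>2))"
        unfolding Je using sqs by simp
      finally show ?thesis unfolding AB(1) Iexpr .
    qed
    moreover have "B i"
    proof -
      \<comment> \<open>By \<open>feq\<close>, combining approximations of \<open>W 2\<close> and
        \<open>Z 0\<close> gives one of \<open>f\<close>. Each of the two has k derivatives left;
        the two powers still missing come from Poincare's inequality, as \<open>\<rho> i\<close> and
        \<open>F\<close> agree at the left end.\<close>
      obtain p2 where p2: "degree p2 \<le> k - 1" 
        "(LINT y|Leb xl xr. (W 2 y - poly p2 y)\<^sup>2) \<le> (xr - xl) ^ (2 * k) * (LINT y|Leb xl xr. (W (k + 2) y)\<^sup>2)"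
        using sobolev_chain_poly_approx[OF W el'(1) lr el'(3), of 2 k] by (auto simp: add.commute)
      obtain pz where pz: "degree pz \<le> k - 1"
        "(LINT y|Leb xl xr. (Z 0 y - poly pz y)\<^sup>2) \<le> (xr - xl) ^ (2 * k) * (LINT y|Leb xl xr. (Z k y)\<^sup>2)"
        using sobolev_chain_poly_approx[OF Z el'(1) lr el'(3), of 0 k] by auto
      define q where "q = smult (-\<nu> / 3) p2 + smult (-2 / 3) pz"
      have q: "degree q \<le> k" unfolding q_def
        using p2(1) pz(1) degree_smult_le[of "-\<nu> / 3" p2] degree_smult_le[of "-2 / 3" pz]
        by (intro degree_add_le) linarith+
      have i2: "integrable (Leb xl xr) (\<lambda>y. (W 2 y - poly p2 y)\<^sup>2)" "integrable (Leb xl xr) (\<lambda>y. (Z 0 y - poly pz y)\<^sup>2)"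
        "integrable (Leb xl xr) (\<lambda>y. (f y - poly q y)\<^sup>2)"
        using sq_integrable_diff[OF sq(3) poly_sq_integrable, of p2] sq_integrable_diff[OF sq(4) poly_sq_integrable, of pz]
          sq_integrable_diff[OF sq(5) poly_sq_integrable, of q]
        unfolding sq_integrable_def by blast+
      have "primitive_on xl xr (\<lambda>y. F y + (-1) * poly (\<rho> i) y) (\<lambda>y. f y + (-1) * poly (proj xl xr k f) y)"
        using primitive_on_poly[OF lr, of "\<rho> i"] \<rho>(1) Fpe by (intro primitive_on_add primitive_on_cmult) simp_all
      then have prim: "primitive_on xl xr (\<lambda>y. F y - poly (\<rho> i) y) (\<lambda>y. f y - poly (proj xl xr k f) y)" by simp
      have "(LINT y|Leb xl xr. (poly (\<rho> i) y - F y)\<^sup>2) = (LINT y|Leb xl xr. (F y - poly (\<rho> i) y)\<^sup>2)"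
        by (simp add: power2_commute)
      also have "\<dots> \<le> (xr - xl)\<^sup>2 * (LINT y|Leb xl xr. (f y - poly (proj xl xr k f) y)\<^sup>2)"
        by (rule Poincare[OF prim]) (use \<rho>(3) sq(5) in auto)
      also have "\<dots> \<le> (xr - xl)\<^sup>2 * (LINT y|Leb xl xr. (f y - poly q y)\<^sup>2)"
        by (rule mult_left_mono[OF proj_best_approx[OF el'(2) sq(5) q]]) simp
      also have "(LINT y|Leb xl xr. (f y - poly q y)\<^sup>2)
          \<le> (LINT y|Leb xl xr. (\<nu>\<^sup>2 + 1) * (W 2 y - poly p2 y)\<^sup>2 + (\<nu>\<^sup>2 + 1) * (Z 0 y - poly pz y)\<^sup>2)"
      proof (rule integral_mono_AE)
        show "AE y in Leb xl xr. (f y - poly q y)\<^sup>2 \<le> (\<nu>\<^sup>2 + 1) * (W 2 y - poly p2 y)\<^sup>2 + (\<nu>\<^sup>2 + 1) * (Z 0 y - poly pz y)\<^sup>2"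
          using AEsub[OF feq]
        proof eventually_elim
          case (elim y)
          define s t where "s = W 2 y - poly p2 y" and "t = Z 0 y - poly pz y"
          have "f y - poly q y = (-\<nu> / 3) * s + (-2 / 3) * t"
            unfolding elim q_def s_def t_def by (simp add: field_simps)
          also have "((-\<nu> / 3) * s + (-2 / 3) * t)\<^sup>2 \<le> 2 * ((-\<nu> / 3) * s)\<^sup>2 + 2 * ((-2 / 3) * t)\<^sup>2"
            using zero_le_power2[of "(-\<nu> / 3) * s - (-2 / 3) * t"] unfolding power2_sum power2_diff by linarith
          also have "\<dots> = 2 / 9 * \<nu>\<^sup>2 * s\<^sup>2 + 8 / 9 * t\<^sup>2"
            by (simp add: power_mult_distrib power_divide)
          also have "\<dots> \<le> (\<nu>\<^sup>2 + 1) * s\<^sup>2 + (\<nu>\<^sup>2 + 1) * t\<^sup>2"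
            by (intro add_mono mult_right_mono) (auto intro: add_nonneg_nonneg)
          finally show ?case by (simp add: s_def t_def)
        qed
      qed (use i2 in auto)
      also have "\<dots> = (\<nu>\<^sup>2 + 1) * ((LINT y|Leb xl xr. (W 2 y - poly p2 y)\<^sup>2) + (LINT y|Leb xl xr. (Z 0 y - poly pz y)\<^sup>2))"
        using i2 by (simp add: distrib_left)
      also have "\<dots> \<le> (\<nu>\<^sup>2 + 1) * ((xr - xl) ^ (2 * k) * (LINT y|Leb xl xr. (W (k + 2) y)\<^sup>2)
          + (xr - xl) ^ (2 * k) * (LINT y|Leb xl xr. (Z k y)\<^sup>2))"
        by (rule mult_left_mono[OF add_mono[OF p2(2) pz(2)]]) simp
      finally have "J i (\<lambda>y. (poly (\<rho> i) y - F y)\<^sup>2) \<le> (xr - xl)\<^sup>2 * ((\<nu>\<^sup>2 + 1) * ((xr - xl) ^ (2 * k) * J i (\<lambda>y. (W (k + 2) y)\<^sup>2)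
          + (xr - xl) ^ (2 * k) * J i (\<lambda>y. (Z k y)\<^sup>2)))"
        unfolding Je by (simp add: mult_left_mono)
      also have "\<dots> = (xr - xl) ^ (2 * (k + 1)) * ((\<nu>\<^sup>2 + 1) * (J i (\<lambda>y. (W (k + 2) y)\<^sup>2) + J i (\<lambda>y. (Z k y)\<^sup>2)))"
        by (simp add: power2_eq_square power_add algebra_simps)
      also have "\<dots> \<le> h ^ (2 * (k + 1)) * ((\<nu>\<^sup>2 + 1) * (J i (\<lambda>y. (W (k + 2) y)\<^sup>2) + J i (\<lambda>y. (Z k y)\<^sup>2)))"
        by (rule mult_right_mono[OF hp]) (simp add: Je)
      finally show ?thesis unfolding AB(2) .
    qed
    moreover have "E i"
    proof -
      \<comment> \<open>Used with \<open>j = 0\<close>, \<open>n = k\<close> for u and with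
        \<open>j = 1\<close>, \<open>n = k + 1\<close> for u_x. In both cases polynomials of degree
        k already give order k + 1.\<close>
      have approx: "J i (\<lambda>y. (g y - poly (proj xl xr n g) y)\<^sup>2) \<le> h ^ (2 * (k + 1)) * J i (\<lambda>y. (W (j + (k + 1)) y)\<^sup>2)"
        if g: "sq_integrable xl xr g" "AE y in Leb xl xr. g y = W j y" and j: "j \<le> 1" and n: "k \<le> n" for g j n
      proof -
        obtain p where p: "degree p \<le> k"
          "(LINT y|Leb xl xr. (W j y - poly p y)\<^sup>2) \<le> (xr - xl) ^ (2 * (k + 1)) * (LINT y|Leb xl xr. (W (j + (k + 1)) y)\<^sup>2)"
          using sobolev_chain_poly_approx[OF W el'(1) lr el'(3), of j "k + 1"] j by auto
        have "(LINT y|Leb xl xr. (g y - poly (proj xl xr n g) y)\<^sup>2) \<le> (LINT y|Leb xl xr. (g y - poly p y)\<^sup>2)"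
          by (rule proj_best_approx[OF el'(2) g(1)]) (use p(1) n in simp)
        also have "\<dots> = (LINT y|Leb xl xr. (W j y - poly p y)\<^sup>2)"
        proof (rule integral_cong_AE)
          show "AE y in Leb xl xr. (g y - poly p y)\<^sup>2 = (W j y - poly p y)\<^sup>2"
            using g(2) by eventually_elim simp
        qed (use sq_integrable_diff[OF g(1) poly_sq_integrable, of p]
              sq_integrable_diff[OF sub[OF sqW[of j]] poly_sq_integrable, of p] j in \<open>auto simp: sq_integrable_def\<close>)
        also note p(2)
        also have "(xr - xl) ^ (2 * (k + 1)) * (LINT y|Leb xl xr. (W (j + (k + 1)) y)\<^sup>2)
            \<le> h ^ (2 * (k + 1)) * (LINT y|Leb xl xr. (W (j + (k + 1)) y)\<^sup>2)"
          by (rule mult_right_mono[OF hp]) simp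
        finally show ?thesis unfolding Je .
      qed
      show ?thesis
        using approx[OF sq(1) AEsub[OF w(2)], of k] approx[OF sq(2), of 1 "k + 1"]
        unfolding AB(3) Dd Ue De by (simp add: add.commute)
    qed
    ultimately show ?thesis by blast
  qed
  note elA = elem[THEN conjunct1, OF _ refl refl refl]
    and elB = elem[THEN conjunct2, THEN conjunct1, OF _ refl refl refl]
    and elE = elem[THEN conjunct2, THEN conjunct2, OF _ refl refl refl]

  \<comment> \<open>Summation over the elements\<close>
  define S where "S g = (\<Sum>i\<in>{1..<N}. J i (g i))" for g
  have Sglobal: "S (\<lambda>i y. (g y)\<^sup>2) = (LINT y|Leb 0 1. (g y)\<^sup>2)" if "sq_integrable 0 1 g" for g
    using partition_integral[OF P, of "\<lambda>y. (g y)\<^sup>2"] that by (simp add: S_def J_def sq_integrable_def)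
  have hn: "0 \<le> h ^ (2 * (k + 1))" using mesh_size_pos[OF P] by (simp add: h_def)
  have SW: "S (\<lambda>i y. (W j y)\<^sup>2) \<le> \<beta>" if "j \<le> k + 2" for j using Sglobal[OF sqW[OF that]] \<beta>(1)[OF that] by simp
  have SZ: "S (\<lambda>i y. (Z j y)\<^sup>2) \<le> \<beta>" if "j \<le> k" for j using Sglobal[OF sqZ[OF that]] \<beta>(2)[OF that] by simp
  have S1: "S (\<lambda>i y. (poly (\<rho> i) y - F y)\<^sup>2) \<le> h ^ (2 * (k + 1)) * ((\<nu>\<^sup>2 + 1) * (\<beta> + \<beta>))"
  proof -
    have "S (\<lambda>i y. (poly (\<rho> i) y - F y)\<^sup>2)
      \<le> (\<Sum>i\<in>{1..<N}. h ^ (2 * (k + 1)) * ((\<nu>\<^sup>2 + 1) * (J i (\<lambda>y. (W (k + 2) y)\<^sup>2) + J i (\<lambda>y. (Z k y)\<^sup>2))))"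
      unfolding S_def by (rule sum_mono) (rule elB)
    also have "\<dots> = h ^ (2 * (k + 1)) * ((\<nu>\<^sup>2 + 1) * (S (\<lambda>i y. (W (k + 2) y)\<^sup>2) + S (\<lambda>i y. (Z k y)\<^sup>2)))"
      by (simp add: S_def sum_distrib_left[symmetric] sum.distrib)
    also have "\<dots> \<le> h ^ (2 * (k + 1)) * ((\<nu>\<^sup>2 + 1) * (\<beta> + \<beta>))"
      by (intro mult_left_mono add_mono SW SZ hn) auto
    finally show ?thesis .
  qed
  have S2: "S (\<lambda>i y. (w y - poly (U i) y)\<^sup>2) \<le> h ^ (2 * (k + 1)) * \<beta>"
  proof -
    have "S (\<lambda>i y. (w y - poly (U i) y)\<^sup>2) \<le> (\<Sum>i\<in>{1..<N}. h ^ (2 * (k + 1)) * J i (\<lambda>y. (W (k + 1) y)\<^sup>2))"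
      unfolding S_def by (rule sum_mono) (rule elE[THEN conjunct1])
    also have "\<dots> = h ^ (2 * (k + 1)) * S (\<lambda>i y. (W (k + 1) y)\<^sup>2)" by (simp add: S_def sum_distrib_left)
    also have "\<dots> \<le> h ^ (2 * (k + 1)) * \<beta>" by (intro mult_left_mono SW hn) auto
    finally show ?thesis .
  qed
  have S3: "S (\<lambda>i y. (W 1 y - poly (D i) y)\<^sup>2) \<le> h ^ (2 * (k + 1)) * \<beta>"
  proof -
    have "S (\<lambda>i y. (W 1 y - poly (D i) y)\<^sup>2) \<le> (\<Sum>i\<in>{1..<N}. h ^ (2 * (k + 1)) * J i (\<lambda>y. (W (k + 2) y)\<^sup>2))"
      unfolding S_def by (rule sum_mono) (rule elE[THEN conjunct2, THEN conjunct1])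
    also have "\<dots> = h ^ (2 * (k + 1)) * S (\<lambda>i y. (W (k + 2) y)\<^sup>2)" by (simp add: S_def sum_distrib_left)
    also have "\<dots> \<le> h ^ (2 * (k + 1)) * \<beta>" by (intro mult_left_mono SW hn) auto
    finally show ?thesis .
  qed
  have "(\<Sum>i\<in>{1..<N}. LINT y|Leb (x i) (x (Suc i)). (W 1 y - poly (dh i + d i) y)\<^sup>2)
      = S (\<lambda>i y. (W 1 y - poly (D i) y)\<^sup>2)"
    unfolding S_def J_def by (rule sum.cong[OF refl]) (simp only: elE[THEN conjunct2, THEN conjunct2])
  then show "(\<Sum>i\<in>{1..<N}. LINT y|Leb (x i) (x (Suc i)). (W 1 y - poly (dh i + d i) y)\<^sup>2)
      \<le> mesh_size N x ^ (2 * (k + 1)) * \<beta>"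
    using S3 by (simp add: h_def)
  have tel: "(\<Sum>i\<in>{1..<N}. b (Suc i) * F (x (Suc i)) - b i * F (x i)) = 0"
    using telescope_partition[OF N, of "\<lambda>i. b i * F (x i)"] vn w(3,4) P by (simp add: b_def is_partition_def)
  have "(\<Sum>i\<in>{1..<N}. J i (\<lambda>y. (Z 0 y - poly (R i) y) * poly (e i) y) + \<nu> * J i (\<lambda>y. (poly (d i) y)\<^sup>2)
        + (J i (\<lambda>y. poly (R i) y * poly (e i) y) + \<nu> * J i (\<lambda>y. poly (dh i) y * poly (d i) y)
           + 1 / 3 * J i (\<lambda>y. (poly (up i) y * poly (dh i) y) * poly (e i) y)
           - 1 / 3 * J i (\<lambda>y. (poly (up i) y * poly (up i) y) * poly (d i) y))
        + (b (Suc i) * F (x (Suc i)) - b i * F (x i)))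
      \<le> (\<Sum>i\<in>{1..<N}. \<nu> / 2 * J i (\<lambda>y. (poly (d i) y)\<^sup>2) + (C * M\<^sup>2 / \<nu> + 1 + C * (4 * \<beta>)) * J i (\<lambda>y. (poly (e i) y)\<^sup>2)
          + (2 / \<nu> + C * M\<^sup>2 + C * M\<^sup>2 / \<nu> + 1) * (J i (\<lambda>y. (poly (\<rho> i) y - F y)\<^sup>2)
            + J i (\<lambda>y. (w y - poly (U i) y)\<^sup>2) + J i (\<lambda>y. (W 1 y - poly (D i) y)\<^sup>2)))"
    by (rule sum_mono) (rule elA)
  then have "S (\<lambda>i y. (Z 0 y - poly (R i) y) * poly (e i) y) + \<nu> * S (\<lambda>i y. (poly (d i) y)\<^sup>2) + 0 + 0
      \<le> \<nu> / 2 * S (\<lambda>i y. (poly (d i) y)\<^sup>2) + (C * M\<^sup>2 / \<nu> + 1 + C * (4 * \<beta>)) * S (\<lambda>i y. (poly (e i) y)\<^sup>2)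
        + (2 / \<nu> + C * M\<^sup>2 + C * M\<^sup>2 / \<nu> + 1) * (S (\<lambda>i y. (poly (\<rho> i) y - F y)\<^sup>2)
            + S (\<lambda>i y. (w y - poly (U i) y)\<^sup>2) + S (\<lambda>i y. (W 1 y - poly (D i) y)\<^sup>2))"
    unfolding sum.distrib tel discrete[folded J_def, unfolded sum.distrib] S_def sum_distrib_left[symmetric]
    using discrete by (simp add: J_def sum.distrib sum_distrib_left[symmetric])
  moreover have "(2 / \<nu> + C * M\<^sup>2 + C * M\<^sup>2 / \<nu> + 1) * (S (\<lambda>i y. (poly (\<rho> i) y - F y)\<^sup>2)
            + S (\<lambda>i y. (w y - poly (U i) y)\<^sup>2) + S (\<lambda>i y. (W 1 y - poly (D i) y)\<^sup>2))
       \<le> (2 / \<nu> + C * M\<^sup>2 + C * M\<^sup>2 / \<nu> + 1) * (h ^ (2 * (k + 1)) * ((\<nu>\<^sup>2 + 1) * (\<beta> + \<beta>))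
          + h ^ (2 * (k + 1)) * \<beta> + h ^ (2 * (k + 1)) * \<beta>)"
    using \<nu> C(2) by (intro mult_left_mono add_mono S1 S2 S3 add_nonneg_nonneg) auto
  \<comment> \<open>The factor 2 \<nu>^2 + 4 adds 2 (\<nu>^2 + 1) from the flux and 1 from each of
    the two projections.\<close>
  moreover have "\<dots> = (2 / \<nu> + C * M\<^sup>2 + C * M\<^sup>2 / \<nu> + 1) * (2 * \<nu>\<^sup>2 + 4) * h ^ (2 * (k + 1)) * \<beta>"
    by (simp add: algebra_simps)
  ultimately show "(\<Sum>i\<in>{1..<N}. LINT y|Leb (x i) (x (Suc i)). (Z 0 y - poly (R i) y) * poly (e i) y)
      + \<nu> / 2 * (\<Sum>i\<in>{1..<N}. LINT y|Leb (x i) (x (Suc i)). (poly (d i) y)\<^sup>2)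
    \<le> (C * M\<^sup>2 / \<nu> + 1 + C * (4 * \<beta>)) * (\<Sum>i\<in>{1..<N}. LINT y|Leb (x i) (x (Suc i)). (poly (e i) y)\<^sup>2)
      + (2 / \<nu> + C * M\<^sup>2 + C * M\<^sup>2 / \<nu> + 1) * (2 * \<nu>\<^sup>2 + 4) * mesh_size N x ^ (2 * (k + 1)) * \<beta>"
    unfolding h_def[symmetric] S_def J_def by linarith
qed

section \<open>Weak time derivatives tested in space\<close>

lemma complete_measure_Leb: "complete_measure (Leb a b)"
proof
  fix A B assume "B \<subseteq> A" "A \<in> null_sets (Leb a b)"
  then have "A \<in> null_sets lebesgue" "A \<subseteq> {a<..<b}"
    by (auto simp: null_sets_restrict_space)
  then have "B \<in> sets lebesgue" "B \<subseteq> {a<..<b}"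
    using \<open>B \<subseteq> A\<close> completion.complete by auto
  then show "B \<in> sets (Leb a b)" by (simp add: sets_restrict_space_iff)
qed

text \<open>Completeness lets measurability survive changes on a null set. It is needed because
  limits of simple functions of time are identified only for almost every time.\<close>

lemma Leb_measurable_cong_AE:
  fixes f g :: "real \<Rightarrow> real"
  assumes g: "g \<in> borel_measurable (Leb a b)" and ae: "AE y in Leb a b. g y = f y"
  shows "f \<in> borel_measurable (Leb a b)"
proof (rule measurableI)
  fix A :: "real set" assume "A \<in> sets borel"
  then have 1: "g -` A \<inter> space (Leb a b) \<in> sets (Leb a b)" using g by (rule measurable_sets[rotated])
  have 2: "AE y in Leb a b. y \<in> g -` A \<inter> space (Leb a b) \<longleftrightarrow> y \<in> f -` A \<inter> space (Leb a b)"
    using ae by eventually_elim auto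
  show "f -` A \<inter> space (Leb a b) \<in> sets (Leb a b)"
    by (rule complete_measure.in_sets_AE[OF complete_measure_Leb 2 1]) auto
qed simp

lemma Leb_measurable_indicator [simp]: "A \<in> sets lebesgue \<Longrightarrow> indicat_real A \<in> borel_measurable (Leb a b)"
  by (intro measurable_restrict_space1 borel_measurable_indicator)

text \<open>The values of \<open>\<sigma>\<close> will be functions of space. Since there are
  finitely many of them, composing with any real function \<open>G\<close> reduces to a finite sum,
  without any structure on the space of values.\<close>

lemma simple_function_integral:
  fixes G :: "'b \<Rightarrow> real"
  assumes M: "finite_measure M" and \<sigma>: "simple_function M \<sigma>"
  shows "integrable M (\<lambda>t. G (\<sigma> t))"
    "(LINT t|M. G (\<sigma> t)) = (\<Sum>c\<in>\<sigma> ` space M. measure M (\<sigma> -` {c} \<inter> space M) * G c)"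
proof -
  interpret finite_measure M by (rule M)
  have fin: "finite (\<sigma> ` space M)" using \<sigma> by (simp add: simple_function_def)
  have sets: "\<sigma> -` {c} \<inter> space M \<in> sets M" if "c \<in> \<sigma> ` space M" for c
    using \<sigma> that unfolding simple_function_def by blast
  have eq: "G (\<sigma> t) = (\<Sum>c\<in>\<sigma> ` space M. indicator (\<sigma> -` {c} \<inter> space M) t * G c)" if "t \<in> space M" for t
  proof -
    have "(\<Sum>c\<in>\<sigma> ` space M. indicator (\<sigma> -` {c} \<inter> space M) t * G c)
      = (\<Sum>c\<in>\<sigma> ` space M. if c = \<sigma> t then G (\<sigma> t) else 0)"
      by (rule sum.cong) (use that in \<open>auto simp: indicator_def\<close>)
    then show ?thesis using fin that by simp
  qed
  have int: "integrable M (\<lambda>t. indicat_real (\<sigma> -` {c} \<inter> space M) t * G c)" if "c \<in> \<sigma> ` space M" for c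
    using sets[OF that] by (intro integrable_mult_left) (simp add: less_top[symmetric])
  have "integrable M (\<lambda>t. G (\<sigma> t)) \<longleftrightarrow>
      integrable M (\<lambda>t. \<Sum>c\<in>\<sigma> ` space M. indicat_real (\<sigma> -` {c} \<inter> space M) t * G c)"
    by (rule Bochner_Integration.integrable_cong[OF refl eq])
  moreover have "integrable M (\<lambda>t. \<Sum>c\<in>\<sigma> ` space M. indicat_real (\<sigma> -` {c} \<inter> space M) t * G c)"
    by (rule Bochner_Integration.integrable_sum) (rule int)
  ultimately show "integrable M (\<lambda>t. G (\<sigma> t))" by blast
  have "(LINT t|M. G (\<sigma> t)) = (LINT t|M. (\<Sum>c\<in>\<sigma> ` space M. indicat_real (\<sigma> -` {c} \<inter> space M) t * G c))"
    by (rule Bochner_Integration.integral_cong[OF refl eq])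
  also have "\<dots> = (\<Sum>c\<in>\<sigma> ` space M. LINT t|M. indicat_real (\<sigma> -` {c} \<inter> space M) t * G c)"
    by (rule Bochner_Integration.integral_sum) (rule int)
  also have "\<dots> = (\<Sum>c\<in>\<sigma> ` space M. measure M (\<sigma> -` {c} \<inter> space M) * G c)"
    by (rule sum.cong) (use sets in auto)
  finally show "(LINT t|M. G (\<sigma> t)) = (\<Sum>c\<in>\<sigma> ` space M. measure M (\<sigma> -` {c} \<inter> space M) * G c)" .
qed

lemma sobolev_norm_nonneg [simp]: "0 \<le> sobolev_norm s f"
  by (simp add: sobolev_norm_def sum_nonneg)

lemma joint_continuous_slice:
  fixes u :: "real \<Rightarrow> real \<Rightarrow> real"
  assumes u: "continuous_on ({0..T} \<times> {0..1}) (\<lambda>(t, y). u t y)" and t: "t \<in> {0..T}"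
  shows "continuous_on {0..1} (u t)"
proof -
  have "continuous_on {0..1} ((\<lambda>(t, y). u t y) \<circ> (\<lambda>y. (t, y)))"
    by (intro continuous_on_compose continuous_intros continuous_on_subset[OF u]) (use t in auto)
  then show ?thesis by (simp add: o_def)
qed

lemma joint_continuous_bound:
  fixes u :: "real \<Rightarrow> real \<Rightarrow> real"
  assumes u: "continuous_on ({0..T} \<times> {0..1}) (\<lambda>(t, y). u t y)"
  shows "\<exists>M. \<forall>t\<in>{0..T}. \<forall>y\<in>{0..1}. \<bar>u t y\<bar> \<le> M"
proof -
  have "bounded ((\<lambda>(t, y). u t y) ` ({0..T} \<times> {0..1}))"
    by (intro compact_imp_bounded compact_continuous_image u compact_Times) auto
  then show ?thesis unfolding bounded_iff by force
qed

section \<open>Pairings of Sobolev-valued functions of time with a bounded function of space\<close>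

context
  fixes z :: "real \<Rightarrow> real" and B :: real
  assumes z: "z \<in> borel_measurable (Leb 0 1)" "AE y in Leb 0 1. \<bar>z y\<bar> \<le> B" and B: "B > 0"
begin

private lemma sq_z: "sq_integrable 0 1 z"
  using z by (rule sq_integrable_bounded)

text \<open>Pairing with \<open>z\<close> is bounded for every Sobolev norm, because each dominates
  the L2 norm. This makes it compatible with Sobolev-valued limits and integrals.\<close>

lemma functional_bound:
  assumes "sq_integrable 0 1 f"
  shows "\<bar>LINT y|Leb 0 1. f y * z y\<bar> \<le> B * sobolev_norm s f"
proof -
  have "(LINT y|Leb 0 1. (z y)\<^sup>2) \<le> (LINT y|Leb 0 1. B\<^sup>2)"
  proof (rule integral_mono_AE)
    show "AE y in Leb 0 1. (z y)\<^sup>2 \<le> B\<^sup>2"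
      using z(2) by eventually_elim (use B in \<open>simp add: abs_le_square_iff[symmetric]\<close>)
  qed (use sq_z in \<open>auto simp: sq_integrable_def\<close>)
  then have zB: "(LINT y|Leb 0 1. (z y)\<^sup>2) \<le> B\<^sup>2" using measure_Leb[of 0 1] by simp
  have "(LINT y|Leb 0 1. f y * z y)\<^sup>2 \<le> (LINT y|Leb 0 1. (f y)\<^sup>2) * (LINT y|Leb 0 1. (z y)\<^sup>2)"
    by (rule integral_Cauchy_Schwarz[OF assms sq_z])
  also have "\<dots> \<le> (sobolev_norm s f)\<^sup>2 * B\<^sup>2"
    by (rule mult_mono[OF L2_le_sobolev_norm[OF assms] zB]) auto
  also have "\<dots> = (B * sobolev_norm s f)\<^sup>2" by (simp add: power_mult_distrib mult.commute)
  finally have "\<bar>LINT y|Leb 0 1. f y * z y\<bar> \<le> \<bar>B * sobolev_norm s f\<bar>" by (simp only: abs_le_square_iff)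
  then show ?thesis using B by (simp add: abs_mult)
qed

lemma functional_diff:
  assumes "sq_integrable 0 1 f" "sq_integrable 0 1 g"
  shows "(LINT y|Leb 0 1. (f y - g y) * z y) = (LINT y|Leb 0 1. f y * z y) - (LINT y|Leb 0 1. g y * z y)"
  using sq_integrable_mult[OF assms(1) sq_z] sq_integrable_mult[OF assms(2) sq_z]
  by (simp add: left_diff_distrib)

lemma functional_measurable:
  assumes "strongly_measurable T s u"
  shows "(\<lambda>t. LINT y|Leb 0 1. u t y * z y) \<in> borel_measurable (Leb 0 T)"
proof -
  obtain \<sigma> where \<sigma>: "\<And>n. sobolev_simple T s (\<sigma> n)" "AE t in Leb 0 T. u t \<in> sobolev s \<and>
             (\<lambda>n. sobolev_norm s (\<lambda>y. u t y - \<sigma> n t y)) \<longlonglongrightarrow> 0"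
    using assms by (auto simp: strongly_measurable_def)
  define l where "l f = (LINT y|Leb 0 1. f y * z y)" for f
  have meas: "(\<lambda>t. l (\<sigma> n t)) \<in> borel_measurable (Leb 0 T)" for n
  proof (rule borel_measurable_simple_function)
    have "simple_function (Leb 0 T) (\<sigma> n)" using \<sigma>(1)[of n] by (simp add: sobolev_simple_def)
    then show "simple_function (Leb 0 T) (\<lambda>t. l (\<sigma> n t))" by (rule simple_function_compose1)
  qed
  have "AE t in Leb 0 T. t \<in> {0<..<T}" by (rule AE_LebI) simp
  with \<sigma>(2) have "AE t in Leb 0 T. lim (\<lambda>n. l (\<sigma> n t)) = l (u t)"
  proof eventually_elim
    case (elim t)
    have u: "sq_integrable 0 1 (u t)" using elim by (auto intro: sobolev_imp_sq_integrable)
    have s: "sq_integrable 0 1 (\<sigma> n t)" for n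
      using \<sigma>(1)[of n] elim by (auto simp: sobolev_simple_def intro: sobolev_imp_sq_integrable)
    have "(\<lambda>n. B * sobolev_norm s (\<lambda>y. u t y - \<sigma> n t y)) \<longlonglongrightarrow> B * 0"
      using elim by (intro tendsto_intros) auto
    then have "(\<lambda>n. B * sobolev_norm s (\<lambda>y. u t y - \<sigma> n t y)) \<longlonglongrightarrow> 0" by simp
    then have "(\<lambda>n. l (u t) - l (\<sigma> n t)) \<longlonglongrightarrow> 0"
    proof (rule Lim_null_comparison[rotated])
      show "\<forall>\<^sub>F n in sequentially. norm (l (u t) - l (\<sigma> n t)) \<le> B * sobolev_norm s (\<lambda>y. u t y - \<sigma> n t y)"
        using functional_bound[OF sq_integrable_diff[OF u s]] functional_diff[OF u s] by (simp add: l_def)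
    qed
    then have "(\<lambda>n. l (u t) - (l (u t) - l (\<sigma> n t))) \<longlonglongrightarrow> l (u t) - 0" by (intro tendsto_intros)
    then show ?case by (intro limI) simp
  qed
  then show ?thesis
    unfolding l_def[symmetric]
    by (rule Leb_measurable_cong_AE[rotated]) (intro borel_measurable_lim_metric meas)
qed

lemma functional_integrable:
  assumes u: "u \<in> L2_sobolev T s"
  shows "integrable (Leb 0 T) (\<lambda>t. LINT y|Leb 0 1. u t y * z y)"
proof (rule Bochner_Integration.integrable_bound[of _ "\<lambda>t. B * (1 + (sobolev_norm s (u t))\<^sup>2)"])
  show "integrable (Leb 0 T) (\<lambda>t. B * (1 + (sobolev_norm s (u t))\<^sup>2))"
    using u by (auto simp: L2_sobolev_def)
  show "(\<lambda>t. LINT y|Leb 0 1. u t y * z y) \<in> borel_measurable (Leb 0 T)"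
    using u functional_measurable by (auto simp: L2_sobolev_def)
  have "AE t in Leb 0 T. u t \<in> sobolev s"
    using u by (auto simp: L2_sobolev_def strongly_measurable_def)
  then show "AE t in Leb 0 T. norm (LINT y|Leb 0 1. u t y * z y) \<le> norm (B * (1 + (sobolev_norm s (u t))\<^sup>2))"
  proof eventually_elim
    case (elim t)
    have "\<bar>LINT y|Leb 0 1. u t y * z y\<bar> \<le> B * sobolev_norm s (u t)"
      by (rule functional_bound[OF sobolev_imp_sq_integrable[OF elim]])
    also have "\<dots> \<le> B * (1 + (sobolev_norm s (u t))\<^sup>2)"
    proof (rule mult_left_mono)
      show "sobolev_norm s (u t) \<le> 1 + (sobolev_norm s (u t))\<^sup>2"
        using sum_squares_bound[of "sobolev_norm s (u t)" 1] sobolev_norm_nonneg[of s "u t"]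
        unfolding power_one mult_1_right by linarith
    qed (use B in simp)
    finally show ?case by simp
  qed
qed

text \<open>For simple functions the pairing commutes with a finite sum. The two convergences in
  \<open>has_sobolev_integral\<close> control the two sides: the pairings converge in L1 over time,
  and the elementary integrals tend to \<open>w\<close>.\<close>

lemma functional_sobolev_integral:
  assumes u: "has_sobolev_integral T s u w" and int: "integrable (Leb 0 T) (\<lambda>t. LINT y|Leb 0 1. u t y * z y)"
  shows "(LINT t|Leb 0 T. LINT y|Leb 0 1. u t y * z y) = (LINT y|Leb 0 1. w y * z y)"
proof -
  define l where "l f = (LINT y|Leb 0 1. f y * z y)" for f
  obtain \<sigma> where \<sigma>: "\<And>n. sobolev_simple T s (\<sigma> n)"
    "(\<lambda>n. \<integral>\<^sup>+ t. ennreal (sobolev_norm s (\<lambda>y. u t y - \<sigma> n t y)) \<partial>Leb 0 T) \<longlonglongrightarrow> 0"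
    "(\<lambda>n. sobolev_norm s (\<lambda>y. (LINT t|Leb 0 T. \<sigma> n t y) - w y)) \<longlonglongrightarrow> 0"
    using u by (auto simp: has_sobolev_integral_def)
  have w: "sq_integrable 0 1 w" using u by (auto simp: has_sobolev_integral_def intro: sobolev_imp_sq_integrable)
  have AEu: "AE t in Leb 0 T. u t \<in> sobolev s"
    using u by (auto simp: has_sobolev_integral_def strongly_measurable_def)
  note simp = simple_function_integral[OF finite_measure_Leb[of 0 T]]
  have sf: "simple_function (Leb 0 T) (\<sigma> n)" for n using \<sigma>(1) by (simp add: sobolev_simple_def)
  have sqv: "sq_integrable 0 1 c" if "c \<in> \<sigma> n ` space (Leb 0 T)" for c n
    using \<sigma>(1)[of n] that by (auto simp: sobolev_simple_def intro: sobolev_imp_sq_integrable)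
  define m where "m n c = measure (Leb 0 T) (\<sigma> n -` {c} \<inter> space (Leb 0 T))" for n c
  define S where "S n y = (LINT t|Leb 0 T. \<sigma> n t y)" for n y
  have S: "S n = (\<lambda>y. \<Sum>c\<in>\<sigma> n ` space (Leb 0 T). m n c * c y)" for n
    unfolding S_def m_def by (rule ext) (rule simp(2)[OF sf, of "\<lambda>c. c y" for y])
  have fin: "finite (\<sigma> n ` space (Leb 0 T))" for n using sf by (auto simp: simple_function_def)
  have sqS: "sq_integrable 0 1 (\<lambda>y. \<Sum>c\<in>A. m n c * c y)" if "A \<subseteq> \<sigma> n ` space (Leb 0 T)" "finite A" for n A
    using that(2,1)
  proof induction
    case (insert c A)
    then have "sq_integrable 0 1 c" using sqv[of c n] by simp
    then show ?case using insert sq_integrable_add[OF sq_integrable_cmult, of 0 1 c] by simp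
  qed simp
  have lS: "l (S n) = (LINT t|Leb 0 T. l (\<sigma> n t))" for n
  proof -
    have "l (S n) = (LINT y|Leb 0 1. (\<Sum>c\<in>\<sigma> n ` space (Leb 0 T). m n c * (c y * z y)))"
      by (simp add: l_def S sum_distrib_right mult.assoc)
    also have "\<dots> = (\<Sum>c\<in>\<sigma> n ` space (Leb 0 T). LINT y|Leb 0 1. m n c * (c y * z y))"
      by (rule Bochner_Integration.integral_sum) (use sq_integrable_mult[OF sqv sq_z] in auto)
    also have "\<dots> = (\<Sum>c\<in>\<sigma> n ` space (Leb 0 T). m n c * l c)" by (simp add: l_def)
    also have "\<dots> = (LINT t|Leb 0 T. l (\<sigma> n t))" unfolding m_def by (rule simp(2)[OF sf, symmetric])
    finally show ?thesis .
  qed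
  have lim1: "(\<lambda>n. l (S n) - l w) \<longlonglongrightarrow> 0"
  proof (rule Lim_null_comparison)
    have "norm (l (S n) - l w) \<le> B * sobolev_norm s (\<lambda>y. S n y - w y)" for n
      using functional_bound[OF sq_integrable_diff[OF _ w], of "S n" s] functional_diff[OF _ w, of "S n"]
        sqS[OF subset_refl fin, of n] by (simp add: l_def S)
    then show "\<forall>\<^sub>F n in sequentially. norm (l (S n) - l w) \<le> B * sobolev_norm s (\<lambda>y. S n y - w y)" by simp
    have "(\<lambda>n. B * sobolev_norm s (\<lambda>y. S n y - w y)) \<longlonglongrightarrow> B * 0"
      using \<sigma>(3) unfolding S_def by (rule tendsto_mult_left)
    then show "(\<lambda>n. B * sobolev_norm s (\<lambda>y. S n y - w y)) \<longlonglongrightarrow> 0" by simp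
  qed
  have intu: "integrable (Leb 0 T) (\<lambda>t. l (u t))" using int by (simp add: l_def)
  have ints: "integrable (Leb 0 T) (\<lambda>t. l (\<sigma> n t))" for n by (rule simp(1)[OF sf])
  \<comment> \<open>The approximation error is given as a nonnegative integral, so the comparison
    takes place in the extended nonnegative reals; dividing by \<open>B\<close> matches
    \<open>functional_bound\<close>.\<close>
  have "(\<lambda>n. ennreal (\<bar>(LINT t|Leb 0 T. l (u t)) - l (S n)\<bar> / B)) \<longlonglongrightarrow> 0"
  proof (rule tendsto_sandwich[OF _ _ tendsto_const \<sigma>(2)])
    show "\<forall>\<^sub>F n in sequentially. ennreal (\<bar>(LINT t|Leb 0 T. l (u t)) - l (S n)\<bar> / B)
        \<le> (\<integral>\<^sup>+ t. ennreal (sobolev_norm s (\<lambda>y. u t y - \<sigma> n t y)) \<partial>Leb 0 T)"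
    proof (rule always_eventually, rule allI)
      fix n
      have intd: "integrable (Leb 0 T) (\<lambda>t. \<bar>l (u t) - l (\<sigma> n t)\<bar> / B)" using intu ints by simp
      have "(LINT t|Leb 0 T. l (u t)) - l (S n) = (LINT t|Leb 0 T. l (u t) - l (\<sigma> n t))"
        unfolding lS using intu ints by simp
      also have "\<bar>\<dots>\<bar> \<le> (LINT t|Leb 0 T. \<bar>l (u t) - l (\<sigma> n t)\<bar>)"
        by (rule integral_abs_bound)
      finally have "\<bar>(LINT t|Leb 0 T. l (u t)) - l (S n)\<bar> / B \<le> (LINT t|Leb 0 T. \<bar>l (u t) - l (\<sigma> n t)\<bar> / B)"
        using B by (simp add: divide_right_mono)
      then have "ennreal (\<bar>(LINT t|Leb 0 T. l (u t)) - l (S n)\<bar> / B) \<le> ennreal (LINT t|Leb 0 T. \<bar>l (u t) - l (\<sigma> n t)\<bar> / B)"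
        by (rule ennreal_leI)
      also have "\<dots> = (\<integral>\<^sup>+ t. ennreal (\<bar>l (u t) - l (\<sigma> n t)\<bar> / B) \<partial>Leb 0 T)"
        by (rule nn_integral_eq_integral[symmetric, OF intd]) (use B in simp)
      also have "\<dots> \<le> (\<integral>\<^sup>+ t. ennreal (sobolev_norm s (\<lambda>y. u t y - \<sigma> n t y)) \<partial>Leb 0 T)"
      proof (rule nn_integral_mono_AE)
        have "AE t in Leb 0 T. t \<in> {0<..<T}" by (rule AE_LebI) simp
        with AEu show "AE t in Leb 0 T. ennreal (\<bar>l (u t) - l (\<sigma> n t)\<bar> / B) \<le> ennreal (sobolev_norm s (\<lambda>y. u t y - \<sigma> n t y))"
        proof eventually_elim
          case (elim t)
          have u: "sq_integrable 0 1 (u t)" using elim by (auto intro: sobolev_imp_sq_integrable)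
          have s: "sq_integrable 0 1 (\<sigma> n t)"
            using \<sigma>(1)[of n] elim by (auto simp: sobolev_simple_def intro: sobolev_imp_sq_integrable)
          have "\<bar>l (u t) - l (\<sigma> n t)\<bar> \<le> B * sobolev_norm s (\<lambda>y. u t y - \<sigma> n t y)"
            using functional_bound[OF sq_integrable_diff[OF u s]] functional_diff[OF u s] by (simp add: l_def)
          then show ?case using B by (intro ennreal_leI) (simp add: field_simps)
        qed
      qed
      finally show "ennreal (\<bar>(LINT t|Leb 0 T. l (u t)) - l (S n)\<bar> / B)
        \<le> (\<integral>\<^sup>+ t. ennreal (sobolev_norm s (\<lambda>y. u t y - \<sigma> n t y)) \<partial>Leb 0 T)" .
    qed
  qed simp
  then have "(\<lambda>n. \<bar>(LINT t|Leb 0 T. l (u t)) - l (S n)\<bar> / B) \<longlonglongrightarrow> 0"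
    using B by (subst (asm) ennreal_0[symmetric], subst (asm) tendsto_ennreal_iff) auto
  then have "(\<lambda>n. B * (\<bar>(LINT t|Leb 0 T. l (u t)) - l (S n)\<bar> / B)) \<longlonglongrightarrow> B * 0"
    by (rule tendsto_mult_left)
  then have "(\<lambda>n. (LINT t|Leb 0 T. l (u t)) - l (S n)) \<longlonglongrightarrow> 0"
    using B by (simp add: tendsto_rabs_zero_iff)
  from tendsto_add[OF this lim1] have "(LINT t|Leb 0 T. l (u t)) - l w = 0"
    by (simp add: LIMSEQ_const_iff)
  then show ?thesis by (simp add: l_def)
qed

text \<open>The weak time derivative, defined by Sobolev-valued integrals, becomes a scalar
  statement to which \<open>weak_derivative_imp_primitive\<close> applies. Continuity of the pairing
  upgrades equality for almost every time to every time in [0, T].\<close>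

lemma functional_primitive:
  assumes T: "T > 0" and v: "has_weak_time_deriv T s 1 u v"
    and cont: "continuous_on {0..T} (\<lambda>t. LINT y|Leb 0 1. u t y * z y)"
  shows "primitive_on 0 T (\<lambda>t. LINT y|Leb 0 1. u t y * z y) (\<lambda>t. LINT y|Leb 0 1. v t y * z y)"
proof -
  define a b where "a t = (LINT y|Leb 0 1. u t y * z y)" and "b t = (LINT y|Leb 0 1. v t y * z y)" for t
  have ia: "integrable (Leb 0 T) a" and ib: "integrable (Leb 0 T) b"
    using v functional_integrable unfolding has_weak_time_deriv_def a_def b_def by blast+
  have "\<exists>F. primitive_on 0 T F b \<and> (AE t in Leb 0 T. a t = F t)"
  proof (rule weak_derivative_imp_primitive[OF T ia ib])
    fix \<phi> assume \<phi>: "\<phi> \<in> test_functions 0 T"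
    obtain w where w: "has_sobolev_integral T s (\<lambda>t y. (deriv ^^ 1) \<phi> t * u t y) w"
      "has_sobolev_integral T s (\<lambda>t y. (-1) ^ 1 * \<phi> t * v t y) w"
      using v \<phi> unfolding has_weak_time_deriv_def by blast
    have c: "continuous_on {0..T} \<phi>" "continuous_on {0..T} (deriv \<phi>)"
      using test_functionsD(4)[OF \<phi> T] test_functionsD(4)[OF test_functions_deriv[OF \<phi> T] T] by auto
    have e1: "(LINT y|Leb 0 1. (deriv ^^ 1) \<phi> t * u t y * z y) = a t * deriv \<phi> t" for t
    proof -
      have "(LINT y|Leb 0 1. (deriv ^^ 1) \<phi> t * u t y * z y) = deriv \<phi> t * a t"
        by (simp add: a_def mult.assoc)
      then show ?thesis by (simp only: mult.commute)
    qed
    have e2: "(LINT y|Leb 0 1. (-1) ^ 1 * \<phi> t * v t y * z y) = - (b t * \<phi> t)" for t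
    proof -
      have "(LINT y|Leb 0 1. (-1) ^ 1 * \<phi> t * v t y * z y) = - (\<phi> t * b t)"
        by (simp add: b_def mult.assoc)
      then show ?thesis by (simp only: mult.commute)
    qed
    have "(LINT t|Leb 0 T. a t * deriv \<phi> t) = (LINT y|Leb 0 1. w y * z y)"
      using functional_sobolev_integral[OF w(1)] Leb_integrable_mult_continuous[OF ia c(2)] unfolding e1 by simp
    also have "\<dots> = (LINT t|Leb 0 T. - (b t * \<phi> t))"
      using functional_sobolev_integral[OF w(2)] Leb_integrable_mult_continuous[OF ib c(1)] unfolding e2 by simp
    finally show "(LINT t|Leb 0 T. a t * deriv \<phi> t) = - (LINT t|Leb 0 T. b t * \<phi> t)" by simp
  qed
  then obtain F where F: "primitive_on 0 T F b" "AE t in Leb 0 T. a t = F t" by blast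
  have "a t = F t" if "t \<in> {0..T}" for t
    using continuous_AE_eq_imp_eq[OF T _ primitive_on_continuous[OF F(1)] F(2) that] cont by (simp add: a_def)
  then show ?thesis
    using primitive_on_cong[OF F(1), of a] unfolding a_def b_def by simp
qed

lemma functional_continuous:
  fixes u :: "real \<Rightarrow> real \<Rightarrow> real"
  assumes u: "continuous_on ({0..T} \<times> {0..1}) (\<lambda>(t, y). u t y)"
  shows "continuous_on {0..T} (\<lambda>t. LINT y|Leb 0 1. u t y * z y)"
  unfolding continuous_on_sequentially o_def
proof (intro allI ballI impI, elim conjE)
  fix X :: "nat \<Rightarrow> real" and t assume X: "t \<in> {0..T}" "\<forall>n. X n \<in> {0..T}" "X \<longlonglongrightarrow> t"
  obtain M where M: "\<And>t y. t \<in> {0..T} \<Longrightarrow> y \<in> {0..1} \<Longrightarrow> \<bar>u t y\<bar> \<le> M"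
    using joint_continuous_bound[OF u] by blast
  note cont = joint_continuous_slice[OF u]
  show "(\<lambda>n. LINT y|Leb 0 1. u (X n) y * z y) \<longlonglongrightarrow> (LINT y|Leb 0 1. u t y * z y)"
  proof (rule integral_dominated_convergence[where w = "\<lambda>y. M * B"])
    show "(\<lambda>y. u t y * z y) \<in> borel_measurable (Leb 0 1)"
      using continuous_imp_Leb_measurable[OF cont[OF X(1)]] z by simp
    show "(\<lambda>y. u (X n) y * z y) \<in> borel_measurable (Leb 0 1)" for n
      using continuous_imp_Leb_measurable[OF cont[of "X n"]] X z by simp
    show "AE y in Leb 0 1. (\<lambda>n. u (X n) y * z y) \<longlonglongrightarrow> u t y * z y"
    proof (rule AE_LebI, rule tendsto_mult_right)
      fix y :: real assume y: "0 < y" "y < 1"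
      have "(\<lambda>n. (X n, y)) \<longlonglongrightarrow> (t, y)" using X by (intro tendsto_intros)
      then have "(\<lambda>n. (\<lambda>(t, y). u t y) (X n, y)) \<longlonglongrightarrow> (\<lambda>(t, y). u t y) (t, y)"
        using u X y by (intro continuous_on_tendsto_compose[OF u]) auto
      then show "(\<lambda>n. u (X n) y) \<longlonglongrightarrow> u t y" by simp
    qed
    show "AE y in Leb 0 1. norm (u (X n) y * z y) \<le> M * B" for n
    proof -
      have "AE y in Leb 0 1. y \<in> {0..1}" by (rule AE_LebI) simp
      with z(2) show ?thesis
      proof eventually_elim
        case (elim y)
        have "\<bar>u (X n) y\<bar> \<le> M" using M[of "X n" y] X(2) elim by blast
        then show ?case using elim(1) abs_ge_zero[of "u (X n) y"]
          unfolding real_norm_def abs_mult by (intro mult_mono) linarith+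
      qed
    qed
  qed simp
qed

end

lemma primitive_on_unique_density:
  assumes "primitive_on a b F f" "primitive_on a b F g"
  shows "AE y in Leb a b. f y = g y"
proof -
  have "AE y in Leb a b. f y - g y = 0"
  proof (rule AE_zero_if_integrals_zero)
    fix y assume y: "a < y" "y < b"
    have sub: "{a<..<y} \<subseteq> {a<..<b}" using y by auto
    have "integrable (Leb a y) f" "integrable (Leb a y) g"
      by (rule Leb_integrable_subset[OF primitive_onD(2)[OF assms(1)] sub]
          Leb_integrable_subset[OF primitive_onD(2)[OF assms(2)] sub])+
    then show "(LINT t|Leb a y. f t - g t) = 0"
      using primitive_onD(3)[OF assms(1), of y] primitive_onD(3)[OF assms(2), of y] y by simp
  qed (use assms in \<open>auto dest: primitive_onD\<close>)
  then show ?thesis by eventually_elim simp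
qed

text \<open>Identifies the time derivative in the Burgers equation, which is only L2-valued, with
  the one from the regularity assumption. Pairing with indicators of half-lines with rational end
  points costs countably many null sets of times; at every remaining time the continuous primitive
  of the difference vanishes at the rationals, hence everywhere.\<close>

lemma weak_time_deriv_unique:
  assumes T: "T > 0" and u: "continuous_on ({0..T} \<times> {0..1}) (\<lambda>(t, y). u t y)"
    and v: "has_weak_time_deriv T s 1 u v" and v': "has_weak_time_deriv T s' 1 u v'"
  shows "AE t in Leb 0 T. AE y in Leb 0 1. v t y = v' t y"
proof -
  have "AE t in Leb 0 T. (LINT y|Leb 0 1. v t y * indicator {..q} y) = (LINT y|Leb 0 1. v' t y * indicator {..q} y)"
    for q :: real
  proof -
    have z: "indicat_real {..q} \<in> borel_measurable (Leb 0 1)" "AE y in Leb 0 1. \<bar>indicat_real {..q} y\<bar> \<le> 1"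
      by (auto intro!: AE_LebI simp: indicator_le_1)
    show ?thesis
      using primitive_on_unique_density[OF functional_primitive[OF z _ T v] functional_primitive[OF z _ T v']]
        functional_continuous[OF z _ u] by simp
  qed
  then have "AE t in Leb 0 T. \<forall>q\<in>\<rat>. (LINT y|Leb 0 1. v t y * indicator {..q} y) = (LINT y|Leb 0 1. v' t y * indicator {..q} y)"
    by (subst AE_ball_countable) (auto simp: countable_rat)
  moreover have "AE t in Leb 0 T. v t \<in> sobolev s" "AE t in Leb 0 T. v' t \<in> sobolev s'"
    using v v' by (auto simp: has_weak_time_deriv_def L2_sobolev_def strongly_measurable_def)
  ultimately show ?thesis
  proof eventually_elim
    case (elim t)
    have int: "integrable (Leb 0 1) (v t)" "integrable (Leb 0 1) (v' t)"
      using elim by (auto intro: sq_integrable_imp_integrable sobolev_imp_sq_integrable)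
    define d where "d y = v t y - v' t y" for y
    have id: "integrable (Leb 0 1) d" unfolding d_def using int by simp
    have P: "primitive_on 0 1 (\<lambda>y. integral\<^sup>L (Leb 0 y) d) d"
      using primitive_on_exists[OF id, of 0] by simp
    have rat: "integral\<^sup>L (Leb 0 q) d = 0" if q: "q \<in> \<rat>" "0 < q" "q < 1" for q
    proof -
      have e: "(LINT y|Leb 0 1. f y * indicator {..q} y) = (LINT y|Leb 0 q. f y)" if "integrable (Leb 0 1) f" for f :: "real \<Rightarrow> real"
      proof -
        have i2: "integrable (Leb 0 1) (\<lambda>y. f y * indicat_real {..q} y)"
          by (rule Leb_integrable_mult_bounded[OF that, of _ 1]) (auto intro!: AE_LebI simp: indicator_le_1)
        have "(LINT y|Leb 0 1. f y * indicat_real {..q} y)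
          = (LINT y|Leb 0 q. f y * indicat_real {..q} y) + (LINT y|Leb q 1. f y * indicat_real {..q} y)"
          by (rule Leb_integral_split[OF i2]) (use q in auto)
        also have "(LINT y|Leb 0 q. f y * indicat_real {..q} y) = (LINT y|Leb 0 q. f y)"
          by (rule Bochner_Integration.integral_cong) auto
        also have "(LINT y|Leb q 1. f y * indicat_real {..q} y) = (LINT y|Leb q 1. 0)"
          by (rule Bochner_Integration.integral_cong) auto
        finally show ?thesis by simp
      qed
      have sub: "{0<..<q} \<subseteq> {0<..<1}" using q by auto
      have "integrable (Leb 0 q) (v t)" "integrable (Leb 0 q) (v' t)"
        by (rule Leb_integrable_subset[OF int(1) sub] Leb_integrable_subset[OF int(2) sub])+
      then show ?thesis
        using elim(1) q(1) e[OF int(1)] e[OF int(2)] by (simp add: d_def[abs_def])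
    qed
    have "AE y in Leb 0 1. d y = 0"
    proof (rule AE_zero_if_integrals_zero[OF id])
      fix y :: real assume y: "0 < y" "y < 1"
      show "integral\<^sup>L (Leb 0 y) d = 0"
      proof (rule continuous_constant_on_closure[of "\<rat> \<inter> {0<..<1}" "\<lambda>y. integral\<^sup>L (Leb 0 y) d"])
        have "closure (\<rat> \<inter> {0<..<1::real}) = {0..1}"
          using closure_open_Int_superset[of "{0<..<1::real}" \<rat>] closure_greaterThanLessThan[of 0 "1::real"]
          by (simp add: Int_commute Rats_closure_real)
        then show "continuous_on (closure (\<rat> \<inter> {0<..<1::real})) (\<lambda>y. integral\<^sup>L (Leb 0 y) d)"
          and "y \<in> closure (\<rat> \<inter> {0<..<1::real})"
          using primitive_on_continuous[OF P] y by auto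
      qed (use rat in auto)
    qed
    then show ?case by eventually_elim (simp add: d_def)
  qed
qed

section \<open>Gronwall's inequality with an integrable coefficient\<close>

lemma primitive_on_power:
  assumes "primitive_on a b F f"
  shows "primitive_on a b (\<lambda>t. F t ^ Suc n) (\<lambda>t. real (Suc n) * (f t * F t ^ n))"
proof (induction n)
  case 0
  then show ?case using assms by simp
next
  case (Suc n)
  have "(\<lambda>t. f t * F t ^ Suc n + (real (Suc n) * (f t * F t ^ n)) * F t)
      = (\<lambda>t. real (Suc (Suc n)) * (f t * F t ^ Suc n))"
    by (simp add: algebra_simps)
  then show ?case using primitive_on_mult[OF assms Suc] by simp
qed

text \<open>Iterating the hypothesis \<open>n\<close> times leaves a Taylor polynomial of the exponential and a
  remainder that tends to zero.\<close>

lemma Gronwall: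
  fixes A \<phi> :: "real \<Rightarrow> real"
  assumes A: "integrable (Leb a b) A" "\<And>t. 0 \<le> A t" and \<phi>: "continuous_on {a..b} \<phi>" and K: "0 \<le> K"
    and bound: "\<And>t. a \<le> t \<Longrightarrow> t \<le> b \<Longrightarrow> \<phi> t \<le> K + (LINT s|Leb a t. A s * \<phi> s)"
    and t: "a \<le> t" "t \<le> b"
  shows "\<phi> t \<le> K * exp (LINT s|Leb a b. A s)"
proof -
  define \<Lambda> where "\<Lambda> t = (LINT s|Leb a t. A s)" for t
  have ab: "a \<le> b" using t by simp
  have \<Lambda>: "primitive_on a b \<Lambda> A" using primitive_on_exists[OF A(1) ab, of 0] by (simp add: \<Lambda>_def[abs_def])
  have \<Lambda>0: "0 \<le> \<Lambda> s" for s unfolding \<Lambda>_def using A(2) by simp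
  have \<Lambda>a: "\<Lambda> a = 0" by (simp add: \<Lambda>_def Leb_integral_empty)
  have "bounded (\<phi> ` {a..b})" by (intro compact_imp_bounded compact_continuous_image \<phi>) auto
  then obtain M where "\<forall>s\<in>{a..b}. \<bar>\<phi> s\<bar> \<le> M" unfolding bounded_iff by auto
  then have M: "\<phi> s \<le> M" if "a \<le> s" "s \<le> b" for s using that by force
  have M0: "0 \<le> M" using \<open>\<forall>s\<in>{a..b}. \<bar>\<phi> s\<bar> \<le> M\<close> t by (meson abs_ge_zero atLeastAtMost_iff order.trans)
  have pow: "primitive_on a b (\<lambda>t. \<Lambda> t ^ Suc j / fact (Suc j)) (\<lambda>t. A t * (\<Lambda> t ^ j / fact j))" for j
  proof -
    have "primitive_on a b (\<lambda>t. (1 / fact (Suc j)) * \<Lambda> t ^ Suc j) (\<lambda>t. (1 / fact (Suc j)) * (real (Suc j) * (A t * \<Lambda> t ^ j)))"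
      by (rule primitive_on_cmult[OF primitive_on_power[OF \<Lambda>]])
    moreover have "(1 / fact (Suc j)) * (real (Suc j) * (A t * \<Lambda> t ^ j)) = A t * (\<Lambda> t ^ j / fact j)" for t
      by (simp add: field_simps del: of_nat_Suc)
    ultimately show ?thesis by simp
  qed
  have iter: "\<phi> t \<le> K * (\<Sum>j<n. \<Lambda> t ^ j / fact j) + M * (\<Lambda> t ^ n / fact n)" if "a \<le> t" "t \<le> b" for n t
    using that
  proof (induction n arbitrary: t)
    case 0
    then show ?case using M by simp
  next
    case (Suc n)
    define G where "G s = K * (\<Sum>j<n. \<Lambda> s ^ Suc j / fact (Suc j)) + M * (\<Lambda> s ^ Suc n / fact (Suc n))" for s
    define g where "g s = K * (\<Sum>j<n. A s * (\<Lambda> s ^ j / fact j)) + M * (A s * (\<Lambda> s ^ n / fact n))" for s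
    have G: "primitive_on a b G g"
      unfolding G_def[abs_def] g_def[abs_def]
      by (intro primitive_on_add primitive_on_cmult primitive_on_sum pow ab)
    have ts: "{a<..<t} \<subseteq> {a<..<b}" using Suc.prems by auto
    have "(LINT s|Leb a t. A s * \<phi> s) \<le> (LINT s|Leb a t. g s)"
    proof (rule integral_mono_AE)
      show "integrable (Leb a t) (\<lambda>s. A s * \<phi> s)"
        by (rule Leb_integrable_mult_continuous[OF Leb_integrable_subset[OF A(1) ts] continuous_on_subset[OF \<phi>]])
           (use Suc.prems in auto)
      show "integrable (Leb a t) g"
        by (rule Leb_integrable_subset[OF primitive_onD(2)[OF G] ts])
      show "AE s in Leb a t. A s * \<phi> s \<le> g s"
      proof (rule AE_LebI)
        fix s assume s: "a < s" "s < t"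
        have "A s * \<phi> s \<le> A s * (K * (\<Sum>j<n. \<Lambda> s ^ j / fact j) + M * (\<Lambda> s ^ n / fact n))"
          by (rule mult_left_mono[OF Suc.IH A(2)]) (use s Suc.prems in auto)
        then show "A s * \<phi> s \<le> g s" by (simp add: g_def sum_distrib_left algebra_simps)
      qed
    qed
    also have "\<dots> = G t" using primitive_onD(3)[OF G, of t] Suc.prems \<Lambda>a by (simp add: G_def)
    finally have "\<phi> t \<le> K + G t" using bound[OF Suc.prems] by linarith
    also have "K + G t = K * (\<Sum>j<Suc n. \<Lambda> t ^ j / fact j) + M * (\<Lambda> t ^ Suc n / fact (Suc n))"
      unfolding sum.lessThan_Suc_shift G_def by (simp add: algebra_simps)
    finally show ?case .
  qed
  have ex: "(\<lambda>j. \<Lambda> t ^ j / fact j) sums exp (\<Lambda> t)"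
    using exp_converges[of "\<Lambda> t"] by (simp add: field_simps)
  have "(\<Sum>j<n. \<Lambda> t ^ j / fact j) \<le> exp (\<Lambda> t)" for n
    using sum_le_suminf[OF sums_summable[OF ex], of "{..<n}"] sums_unique[OF ex] \<Lambda>0 by simp
  then have "\<phi> t \<le> K * exp (\<Lambda> t) + M * (\<Lambda> t ^ n / fact n)" for n
    using iter[OF t, of n] mult_left_mono[OF _ K] by (meson add_right_mono order.trans)
  moreover have "(\<lambda>n. K * exp (\<Lambda> t) + M * (\<Lambda> t ^ n / fact n)) \<longlonglongrightarrow> K * exp (\<Lambda> t) + M * 0"
    by (intro tendsto_intros summable_LIMSEQ_zero sums_summable[OF ex])
  ultimately have "\<phi> t \<le> K * exp (\<Lambda> t)"
    using LIMSEQ_le_const[of _ "K * exp (\<Lambda> t)" "\<phi> t"] by auto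
  also have "\<Lambda> t \<le> \<Lambda> b"
    using primitive_on_diff[OF \<Lambda> t(1,2)] A(2) by (smt (verit) integral_nonneg_AE AE_I2 order.refl)
  then have "K * exp (\<Lambda> t) \<le> K * exp (\<Lambda> b)" using K by (intro mult_left_mono) auto
  finally show ?thesis by (simp add: \<Lambda>_def)
qed

section \<open>Time dependent polynomials\<close>

lemma poly_coeff_functional:
  assumes "a < b"
  shows "\<exists>q. \<forall>j\<le>k. degree (q j) \<le> k \<and> (\<forall>p. degree p \<le> k \<longrightarrow> (LINT y|Leb a b. poly p y * poly (q j) y) = coeff p j)"
proof -
  have "\<exists>q. degree q \<le> k \<and> (\<forall>p. degree p \<le> k \<longrightarrow> (LINT y|Leb a b. poly q y * poly p y) = coeff p j)" for j
    by (rule poly_Riesz_exists[OF assms]) (simp add: linear_on_polys_def)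
  then obtain q where "\<And>j. degree (q j) \<le> k \<and> (\<forall>p. degree p \<le> k \<longrightarrow> (LINT y|Leb a b. poly (q j) y * poly p y) = coeff p j)"
    by metis
  then show ?thesis by (intro exI[of _ q]) (simp add: mult.commute)
qed

lemma poly_eq_sum_monom: "degree (p :: real poly) \<le> k \<Longrightarrow> p = (\<Sum>j\<le>k. smult (coeff p j) (monom 1 j))"
  using poly_as_sum_of_monoms'[of p k] by (simp add: smult_monom)

lemma Leb_integral_poly_sum:
  assumes "integrable (Leb a b) f"
  shows "(LINT y|Leb a b. f y * poly (\<Sum>j\<in>S. smult (c j) (q j)) y) = (\<Sum>j\<in>S. c j * (LINT y|Leb a b. f y * poly (q j) y))"
proof -
  have "(LINT y|Leb a b. f y * poly (\<Sum>j\<in>S. smult (c j) (q j)) y) = (LINT y|Leb a b. (\<Sum>j\<in>S. c j * (f y * poly (q j) y)))"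
    by (simp add: poly_sum sum_distrib_left mult.left_commute)
  also have "\<dots> = (\<Sum>j\<in>S. LINT y|Leb a b. c j * (f y * poly (q j) y))"
    by (rule Bochner_Integration.integral_sum) (use assms in auto)
  finally show ?thesis by simp
qed

text \<open>Only pairings of \<open>e t\<close> with fixed polynomials are known to be absolutely
  continuous. The squared norm is a sum over j of the coefficient of order j, itself such a pairing,
  times the pairing with the monomial of order j, so the product rule applies. The density is
  computed at times where \<open>v t\<close> is integrable.\<close>

lemma primitive_on_poly_square:
  fixes e R :: "real \<Rightarrow> real poly" and v :: "real \<Rightarrow> real \<Rightarrow> real"
  assumes ab: "a < b" and T: "\<alpha> \<le> \<tau>" and deg: "\<And>t. \<alpha> \<le> t \<Longrightarrow> t \<le> \<tau> \<Longrightarrow> degree (e t) \<le> k"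
    and prim: "\<And>q. degree q \<le> k \<Longrightarrow> primitive_on \<alpha> \<tau> (\<lambda>t. LINT y|Leb a b. poly (e t) y * poly q y)
        (\<lambda>t. (LINT y|Leb a b. v t y * poly q y) - (LINT y|Leb a b. poly (R t) y * poly q y))"
  shows "\<exists>D. primitive_on \<alpha> \<tau> (\<lambda>t. LINT y|Leb a b. (poly (e t) y)\<^sup>2) D \<and>
    (\<forall>t. \<alpha> \<le> t \<longrightarrow> t \<le> \<tau> \<longrightarrow> integrable (Leb a b) (v t) \<longrightarrow>
      D t = 2 * (LINT y|Leb a b. (v t y - poly (R t) y) * poly (e t) y))"
proof -
  define r where "r t q = (LINT y|Leb a b. v t y * poly q y) - (LINT y|Leb a b. poly (R t) y * poly q y)" for t q
  obtain q where q: "\<And>j. j \<le> k \<Longrightarrow> degree (q j) \<le> k"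
    "\<And>j p. j \<le> k \<Longrightarrow> degree p \<le> k \<Longrightarrow> (LINT y|Leb a b. poly p y * poly (q j) y) = coeff p j"
    using poly_coeff_functional[OF ab, of k] by blast
  define A where "A j t = (LINT y|Leb a b. poly (e t) y * poly (q j) y)" for j t
  define B where "B j t = (LINT y|Leb a b. poly (e t) y * poly (monom 1 j) y)" for j t
  have mon: "degree (monom 1 j :: real poly) \<le> k" if "j \<le> k" for j
    using that degree_monom_le[of "1::real" j] by simp
  define D where "D t = (\<Sum>j\<le>k. r t (q j) * B j t + r t (monom 1 j) * A j t)" for t
  have P: "primitive_on \<alpha> \<tau> (\<lambda>t. \<Sum>j\<le>k. A j t * B j t) D"
    unfolding D_def[abs_def]
  proof (rule primitive_on_sum[OF T])
    fix j assume "j \<in> {..k}"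
    then have j: "j \<le> k" by simp
    show "primitive_on \<alpha> \<tau> (\<lambda>t. A j t * B j t) (\<lambda>t. r t (q j) * B j t + r t (monom 1 j) * A j t)"
      using prim[OF q(1)[OF j]] prim[OF mon[OF j]]
      unfolding A_def B_def r_def by (rule primitive_on_mult)
  qed
  have cA: "A j t = coeff (e t) j" if "\<alpha> \<le> t" "t \<le> \<tau>" "j \<le> k" for j t
    using q(2)[OF that(3) deg] that by (simp add: A_def)
  have sq: "(\<Sum>j\<le>k. A j t * B j t) = (LINT y|Leb a b. (poly (e t) y)\<^sup>2)" if t: "\<alpha> \<le> t" "t \<le> \<tau>" for t
  proof -
    have "(LINT y|Leb a b. (poly (e t) y)\<^sup>2) = (LINT y|Leb a b. poly (e t) y * poly (\<Sum>j\<le>k. smult (coeff (e t) j) (monom 1 j)) y)"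
      using poly_eq_sum_monom[OF deg[OF t]] by (simp add: power2_eq_square)
    also have "\<dots> = (\<Sum>j\<le>k. coeff (e t) j * B j t)" unfolding B_def by (rule Leb_integral_poly_sum) simp
    finally show ?thesis using cA[OF t] by simp
  qed
  have D: "D t = 2 * (LINT y|Leb a b. (v t y - poly (R t) y) * poly (e t) y)"
    if t: "\<alpha> \<le> t" "t \<le> \<tau>" and v: "integrable (Leb a b) (v t)" for t
  proof -
    define f where "f y = v t y - poly (R t) y" for y
    have f: "integrable (Leb a b) f" unfolding f_def using v by simp
    have r: "r t p = (LINT y|Leb a b. f y * poly p y)" for p
      unfolding r_def f_def left_diff_distrib using v by simp
    have et: "(LINT y|Leb a b. f y * poly (\<Sum>j\<le>k. smult (coeff (e t) j) (monom 1 j)) y) = (LINT y|Leb a b. f y * poly (e t) y)"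
      using poly_eq_sum_monom[OF deg[OF t]] by simp
    have 1: "(\<Sum>j\<le>k. r t (monom 1 j) * A j t) = (LINT y|Leb a b. f y * poly (e t) y)"
    proof -
      have "(\<Sum>j\<le>k. r t (monom 1 j) * A j t) = (\<Sum>j\<le>k. coeff (e t) j * (LINT y|Leb a b. f y * poly (monom 1 j) y))"
        by (rule sum.cong) (use cA[OF t] in \<open>auto simp: r\<close>)
      also have "\<dots> = (LINT y|Leb a b. f y * poly (\<Sum>j\<le>k. smult (coeff (e t) j) (monom 1 j)) y)"
        by (rule Leb_integral_poly_sum[OF f, symmetric])
      finally show ?thesis unfolding et .
    qed
    \<comment> \<open>The pairings of \<open>f\<close> with the dual polynomials \<open>q j\<close>
      are the coefficients of its projection, which turns the second half into the same integral as
      the first.\<close>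
    define p where "p = proj a b k f"
    note p = proj[OF ab f, where m = k, folded p_def]
    have 2: "(\<Sum>j\<le>k. r t (q j) * B j t) = (LINT y|Leb a b. f y * poly (e t) y)"
    proof -
      have "(\<Sum>j\<le>k. r t (q j) * B j t) = (\<Sum>j\<le>k. coeff p j * (LINT y|Leb a b. poly (e t) y * poly (monom 1 j) y))"
      proof (rule sum.cong[OF refl])
        fix j assume "j \<in> {..k}"
        then have j: "j \<le> k" by simp
        show "r t (q j) * B j t = coeff p j * (LINT y|Leb a b. poly (e t) y * poly (monom 1 j) y)"
          using p(2)[OF q(1)[OF j]] q(2)[OF j p(1)] by (simp add: r B_def)
      qed
      also have "\<dots> = (LINT y|Leb a b. poly (e t) y * poly (\<Sum>j\<le>k. smult (coeff p j) (monom 1 j)) y)"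
        by (rule Leb_integral_poly_sum[symmetric]) simp
      also have "\<dots> = (LINT y|Leb a b. poly (e t) y * poly p y)"
        using poly_eq_sum_monom[OF p(1)] by simp
      also have "\<dots> = (LINT y|Leb a b. f y * poly (e t) y)"
        using p(2)[OF deg[OF t]] by (simp add: mult.commute)
      finally show ?thesis .
    qed
    show ?thesis unfolding D_def sum.distrib 1 2 by (simp add: f_def)
  qed
  have "primitive_on \<alpha> \<tau> (\<lambda>t. LINT y|Leb a b. (poly (e t) y)\<^sup>2) D"
    by (rule primitive_on_cong[OF P]) (rule sq)
  then show ?thesis using D by blast
qed

text \<open>The same coefficient expansion, here for continuity alone; it reaches time 0, where no
  time derivative is available.\<close>

lemma continuous_on_poly_square:
  fixes e :: "'a::topological_space \<Rightarrow> real poly"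
  assumes ab: "a < b" and deg: "\<And>t. t \<in> S \<Longrightarrow> degree (e t) \<le> k"
    and cont: "\<And>q. degree q \<le> k \<Longrightarrow> continuous_on S (\<lambda>t. LINT y|Leb a b. poly (e t) y * poly q y)"
  shows "continuous_on S (\<lambda>t. LINT y|Leb a b. (poly (e t) y)\<^sup>2)"
proof -
  obtain q where q: "\<And>j. j \<le> k \<Longrightarrow> degree (q j) \<le> k"
    "\<And>j p. j \<le> k \<Longrightarrow> degree p \<le> k \<Longrightarrow> (LINT y|Leb a b. poly p y * poly (q j) y) = coeff p j"
    using poly_coeff_functional[OF ab, of k] by blast
  have "continuous_on S (\<lambda>t. \<Sum>j\<le>k. (LINT y|Leb a b. poly (e t) y * poly (q j) y) * (LINT y|Leb a b. poly (e t) y * poly (monom 1 j) y))"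
    by (intro continuous_on_sum continuous_on_mult cont q(1)) (auto intro: order.trans[OF degree_monom_le])
  moreover have "(\<Sum>j\<le>k. (LINT y|Leb a b. poly (e t) y * poly (q j) y) * (LINT y|Leb a b. poly (e t) y * poly (monom 1 j) y))
      = (LINT y|Leb a b. (poly (e t) y)\<^sup>2)" if t: "t \<in> S" for t
  proof -
    have "(LINT y|Leb a b. (poly (e t) y)\<^sup>2) = (LINT y|Leb a b. poly (e t) y * poly (\<Sum>j\<le>k. smult (coeff (e t) j) (monom 1 j)) y)"
      using poly_eq_sum_monom[OF deg[OF t]] by (simp add: power2_eq_square)
    also have "\<dots> = (\<Sum>j\<le>k. coeff (e t) j * (LINT y|Leb a b. poly (e t) y * poly (monom 1 j) y))"
      by (rule Leb_integral_poly_sum) simp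
    finally show ?thesis using q(2)[OF _ deg[OF t]] by simp
  qed
  ultimately show ?thesis by (rule continuous_on_eq)
qed

text \<open>Interpolation at finitely many points of the element turns regularity in time at each
  point into regularity of all pairings, and shows that the time derivative is again a polynomial in
  space. Intervals start at \<open>\<delta>\<close> because differentiability is assumed only for
  positive times.\<close>

lemma time_regular_poly:
  fixes w :: "real \<Rightarrow> real \<Rightarrow> real"
  assumes ab: "a < b" and deg: "\<And>t. t \<in> {0..T} \<Longrightarrow> degree (p t) \<le> k"
    and w: "\<And>t y. t \<in> {0..T} \<Longrightarrow> y \<in> {a<..<b} \<Longrightarrow> w t y = poly (p t) y"
    and reg: "\<And>y. y \<in> {a<..<b} \<Longrightarrow> continuous_on {0..T} (\<lambda>t. w t y) \<and> (\<lambda>t. w t y) differentiable_on {0<..T} \<and>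
      continuous_on {0<..T} (\<lambda>t. time_deriv T w t y)"
  shows "\<exists>R. (\<forall>t\<in>{0<..T}. \<forall>y\<in>{a<..<b}. time_deriv T w t y = poly (R t) y) \<and>
    (\<forall>q. continuous_on {0..T} (\<lambda>t. LINT y|Leb a b. poly (p t) y * poly q y)) \<and>
    (\<forall>q \<delta>. 0 < \<delta> \<longrightarrow> \<delta> \<le> T \<longrightarrow> primitive_on \<delta> T (\<lambda>t. LINT y|Leb a b. poly (p t) y * poly q y)
      (\<lambda>t. LINT y|Leb a b. poly (R t) y * poly q y))"
proof -
  obtain ys :: "nat \<Rightarrow> real" and L where ys: "\<And>j. j \<le> k \<Longrightarrow> ys j \<in> {a<..<b}" and
    L: "\<And>p. degree p \<le> k \<Longrightarrow> p = (\<Sum>j\<le>k. smult (poly p (ys j)) (L j))"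
    using Lagrange_interpolation[OF ab, of k] by blast
  have p: "p t = (\<Sum>j\<le>k. smult (w t (ys j)) (L j))" if "t \<in> {0..T}" for t
    using L[OF deg[OF that]] w[OF that ys] by simp
  define R where "R t = (\<Sum>j\<le>k. smult (time_deriv T w t (ys j)) (L j))" for t
  have der: "((\<lambda>s. w s y) has_real_derivative time_deriv T w t y) (at t within {0<..T})"
    if "t \<in> {0<..T}" "y \<in> {a<..<b}" for t y
    using reg[OF that(2)] that(1) unfolding differentiable_on_def time_deriv_def
    by (simp add: has_real_derivative_iff_has_vector_derivative vector_derivative_works[symmetric])
  have "time_deriv T w t y = poly (R t) y" if t: "t \<in> {0<..T}" and y: "y \<in> {a<..<b}" for t y
  proof -
    have "((\<lambda>s. \<Sum>j\<le>k. w s (ys j) * poly (L j) y) has_real_derivative (\<Sum>j\<le>k. time_deriv T w t (ys j) * poly (L j) y)) (at t within {0<..T})"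
      by (intro DERIV_sum DERIV_cmult_right der[OF t] ys) auto
    moreover have "(\<Sum>j\<le>k. w s (ys j) * poly (L j) y) = w s y" if "s \<in> {0<..T}" for s
      using p[of s] w[of s y] that y by (simp add: poly_sum)
    ultimately have "((\<lambda>s. w s y) has_vector_derivative (\<Sum>j\<le>k. time_deriv T w t (ys j) * poly (L j) y)) (at t within {0<..T})"
      unfolding has_real_derivative_iff_has_vector_derivative
      by (intro has_vector_derivative_transform[OF t, of "\<lambda>s. w s y"]) auto
    \<comment> \<open>Derivatives within this set are unique because each of its points is a limit
      of earlier ones, including the one-sided case t = T.\<close>
    moreover have "at t within {0<..T} \<noteq> bot"
    proof -
      have "t islimpt {0<..<t}" using t by (simp add: islimpt_greaterThanLessThan2)
      then have "t islimpt {0<..T}" by (rule islimpt_subset) (use t in auto)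
      then show ?thesis by (simp add: trivial_limit_within)
    qed
    ultimately have "time_deriv T w t y = (\<Sum>j\<le>k. time_deriv T w t (ys j) * poly (L j) y)"
      using der[OF t y] vector_derivative_unique_within
      unfolding has_real_derivative_iff_has_vector_derivative by blast
    then show ?thesis by (simp add: R_def poly_sum)
  qed
  moreover have exp: "(LINT y|Leb a b. poly (\<Sum>j\<le>k. smult (c j) (L j)) y * poly q y) = (\<Sum>j\<le>k. (LINT y|Leb a b. poly (L j) y * poly q y) * c j)" for c q
    using Leb_integral_poly_sum[of a b "poly q" c L "{..k}"] by (simp add: mult.commute)
  have "continuous_on {0..T} (\<lambda>t. LINT y|Leb a b. poly (p t) y * poly q y)" for q
  proof -
    have "continuous_on {0..T} (\<lambda>t. \<Sum>j\<le>k. (LINT y|Leb a b. poly (L j) y * poly q y) * w t (ys j))"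
      using reg ys by (intro continuous_intros) auto
    then show ?thesis by (rule continuous_on_eq) (simp add: p exp)
  qed
  moreover have "primitive_on \<delta> T (\<lambda>t. LINT y|Leb a b. poly (p t) y * poly q y) (\<lambda>t. LINT y|Leb a b. poly (R t) y * poly q y)"
    if \<delta>: "0 < \<delta>" "\<delta> \<le> T" for q \<delta>
  proof -
    have sub: "{\<delta>..T} \<subseteq> {0<..T}" using \<delta> by auto
    have "primitive_on \<delta> T (\<lambda>t. \<Sum>j\<le>k. (LINT y|Leb a b. poly (L j) y * poly q y) * w t (ys j))
       (\<lambda>t. \<Sum>j\<le>k. (LINT y|Leb a b. poly (L j) y * poly q y) * time_deriv T w t (ys j))"
    proof (intro primitive_on_sum primitive_on_cmult \<delta>(2) primitive_on_deriv)
      fix j t assume "j \<in> {..k}" "\<delta> \<le> t" "t \<le> T"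
      then show "((\<lambda>t. w t (ys j)) has_real_derivative time_deriv T w t (ys j)) (at t within {\<delta>..T})"
        using der[of t "ys j"] ys[of j] \<delta> by (intro has_field_derivative_subset[OF _ sub]) auto
    next
      fix j assume "j \<in> {..k}"
      then show "continuous_on {\<delta>..T} (\<lambda>t. time_deriv T w t (ys j))"
        using reg[of "ys j"] ys[of j] continuous_on_subset[OF _ sub] by auto
    qed
    then show ?thesis
      unfolding R_def exp
      by (rule primitive_on_cong) (use \<delta> in \<open>auto simp: p exp\<close>)
  qed
  ultimately show ?thesis by blast
qed

section \<open>The error inequality\<close>

lemma norm_h_squared: "(norm_h N x f)\<^sup>2 = (\<Sum>i\<in>{1..<N}. LINT y|Leb (x i) (x (Suc i)). (f y)\<^sup>2)"
  unfolding norm_h_def inner_h_def power2_eq_square by (simp add: sum_nonneg)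

lemma inner_h_poly:
  assumes "\<And>i y. i \<in> {1..<N} \<Longrightarrow> y \<in> elem x i \<Longrightarrow> f y * g y = F i y"
  shows "inner_h N x f g = (\<Sum>i\<in>{1..<N}. LINT y|Leb (x i) (x (Suc i)). F i y)"
  unfolding inner_h_def
  by (rule sum.cong[OF refl], rule Bochner_Integration.integral_cong) (use assms in auto)

text \<open>\<open>z\<close> and \<open>w1\<close> are the given functions, \<open>Z 0\<close> and
  \<open>W 1\<close> their versions in the chains. The gradient error is bounded through the slack
  \<open>bound - 2 * Q\<close>: as \<open>2 * Q\<close> will be the time derivative of the squared
  error, the slack can be integrated in time without integrating the norm of
  \<open>d\<close>.\<close>

lemma error_inequality_at_time:
  fixes W Z :: "nat \<Rightarrow> real \<Rightarrow> real" and up R e :: "nat \<Rightarrow> real poly" and uh :: weak_fun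
  assumes P: "is_partition N x" and \<nu>: "\<nu> > 0"
    and W: "sobolev_chain (k + 2) W" and Z: "sobolev_chain k Z"
    and w: "continuous_on {0..1} w" "AE y in Leb 0 1. w y = W 0 y" "w 0 = 0" "w 1 = 0"
      "\<And>y. y \<in> {0..1} \<Longrightarrow> \<bar>w y\<bar> \<le> M"
    and eq: "AE y in Leb 0 1. Z 0 y + w y * W 1 y - \<nu> * W 2 y = 0"
    and \<beta>: "\<And>j. j \<le> k + 2 \<Longrightarrow> (LINT y|Leb 0 1. (W j y)\<^sup>2) \<le> \<beta>"
      "\<And>j. j \<le> k \<Longrightarrow> (LINT y|Leb 0 1. (Z j y)\<^sup>2) \<le> \<beta>"
    and C: "\<forall>a b p. a < b \<longrightarrow> degree p \<le> k + 1 \<longrightarrow>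
       (\<forall>y\<in>{a..b}. (b - a) * (poly p y)\<^sup>2 \<le> C * (LINT y|Leb a b. (poly p y)\<^sup>2))" "C \<ge> 1"
    and z: "AE y in Leb 0 1. z y = Z 0 y" "sq_integrable 0 1 z"
    and w1: "AE y in Leb 0 1. w1 y = W 1 y" "sq_integrable 0 1 w1"
    and uh: "uh \<in> weak_space0 N x k"
    and up: "\<And>i y. i \<in> {1..<N} \<Longrightarrow> y \<in> elem x i \<Longrightarrow> interior_part uh y = poly (up i) y"
      "\<And>i. i \<in> {1..<N} \<Longrightarrow> degree (up i) \<le> k"
    and R: "\<And>i y. i \<in> {1..<N} \<Longrightarrow> y \<in> elem x i \<Longrightarrow> uht y = poly (R i) y"
    and eqh: "\<And>v. v \<in> weak_space0 N x k \<Longrightarrow>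
        inner_h N x uht (interior_part v)
        + \<nu> * inner_h N x (discrete_weak_deriv N x (k + 1) uh) (discrete_weak_deriv N x (k + 1) v)
        + 1 / 3 * inner_h N x (\<lambda>y. interior_part uh y * discrete_weak_deriv N x (k + 1) uh y) (interior_part v)
        - 1 / 3 * inner_h N x (\<lambda>y. interior_part uh y * interior_part uh y) (discrete_weak_deriv N x (k + 1) v) = 0"
    and e: "\<And>i. e i = proj (x i) (x (Suc i)) k w - up i"
    and Q: "Q = (\<Sum>i\<in>{1..<N}. LINT y|Leb (x i) (x (Suc i)). (z y - poly (R i) y) * poly (e i) y)"
    and bound: "bound = 2 * (C * M\<^sup>2 / \<nu> + 1 + C * (4 * \<beta>)) * (\<Sum>i\<in>{1..<N}. LINT y|Leb (x i) (x (Suc i)). (poly (e i) y)\<^sup>2)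
      + 2 * ((2 / \<nu> + C * M\<^sup>2 + C * M\<^sup>2 / \<nu> + 1) * (2 * \<nu>\<^sup>2 + 4) * mesh_size N x ^ (2 * (k + 1)) * \<beta>)"
  shows "2 * Q \<le> bound"
    and "\<nu> * (norm_h N x (\<lambda>y. w1 y - discrete_weak_deriv N x (k + 1) uh y))\<^sup>2
      \<le> 2 * \<nu> * mesh_size N x ^ (2 * (k + 1)) * \<beta> + 2 * (bound - 2 * Q)"
proof -
  note el = partition_elem_subset[OF P]
  have wi: "integrable (Leb (x i) (x (Suc i))) w" if "i \<in> {1..<N}" for i
    using continuous_imp_Leb_integrable[OF w(1)] el(4)[OF that] by (rule Leb_integrable_subset)
  have dege: "degree (e i) \<le> k" if i: "i \<in> {1..<N}" for i
    unfolding e by (rule degree_diff_le[OF proj(1)[OF el(2)[OF i] wi[OF i]] up(2)[OF i]])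
  \<comment> \<open>The test function is the projection of u minus the discrete solution; it
    vanishes at the end nodes because both do.\<close>
  define v where "v = Weak_Fun (glue N x e) (\<lambda>i. w (x i) - nodal_value uh i)"
  have vint: "interior_part v y = poly (e i) y" if "i \<in> {1..<N}" "y \<in> elem x i" for i y
    using glue_eq[OF P that] by (simp add: v_def)
  have vn: "nodal_value v i = w (x i) - nodal_value uh i" for i by (simp add: v_def)
  have uh0: "nodal_value uh 1 = 0" "nodal_value uh N = 0" using uh by (auto simp: weak_space0_def)
  have v: "v \<in> weak_space0 N x k"
    unfolding weak_space0_def weak_space_def using vint dege uh0 w(3,4) P
    by (auto simp: v_def is_partition_def intro!: exI[of _ "e _"])
  have "\<exists>D. \<forall>i\<in>{1..<N}. degree (D i) \<le> k + 1 \<and> (\<forall>y\<in>elem x i. discrete_weak_deriv N x (k + 1) uh y = poly (D i) y) \<and>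
    (\<forall>q. degree q \<le> k + 1 \<longrightarrow> (LINT y|Leb (x i) (x (Suc i)). poly (D i) y * poly q y)
          = - (LINT y|Leb (x i) (x (Suc i)). poly (up i) y * poly (pderiv q) y)
            + nodal_value uh (Suc i) * poly q (x (Suc i)) - nodal_value uh i * poly q (x i))"
    by (rule bchoice) (use discrete_weak_deriv_poly[OF P _ up(1), where r = "k + 1"] in blast)
  then obtain dh where dh: "\<And>i. i \<in> {1..<N} \<Longrightarrow> degree (dh i) \<le> k + 1"
    "\<And>i y. i \<in> {1..<N} \<Longrightarrow> y \<in> elem x i \<Longrightarrow> discrete_weak_deriv N x (k + 1) uh y = poly (dh i) y"
    "\<And>i q. i \<in> {1..<N} \<Longrightarrow> degree q \<le> k + 1 \<Longrightarrow> (LINT y|Leb (x i) (x (Suc i)). poly (dh i) y * poly q y)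
          = - (LINT y|Leb (x i) (x (Suc i)). poly (up i) y * poly (pderiv q) y)
            + nodal_value uh (Suc i) * poly q (x (Suc i)) - nodal_value uh i * poly q (x i)"
    by blast
  have "\<exists>D. \<forall>i\<in>{1..<N}. degree (D i) \<le> k + 1 \<and> (\<forall>y\<in>elem x i. discrete_weak_deriv N x (k + 1) v y = poly (D i) y) \<and>
    (\<forall>q. degree q \<le> k + 1 \<longrightarrow> (LINT y|Leb (x i) (x (Suc i)). poly (D i) y * poly q y)
          = - (LINT y|Leb (x i) (x (Suc i)). poly (e i) y * poly (pderiv q) y)
            + nodal_value v (Suc i) * poly q (x (Suc i)) - nodal_value v i * poly q (x i))"
    by (rule bchoice) (use discrete_weak_deriv_poly[OF P _ vint, where r = "k + 1"] in blast)
  then obtain d where d: "\<And>i. i \<in> {1..<N} \<Longrightarrow> degree (d i) \<le> k + 1"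
    "\<And>i y. i \<in> {1..<N} \<Longrightarrow> y \<in> elem x i \<Longrightarrow> discrete_weak_deriv N x (k + 1) v y = poly (d i) y"
    "\<And>i q. i \<in> {1..<N} \<Longrightarrow> degree q \<le> k + 1 \<Longrightarrow> (LINT y|Leb (x i) (x (Suc i)). poly (d i) y * poly q y)
          = - (LINT y|Leb (x i) (x (Suc i)). poly (e i) y * poly (pderiv q) y)
            + (w (x (Suc i)) - nodal_value uh (Suc i)) * poly q (x (Suc i)) - (w (x i) - nodal_value uh i) * poly q (x i)"
    unfolding vn by blast
  have discrete: "(\<Sum>i\<in>{1..<N}. (LINT y|Leb (x i) (x (Suc i)). poly (R i) y * poly (e i) y)
        + \<nu> * (LINT y|Leb (x i) (x (Suc i)). poly (dh i) y * poly (d i) y)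
        + 1 / 3 * (LINT y|Leb (x i) (x (Suc i)). (poly (up i) y * poly (dh i) y) * poly (e i) y)
        - 1 / 3 * (LINT y|Leb (x i) (x (Suc i)). (poly (up i) y * poly (up i) y) * poly (d i) y)) = 0"
  proof -
    have 1: "inner_h N x uht (interior_part v) = (\<Sum>i\<in>{1..<N}. LINT y|Leb (x i) (x (Suc i)). poly (R i) y * poly (e i) y)"
      by (rule inner_h_poly) (simp add: R vint)
    have 2: "inner_h N x (discrete_weak_deriv N x (k + 1) uh) (discrete_weak_deriv N x (k + 1) v)
        = (\<Sum>i\<in>{1..<N}. LINT y|Leb (x i) (x (Suc i)). poly (dh i) y * poly (d i) y)"
      by (rule inner_h_poly) (simp add: dh(2) d(2) del: One_nat_def add_Suc_right)
    have 3: "inner_h N x (\<lambda>y. interior_part uh y * discrete_weak_deriv N x (k + 1) uh y) (interior_part v)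
        = (\<Sum>i\<in>{1..<N}. LINT y|Leb (x i) (x (Suc i)). (poly (up i) y * poly (dh i) y) * poly (e i) y)"
      by (rule inner_h_poly) (simp only: up(1) dh(2) vint)
    have 4: "inner_h N x (\<lambda>y. interior_part uh y * interior_part uh y) (discrete_weak_deriv N x (k + 1) v)
        = (\<Sum>i\<in>{1..<N}. LINT y|Leb (x i) (x (Suc i)). (poly (up i) y * poly (up i) y) * poly (d i) y)"
      by (rule inner_h_poly) (simp only: up(1) d(2))
    show ?thesis
      using eqh[OF v] unfolding 1 2 3 4 by (simp only: sum.distrib sum_subtractf sum_distrib_left[symmetric])
  qed
  note est = spatial_estimate[OF P \<nu> W Z w eq \<beta> C up(2) dh(1) dh(3) uh0 e d(1) d(3) discrete]
  define S where "S = (\<Sum>i\<in>{1..<N}. LINT y|Leb (x i) (x (Suc i)). (poly (d i) y)\<^sup>2)"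
  have Q': "Q = (\<Sum>i\<in>{1..<N}. LINT y|Leb (x i) (x (Suc i)). (Z 0 y - poly (R i) y) * poly (e i) y)"
    unfolding Q
  proof (rule sum.cong[OF refl], rule integral_cong_AE)
    fix i assume i: "i \<in> {1..<N}"
    show "AE y in Leb (x i) (x (Suc i)). (z y - poly (R i) y) * poly (e i) y = (Z 0 y - poly (R i) y) * poly (e i) y"
      using AE_Leb_subset[OF z(1) el(4)[OF i]] by eventually_elim simp
    have poly: "poly q \<in> borel_measurable (Leb (x i) (x (Suc i)))" for q
      using poly_Leb_integrable by (rule borel_measurable_integrable)
    have "sq_integrable 0 1 (Z 0)" using Z by (simp add: sobolev_chain_def)
    then have "z \<in> borel_measurable (Leb (x i) (x (Suc i)))" "Z 0 \<in> borel_measurable (Leb (x i) (x (Suc i)))"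
      using sq_integrable_subset[OF _ el(4)[OF i]] z(2) by (auto simp: sq_integrable_def)
    then show "(\<lambda>y. (z y - poly (R i) y) * poly (e i) y) \<in> borel_measurable (Leb (x i) (x (Suc i)))"
      "(\<lambda>y. (Z 0 y - poly (R i) y) * poly (e i) y) \<in> borel_measurable (Leb (x i) (x (Suc i)))"
      using poly by auto
  qed
  have 1: "2 * Q + \<nu> * S \<le> bound"
  proof -
    have "2 * (q + \<nu> / 2 * s) \<le> 2 * a * E + 2 * c" if "q + \<nu> / 2 * s \<le> a * E + c" for q s a E c
      using that by (simp add: algebra_simps)
    from this[OF est(1)[folded Q' S_def]] show ?thesis unfolding bound by (simp only: distrib_left) simp
  qed
  have S0: "0 \<le> S" unfolding S_def by (intro sum_nonneg) simp
  then show "2 * Q \<le> bound" using 1 \<nu> zero_le_mult_iff[of \<nu> S] by linarith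
  have "(norm_h N x (\<lambda>y. w1 y - discrete_weak_deriv N x (k + 1) uh y))\<^sup>2
    \<le> (\<Sum>i\<in>{1..<N}. 2 * (LINT y|Leb (x i) (x (Suc i)). (W 1 y - poly (dh i + d i) y)\<^sup>2)
        + 2 * (LINT y|Leb (x i) (x (Suc i)). (poly (d i) y)\<^sup>2))"
    unfolding norm_h_squared
  proof (rule sum_mono)
    fix i assume i: "i \<in> {1..<N}"
    have sqW: "sq_integrable (x i) (x (Suc i)) (W 1)"
      using sq_integrable_subset[OF _ el(4)[OF i]] W by (simp add: sobolev_chain_def)
    have ints: "integrable (Leb (x i) (x (Suc i))) (\<lambda>y. (W 1 y - poly (dh i + d i) y)\<^sup>2)"
       "integrable (Leb (x i) (x (Suc i))) (\<lambda>y. (poly (d i) y)\<^sup>2)"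
      using sq_integrable_diff[OF sqW poly_sq_integrable, of "dh i + d i"] poly_sq_integrable[of _ _ "d i"]
      unfolding sq_integrable_def by blast+
    have "(LINT y|Leb (x i) (x (Suc i)). (w1 y - discrete_weak_deriv N x (k + 1) uh y)\<^sup>2)
       \<le> (LINT y|Leb (x i) (x (Suc i)). 2 * (W 1 y - poly (dh i + d i) y)\<^sup>2 + 2 * (poly (d i) y)\<^sup>2)"
    proof (rule integral_mono_AE')
      have "AE y in Leb (x i) (x (Suc i)). y \<in> elem x i" by (rule AE_LebI) simp
      with AE_Leb_subset[OF w1(1) el(4)[OF i]]
      show "AE y in Leb (x i) (x (Suc i)). (w1 y - discrete_weak_deriv N x (k + 1) uh y)\<^sup>2
        \<le> 2 * (W 1 y - poly (dh i + d i) y)\<^sup>2 + 2 * (poly (d i) y)\<^sup>2"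
      proof eventually_elim
        case (elim y)
        define a b where "a = W 1 y - poly (dh i + d i) y" and "b = poly (d i) y"
        have "w1 y - discrete_weak_deriv N x (k + 1) uh y = a + b"
          using dh(2)[OF i, of y] elim by (simp add: a_def b_def)
        moreover have "(a + b)\<^sup>2 \<le> 2 * a\<^sup>2 + 2 * b\<^sup>2"
          using zero_le_power2[of "a - b"] unfolding power2_sum power2_diff by linarith
        ultimately show ?case by (simp add: a_def b_def)
      qed
    qed (use ints in auto)
    then show "(LINT y|Leb (x i) (x (Suc i)). (w1 y - discrete_weak_deriv N x (k + 1) uh y)\<^sup>2)
      \<le> 2 * (LINT y|Leb (x i) (x (Suc i)). (W 1 y - poly (dh i + d i) y)\<^sup>2)
        + 2 * (LINT y|Leb (x i) (x (Suc i)). (poly (d i) y)\<^sup>2)"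
      using ints by simp
  qed
  also have "\<dots> = 2 * (\<Sum>i\<in>{1..<N}. LINT y|Leb (x i) (x (Suc i)). (W 1 y - poly (dh i + d i) y)\<^sup>2) + 2 * S"
    by (simp add: S_def sum.distrib sum_distrib_left)
  also have "\<dots> \<le> 2 * (mesh_size N x ^ (2 * (k + 1)) * \<beta>) + 2 * S"
    using est(2) by simp
  finally have "\<nu> * (norm_h N x (\<lambda>y. w1 y - discrete_weak_deriv N x (k + 1) uh y))\<^sup>2
    \<le> \<nu> * (2 * (mesh_size N x ^ (2 * (k + 1)) * \<beta>) + 2 * S)"
    using \<nu> by (intro mult_left_mono) auto
  also have "\<dots> = 2 * \<nu> * mesh_size N x ^ (2 * (k + 1)) * \<beta> + 2 * (\<nu> * S)" by (simp add: algebra_simps)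
  also have "\<dots> \<le> 2 * \<nu> * mesh_size N x ^ (2 * (k + 1)) * \<beta> + 2 * (bound - 2 * Q)"
  proof -
    have "\<nu> * S \<le> bound - 2 * Q" using 1 by (simp only: le_diff_eq add.commute)
    then show ?thesis by simp
  qed
  finally show "\<nu> * (norm_h N x (\<lambda>y. w1 y - discrete_weak_deriv N x (k + 1) uh y))\<^sup>2
      \<le> 2 * \<nu> * mesh_size N x ^ (2 * (k + 1)) * \<beta> + 2 * (bound - 2 * Q)" .
qed

lemma proj_cong:
  assumes "\<And>y. a < y \<Longrightarrow> y < b \<Longrightarrow> f y = g y"
  shows "proj a b m f = proj a b m g"
proof -
  have "(LINT y|Leb a b. f y * poly q y) = (LINT y|Leb a b. g y * poly q y)" for q
    by (rule Bochner_Integration.integral_cong) (use assms in auto)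
  then show ?thesis by (simp add: proj_def)
qed

text \<open>Here \<open>\<Lambda>\<close> is the time integral of the Gronwall coefficient and \<open>c\<close> comes from the consistency error.\<close>

definition error_amplification :: "real \<Rightarrow> real \<Rightarrow> real \<Rightarrow> real \<Rightarrow> real \<Rightarrow> real" where
  "error_amplification C M \<nu> T B =
    (let c = 2 * ((2 / \<nu> + C * M\<^sup>2 + C * M\<^sup>2 / \<nu> + 1) * (2 * \<nu>\<^sup>2 + 4));
         \<Lambda> = 2 * (C * M\<^sup>2 / \<nu> + 1) * T + 8 * C * B
     in c * exp \<Lambda> * (4 + 2 * \<Lambda>) + 2 * \<nu> + 2 * c)"

text \<open>Stated for abstract \<open>v\<close>, \<open>\<beta>\<close> and \<open>\<zeta>\<close>
  because it is applied twice: to the actual derivative and norms, and to a vanishing solution with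
  all three equal to 0. The number \<open>\<zeta>\<close> carries the projection error at the single
  time t, the other term the error accumulated up to then.\<close>

lemma semidiscrete_error:
  fixes u v :: "real \<Rightarrow> real \<Rightarrow> real" and \<beta> :: "real \<Rightarrow> real"
  assumes P: "is_partition N x" and sol: "semidiscrete_solution N x k (k + 1) \<nu> T g uh"
    and \<nu>: "\<nu> > 0" and T: "T > 0"
    and u: "continuous_on ({0..T} \<times> {0..1}) (\<lambda>(t, y). u t y)"
      "\<And>t y. t \<in> {0..T} \<Longrightarrow> y \<in> {0..1} \<Longrightarrow> \<bar>u t y\<bar> \<le> M"
      "\<And>t. t \<in> {0<..T} \<Longrightarrow> u t 0 = 0 \<and> u t 1 = 0" "\<And>y. y \<in> unit_I \<Longrightarrow> u 0 y = g y"
    and v: "\<And>z B. z \<in> borel_measurable (Leb 0 1) \<Longrightarrow> AE y in Leb 0 1. \<bar>z y\<bar> \<le> B \<Longrightarrow> B > 0 \<Longrightarrow>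
      primitive_on 0 T (\<lambda>t. LINT y|Leb 0 1. u t y * z y) (\<lambda>t. LINT y|Leb 0 1. v t y * z y)"
    and \<beta>: "integrable (Leb 0 T) \<beta>" "\<And>t. 0 \<le> \<beta> t"
    and data: "AE t in Leb 0 T. \<exists>W Z. sobolev_chain (k + 2) W \<and> sobolev_chain k Z \<and>
      (AE y in Leb 0 1. u t y = W 0 y) \<and> (AE y in Leb 0 1. v t y = Z 0 y) \<and> sq_integrable 0 1 (v t) \<and>
      (AE y in Leb 0 1. weak_deriv 1 (u t) y = W 1 y) \<and> sq_integrable 0 1 (weak_deriv 1 (u t)) \<and>
      (AE y in Leb 0 1. Z 0 y + u t y * W 1 y - \<nu> * W 2 y = 0) \<and>
      (\<forall>j\<le>k + 2. (LINT y|Leb 0 1. (W j y)\<^sup>2) \<le> \<beta> t) \<and> (\<forall>j\<le>k. (LINT y|Leb 0 1. (Z j y)\<^sup>2) \<le> \<beta> t)"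
    and \<zeta>: "\<And>t. t \<in> {0<..T} \<Longrightarrow>
      (\<Sum>i\<in>{1..<N}. LINT y|Leb (x i) (x (Suc i)). (u t y - poly (proj (x i) (x (Suc i)) k (u t)) y)\<^sup>2)
        \<le> \<zeta> * mesh_size N x ^ (2 * (k + 1))"
    and C: "\<forall>a b p. a < b \<longrightarrow> degree p \<le> k + 1 \<longrightarrow>
       (\<forall>y\<in>{a..b}. (b - a) * (poly p y)\<^sup>2 \<le> C * (LINT y|Leb a b. (poly p y)\<^sup>2))" "C \<ge> 1"
    and t: "t \<in> {0<..T}"
  shows "(norm_h N x (\<lambda>y. u t y - interior_part (uh t) y))\<^sup>2
        + \<nu> * (LINT s|Leb 0 t. (norm_h N x (\<lambda>y. weak_deriv 1 (u s) y - discrete_weak_deriv N x (k + 1) (uh s) y))\<^sup>2)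
      \<le> mesh_size N x ^ (2 * (k + 1)) * (2 * \<zeta> + error_amplification C M \<nu> T (LINT t|Leb 0 T. \<beta> t) * (LINT t|Leb 0 T. \<beta> t))"
proof -
  define h where "h = mesh_size N x ^ (2 * (k + 1))"
  define B where "B = (LINT t|Leb 0 T. \<beta> t)"
  define c1 where "c1 = C * M\<^sup>2 / \<nu> + 1"
  define c where "c = 2 * ((2 / \<nu> + C * M\<^sup>2 + C * M\<^sup>2 / \<nu> + 1) * (2 * \<nu>\<^sup>2 + 4))"
  \<comment> \<open>The Gronwall coefficient contains \<open>\<beta>\<close> through the maximum
    bound on u_x, so it is merely integrable in time.\<close>
  define A where "A s = 2 * (c1 + C * (4 * \<beta> s))" for s
  define \<Lambda> where "\<Lambda> = 2 * c1 * T + 8 * C * B"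
  define E0 where "E0 = c * B * exp \<Lambda>"
  define X where "X s = (norm_h N x (\<lambda>y. weak_deriv 1 (u s) y - discrete_weak_deriv N x (k + 1) (uh s) y))\<^sup>2" for s
  have h0: "0 \<le> h" using mesh_size_pos[OF P] by (simp add: h_def)
  have B0: "0 \<le> B" unfolding B_def using \<beta>(2) by simp
  have c10: "0 \<le> c1" unfolding c1_def using C(2) \<nu> by (intro add_nonneg_nonneg) auto
  have c0: "0 \<le> c" unfolding c_def using C(2) \<nu> by (intro mult_nonneg_nonneg add_nonneg_nonneg) auto
  have A0: "0 \<le> A s" for s unfolding A_def using C(2) \<beta>(2)[of s] c10 by simp
  have \<Lambda>0: "0 \<le> \<Lambda>" unfolding \<Lambda>_def using c10 T C(2) B0 by simp
  have E00: "0 \<le> E0" unfolding E0_def using c0 B0 by simp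
  have intA: "integrable (Leb 0 T) A" unfolding A_def[abs_def] using \<beta>(1) by simp
  have A\<Lambda>: "(LINT s|Leb 0 T. A s) = \<Lambda>"
    unfolding A_def[abs_def] \<Lambda>_def B_def using \<beta>(1) T measure_Leb[of 0 T] by (simp add: algebra_simps)
  note el = partition_elem_subset[OF P]
  have slice: "continuous_on {0..1} (u s)" if "s \<in> {0..T}" for s
    using joint_continuous_slice[OF u(1) that] .
  have ui: "integrable (Leb (x i) (x (Suc i))) (u s)" if "i \<in> {1..<N}" "s \<in> {0..T}" for i s
    using continuous_imp_Leb_integrable[OF slice[OF that(2)]] el(4)[OF that(1)] by (rule Leb_integrable_subset)

  \<comment> \<open>Polynomial pieces of the discrete solution\<close>
  have uh0: "uh s \<in> weak_space0 N x k" if "s \<in> {0..T}" for s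
    using sol that by (simp add: semidiscrete_solution_def)
  have "\<exists>up. \<forall>i\<in>{1..<N}. \<forall>s\<in>{0..T}. degree (up i s) \<le> k \<and> (\<forall>y\<in>elem x i. interior_part (uh s) y = poly (up i s) y)"
  proof -
    have "\<forall>i s. \<exists>p. i \<in> {1..<N} \<longrightarrow> s \<in> {0..T} \<longrightarrow> degree p \<le> k \<and> (\<forall>y\<in>elem x i. interior_part (uh s) y = poly p y)"
      using uh0 by (auto simp: weak_space0_def weak_space_def)
    then show ?thesis by metis
  qed
  then obtain up where up: "\<And>i s. i \<in> {1..<N} \<Longrightarrow> s \<in> {0..T} \<Longrightarrow> degree (up i s) \<le> k"
    "\<And>i s y. i \<in> {1..<N} \<Longrightarrow> s \<in> {0..T} \<Longrightarrow> y \<in> elem x i \<Longrightarrow> interior_part (uh s) y = poly (up i s) y"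
    by blast
  have Rex: "\<exists>R. (\<forall>s\<in>{0<..T}. \<forall>y\<in>{x i<..<x (Suc i)}. time_deriv T (\<lambda>s. interior_part (uh s)) s y = poly (R s) y) \<and>
    (\<forall>q. continuous_on {0..T} (\<lambda>s. LINT y|Leb (x i) (x (Suc i)). poly (up i s) y * poly q y)) \<and>
    (\<forall>q \<delta>. 0 < \<delta> \<longrightarrow> \<delta> \<le> T \<longrightarrow> primitive_on \<delta> T (\<lambda>s. LINT y|Leb (x i) (x (Suc i)). poly (up i s) y * poly q y)
      (\<lambda>s. LINT y|Leb (x i) (x (Suc i)). poly (R s) y * poly q y))" if i: "i \<in> {1..<N}" for i
  proof (rule time_regular_poly[OF el(2)[OF i] up(1)[OF i] up(2)[OF i]])
    show "continuous_on {0..T} (\<lambda>t. interior_part (uh t) y) \<and> (\<lambda>t. interior_part (uh t) y) differentiable_on {0<..T} \<and>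
      continuous_on {0<..T} (\<lambda>t. time_deriv T (\<lambda>s. interior_part (uh s)) t y)" if "y \<in> {x i<..<x (Suc i)}" for y
      using sol i that unfolding semidiscrete_solution_def time_regular_def by auto
  qed auto
  have "\<exists>R. \<forall>i\<in>{1..<N}. (\<forall>s\<in>{0<..T}. \<forall>y\<in>{x i<..<x (Suc i)}. time_deriv T (\<lambda>s. interior_part (uh s)) s y = poly (R i s) y) \<and>
    (\<forall>q. continuous_on {0..T} (\<lambda>s. LINT y|Leb (x i) (x (Suc i)). poly (up i s) y * poly q y)) \<and>
    (\<forall>q \<delta>. 0 < \<delta> \<longrightarrow> \<delta> \<le> T \<longrightarrow> primitive_on \<delta> T (\<lambda>s. LINT y|Leb (x i) (x (Suc i)). poly (up i s) y * poly q y)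
      (\<lambda>s. LINT y|Leb (x i) (x (Suc i)). poly (R i s) y * poly q y))"
    by (rule bchoice, rule ballI, rule Rex)
  then obtain R where R': "\<forall>i\<in>{1..<N}. (\<forall>s\<in>{0<..T}. \<forall>y\<in>{x i<..<x (Suc i)}. time_deriv T (\<lambda>s. interior_part (uh s)) s y = poly (R i s) y) \<and>
    (\<forall>q. continuous_on {0..T} (\<lambda>s. LINT y|Leb (x i) (x (Suc i)). poly (up i s) y * poly q y)) \<and>
    (\<forall>q \<delta>. 0 < \<delta> \<longrightarrow> \<delta> \<le> T \<longrightarrow> primitive_on \<delta> T (\<lambda>s. LINT y|Leb (x i) (x (Suc i)). poly (up i s) y * poly q y)
      (\<lambda>s. LINT y|Leb (x i) (x (Suc i)). poly (R i s) y * poly q y))" ..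
  have R: "\<And>i s y. i \<in> {1..<N} \<Longrightarrow> s \<in> {0<..T} \<Longrightarrow> y \<in> elem x i \<Longrightarrow>
        time_deriv T (\<lambda>s. interior_part (uh s)) s y = poly (R i s) y"
    "\<And>i q. i \<in> {1..<N} \<Longrightarrow> continuous_on {0..T} (\<lambda>s. LINT y|Leb (x i) (x (Suc i)). poly (up i s) y * poly q y)"
    "\<And>i q \<delta>. i \<in> {1..<N} \<Longrightarrow> 0 < \<delta> \<Longrightarrow> \<delta> \<le> T \<Longrightarrow> primitive_on \<delta> T (\<lambda>s. LINT y|Leb (x i) (x (Suc i)). poly (up i s) y * poly q y)
      (\<lambda>s. LINT y|Leb (x i) (x (Suc i)). poly (R i s) y * poly q y)"
    using R' unfolding Suc_eq_plus1[symmetric] by blast+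

  \<comment> \<open>The projected error\<close>
  define e where "e s i = proj (x i) (x (Suc i)) k (u s) - up i s" for s i
  define E where "E s = (\<Sum>i\<in>{1..<N}. LINT y|Leb (x i) (x (Suc i)). (poly (e s i) y)\<^sup>2)" for s
  have E_nonneg: "0 \<le> E s" for s unfolding E_def by (intro sum_nonneg) simp
  have dege: "degree (e s i) \<le> k" if "i \<in> {1..<N}" "s \<in> {0..T}" for s i
    unfolding e_def by (rule degree_diff_le[OF proj(1)[OF el(2)[OF that(1)] ui[OF that]] up(1)[OF that]])
  have e_int: "(LINT y|Leb (x i) (x (Suc i)). poly (e s i) y * poly q y)
      = (LINT y|Leb (x i) (x (Suc i)). u s y * poly q y) - (LINT y|Leb (x i) (x (Suc i)). poly (up i s) y * poly q y)"
    if "i \<in> {1..<N}" "s \<in> {0..T}" "degree q \<le> k" for s i q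
    using proj(2)[OF el(2)[OF that(1)] ui[OF that(1,2)] that(3)] by (simp add: e_def left_diff_distrib)
  have local: "(LINT y|Leb 0 1. f y * (indicat_real (elem x i) y * poly q y)) = (LINT y|Leb (x i) (x (Suc i)). f y * poly q y)"
    if i: "i \<in> {1..<N}" for i q and f :: "real \<Rightarrow> real"
    unfolding Leb_integral_eq set_lebesgue_integral_def
    by (rule Bochner_Integration.integral_cong) (use el(4)[OF i] in \<open>auto simp: indicator_def\<close>)
  have Uprim: "primitive_on 0 T (\<lambda>s. LINT y|Leb (x i) (x (Suc i)). u s y * poly q y)
      (\<lambda>s. LINT y|Leb (x i) (x (Suc i)). v s y * poly q y)" if i: "i \<in> {1..<N}" for i q
  proof -
    have "bounded (poly q ` {0..1})" by (intro compact_imp_bounded compact_continuous_image continuous_intros) auto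
    then obtain b where b: "\<forall>y\<in>{0..1}. \<bar>poly q y\<bar> \<le> b" unfolding bounded_iff by auto
    \<comment> \<open>A polynomial cut off to one element is bounded and measurable but in general
      not continuous, which is why the hypothesis on \<open>v\<close> covers all bounded measurable
      \<open>z\<close>.\<close>
    have "primitive_on 0 T (\<lambda>s. LINT y|Leb 0 1. u s y * (indicat_real (elem x i) y * poly q y))
      (\<lambda>s. LINT y|Leb 0 1. v s y * (indicat_real (elem x i) y * poly q y))"
    proof (rule v[where B = "max 1 b"])
      show "(\<lambda>y. indicat_real (elem x i) y * poly q y) \<in> borel_measurable (Leb 0 1)"
        using borel_measurable_integrable[OF poly_Leb_integrable[of 0 1 q]]
        by (intro borel_measurable_times Leb_measurable_indicator) auto
      show "AE y in Leb 0 1. \<bar>indicat_real (elem x i) y * poly q y\<bar> \<le> max 1 b"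
        using b by (intro AE_LebI) (auto simp: indicator_def le_max_iff_disj)
    qed simp
    then show ?thesis by (simp only: local[OF i])
  qed
  have eprim: "primitive_on \<delta> T (\<lambda>s. LINT y|Leb (x i) (x (Suc i)). poly (e s i) y * poly q y)
        (\<lambda>s. (LINT y|Leb (x i) (x (Suc i)). v s y * poly q y) - (LINT y|Leb (x i) (x (Suc i)). poly (R i s) y * poly q y))"
    if i: "i \<in> {1..<N}" and \<delta>: "0 < \<delta>" "\<delta> \<le> T" and q: "degree q \<le> k" for i \<delta> q
  proof -
    have "primitive_on \<delta> T (\<lambda>s. (LINT y|Leb (x i) (x (Suc i)). u s y * poly q y) + (-1) * (LINT y|Leb (x i) (x (Suc i)). poly (up i s) y * poly q y))
        (\<lambda>s. (LINT y|Leb (x i) (x (Suc i)). v s y * poly q y) + (-1) * (LINT y|Leb (x i) (x (Suc i)). poly (R i s) y * poly q y))"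
      by (intro primitive_on_add primitive_on_cmult R(3) i \<delta> primitive_on_subset[OF Uprim]) (use \<delta> in auto)
    then have *: "primitive_on \<delta> T (\<lambda>s. (LINT y|Leb (x i) (x (Suc i)). u s y * poly q y) - (LINT y|Leb (x i) (x (Suc i)). poly (up i s) y * poly q y))
        (\<lambda>s. (LINT y|Leb (x i) (x (Suc i)). v s y * poly q y) - (LINT y|Leb (x i) (x (Suc i)). poly (R i s) y * poly q y))"
      by simp
    show ?thesis
      by (rule primitive_on_cong[OF *]) (use \<delta> e_int[OF i _ q] in auto)
  qed
  have Econt: "continuous_on {0..T} E"
    unfolding E_def[abs_def]
  proof (intro continuous_on_sum continuous_on_poly_square[where k = k])
    fix i and q :: "real poly" assume i: "i \<in> {1..<N}" and q: "degree q \<le> k"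
    have "continuous_on {0..T} (\<lambda>s. (LINT y|Leb (x i) (x (Suc i)). u s y * poly q y) - (LINT y|Leb (x i) (x (Suc i)). poly (up i s) y * poly q y))"
      by (intro continuous_intros R(2) i primitive_on_continuous[OF Uprim[OF i]])
    then show "continuous_on {0..T} (\<lambda>s. LINT y|Leb (x i) (x (Suc i)). poly (e s i) y * poly q y)"
      by (rule continuous_on_eq) (rule e_int[OF i _ q, symmetric])
  qed (use el(2) dege in auto)
  \<comment> \<open>The discrete initial value is the projection of \<open>g\<close>, and
    \<open>g\<close> equals \<open>u 0\<close> inside the unit interval, so the projected error
    starts from 0.\<close>
  have E_0: "E 0 = 0"
    unfolding E_def
  proof (rule sum.neutral, rule ballI)
    fix i assume i: "i \<in> {1..<N}"
    have gi: "integrable (Leb (x i) (x (Suc i))) g"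
    proof -
      have "integrable (Leb (x i) (x (Suc i))) (u 0) \<longleftrightarrow> integrable (Leb (x i) (x (Suc i))) g"
        by (rule Bochner_Integration.integrable_cong[OF refl]) (use u(4) el(4)[OF i] in auto)
      then show ?thesis using ui[OF i, of 0] T by simp
    qed
    have "poly (e 0 i) y = 0" if y: "y \<in> elem x i" for y
    proof -
      have "interior_part (uh 0) y = interior_part (proj_h N x k g) y"
        using sol i y unfolding semidiscrete_solution_def weak_fun_eq_def by blast
      also have "\<dots> = poly (proj (x i) (x (Suc i)) k g) y" by (rule proj_h_interior[OF P i gi y])
      also have "proj (x i) (x (Suc i)) k g = proj (x i) (x (Suc i)) k (u 0)"
        by (rule proj_cong) (use u(4) el(4)[OF i] in auto)
      finally show ?thesis using up(2)[OF i _ y, of 0] T by (simp add: e_def)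
    qed
    then have "(LINT y|Leb (x i) (x (Suc i)). (poly (e 0 i) y)\<^sup>2) = (LINT y|Leb (x i) (x (Suc i)). 0)"
      by (intro Bochner_Integration.integral_cong) auto
    then show "(LINT y|Leb (x i) (x (Suc i)). (poly (e 0 i) y)\<^sup>2) = 0" by simp
  qed

  \<comment> \<open>Differential inequality for the squared error\<close>
  define Q where "Q s = (\<Sum>i\<in>{1..<N}. LINT y|Leb (x i) (x (Suc i)). (v s y - poly (R i s) y) * poly (e s i) y)" for s
  have ineq: "AE s in Leb 0 T. integrable (Leb 0 1) (v s) \<and> 2 * Q s \<le> A s * E s + c * h * \<beta> s \<and>
      \<nu> * X s \<le> 2 * \<nu> * h * \<beta> s + 2 * (A s * E s + c * h * \<beta> s - 2 * Q s)"
  proof -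
    have "AE s in Leb 0 T. s \<in> {0<..<T}" by (rule AE_LebI) simp
    with data show ?thesis
    proof eventually_elim
      case (elim s)
      then obtain W Z where WZ: "sobolev_chain (k + 2) W" "sobolev_chain k Z"
        "AE y in Leb 0 1. u s y = W 0 y" "AE y in Leb 0 1. v s y = Z 0 y" "sq_integrable 0 1 (v s)"
        "AE y in Leb 0 1. weak_deriv 1 (u s) y = W 1 y" "sq_integrable 0 1 (weak_deriv 1 (u s))"
        "AE y in Leb 0 1. Z 0 y + u s y * W 1 y - \<nu> * W 2 y = 0"
        "\<And>j. j \<le> k + 2 \<Longrightarrow> (LINT y|Leb 0 1. (W j y)\<^sup>2) \<le> \<beta> s" "\<And>j. j \<le> k \<Longrightarrow> (LINT y|Leb 0 1. (Z j y)\<^sup>2) \<le> \<beta> s"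
        by blast
      have s: "s \<in> {0..T}" "s \<in> {0<..T}" using elim by auto
      have bd: "u s 0 = 0" "u s 1 = 0" using u(3)[OF s(2)] by auto
      have eqh: "inner_h N x (time_deriv T (\<lambda>s. interior_part (uh s)) s) (interior_part w)
        + \<nu> * inner_h N x (discrete_weak_deriv N x (k + 1) (uh s)) (discrete_weak_deriv N x (k + 1) w)
        + 1 / 3 * inner_h N x (\<lambda>y. interior_part (uh s) y * discrete_weak_deriv N x (k + 1) (uh s) y) (interior_part w)
        - 1 / 3 * inner_h N x (\<lambda>y. interior_part (uh s) y * interior_part (uh s) y) (discrete_weak_deriv N x (k + 1) w) = 0"
        if "w \<in> weak_space0 N x k" for w
        using sol s(2) that unfolding semidiscrete_solution_def by blast
      have bnd: "A s * E s + c * h * \<beta> s = 2 * (C * M\<^sup>2 / \<nu> + 1 + C * (4 * \<beta> s)) * (\<Sum>i\<in>{1..<N}. LINT y|Leb (x i) (x (Suc i)). (poly (e s i) y)\<^sup>2)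
      + 2 * ((2 / \<nu> + C * M\<^sup>2 + C * M\<^sup>2 / \<nu> + 1) * (2 * \<nu>\<^sup>2 + 4) * mesh_size N x ^ (2 * (k + 1)) * \<beta> s)"
        by (simp add: A_def c1_def c_def h_def E_def)
      note main = error_inequality_at_time[OF P \<nu> WZ(1,2) slice[OF s(1)] WZ(3) bd u(2)[OF s(1)] WZ(8,9,10) C WZ(4-7)
          uh0[OF s(1)] up(2)[OF _ s(1)] up(1)[OF _ s(1)] R(1)[OF _ s(2)] eqh e_def Q_def bnd]
      show ?case
        using main sq_integrable_imp_integrable[OF WZ(5)] by (simp add: X_def h_def)
    qed
  qed
  have D: "\<exists>D. primitive_on \<delta> T E D \<and> (AE s in Leb \<delta> T. D s = 2 * Q s)" if \<delta>: "0 < \<delta>" "\<delta> \<le> T" for \<delta>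
  proof -
    have "\<exists>D. \<forall>i\<in>{1..<N}. primitive_on \<delta> T (\<lambda>s. LINT y|Leb (x i) (x (Suc i)). (poly (e s i) y)\<^sup>2) (D i) \<and>
      (\<forall>s. \<delta> \<le> s \<longrightarrow> s \<le> T \<longrightarrow> integrable (Leb (x i) (x (Suc i))) (v s) \<longrightarrow>
        D i s = 2 * (LINT y|Leb (x i) (x (Suc i)). (v s y - poly (R i s) y) * poly (e s i) y))"
    proof (rule bchoice, rule ballI)
      fix i assume i: "i \<in> {1..<N}"
      show "\<exists>D. primitive_on \<delta> T (\<lambda>s. LINT y|Leb (x i) (x (Suc i)). (poly (e s i) y)\<^sup>2) D \<and>
        (\<forall>s. \<delta> \<le> s \<longrightarrow> s \<le> T \<longrightarrow> integrable (Leb (x i) (x (Suc i))) (v s) \<longrightarrow>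
        D s = 2 * (LINT y|Leb (x i) (x (Suc i)). (v s y - poly (R i s) y) * poly (e s i) y))"
        by (rule primitive_on_poly_square[OF el(2)[OF i] \<delta>(2), of _ k])
           (use dege[OF i] \<delta> eprim[OF i \<delta>] in auto)
    qed
    then obtain D where D: "\<And>i. i \<in> {1..<N} \<Longrightarrow> primitive_on \<delta> T (\<lambda>s. LINT y|Leb (x i) (x (Suc i)). (poly (e s i) y)\<^sup>2) (D i)"
      "\<And>i s. i \<in> {1..<N} \<Longrightarrow> \<delta> \<le> s \<Longrightarrow> s \<le> T \<Longrightarrow> integrable (Leb (x i) (x (Suc i))) (v s) \<Longrightarrow>
        D i s = 2 * (LINT y|Leb (x i) (x (Suc i)). (v s y - poly (R i s) y) * poly (e s i) y)" by blast
    have "primitive_on \<delta> T E (\<lambda>s. \<Sum>i\<in>{1..<N}. D i s)"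
      unfolding E_def[abs_def] by (rule primitive_on_sum[OF \<delta>(2) D(1)])
    moreover have "AE s in Leb \<delta> T. (\<Sum>i\<in>{1..<N}. D i s) = 2 * Q s"
    proof -
      have "AE s in Leb \<delta> T. s \<in> {\<delta><..<T}" by (rule AE_LebI) simp
      moreover have "{\<delta><..<T} \<subseteq> {0<..<T}" using \<delta> by auto
      note AE_Leb_subset[OF ineq this]
      ultimately show ?thesis
      proof eventually_elim
        case (elim s)
        have "integrable (Leb (x i) (x (Suc i))) (v s)" if "i \<in> {1..<N}" for i
          using elim(2) Leb_integrable_subset[OF _ el(4)[OF that]] by blast
        then show ?case using D(2) elim(1) by (auto simp: Q_def sum_distrib_left intro!: sum.cong)
      qed
    qed
    ultimately show ?thesis by blast
  qed

  \<comment> \<open>\<open>2 * Q'\<close> is a density of \<open>E\<close> on [\<delta>, T], while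
    \<open>2 * Q\<close> is known to agree with it only almost everywhere; integrals are formed with
    \<open>Q'\<close> and inequalities are imported from \<open>Q\<close>.\<close>
  have diss: "integrable (Leb \<delta> \<tau>) (\<lambda>s. A s * E s) \<and> integrable (Leb \<delta> \<tau>) \<beta> \<and> integrable (Leb \<delta> \<tau>) (\<lambda>s. 2 * Q' s) \<and>
      E \<tau> - E \<delta> = (LINT s|Leb \<delta> \<tau>. 2 * Q' s) \<and> (AE s in Leb \<delta> \<tau>. 2 * Q' s = 2 * Q s) \<and>
      (LINT s|Leb \<delta> \<tau>. \<beta> s) \<le> B"
    if "0 < \<delta>" "\<delta> \<le> \<tau>" "\<tau> \<le> T" "primitive_on \<delta> T E (\<lambda>s. 2 * Q' s)" "AE s in Leb \<delta> T. 2 * Q' s = 2 * Q s" for \<delta> \<tau> Q'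
  proof -
    have sub: "{\<delta><..<\<tau>} \<subseteq> {0<..<T}" "{\<delta><..<\<tau>} \<subseteq> {\<delta><..<T}" using that by auto
    have ib: "integrable (Leb \<delta> \<tau>) \<beta>" by (rule Leb_integrable_subset[OF \<beta>(1) sub(1)])
    moreover have "integrable (Leb \<delta> \<tau>) (\<lambda>s. A s * E s)"
      by (rule Leb_integrable_mult_continuous[OF Leb_integrable_subset[OF intA sub(1)] continuous_on_subset[OF Econt]])
         (use that in auto)
    moreover have "integrable (Leb \<delta> \<tau>) (\<lambda>s. 2 * Q' s)"
      by (rule Leb_integrable_subset[OF primitive_onD(2)[OF that(4)] sub(2)])
    moreover have "E \<tau> - E \<delta> = (LINT s|Leb \<delta> \<tau>. 2 * Q' s)"
      by (rule primitive_on_diff[OF that(4)]) (use that in auto)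
    moreover have "(LINT s|Leb \<delta> \<tau>. \<beta> s) \<le> B"
    proof -
      have "B = (LINT s|Leb 0 \<delta>. \<beta> s) + (LINT s|Leb \<delta> T. \<beta> s)"
        unfolding B_def by (rule Leb_integral_split[OF \<beta>(1)]) (use that in auto)
      also have "(LINT s|Leb \<delta> T. \<beta> s) = (LINT s|Leb \<delta> \<tau>. \<beta> s) + (LINT s|Leb \<tau> T. \<beta> s)"
        by (rule Leb_integral_split[OF Leb_integrable_subset[OF \<beta>(1)]]) (use that in auto)
      finally show ?thesis using \<beta>(2) integral_nonneg_AE[of \<beta> "Leb 0 \<delta>"] integral_nonneg_AE[of \<beta> "Leb \<tau> T"] by simp
    qed
    moreover have "AE s in Leb \<delta> \<tau>. 2 * Q' s = 2 * Q s" by (rule AE_Leb_subset[OF that(5) sub(2)])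
    ultimately show ?thesis by blast
  qed
  have Dex: "\<exists>Q'. primitive_on \<delta> T E (\<lambda>s. 2 * Q' s) \<and> (AE s in Leb \<delta> T. 2 * Q' s = 2 * Q s)" if \<delta>: "0 < \<delta>" "\<delta> \<le> T" for \<delta>
  proof -
    obtain D where "primitive_on \<delta> T E D" "AE s in Leb \<delta> T. D s = 2 * Q s" using D[OF \<delta>] by blast
    then show ?thesis by (intro exI[of _ "\<lambda>s. D s / 2"]) simp
  qed

  \<comment> \<open>Gronwall's inequality and the limit to time 0\<close>
  have gron: "E \<tau> \<le> (E \<delta> + c * h * B) * exp \<Lambda>" if \<delta>: "0 < \<delta>" "\<delta> \<le> \<tau>" "\<tau> \<le> T" for \<delta> \<tau>
  proof -
    obtain Q' where Q': "primitive_on \<delta> T E (\<lambda>s. 2 * Q' s)" "AE s in Leb \<delta> T. 2 * Q' s = 2 * Q s"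
      using Dex[of \<delta>] \<delta> by auto
    have "E \<tau> \<le> (E \<delta> + c * h * B) * exp (LINT s|Leb \<delta> T. A s)"
    proof (rule Gronwall[OF Leb_integrable_subset[OF intA] A0 continuous_on_subset[OF Econt] _ _ \<delta>(2,3)])
      show "0 \<le> E \<delta> + c * h * B" using E_nonneg c0 h0 B0 by simp
      fix t assume t: "\<delta> \<le> t" "t \<le> T"
      note d = diss[OF \<delta>(1) t Q']
      have "(LINT s|Leb \<delta> t. 2 * Q' s) \<le> (LINT s|Leb \<delta> t. A s * E s + c * h * \<beta> s)"
      proof (rule integral_mono_AE)
        have sub: "{\<delta><..<t} \<subseteq> {0<..<T}" using \<delta> t by auto
        have "AE s in Leb \<delta> t. 2 * Q' s = 2 * Q s" using d by blast
        with AE_Leb_subset[OF ineq sub] show "AE s in Leb \<delta> t. 2 * Q' s \<le> A s * E s + c * h * \<beta> s"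
          by eventually_elim simp
      qed (use d in auto)
      also have "\<dots> = (LINT s|Leb \<delta> t. A s * E s) + c * h * (LINT s|Leb \<delta> t. \<beta> s)"
        using d by simp
      also have "\<dots> \<le> (LINT s|Leb \<delta> t. A s * E s) + c * h * B"
        using d c0 h0 by (intro add_left_mono mult_left_mono) auto
      finally show "E t \<le> E \<delta> + c * h * B + (LINT s|Leb \<delta> t. A s * E s)" using d by simp
    qed (use \<delta> in auto)
    also have "\<dots> \<le> (E \<delta> + c * h * B) * exp \<Lambda>"
    proof (rule mult_left_mono)
      have "\<Lambda> = (LINT s|Leb 0 \<delta>. A s) + (LINT s|Leb \<delta> T. A s)"
        unfolding A\<Lambda>[symmetric] by (rule Leb_integral_split[OF intA]) (use \<delta> in auto)
      then show "exp (LINT s|Leb \<delta> T. A s) \<le> exp \<Lambda>" using integral_nonneg_AE[of A "Leb 0 \<delta>"] A0 by simp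
    qed (use E_nonneg c0 h0 B0 in simp)
    finally show ?thesis .
  qed
  have at0: "(f \<longlongrightarrow> f 0) (at_right 0)" if "continuous_on {0..t} f" for f :: "real \<Rightarrow> real"
  proof -
    have "(f \<longlongrightarrow> f 0) (at 0 within {0..t})" using that t by (auto simp: continuous_on_def)
    then show ?thesis using t by (simp add: at_within_Icc_at_right)
  qed
  \<comment> \<open>The energy argument works away from time 0 only; since \<open>E\<close> is
    continuous at 0 with value 0, letting \<open>\<delta>\<close> tend to 0 removes the initial
    term.\<close>
  have Ebound: "E \<tau> \<le> h * E0" if \<tau>: "0 < \<tau>" "\<tau> \<le> T" for \<tau>
  proof (rule tendsto_lowerbound)
    have "(E \<longlongrightarrow> E 0) (at_right 0)"
      by (rule at0) (rule continuous_on_subset[OF Econt], use t in auto)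
    then have "((\<lambda>\<delta>. (E \<delta> + c * h * B) * exp \<Lambda>) \<longlongrightarrow> (0 + c * h * B) * exp \<Lambda>) (at_right 0)"
      unfolding E_0 by (intro tendsto_intros)
    then show "((\<lambda>\<delta>. (E \<delta> + c * h * B) * exp \<Lambda>) \<longlongrightarrow> h * E0) (at_right 0)"
      by (simp add: E0_def mult_ac)
    have "eventually (\<lambda>\<delta>. \<delta> \<in> {0<..<\<tau>}) (at_right (0::real))"
      by (rule eventually_at_right_real[OF \<tau>(1)])
    then show "eventually (\<lambda>\<delta>. E \<tau> \<le> (E \<delta> + c * h * B) * exp \<Lambda>) (at_right 0)"
      by eventually_elim (use gron \<tau> in auto)
  qed simp
  have Ebound': "E \<tau> \<le> h * E0" if "0 \<le> \<tau>" "\<tau> \<le> T" for \<tau>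
    using Ebound[of \<tau>] that E_0 E00 h0 by (cases "\<tau> = 0") auto

  \<comment> \<open>The three parts stem from the consistency error, from the Gronwall term with
    \<open>E\<close> at most \<open>h * E0\<close>, and from the integral of \<open>2 * Q'\<close>,
    which is a difference of two values of \<open>E\<close>.\<close>
  define KX where "KX = h * ((2 * \<nu> + 2 * c) * B + 2 * \<Lambda> * E0 + 2 * E0)"
  have KX0: "0 \<le> KX" unfolding KX_def using h0 \<nu> c0 B0 \<Lambda>0 E00 by simp
  have X\<delta>: "\<nu> * (LINT s|Leb \<delta> t. X s) \<le> KX" if X: "integrable (Leb 0 t) X" and \<delta>: "0 < \<delta>" "\<delta> < t" for \<delta>
  proof -
    have \<delta>': "\<delta> \<le> t" "t \<le> T" "\<delta> \<le> T" using \<delta> t by auto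
    obtain Q' where Q': "primitive_on \<delta> T E (\<lambda>s. 2 * Q' s)" "AE s in Leb \<delta> T. 2 * Q' s = 2 * Q s"
      using Dex[OF \<delta>(1) \<delta>'(3)] by blast
    note d = diss[OF \<delta>(1) \<delta>'(1,2) Q']
    have sub: "{\<delta><..<t} \<subseteq> {0<..<T}" "{\<delta><..<t} \<subseteq> {0<..<t}" using \<delta> t by auto
    have AEbound: "(LINT s|Leb \<delta> t. A s * E s) \<le> \<Lambda> * (h * E0)"
    proof -
      have "(LINT s|Leb \<delta> t. A s * E s) \<le> (LINT s|Leb \<delta> t. A s * (h * E0))"
        by (rule integral_mono_AE)
           (use d Leb_integrable_subset[OF intA sub(1)] A0 Ebound' \<delta> t in \<open>auto intro!: AE_LebI mult_left_mono\<close>)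
      also have "\<dots> = (LINT s|Leb \<delta> t. A s) * (h * E0)" by simp
      also have "\<dots> \<le> \<Lambda> * (h * E0)"
      proof (rule mult_right_mono)
        have "\<Lambda> = (LINT s|Leb 0 \<delta>. A s) + (LINT s|Leb \<delta> T. A s)"
          unfolding A\<Lambda>[symmetric] by (rule Leb_integral_split[OF intA]) (use \<delta> \<delta>' in auto)
        also have "(LINT s|Leb \<delta> T. A s) = (LINT s|Leb \<delta> t. A s) + (LINT s|Leb t T. A s)"
          by (rule Leb_integral_split[OF Leb_integrable_subset[OF intA]]) (use \<delta> \<delta>' in auto)
        finally show "(LINT s|Leb \<delta> t. A s) \<le> \<Lambda>"
          using integral_nonneg_AE[of A "Leb 0 \<delta>"] integral_nonneg_AE[of A "Leb t T"] A0 by simp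
      qed (use h0 E00 in simp)
      finally show ?thesis .
    qed
    have "\<nu> * (LINT s|Leb \<delta> t. X s) = (LINT s|Leb \<delta> t. \<nu> * X s)" by simp
    also have "\<dots> \<le> (LINT s|Leb \<delta> t. 2 * \<nu> * h * \<beta> s + 2 * (A s * E s + c * h * \<beta> s - 2 * Q' s))"
    proof (rule integral_mono_AE)
      show "integrable (Leb \<delta> t) (\<lambda>s. \<nu> * X s)" using Leb_integrable_subset[OF X sub(2)] by simp
      have "AE s in Leb \<delta> t. 2 * Q' s = 2 * Q s" using d by blast
      with AE_Leb_subset[OF ineq sub(1)]
      show "AE s in Leb \<delta> t. \<nu> * X s \<le> 2 * \<nu> * h * \<beta> s + 2 * (A s * E s + c * h * \<beta> s - 2 * Q' s)"
        by eventually_elim simp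
    qed (use d in auto)
    also have "\<dots> = (2 * \<nu> + 2 * c) * h * (LINT s|Leb \<delta> t. \<beta> s) + 2 * (LINT s|Leb \<delta> t. A s * E s) - 2 * (LINT s|Leb \<delta> t. 2 * Q' s)"
    proof -
      have "integrable (Leb \<delta> t) (\<lambda>s. A s * E s)" "integrable (Leb \<delta> t) \<beta>" "integrable (Leb \<delta> t) (\<lambda>s. 2 * Q' s)"
        using d by blast+
      then have "(LINT s|Leb \<delta> t. 2 * \<nu> * h * \<beta> s + 2 * (A s * E s + c * h * \<beta> s - 2 * Q' s))
          = 2 * \<nu> * h * (LINT s|Leb \<delta> t. \<beta> s) + 2 * ((LINT s|Leb \<delta> t. A s * E s) + c * h * (LINT s|Leb \<delta> t. \<beta> s)
            - (LINT s|Leb \<delta> t. 2 * Q' s))"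
        by simp
      then show ?thesis by (simp add: algebra_simps)
    qed
    also have "\<dots> \<le> (2 * \<nu> + 2 * c) * h * B + 2 * (\<Lambda> * (h * E0)) - 2 * (E t - E \<delta>)"
    proof -
      have "(2 * \<nu> + 2 * c) * h * (LINT s|Leb \<delta> t. \<beta> s) \<le> (2 * \<nu> + 2 * c) * h * B"
        using d \<nu> c0 h0 by (intro mult_left_mono) auto
      then show ?thesis using AEbound d by simp
    qed
    also have "\<dots> \<le> (2 * \<nu> + 2 * c) * h * B + 2 * (\<Lambda> * (h * E0)) + 2 * (h * E0)"
      using E_nonneg[of t] Ebound'[of \<delta>] \<delta> \<delta>' by simp
    also have "\<dots> = KX" by (simp add: KX_def algebra_simps)
    finally show ?thesis .
  qed
  have Xbound: "\<nu> * (LINT s|Leb 0 t. X s) \<le> KX"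
  \<comment> \<open>A function that is not integrable has Bochner integral 0, for which the bound is
    trivial; otherwise the lower limit of integration tends to 0.\<close>
  proof (cases "integrable (Leb 0 t) X")
    case False
    then show ?thesis using KX0 by (simp add: not_integrable_integral_eq)
  next
    case True
    have t0: "0 \<le> t" using t by simp
    define F where "F s = 0 + (LINT s|Leb 0 s. X s)" for s
    have F: "primitive_on 0 t F X" unfolding F_def[abs_def] by (rule primitive_on_exists[OF True t0])
    have "(F \<longlongrightarrow> F 0) (at_right 0)" by (rule at0[OF primitive_on_continuous[OF F]])
    then have "((\<lambda>\<delta>. \<nu> * (F t - F \<delta>)) \<longlongrightarrow> \<nu> * (F t - F 0)) (at_right 0)" by (intro tendsto_intros)
    moreover have "eventually (\<lambda>\<delta>. \<nu> * (F t - F \<delta>) \<le> KX) (at_right 0)"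
    proof -
      have "eventually (\<lambda>\<delta>. \<delta> \<in> {0<..<t}) (at_right (0::real))"
        by (rule eventually_at_right_real) (use t in simp)
      then show ?thesis
      proof eventually_elim
        case (elim \<delta>)
        then show ?case using X\<delta>[OF True, of \<delta>] primitive_on_diff[OF F, of \<delta> t] by simp
      qed
    qed
    ultimately have "\<nu> * (F t - F 0) \<le> KX" by (rule tendsto_upperbound) simp
    then show ?thesis by (simp add: F_def Leb_integral_empty)
  qed

  \<comment> \<open>L2 error at time t\<close>
  have L2: "(norm_h N x (\<lambda>y. u t y - interior_part (uh t) y))\<^sup>2 \<le> 2 * (\<zeta> * h) + 2 * (h * E0)"
  proof -
    have t': "t \<in> {0..T}" using t by auto
    have "(norm_h N x (\<lambda>y. u t y - interior_part (uh t) y))\<^sup>2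
      \<le> (\<Sum>i\<in>{1..<N}. 2 * (LINT y|Leb (x i) (x (Suc i)). (u t y - poly (proj (x i) (x (Suc i)) k (u t)) y)\<^sup>2)
          + 2 * (LINT y|Leb (x i) (x (Suc i)). (poly (e t i) y)\<^sup>2))"
      unfolding norm_h_squared
    proof (rule sum_mono)
      fix i assume i: "i \<in> {1..<N}"
      define p where "p = proj (x i) (x (Suc i)) k (u t)"
      have sq: "sq_integrable (x i) (x (Suc i)) (u t)"
        by (rule sq_integrable_subset[OF continuous_imp_sq_integrable[OF slice[OF t']] el(4)[OF i]])
      have ints: "integrable (Leb (x i) (x (Suc i))) (\<lambda>y. (u t y - poly p y)\<^sup>2)"
        "integrable (Leb (x i) (x (Suc i))) (\<lambda>y. (poly (e t i) y)\<^sup>2)"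
        using sq_integrable_diff[OF sq poly_sq_integrable, of p] poly_sq_integrable[of _ _ "e t i"]
        unfolding sq_integrable_def by blast+
      have "(LINT y|Leb (x i) (x (Suc i)). (u t y - interior_part (uh t) y)\<^sup>2)
        \<le> (LINT y|Leb (x i) (x (Suc i)). 2 * (u t y - poly p y)\<^sup>2 + 2 * (poly (e t i) y)\<^sup>2)"
      proof (rule integral_mono_AE')
        show "AE y in Leb (x i) (x (Suc i)). (u t y - interior_part (uh t) y)\<^sup>2 \<le> 2 * (u t y - poly p y)\<^sup>2 + 2 * (poly (e t i) y)\<^sup>2"
        proof (rule AE_LebI)
          fix y assume y: "x i < y" "y < x (Suc i)"
          define a b where "a = u t y - poly p y" and "b = poly (e t i) y"
          have "u t y - interior_part (uh t) y = a + b"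
            using up(2)[OF i t', of y] y by (simp add: a_def b_def e_def p_def)
          moreover have "(a + b)\<^sup>2 \<le> 2 * a\<^sup>2 + 2 * b\<^sup>2"
            using zero_le_power2[of "a - b"] unfolding power2_sum power2_diff by linarith
          ultimately have "(u t y - interior_part (uh t) y)\<^sup>2 \<le> 2 * a\<^sup>2 + 2 * b\<^sup>2" by simp
          then show "(u t y - interior_part (uh t) y)\<^sup>2 \<le> 2 * (u t y - poly p y)\<^sup>2 + 2 * (poly (e t i) y)\<^sup>2"
            by (simp only: a_def b_def)
        qed
      qed (use ints in auto)
      then show "(LINT y|Leb (x i) (x (Suc i)). (u t y - interior_part (uh t) y)\<^sup>2)
        \<le> 2 * (LINT y|Leb (x i) (x (Suc i)). (u t y - poly (proj (x i) (x (Suc i)) k (u t)) y)\<^sup>2)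
          + 2 * (LINT y|Leb (x i) (x (Suc i)). (poly (e t i) y)\<^sup>2)"
        unfolding p_def[symmetric] using ints by simp
    qed
    also have "\<dots> = 2 * (\<Sum>i\<in>{1..<N}. LINT y|Leb (x i) (x (Suc i)). (u t y - poly (proj (x i) (x (Suc i)) k (u t)) y)\<^sup>2) + 2 * E t"
      by (simp add: E_def sum.distrib sum_distrib_left)
    also have "\<dots> \<le> 2 * (\<zeta> * h) + 2 * (h * E0)"
      using \<zeta>[OF t] Ebound[of t] t by (simp add: h_def)
    finally show ?thesis .
  qed
  \<comment> \<open>\<open>E0\<close> occurs with the total factor 4 + 2 \<Lambda>: 2 from the L2
    error, 2 + 2 \<Lambda> from \<open>KX\<close>.\<close>
  have "2 * (\<zeta> * h) + 2 * (h * E0) + KX = h * (2 * \<zeta> + error_amplification C M \<nu> T B * B)"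
    unfolding KX_def E0_def error_amplification_def Let_def c_def[symmetric] c1_def[symmetric] \<Lambda>_def[symmetric]
    by (simp add: algebra_simps)
  then show ?thesis
    using L2 Xbound unfolding X_def h_def[symmetric] B_def[symmetric] by linarith
qed

section \<open>Projection error at every time\<close>

lemma sobolev_mono: "f \<in> sobolev m \<Longrightarrow> n \<le> m \<Longrightarrow> f \<in> sobolev n"
  by (auto simp: sobolev_def)

lemma glue_measurable: "glue N x p \<in> borel_measurable (Leb a b)"
proof -
  have "poly q \<in> borel_measurable (Leb a b)" for q :: "real poly"
    by (rule borel_measurable_integrable[OF poly_Leb_integrable])
  then show ?thesis
    unfolding glue_def[abs_def] by (intro borel_measurable_sum borel_measurable_times Leb_measurable_indicator) auto
qed

lemma glue_bounded: "\<exists>M. \<forall>y\<in>{a..b}. \<bar>glue N x p y\<bar> \<le> M"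
proof -
  have "\<exists>M. \<forall>y\<in>{a..b}. \<bar>poly (p i) y\<bar> \<le> M" for i
  proof -
    have "bounded (poly (p i) ` {a..b})" by (intro compact_imp_bounded compact_continuous_image continuous_intros) auto
    then show ?thesis unfolding bounded_iff by auto
  qed
  then obtain M where M: "\<And>i y. y \<in> {a..b} \<Longrightarrow> \<bar>poly (p i) y\<bar> \<le> M i" by metis
  have "\<bar>glue N x p y\<bar> \<le> (\<Sum>i\<in>{1..<N}. M i)" if y: "y \<in> {a..b}" for y
    unfolding glue_def
  proof (rule order.trans[OF sum_abs sum_mono])
    fix i
    show "\<bar>indicator (elem x i) y * poly (p i) y\<bar> \<le> M i"
      using M[OF y, of i] abs_ge_zero[of "poly (p i) y"] by (auto simp: indicator_def)
  qed
  then show ?thesis by blast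
qed

lemma glue_sq_integrable: "sq_integrable 0 1 (glue N x p)"
proof -
  obtain M where "\<forall>y\<in>{0..1}. \<bar>glue N x p y\<bar> \<le> M" using glue_bounded by blast
  then show ?thesis by (intro sq_integrable_bounded[where M = M] glue_measurable AE_LebI) auto
qed

text \<open>As \<open>z\<close> is orthogonal to piecewise polynomials of degree k, \<open>f\<close>
  may be replaced by its local approximation error. The power of the mesh size is thus gained from
  the regularity of \<open>f\<close> alone, \<open>z\<close> being merely square integrable.\<close>

lemma orthogonal_integral_bound:
  assumes P: "is_partition N x" and f: "f \<in> sobolev s" "k + 1 \<le> s" and z: "sq_integrable 0 1 z"
    and orth: "\<And>i q. i \<in> {1..<N} \<Longrightarrow> degree q \<le> k \<Longrightarrow> (LINT y|Leb (x i) (x (Suc i)). z y * poly q y) = 0"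
  shows "\<bar>LINT y|Leb 0 1. f y * z y\<bar>
    \<le> mesh_size N x ^ (k + 1) * sobolev_norm s f * sqrt (LINT y|Leb 0 1. (z y)\<^sup>2)"
proof -
  define h where "h = mesh_size N x"
  note el = partition_elem_subset[OF P]
  have sqf: "sq_integrable 0 1 f" by (rule sobolev_imp_sq_integrable[OF f(1)])
  have f0: "AE y in Leb 0 1. weak_deriv 0 f y = f y" by (rule weak_deriv_AE[OF has_weak_deriv_0[OF sqf]])
  have W: "sobolev_chain (k + 1) (\<lambda>j. weak_deriv j f)"
    by (rule sobolev_imp_chain[OF sobolev_mono[OF f]])
  have sq0: "sq_integrable 0 1 (weak_deriv 0 f)" "sq_integrable 0 1 (weak_deriv (k + 1) f)"
    using W by (auto simp: sobolev_chain_def)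
  have "\<exists>p. \<forall>i\<in>{1..<N}. degree (p i) \<le> k \<and> (LINT y|Leb (x i) (x (Suc i)). (weak_deriv 0 f y - poly (p i) y)\<^sup>2)
      \<le> h ^ (2 * (k + 1)) * (LINT y|Leb (x i) (x (Suc i)). (weak_deriv (k + 1) f y)\<^sup>2)"
  proof (rule bchoice, rule ballI)
    fix i assume i: "i \<in> {1..<N}"
    have le: "x i \<le> x (Suc i)" using el(2)[OF i] by simp
    obtain p where p: "degree p \<le> k" "(LINT y|Leb (x i) (x (Suc i)). (weak_deriv 0 f y - poly p y)\<^sup>2)
      \<le> (x (Suc i) - x i) ^ (2 * (k + 1)) * (LINT y|Leb (x i) (x (Suc i)). (weak_deriv (k + 1) f y)\<^sup>2)"
      using sobolev_chain_poly_approx[OF W el(1)[OF i] le el(3)[OF i], of 0 "k + 1"] by auto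
    have "(x (Suc i) - x i) ^ (2 * (k + 1)) \<le> h ^ (2 * (k + 1))"
      by (rule power_mono) (use mesh_size_ge[OF i, of x] le in \<open>auto simp: h_def\<close>)
    then have "(x (Suc i) - x i) ^ (2 * (k + 1)) * (LINT y|Leb (x i) (x (Suc i)). (weak_deriv (k + 1) f y)\<^sup>2)
      \<le> h ^ (2 * (k + 1)) * (LINT y|Leb (x i) (x (Suc i)). (weak_deriv (k + 1) f y)\<^sup>2)"
      by (rule mult_right_mono) simp
    then show "\<exists>p. degree p \<le> k \<and> (LINT y|Leb (x i) (x (Suc i)). (weak_deriv 0 f y - poly p y)\<^sup>2)
      \<le> h ^ (2 * (k + 1)) * (LINT y|Leb (x i) (x (Suc i)). (weak_deriv (k + 1) f y)\<^sup>2)"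
      using p by (intro exI[of _ p]) linarith
  qed
  then obtain p where p: "\<And>i. i \<in> {1..<N} \<Longrightarrow> degree (p i) \<le> k"
    "\<And>i. i \<in> {1..<N} \<Longrightarrow> (LINT y|Leb (x i) (x (Suc i)). (weak_deriv 0 f y - poly (p i) y)\<^sup>2)
      \<le> h ^ (2 * (k + 1)) * (LINT y|Leb (x i) (x (Suc i)). (weak_deriv (k + 1) f y)\<^sup>2)" by blast
  define q where "q = glue N x p"
  have sqq: "sq_integrable 0 1 q" unfolding q_def by (rule glue_sq_integrable)
  have qe: "q y = poly (p i) y" if "i \<in> {1..<N}" "y \<in> elem x i" for i y
    unfolding q_def by (rule glue_eq[OF P that])
  have "(LINT y|Leb 0 1. q y * z y) = (\<Sum>i\<in>{1..<N}. LINT y|Leb (x i) (x (Suc i)). q y * z y)"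
    by (rule partition_integral[OF P sq_integrable_mult[OF sqq z]])
  also have "\<dots> = 0"
  proof (rule sum.neutral, rule ballI)
    fix i assume i: "i \<in> {1..<N}"
    have "(LINT y|Leb (x i) (x (Suc i)). q y * z y) = (LINT y|Leb (x i) (x (Suc i)). z y * poly (p i) y)"
      by (rule Bochner_Integration.integral_cong) (use qe[OF i] in auto)
    then show "(LINT y|Leb (x i) (x (Suc i)). q y * z y) = 0" using orth[OF i p(1)[OF i]] by simp
  qed
  finally have qz: "(LINT y|Leb 0 1. q y * z y) = 0" .
  define F where "F y = weak_deriv 0 f y - q y" for y
  have sqF: "sq_integrable 0 1 F" unfolding F_def[abs_def] by (rule sq_integrable_diff[OF sq0(1) sqq])
  have "(LINT y|Leb 0 1. f y * z y) = (LINT y|Leb 0 1. weak_deriv 0 f y * z y)"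
  proof (rule integral_cong_AE)
    show "AE y in Leb 0 1. f y * z y = weak_deriv 0 f y * z y" using f0 by eventually_elim simp
  qed (use sq_integrable_mult[OF sqf z] sq_integrable_mult[OF sq0(1) z] in auto)
  also have "\<dots> = (LINT y|Leb 0 1. F y * z y)"
    using qz sq_integrable_mult[OF sq0(1) z] sq_integrable_mult[OF sqq z] by (simp add: F_def left_diff_distrib)
  finally have fz: "(LINT y|Leb 0 1. f y * z y) = (LINT y|Leb 0 1. F y * z y)" .
  have "(LINT y|Leb 0 1. (F y)\<^sup>2) = (\<Sum>i\<in>{1..<N}. LINT y|Leb (x i) (x (Suc i)). (F y)\<^sup>2)"
    using sqF by (intro partition_integral[OF P]) (simp add: sq_integrable_def)
  also have "\<dots> \<le> (\<Sum>i\<in>{1..<N}. h ^ (2 * (k + 1)) * (LINT y|Leb (x i) (x (Suc i)). (weak_deriv (k + 1) f y)\<^sup>2))"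
  proof (rule sum_mono)
    fix i assume i: "i \<in> {1..<N}"
    have "(LINT y|Leb (x i) (x (Suc i)). (F y)\<^sup>2) = (LINT y|Leb (x i) (x (Suc i)). (weak_deriv 0 f y - poly (p i) y)\<^sup>2)"
      by (rule Bochner_Integration.integral_cong) (use qe[OF i] in \<open>auto simp: F_def\<close>)
    then show "(LINT y|Leb (x i) (x (Suc i)). (F y)\<^sup>2)
        \<le> h ^ (2 * (k + 1)) * (LINT y|Leb (x i) (x (Suc i)). (weak_deriv (k + 1) f y)\<^sup>2)"
      using p(2)[OF i] by simp
  qed
  also have "\<dots> = h ^ (2 * (k + 1)) * (LINT y|Leb 0 1. (weak_deriv (k + 1) f y)\<^sup>2)"
    using partition_integral[OF P, of "\<lambda>y. (weak_deriv (k + 1) f y)\<^sup>2"] sq0(2)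
    by (simp add: sum_distrib_left sq_integrable_def)
  also have "\<dots> \<le> h ^ (2 * (k + 1)) * (sobolev_norm s f)\<^sup>2"
    by (rule mult_left_mono[OF weak_deriv_le_sobolev_norm[OF f(2)]]) (use mesh_size_pos[OF P] in \<open>simp add: h_def\<close>)
  finally have FF: "(LINT y|Leb 0 1. (F y)\<^sup>2) \<le> h ^ (2 * (k + 1)) * (sobolev_norm s f)\<^sup>2" .
  have "(LINT y|Leb 0 1. F y * z y)\<^sup>2 \<le> (LINT y|Leb 0 1. (F y)\<^sup>2) * (LINT y|Leb 0 1. (z y)\<^sup>2)"
    by (rule integral_Cauchy_Schwarz[OF sqF z])
  also have "\<dots> \<le> h ^ (2 * (k + 1)) * (sobolev_norm s f)\<^sup>2 * (LINT y|Leb 0 1. (z y)\<^sup>2)"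
    by (rule mult_right_mono[OF FF]) simp
  also have "\<dots> = (h ^ (k + 1) * sobolev_norm s f * sqrt (LINT y|Leb 0 1. (z y)\<^sup>2))\<^sup>2"
    by (simp add: power_mult_distrib power_mult[symmetric] mult.commute[of _ 2] del: power_Suc)
  finally have "\<bar>LINT y|Leb 0 1. F y * z y\<bar> \<le> \<bar>h ^ (k + 1) * sobolev_norm s f * sqrt (LINT y|Leb 0 1. (z y)\<^sup>2)\<bar>"
    by (simp only: abs_le_square_iff)
  also have "\<dots> = h ^ (k + 1) * sobolev_norm s f * sqrt (LINT y|Leb 0 1. (z y)\<^sup>2)"
    using mesh_size_pos[OF P] by (intro abs_of_nonneg mult_nonneg_nonneg) (auto simp: h_def)
  finally show ?thesis unfolding fz h_def .
qed

text \<open>The bound holds at every time, since \<open>u t\<close> is recovered from its value at a single good time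
  and the time integral of \<open>v\<close>; both are tested with the projection error itself.\<close>

lemma projection_error_all_times:
  fixes u v :: "real \<Rightarrow> real \<Rightarrow> real"
  assumes T: "T > 0" and u: "continuous_on ({0..T} \<times> {0..1}) (\<lambda>(t, y). u t y)"
    and v: "has_weak_time_deriv T s 1 u v" and s: "k + 1 \<le> s"
  shows "\<exists>\<zeta>\<ge>0. \<forall>N x. is_partition N x \<longrightarrow> (\<forall>t\<in>{0..T}.
      (\<Sum>i\<in>{1..<N}. LINT y|Leb (x i) (x (Suc i)). (u t y - poly (proj (x i) (x (Suc i)) k (u t)) y)\<^sup>2)
        \<le> \<zeta> * mesh_size N x ^ (2 * (k + 1)))"
proof -
  have L2: "u \<in> L2_sobolev T s" "v \<in> L2_sobolev T s" using v by (auto simp: has_weak_time_deriv_def)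
  have AEu: "AE t in Leb 0 T. u t \<in> sobolev s" and AEv: "AE t in Leb 0 T. v t \<in> sobolev s"
    using L2 by (auto simp: L2_sobolev_def strongly_measurable_def)
  define n where "n t = sobolev_norm s (v t)" for t
  have n0: "0 \<le> n t" for t by (simp add: n_def)
  have n2: "integrable (Leb 0 T) (\<lambda>t. (n t)\<^sup>2)" using L2(2) by (simp add: L2_sobolev_def n_def)
  have "(\<lambda>t. sqrt ((n t)\<^sup>2)) \<in> borel_measurable (Leb 0 T)"
    by (rule measurable_compose[OF borel_measurable_integrable[OF n2] borel_measurable_sqrt])
  then have nm: "n \<in> borel_measurable (Leb 0 T)" using n0 by simp
  have "sq_integrable 0 T n" using nm n2 by (simp add: sq_integrable_def)
  then have ni: "integrable (Leb 0 T) n" by (rule sq_integrable_imp_integrable)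
  have "\<exists>\<tau>\<in>{0<..<T}. u \<tau> \<in> sobolev s"
  proof (rule ccontr)
    assume no: "\<not> (\<exists>\<tau>\<in>{0<..<T}. u \<tau> \<in> sobolev s)"
    have "AE t in Leb 0 T. t \<in> {0<..<T}" by (rule AE_LebI) simp
    with AEu have "AE t in Leb 0 T. (1::real) = 0" by eventually_elim (use no in auto)
    then have "(LINT t|Leb 0 T. (1::real)) = (LINT t|Leb 0 T. 0)"
      by (intro integral_cong_AE) auto
    then show False using measure_Leb[of 0 T] T by simp
  qed
  then obtain \<tau> where \<tau>: "\<tau> \<in> {0<..<T}" "u \<tau> \<in> sobolev s" by blast
  define K where "K = sobolev_norm s (u \<tau>) + (LINT t|Leb 0 T. n t)"
  have K0: "0 \<le> K" unfolding K_def using n0 by simp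
  show ?thesis
  proof (intro exI[of _ "K\<^sup>2"] conjI allI impI ballI)
    fix N x t assume P: "is_partition N x" and t: "t \<in> {0..T}"
    note el = partition_elem_subset[OF P]
    have cu: "continuous_on {0..1} (u t)" by (rule joint_continuous_slice[OF u t])
    have ui: "integrable (Leb (x i) (x (Suc i))) (u t)" if "i \<in> {1..<N}" for i
      using continuous_imp_Leb_integrable[OF cu] el(4)[OF that] by (rule Leb_integrable_subset)
    define p where "p i = proj (x i) (x (Suc i)) k (u t)" for i
    define z where "z y = u t y - glue N x p y" for y
    define h where "h = mesh_size N x ^ (k + 1)"
    have h0: "0 \<le> h" using mesh_size_pos[OF P] by (simp add: h_def)
    have ze: "z y = u t y - poly (p i) y" if "i \<in> {1..<N}" "y \<in> elem x i" for i y
      using glue_eq[OF P that] by (simp add: z_def)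
    have sqz: "sq_integrable 0 1 z"
      unfolding z_def[abs_def] by (intro sq_integrable_diff continuous_imp_sq_integrable cu glue_sq_integrable)
    have zm: "z \<in> borel_measurable (Leb 0 1)" using sqz by (simp add: sq_integrable_def)
    obtain b where b: "\<And>y. y \<in> {0..1} \<Longrightarrow> \<bar>z y\<bar> \<le> b"
    proof -
      obtain M where M: "\<forall>t\<in>{0..T}. \<forall>y\<in>{0..1}. \<bar>u t y\<bar> \<le> M" using joint_continuous_bound[OF u] by blast
      obtain M' where M': "\<forall>y\<in>{0..1}. \<bar>glue N x p y\<bar> \<le> M'" using glue_bounded by blast
      have "\<bar>z y\<bar> \<le> M + M'" if y: "y \<in> {0..1}" for y
      proof -
        have "\<bar>z y\<bar> \<le> \<bar>u t y\<bar> + \<bar>glue N x p y\<bar>" unfolding z_def by (rule abs_triangle_ineq4)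
        then show ?thesis using M t y M' by fastforce
      qed
      then show thesis using that by blast
    qed
    have zb: "AE y in Leb 0 1. \<bar>z y\<bar> \<le> max 1 b" using b by (intro AE_LebI) (auto simp: le_max_iff_disj)
    have orth: "(LINT y|Leb (x i) (x (Suc i)). z y * poly q y) = 0" if i: "i \<in> {1..<N}" and q: "degree q \<le> k" for i q
    proof -
      have "(LINT y|Leb (x i) (x (Suc i)). z y * poly q y) = (LINT y|Leb (x i) (x (Suc i)). u t y * poly q y - poly (p i) y * poly q y)"
        by (rule Bochner_Integration.integral_cong) (use ze[OF i] in \<open>auto simp: left_diff_distrib\<close>)
      also have "\<dots> = (LINT y|Leb (x i) (x (Suc i)). u t y * poly q y) - (LINT y|Leb (x i) (x (Suc i)). poly (p i) y * poly q y)"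
        using ui[OF i] by simp
      also have "\<dots> = 0" unfolding p_def using proj(2)[OF el(2)[OF i] ui[OF i] q] by simp
      finally show ?thesis .
    qed
    define S where "S = (LINT y|Leb 0 1. (z y)\<^sup>2)"
    have S0: "0 \<le> S" by (simp add: S_def)
    \<comment> \<open>\<open>z\<close> is frozen at the fixed time while the time in
      \<open>a\<close> runs. At the fixed time \<open>a\<close> is the squared norm of
      \<open>z\<close> by orthogonality; at \<open>\<tau>\<close>, and in the density
      \<open>d\<close> at almost every time, it is a Sobolev function that is paired with
      \<open>z\<close>.\<close>
    define a where "a t = (LINT y|Leb 0 1. u t y * z y)" for t
    define d where "d t = (LINT y|Leb 0 1. v t y * z y)" for t
    have prim: "primitive_on 0 T a d"
      unfolding a_def[abs_def] d_def[abs_def]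
      by (rule functional_primitive[OF zm zb _ T v functional_continuous[OF zm zb _ u]]) auto
    have at: "a t = S"
    proof -
      have "(LINT y|Leb 0 1. glue N x p y * z y) = (\<Sum>i\<in>{1..<N}. LINT y|Leb (x i) (x (Suc i)). glue N x p y * z y)"
        by (rule partition_integral[OF P sq_integrable_mult[OF glue_sq_integrable sqz]])
      also have "\<dots> = 0"
      proof (rule sum.neutral, rule ballI)
        fix i assume i: "i \<in> {1..<N}"
        have "(LINT y|Leb (x i) (x (Suc i)). glue N x p y * z y) = (LINT y|Leb (x i) (x (Suc i)). z y * poly (p i) y)"
          by (rule Bochner_Integration.integral_cong) (use glue_eq[OF P i] in auto)
        also have "\<dots> = 0" by (rule orth[OF i]) (unfold p_def, rule proj(1)[OF el(2)[OF i] ui[OF i]])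
        finally show "(LINT y|Leb (x i) (x (Suc i)). glue N x p y * z y) = 0" .
      qed
      finally have gz: "(LINT y|Leb 0 1. glue N x p y * z y) = 0" .
      have "S = (LINT y|Leb 0 1. u t y * z y - glue N x p y * z y)"
        unfolding S_def power2_eq_square by (simp add: z_def left_diff_distrib)
      also have "\<dots> = a t - (LINT y|Leb 0 1. glue N x p y * z y)"
        unfolding a_def
        by (rule Bochner_Integration.integral_diff)
           (intro sq_integrable_mult continuous_imp_sq_integrable cu sqz glue_sq_integrable)+
      finally show ?thesis using gz by simp
    qed
    have a\<tau>: "\<bar>a \<tau>\<bar> \<le> h * sobolev_norm s (u \<tau>) * sqrt S"
      unfolding a_def h_def S_def by (rule orthogonal_integral_bound[OF P \<tau>(2) s sqz orth])
    have db: "AE r in Leb 0 T. \<bar>d r\<bar> \<le> h * n r * sqrt S"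
      using AEv
    proof eventually_elim
      case (elim r)
      show ?case unfolding d_def h_def S_def n_def by (rule orthogonal_integral_bound[OF P elim s sqz orth])
    qed
    have di: "integrable (Leb 0 T) d" by (rule primitive_onD(2)[OF prim])
    have seg: "\<bar>LINT r|Leb p q. d r\<bar> \<le> (LINT r|Leb 0 T. h * n r * sqrt S)" if pq: "0 \<le> p" "p \<le> q" "q \<le> T" for p q
    proof -
      have sub: "{p<..<q} \<subseteq> {0<..<T}" using pq by auto
      have nn: "0 \<le> h * n r * sqrt S" for r using h0 n0 S0 by simp
      have int: "integrable (Leb 0 T) (\<lambda>r. h * n r * sqrt S)" using ni by simp
      have "\<bar>LINT r|Leb p q. d r\<bar> \<le> (LINT r|Leb p q. \<bar>d r\<bar>)" by (rule integral_abs_bound)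
      also have "\<dots> \<le> (LINT r|Leb p q. h * n r * sqrt S)"
        by (rule integral_mono_AE[OF _ _ AE_Leb_subset[OF db sub]])
           (use Leb_integrable_subset[OF di sub] Leb_integrable_subset[OF int sub] in auto)
      also have "\<dots> \<le> (LINT r|Leb 0 T. h * n r * sqrt S)"
      proof -
        have "(LINT r|Leb 0 T. h * n r * sqrt S) = (LINT r|Leb 0 p. h * n r * sqrt S) + (LINT r|Leb p T. h * n r * sqrt S)"
          by (rule Leb_integral_split[OF int]) (use pq in auto)
        also have "(LINT r|Leb p T. h * n r * sqrt S) = (LINT r|Leb p q. h * n r * sqrt S) + (LINT r|Leb q T. h * n r * sqrt S)"
          by (rule Leb_integral_split[OF Leb_integrable_subset[OF int]]) (use pq in auto)
        finally show ?thesis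
          using Bochner_Integration.integral_nonneg[of "Leb 0 p" "\<lambda>r. h * n r * sqrt S"]
            Bochner_Integration.integral_nonneg[of "Leb q T" "\<lambda>r. h * n r * sqrt S"] nn by simp
      qed
      finally show ?thesis .
    qed
    have "\<bar>a t - a \<tau>\<bar> \<le> (LINT r|Leb 0 T. h * n r * sqrt S)"
    proof (cases "\<tau> \<le> t")
      case True
      then show ?thesis using primitive_on_diff[OF prim, of \<tau> t] seg[of \<tau> t] t \<tau> by simp
    next
      case False
      then show ?thesis using primitive_on_diff[OF prim, of t \<tau>] seg[of t \<tau>] t \<tau> by simp
    qed
    then have "S \<le> h * sobolev_norm s (u \<tau>) * sqrt S + (LINT r|Leb 0 T. h * n r * sqrt S)"
      using a\<tau> unfolding at by linarith
    also have "\<dots> = h * K * sqrt S" by (simp add: K_def algebra_simps)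
    finally have SK: "sqrt S * sqrt S \<le> (h * K) * sqrt S" using S0 by simp
    \<comment> \<open>One factor \<open>sqrt S\<close> cancels, since the orthogonality bound is
      linear in the norm of \<open>z\<close>.\<close>
    have "sqrt S \<le> h * K"
    proof (cases "S = 0")
      case True
      then show ?thesis using h0 K0 by simp
    next
      case False
      then have "0 < sqrt S" using S0 by simp
      then show ?thesis using SK by (simp only: mult_le_cancel_right_pos)
    qed
    then have "(sqrt S)\<^sup>2 \<le> (h * K)\<^sup>2" by (rule power_mono) (use S0 in simp)
    then have "S \<le> K\<^sup>2 * mesh_size N x ^ (2 * (k + 1))"
      using S0 by (simp add: h_def power_mult_distrib power_mult[symmetric] mult.commute del: power_Suc)
    moreover have "S = (\<Sum>i\<in>{1..<N}. LINT y|Leb (x i) (x (Suc i)). (z y)\<^sup>2)"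
      unfolding S_def using sqz by (intro partition_integral[OF P]) (simp add: sq_integrable_def)
    moreover have "(LINT y|Leb (x i) (x (Suc i)). (z y)\<^sup>2) = (LINT y|Leb (x i) (x (Suc i)). (u t y - poly (p i) y)\<^sup>2)"
      if "i \<in> {1..<N}" for i
      by (rule Bochner_Integration.integral_cong) (use ze[OF that] in auto)
    ultimately show "(\<Sum>i\<in>{1..<N}. LINT y|Leb (x i) (x (Suc i)). (u t y - poly (proj (x i) (x (Suc i)) k (u t)) y)\<^sup>2)
        \<le> K\<^sup>2 * mesh_size N x ^ (2 * (k + 1))"
      by (simp add: p_def)
  qed simp
qed

section \<open>The case of zero initial data\<close>

lemma proj_zero: 
  assumes "a < b"
  shows "proj a b m (\<lambda>y. 0) = 0"
proof (rule poly_eq_if_integrals_eq[OF assms, of _ m])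
  show "degree (proj a b m (\<lambda>y. 0)) \<le> m" by (rule proj(1)[OF assms]) simp
  show "(LINT y|Leb a b. poly (proj a b m (\<lambda>y. 0)) y * poly q y) = (LINT y|Leb a b. poly 0 y * poly q y)"
    if "degree q \<le> m" for q
    using proj(2)[OF assms, of "\<lambda>y. 0" q m] that by simp
qed simp

lemma discrete_weak_deriv_zero:
  assumes P: "is_partition N x" and i: "i \<in> {1..<N}" and y: "y \<in> elem x i"
  shows "discrete_weak_deriv N x r (Weak_Fun (\<lambda>y. 0) (\<lambda>i. 0)) y = 0"
proof -
  obtain D where D: "degree D \<le> r" "\<And>y. y \<in> elem x i \<Longrightarrow> discrete_weak_deriv N x r (Weak_Fun (\<lambda>y. 0) (\<lambda>i. 0)) y = poly D y"
    "\<And>q. degree q \<le> r \<Longrightarrow> (LINT y|Leb (x i) (x (Suc i)). poly D y * poly q y)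
          = - (LINT y|Leb (x i) (x (Suc i)). poly 0 y * poly (pderiv q) y) + 0 * poly q (x (Suc i)) - 0 * poly q (x i)"
    using discrete_weak_deriv_poly[OF P i, of "Weak_Fun (\<lambda>y. 0) (\<lambda>i. 0)" 0 r] by auto
  have "D = 0"
    by (rule poly_eq_if_integrals_eq[OF partition_less[OF P i] D(1), of 0]) (use D(3) in auto)
  then show ?thesis using D(2)[OF y] by simp
qed

lemma time_deriv_const:
  assumes "t \<in> {0<..T}"
  shows "time_deriv T (\<lambda>s y. c) t y = 0"
proof -
  have "t islimpt {0<..<t}" using assms by (simp add: islimpt_greaterThanLessThan2)
  then have "t islimpt {0<..T}" by (rule islimpt_subset) (use assms in auto)
  then have "at t within {0<..T} \<noteq> bot" by (simp add: trivial_limit_within)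
  then show ?thesis unfolding time_deriv_def
    by (rule vector_derivative_within) (rule has_vector_derivative_const)
qed

lemma semidiscrete_solution_zero:
  assumes P: "is_partition N x" and g: "\<And>y. y \<in> {0..1} \<Longrightarrow> g y = 0"
  shows "semidiscrete_solution N x k r \<nu> T g (\<lambda>t. Weak_Fun (\<lambda>y. 0) (\<lambda>i. 0))"
  unfolding semidiscrete_solution_def
proof (intro conjI ballI)
  note el = partition_elem_subset[OF P]
  have zero: "inner_h N x f f' = 0" if "\<And>i y. i \<in> {1..<N} \<Longrightarrow> y \<in> elem x i \<Longrightarrow> f y * f' y = 0" for f f'
    using inner_h_poly[of N x f f' "\<lambda>i y. 0"] that by simp
  show "Weak_Fun (\<lambda>y. 0) (\<lambda>i. 0) \<in> weak_space0 N x k" for t :: real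
    by (auto simp: weak_space0_def weak_space_def intro!: exI[of _ 0])
  show "time_regular N x T (\<lambda>t. interior_part (Weak_Fun (\<lambda>y. 0) (\<lambda>i. 0)))"
    unfolding time_regular_def weak_fun.sel
  proof (intro ballI conjI)
    show "continuous_on {0<..T} (\<lambda>t. time_deriv T (\<lambda>t y. 0) t y)" for y
      by (rule continuous_on_eq[OF continuous_on_const[of _ 0]]) (simp add: time_deriv_const)
  qed auto
  show "weak_fun_eq N x (Weak_Fun (\<lambda>y. 0) (\<lambda>i. 0)) (proj_h N x k g)"
    unfolding weak_fun_eq_def
  proof (intro conjI ballI)
    fix i y assume i: "i \<in> {1..<N}" and y: "y \<in> elem x i"
    have "integrable (Leb (x i) (x (Suc i))) g \<longleftrightarrow> integrable (Leb (x i) (x (Suc i))) (\<lambda>y. 0 :: real)"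
      by (rule Bochner_Integration.integrable_cong[OF refl]) (use g el[OF i] in auto)
    then have "interior_part (proj_h N x k g) y = poly (proj (x i) (x (Suc i)) k g) y"
      by (intro proj_h_interior[OF P i _ y]) simp
    also have "proj (x i) (x (Suc i)) k g = proj (x i) (x (Suc i)) k (\<lambda>y. 0)"
      by (rule proj_cong) (use g el[OF i] in auto)
    finally show "interior_part (Weak_Fun (\<lambda>y. 0) (\<lambda>i. 0)) y = interior_part (proj_h N x k g) y"
      using proj_zero[OF el(2)[OF i]] by simp
  next
    fix i assume "i \<in> {1..N}"
    then show "nodal_value (Weak_Fun (\<lambda>y. 0) (\<lambda>i. 0)) i = nodal_value (proj_h N x k g) i"
      using g[of "x i"] partition_bounds[OF P] by (simp add: proj_h_def)
  qed
  fix t v assume t: "t \<in> {0<..T}"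
  have "inner_h N x (time_deriv T (\<lambda>s. interior_part (Weak_Fun (\<lambda>y. 0) (\<lambda>i. 0))) t) (interior_part v) = 0"
    by (rule zero) (simp add: time_deriv_const[OF t])
  moreover have "inner_h N x (discrete_weak_deriv N x r (Weak_Fun (\<lambda>y. 0) (\<lambda>i. 0))) (discrete_weak_deriv N x r v) = 0"
    by (rule zero) (simp add: discrete_weak_deriv_zero[OF P])
  moreover have "inner_h N x (\<lambda>y. interior_part (Weak_Fun (\<lambda>y. 0) (\<lambda>i. 0)) y * discrete_weak_deriv N x r (Weak_Fun (\<lambda>y. 0) (\<lambda>i. 0)) y)
                    (interior_part v) = 0"
    by (rule zero) simp
  moreover have "inner_h N x (\<lambda>y. interior_part (Weak_Fun (\<lambda>y. 0) (\<lambda>i. 0)) y * interior_part (Weak_Fun (\<lambda>y. 0) (\<lambda>i. 0)) y)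
                    (discrete_weak_deriv N x r v) = 0"
    by (rule zero) simp
  ultimately show "inner_h N x (time_deriv T (\<lambda>s. interior_part (Weak_Fun (\<lambda>y. 0) (\<lambda>i. 0))) t) (interior_part v)
        + \<nu> * inner_h N x (discrete_weak_deriv N x r (Weak_Fun (\<lambda>y. 0) (\<lambda>i. 0))) (discrete_weak_deriv N x r v)
        + 1 / 3 * inner_h N x (\<lambda>y. interior_part (Weak_Fun (\<lambda>y. 0) (\<lambda>i. 0)) y * discrete_weak_deriv N x r (Weak_Fun (\<lambda>y. 0) (\<lambda>i. 0)) y)
                    (interior_part v)
        - 1 / 3 * inner_h N x (\<lambda>y. interior_part (Weak_Fun (\<lambda>y. 0) (\<lambda>i. 0)) y * interior_part (Weak_Fun (\<lambda>y. 0) (\<lambda>i. 0)) y)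
                    (discrete_weak_deriv N x r v) = 0"
    by simp
qed

text \<open>Nodes are numbered from 1, and n + 2 of them bound n + 1 elements. It supplies meshes of
  arbitrarily small size for the refinement argument.\<close>

lemma uniform_partition: "is_partition (n + 2) (\<lambda>i. (real i - 1) / real (Suc n))"
  "mesh_size (n + 2) (\<lambda>i. (real i - 1) / real (Suc n)) = 1 / real (Suc n)"
proof -
  show "is_partition (n + 2) (\<lambda>i. (real i - 1) / real (Suc n))"
    by (auto simp: is_partition_def divide_strict_right_mono)
  have "(\<lambda>i. (real (i + 1) - 1) / real (Suc n) - (real i - 1) / real (Suc n)) ` {1..<n + 2} = {1 / real (Suc n)}"
    by (auto simp: diff_divide_distrib[symmetric] image_constant_conv)
  then show "mesh_size (n + 2) (\<lambda>i. (real i - 1) / real (Suc n)) = 1 / real (Suc n)"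
    unfolding mesh_size_def by simp
qed

lemma sobolev_chain_zero: "sobolev_chain m (\<lambda>j y. 0)"
  unfolding sobolev_chain_def using primitive_on_const[of 0 1 0] by auto

section \<open>The error estimate\<close>

lemma L2_norm_continuous:
  fixes u :: "real \<Rightarrow> real \<Rightarrow> real"
  assumes u: "continuous_on ({0..T} \<times> {0..1}) (\<lambda>(t, y). u t y)"
  shows "continuous_on {0..T} (\<lambda>t. LINT y|Leb 0 1. (u t y)\<^sup>2)"
proof -
  have "continuous_on ({0..T} \<times> {0..1}) (\<lambda>(t, y). (u t y)\<^sup>2)"
    using continuous_on_power[OF u, of 2] by (simp add: case_prod_beta)
  from functional_continuous[of "\<lambda>y. 1" 1, OF _ _ _ this] show ?thesis by simp
qed

theorem theorem1:
  fixes k r :: nat and \<nu> T :: real and g :: "real \<Rightarrow> real" and u :: "real \<Rightarrow> real \<Rightarrow> real"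
  assumes "r = k + 1" and "\<nu> > 0" and "T > 0"
    and "continuous_on {0..1} g"
    and "burgers_solution \<nu> T g u"
    and "u \<in> H_sobolev T 1 (1 + r)"
  shows "\<exists>C::real. \<forall>N x uh.
     is_partition N x \<longrightarrow> semidiscrete_solution N x k r \<nu> T g uh \<longrightarrow>
     (\<forall>t\<in>{0<..T}.
        (norm_h N x (\<lambda>y. u t y - interior_part (uh t) y))\<^sup>2
        + \<nu> * (LINT s|lebesgue_on {0<..<t}.
             (norm_h N x (\<lambda>y. weak_deriv 1 (u s) y - discrete_weak_deriv N x r (uh s) y))\<^sup>2)
        \<le> C * mesh_size N x ^ (2 * (k + 1)) *
           ((sobolev_norm (k + 2 - 1) (u t))\<^sup>2
            + (LINT s|lebesgue_on {0<..<t}. (sobolev_norm (k + 2) (u s))\<^sup>2)))"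
proof -
  note r = assms(1) and \<nu> = assms(2) and T = assms(3) and g = assms(4)
  have u: "continuous_on ({0..T} \<times> {0..1}) (\<lambda>(t, y). u t y)"
    and init: "\<And>y. y \<in> unit_I \<Longrightarrow> u 0 y = g y" and bd: "\<And>t. t \<in> {0<..T} \<Longrightarrow> u t 0 = 0 \<and> u t 1 = 0"
    using assms(5) by (auto simp: burgers_solution_def)
  obtain ut where ut: "has_weak_time_deriv T 0 1 u ut"
    "AE t in Leb 0 T. u t \<in> sobolev 2 \<and>
           (AE y in Leb 0 1. ut t y + u t y * weak_deriv 1 (u t) y - \<nu> * weak_deriv 2 (u t) y = 0)"
    using assms(5) by (auto simp: burgers_solution_def)
  have "\<exists>v. has_weak_time_deriv T (1 + r) 1 u v" using assms(6) by (auto simp: H_sobolev_def)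
  moreover have "1 + r = k + 2" using r by simp
  ultimately obtain v where v: "has_weak_time_deriv T (k + 2) 1 u v" by metis
  have L2: "u \<in> L2_sobolev T (k + 2)" "v \<in> L2_sobolev T (k + 2)" using v by (auto simp: has_weak_time_deriv_def)
  have intu: "integrable (Leb 0 T) (\<lambda>t. (sobolev_norm (k + 2) (u t))\<^sup>2)" using L2 by (simp add: L2_sobolev_def)
  \<comment> \<open>The norm of \<open>v\<close> is needed for the consistency error but is absent
    from the right-hand side of the claim; it ends up in the constant.\<close>
  define \<beta> where "\<beta> t = (sobolev_norm (k + 2) (u t))\<^sup>2 + (sobolev_norm (k + 2) (v t))\<^sup>2" for t
  have \<beta>: "integrable (Leb 0 T) \<beta>" "\<And>t. 0 \<le> \<beta> t"
    using L2 by (auto simp: \<beta>_def[abs_def] L2_sobolev_def)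
  obtain M where M: "\<And>t y. t \<in> {0..T} \<Longrightarrow> y \<in> {0..1} \<Longrightarrow> \<bar>u t y\<bar> \<le> M"
    using joint_continuous_bound[OF u] by blast
  obtain \<zeta> where \<zeta>: "\<zeta> \<ge> 0" "\<And>N x t. is_partition N x \<Longrightarrow> t \<in> {0..T} \<Longrightarrow>
      (\<Sum>i\<in>{1..<N}. LINT y|Leb (x i) (x (Suc i)). (u t y - poly (proj (x i) (x (Suc i)) k (u t)) y)\<^sup>2)
        \<le> \<zeta> * mesh_size N x ^ (2 * (k + 1))"
    using projection_error_all_times[OF T u v, of k] by auto
  obtain C where C: "C \<ge> 1" "\<forall>a b p. a < b \<longrightarrow> degree p \<le> k + 1 \<longrightarrow>
     (\<forall>y\<in>{a..b}. (b - a) * (poly p y)\<^sup>2 \<le> C * (LINT y|Leb a b. (poly p y)\<^sup>2))"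
    using poly_sup_bound[of "k + 1"] by blast
  have slice: "continuous_on {0..1} (u t)" if "t \<in> {0..T}" for t by (rule joint_continuous_slice[OF u that])
  have data: "AE t in Leb 0 T. \<exists>W Z. sobolev_chain (k + 2) W \<and> sobolev_chain k Z \<and>
      (AE y in Leb 0 1. u t y = W 0 y) \<and> (AE y in Leb 0 1. v t y = Z 0 y) \<and> sq_integrable 0 1 (v t) \<and>
      (AE y in Leb 0 1. weak_deriv 1 (u t) y = W 1 y) \<and> sq_integrable 0 1 (weak_deriv 1 (u t)) \<and>
      (AE y in Leb 0 1. Z 0 y + u t y * W 1 y - \<nu> * W 2 y = 0) \<and>
      (\<forall>j\<le>k + 2. (LINT y|Leb 0 1. (W j y)\<^sup>2) \<le> \<beta> t) \<and> (\<forall>j\<le>k. (LINT y|Leb 0 1. (Z j y)\<^sup>2) \<le> \<beta> t)"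
  proof -
    have "AE t in Leb 0 T. u t \<in> sobolev (k + 2)" "AE t in Leb 0 T. v t \<in> sobolev (k + 2)"
      using L2 by (auto simp: L2_sobolev_def strongly_measurable_def)
    moreover note ut(2) weak_time_deriv_unique[OF T u ut(1) v]
    ultimately show ?thesis
    proof eventually_elim
      case (elim t)
      have sq: "sq_integrable 0 1 (u t)" "sq_integrable 0 1 (v t)" using elim by (auto intro: sobolev_imp_sq_integrable)
      have W: "sobolev_chain (k + 2) (\<lambda>j. weak_deriv j (u t))" using elim by (auto intro: sobolev_imp_chain)
      have Z: "sobolev_chain k (\<lambda>j. weak_deriv j (v t))" using sobolev_mono[of "v t" "k + 2" k] elim by (auto intro: sobolev_imp_chain)
      have u0: "AE y in Leb 0 1. weak_deriv 0 (u t) y = u t y" by (rule weak_deriv_AE[OF has_weak_deriv_0[OF sq(1)]])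
      have v0: "AE y in Leb 0 1. weak_deriv 0 (v t) y = v t y" by (rule weak_deriv_AE[OF has_weak_deriv_0[OF sq(2)]])
      have eq: "AE y in Leb 0 1. weak_deriv 0 (v t) y + u t y * weak_deriv 1 (u t) y - \<nu> * weak_deriv 2 (u t) y = 0"
        using elim(3)[THEN conjunct2] elim(4) v0 by eventually_elim simp
      have b1: "(LINT y|Leb 0 1. (weak_deriv j (u t) y)\<^sup>2) \<le> \<beta> t" if "j \<le> k + 2" for j
        using weak_deriv_le_sobolev_norm[OF that, of "u t"] zero_le_power2[of "sobolev_norm (k + 2) (v t)"]
        unfolding \<beta>_def by linarith
      have b2: "(LINT y|Leb 0 1. (weak_deriv j (v t) y)\<^sup>2) \<le> \<beta> t" if "j \<le> k" for j
        using weak_deriv_le_sobolev_norm[of j "k + 2" "v t"] that zero_le_power2[of "sobolev_norm (k + 2) (u t)"]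
        unfolding \<beta>_def by linarith
      show ?case
      proof (intro exI conjI allI impI)
        show "AE y in Leb 0 1. u t y = weak_deriv 0 (u t) y" using u0 by eventually_elim simp
        show "AE y in Leb 0 1. v t y = weak_deriv 0 (v t) y" using v0 by eventually_elim simp
        show "sq_integrable 0 1 (weak_deriv 1 (u t))" using W by (simp add: sobolev_chain_def)
      qed (use W Z sq eq b1 b2 in auto)
    qed
  qed
  define K where "K = 2 * \<zeta> + error_amplification C M \<nu> T (LINT t|Leb 0 T. \<beta> t) * (LINT t|Leb 0 T. \<beta> t)"
  have main: "(norm_h N x (\<lambda>y. u t y - interior_part (uh t) y))\<^sup>2
        + \<nu> * (LINT s|Leb 0 t. (norm_h N x (\<lambda>y. weak_deriv 1 (u s) y - discrete_weak_deriv N x (k + 1) (uh s) y))\<^sup>2)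
      \<le> mesh_size N x ^ (2 * (k + 1)) * K"
    if P: "is_partition N x" and sol: "semidiscrete_solution N x k (k + 1) \<nu> T g uh" and t: "t \<in> {0<..T}" for N x uh t
    unfolding K_def
  proof (rule semidiscrete_error[OF P sol \<nu> T u M bd init _ \<beta> data _ C(2,1) t])
    show "primitive_on 0 T (\<lambda>t. LINT y|Leb 0 1. u t y * z y) (\<lambda>t. LINT y|Leb 0 1. v t y * z y)"
      if "z \<in> borel_measurable (Leb 0 1)" "AE y in Leb 0 1. \<bar>z y\<bar> \<le> B" "B > 0" for z B
      by (rule functional_primitive[OF that T v functional_continuous[OF that u]])
  qed (use \<zeta>(2)[OF P] in auto)
  show ?thesis
  proof (cases "\<forall>y\<in>{0<..<1}. u 0 y = 0")
    case False
    define n where "n t = (LINT y|Leb 0 1. (u t y)\<^sup>2)" for t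
    have n: "continuous_on {0..T} n" unfolding n_def[abs_def] by (rule L2_norm_continuous[OF u])
    have n0: "n 0 > 0"
    proof (rule ccontr)
      assume "\<not> n 0 > 0"
      moreover have "0 \<le> n 0" by (simp add: n_def)
      ultimately have z: "n 0 = 0" by simp
      have c: "continuous_on {0..1} (u 0)" using slice[of 0] T by simp
      have "AE y in Leb 0 1. (u 0 y)\<^sup>2 = 0"
      proof (rule integral_nonneg_eq_0_iff_AE[THEN iffD1])
        show "integrable (Leb 0 1) (\<lambda>y. (u 0 y)\<^sup>2)"
          using continuous_imp_sq_integrable[OF c] by (simp add: sq_integrable_def)
        show "(LINT y|Leb 0 1. (u 0 y)\<^sup>2) = 0" using z by (simp add: n_def)
      qed simp
      then have "AE y in Leb 0 1. u 0 y = 0" by simp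
      then have "u 0 y = 0" if "y \<in> {0..1}" for y
        by (intro continuous_AE_eq_imp_eq[OF _ c _ _ that, of "\<lambda>_. 0"]) auto
      then show False using False by auto
    qed
    obtain \<delta> where \<delta>: "0 < \<delta>" "\<delta> \<le> T" "\<And>t. 0 \<le> t \<Longrightarrow> t \<le> \<delta> \<Longrightarrow> n 0 / 2 \<le> n t"
    proof -
      have "\<exists>d>0. \<forall>t\<in>{0..T}. dist t 0 < d \<longrightarrow> dist (n t) (n 0) < n 0 / 2"
        using n[unfolded continuous_on_iff, rule_format, of 0 "n 0 / 2"] n0 T by auto
      then obtain d where d: "d > 0" "\<forall>t\<in>{0..T}. dist t 0 < d \<longrightarrow> dist (n t) (n 0) < n 0 / 2" by blast
      have "n 0 / 2 \<le> n t" if "0 \<le> t" "t \<le> min (d / 2) T" for t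
      proof -
        have "dist (n t) (n 0) < n 0 / 2" using d that by auto
        then show ?thesis unfolding dist_real_def by linarith
      qed
      then show thesis using that[of "min (d / 2) T"] d T by auto
    qed
    \<comment> \<open>For \<open>t \<le> \<delta>\<close> the squared norm at time t is at least
      n(0)/2; for later t the time integral over (0, \<delta>) contributes at least \<delta> n(0)/2.
      The minimum covers both cases.\<close>
    define c0 where "c0 = min 1 \<delta> * (n 0 / 2)"
    have c0: "c0 > 0" unfolding c0_def using \<delta> n0 by simp
    have low: "c0 \<le> (sobolev_norm (k + 2 - 1) (u t))\<^sup>2 + (LINT s|Leb 0 t. (sobolev_norm (k + 2) (u s))\<^sup>2)"
      if t: "t \<in> {0<..T}" for t
    proof -
      have norm: "n s \<le> (sobolev_norm m (u s))\<^sup>2" if "s \<in> {0..T}" for s m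
        unfolding n_def by (rule L2_le_sobolev_norm[OF continuous_imp_sq_integrable[OF slice[OF that]]])
      have inn: "0 \<le> (LINT s|Leb p q. (sobolev_norm (k + 2) (u s))\<^sup>2)" for p q by simp
      show ?thesis
      proof (cases "t \<le> \<delta>")
        case True
        have "c0 \<le> 1 * (n 0 / 2)" unfolding c0_def by (rule mult_right_mono) (use n0 in auto)
        also have "\<dots> \<le> n t" using \<delta>(3)[of t] True t by simp
        also have "\<dots> \<le> (sobolev_norm (k + 2 - 1) (u t))\<^sup>2" by (rule norm) (use t in auto)
        finally show ?thesis using inn[of 0 t] by linarith
      next
        case False
        have it: "integrable (Leb 0 t) (\<lambda>s. (sobolev_norm (k + 2) (u s))\<^sup>2)"
          by (rule Leb_integrable_subset[OF intu]) (use t in auto)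
        have "c0 \<le> \<delta> * (n 0 / 2)" unfolding c0_def by (rule mult_right_mono) (use n0 in auto)
        also have "\<dots> = (LINT s|Leb 0 \<delta>. n 0 / 2)" using \<delta>(1) measure_Leb[of 0 \<delta>] by simp
        also have "\<dots> \<le> (LINT s|Leb 0 \<delta>. (sobolev_norm (k + 2) (u s))\<^sup>2)"
        proof (rule integral_mono_AE)
          show "integrable (Leb 0 \<delta>) (\<lambda>s. (sobolev_norm (k + 2) (u s))\<^sup>2)"
            by (rule Leb_integrable_subset[OF intu]) (use \<delta> in auto)
          show "AE s in Leb 0 \<delta>. n 0 / 2 \<le> (sobolev_norm (k + 2) (u s))\<^sup>2"
          proof (rule AE_LebI)
            fix s assume "0 < s" "s < \<delta>"
            then show "n 0 / 2 \<le> (sobolev_norm (k + 2) (u s))\<^sup>2"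
              using \<delta>(3)[of s] norm[of s "k + 2"] \<delta>(2) by simp
          qed
        qed simp
        also have "\<dots> \<le> (LINT s|Leb 0 t. (sobolev_norm (k + 2) (u s))\<^sup>2)"
          using Leb_integral_split[OF it, of \<delta>] inn[of \<delta> t] \<delta>(1) False by simp
        finally show ?thesis using zero_le_power2[of "sobolev_norm (k + 2 - 1) (u t)"] by linarith
      qed
    qed
    show ?thesis
    \<comment> \<open>Dividing by \<open>c0\<close> makes room for the bracket, and the absolute
      value makes its factor nonnegative.\<close>
    proof (intro exI[of _ "\<bar>K\<bar> / c0"] allI impI ballI)
      fix N x uh t assume P: "is_partition N x" and sol: "semidiscrete_solution N x k r \<nu> T g uh" and t: "t \<in> {0<..T}"
      define h where "h = mesh_size N x ^ (2 * (k + 1))"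
      define b where "b = (sobolev_norm (k + 2 - 1) (u t))\<^sup>2 + (LINT s|Leb 0 t. (sobolev_norm (k + 2) (u s))\<^sup>2)"
      have h0: "0 \<le> h" using mesh_size_pos[OF P] by (simp add: h_def)
      have "h * K \<le> h * \<bar>K\<bar>" by (rule mult_left_mono) (use h0 in auto)
      also have "\<dots> = \<bar>K\<bar> / c0 * h * c0" using c0 by simp
      also have "\<dots> \<le> \<bar>K\<bar> / c0 * h * b"
        by (rule mult_left_mono) (use low[OF t] c0 h0 in \<open>auto simp: b_def\<close>)
      finally show "(norm_h N x (\<lambda>y. u t y - interior_part (uh t) y))\<^sup>2
        + \<nu> * (LINT s|Leb 0 t. (norm_h N x (\<lambda>y. weak_deriv 1 (u s) y - discrete_weak_deriv N x r (uh s) y))\<^sup>2)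
        \<le> \<bar>K\<bar> / c0 * mesh_size N x ^ (2 * (k + 1)) *
           ((sobolev_norm (k + 2 - 1) (u t))\<^sup>2 + (LINT s|Leb 0 t. (sobolev_norm (k + 2) (u s))\<^sup>2))"
        using main[OF P sol[unfolded r] t] unfolding r h_def[symmetric] b_def[symmetric] by linarith
    qed
  next
    case True
    have g0: "g y = 0" if "y \<in> {0..1}" for y
    proof -
      have "continuous_on (closure {0<..<1::real}) g" using g by simp
      then show ?thesis
        by (rule continuous_constant_on_closure) (use True init that in auto)
    qed
    text \<open>The zero function solves every semi-discrete problem, so the estimate forces \<open>u = 0\<close> as
      the mesh is refined. A second application, to vanishing data, then gives \<open>uh = 0\<close>.\<close>
    have int0: "(LINT y|Leb 0 1. (u t y)\<^sup>2) = 0" if t: "t \<in> {0<..T}" for t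
    proof -
      have sq: "sq_integrable 0 1 (u t)" by (rule continuous_imp_sq_integrable[OF slice]) (use t in auto)
      have bound: "(LINT y|Leb 0 1. (u t y)\<^sup>2) \<le> (1 / real (Suc n)) ^ (2 * (k + 1)) * K" for n
      proof -
        define N x where "N = n + 2" and "x i = (real i - 1) / real (Suc n)" for i
        have P: "is_partition N x" and h: "mesh_size N x = 1 / real (Suc n)"
          using uniform_partition[of n] by (simp_all add: N_def x_def[abs_def])
        have "(LINT y|Leb 0 1. (u t y)\<^sup>2) = (norm_h N x (\<lambda>y. u t y))\<^sup>2"
          using partition_integral[OF P, of "\<lambda>y. (u t y)\<^sup>2"] sq by (simp add: norm_h_squared sq_integrable_def)
        also have "\<dots> \<le> mesh_size N x ^ (2 * (k + 1)) * K"
        proof -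
          have "0 \<le> \<nu> * (LINT s|Leb 0 t. (norm_h N x (\<lambda>y. weak_deriv 1 (u s) y
              - discrete_weak_deriv N x (k + 1) (Weak_Fun (\<lambda>y. 0) (\<lambda>i. 0)) y))\<^sup>2)"
            using \<nu> by (intro mult_nonneg_nonneg) auto
          then show ?thesis
            using main[OF P semidiscrete_solution_zero[OF P g0] t] by simp
        qed
        finally show ?thesis unfolding h .
      qed
      have "(\<lambda>n. (1 / real (Suc n)) ^ (2 * (k + 1)) * K) \<longlonglongrightarrow> 0 ^ (2 * (k + 1)) * K"
        using LIMSEQ_inverse_real_of_nat by (intro tendsto_intros) (simp add: inverse_eq_divide)
      then have "(\<lambda>n. (1 / real (Suc n)) ^ (2 * (k + 1)) * K) \<longlonglongrightarrow> 0" by simp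
      then have "(LINT y|Leb 0 1. (u t y)\<^sup>2) \<le> 0" by (rule LIMSEQ_le_const) (use bound in blast)
      then show ?thesis by (simp add: order.antisym)
    qed
    have u0: "u t y = 0" if t: "t \<in> {0..T}" and y: "y \<in> {0<..<1}" for t y
    proof (cases "t = 0")
      case False
      have c: "continuous_on {0..1} (u t)" by (rule slice[OF t])
      have "AE y in Leb 0 1. (u t y)\<^sup>2 = 0"
      proof (rule integral_nonneg_eq_0_iff_AE[THEN iffD1])
        show "integrable (Leb 0 1) (\<lambda>y. (u t y)\<^sup>2)"
          using continuous_imp_sq_integrable[OF c] by (simp add: sq_integrable_def)
        show "(LINT y|Leb 0 1. (u t y)\<^sup>2) = 0" by (rule int0) (use t False in auto)
      qed simp
      then have "AE y in Leb 0 1. u t y = 0" by simp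
      then show ?thesis
        using y by (intro continuous_AE_eq_imp_eq[OF _ c _ _, of "\<lambda>_. 0"]) auto
    qed (use True y in simp)
    \<comment> \<open>\<open>weak_deriv\<close> is a choice, so the vanishing of \<open>u t\<close>
      determines it only up to null sets; the zero function is exhibited as a weak derivative to
      compare with.\<close>
    have wd: "has_weak_deriv 1 (u t) (\<lambda>y. 0)" if t: "t \<in> {0..T}" for t
      unfolding has_weak_deriv_iff
    proof (intro conjI ballI)
      show "sq_integrable 0 1 (u t)" by (rule continuous_imp_sq_integrable[OF slice[OF t]])
      fix \<phi> :: "real \<Rightarrow> real"
      have "(LINT y|Leb 0 1. u t y * (deriv ^^ 1) \<phi> y) = (LINT y|Leb 0 1. 0)"
        by (rule Bochner_Integration.integral_cong) (use u0[OF t] in auto)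
      then show "(LINT y|Leb 0 1. u t y * (deriv ^^ 1) \<phi> y) = (- 1) ^ 1 * (LINT y|Leb 0 1. 0 * \<phi> y)" by simp
    qed simp
    \<comment> \<open>With all data equal to 0 the estimate bounds the error by 0, so the constant 0
      works and no lower bound on the bracket is required.\<close>
    show ?thesis
    proof (intro exI[of _ 0] allI impI ballI)
      fix N x uh t assume P: "is_partition N x" and sol: "semidiscrete_solution N x k r \<nu> T g uh" and t: "t \<in> {0<..T}"
      have "(norm_h N x (\<lambda>y. u t y - interior_part (uh t) y))\<^sup>2
        + \<nu> * (LINT s|Leb 0 t. (norm_h N x (\<lambda>y. weak_deriv 1 (u s) y - discrete_weak_deriv N x (k + 1) (uh s) y))\<^sup>2)
        \<le> mesh_size N x ^ (2 * (k + 1)) * (2 * 0 + error_amplification C M \<nu> T (LINT t|Leb 0 T. 0) * (LINT t|Leb 0 T. 0))"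
      proof (rule semidiscrete_error[OF P sol[unfolded r] \<nu> T u M bd init, where v = "\<lambda>t y. 0", OF _ _ _ _ _ _ _ _ _ C(2,1) t])
        fix z :: "real \<Rightarrow> real"
        have "(LINT y|Leb 0 1. u t y * z y) = 0" if "t \<in> {0..T}" for t
        proof -
          have "(LINT y|Leb 0 1. u t y * z y) = (LINT y|Leb 0 1. 0)"
            by (rule Bochner_Integration.integral_cong) (use u0[OF that] in auto)
          then show ?thesis by simp
        qed
        then show "primitive_on 0 T (\<lambda>t. LINT y|Leb 0 1. u t y * z y) (\<lambda>t. LINT y|Leb 0 1. 0 * z y)"
          using primitive_on_cong[OF primitive_on_const[of 0 T 0], of "\<lambda>t. LINT y|Leb 0 1. u t y * z y"] T by simp
      next
        show "AE t in Leb 0 T. \<exists>W Z. sobolev_chain (k + 2) W \<and> sobolev_chain k Z \<and>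
          (AE y in Leb 0 1. u t y = W 0 y) \<and> (AE y in Leb 0 1. 0 = Z 0 y) \<and> sq_integrable 0 1 (\<lambda>y. 0) \<and>
          (AE y in Leb 0 1. weak_deriv 1 (u t) y = W 1 y) \<and> sq_integrable 0 1 (weak_deriv 1 (u t)) \<and>
          (AE y in Leb 0 1. Z 0 y + u t y * W 1 y - \<nu> * W 2 y = 0) \<and>
          (\<forall>j\<le>k + 2. (LINT y|Leb 0 1. (W j y)\<^sup>2) \<le> 0) \<and> (\<forall>j\<le>k. (LINT y|Leb 0 1. (Z j y)\<^sup>2) \<le> 0)"
        proof (rule AE_LebI)
          fix t assume t: "0 < t" "t < T"
          then have t': "t \<in> {0..T}" by simp
          have "AE y in Leb 0 1. u t y = 0" by (rule AE_LebI) (use u0[OF t'] in auto)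
          moreover have "AE y in Leb 0 1. weak_deriv 1 (u t) y = 0" by (rule weak_deriv_AE[OF wd[OF t']])
          moreover have "sq_integrable 0 1 (weak_deriv 1 (u t))"
            using has_weak_deriv_weak_deriv[OF wd[OF t']] by (simp add: has_weak_deriv_iff)
          ultimately show "\<exists>W Z. sobolev_chain (k + 2) W \<and> sobolev_chain k Z \<and>
            (AE y in Leb 0 1. u t y = W 0 y) \<and> (AE y in Leb 0 1. 0 = Z 0 y) \<and> sq_integrable 0 1 (\<lambda>y. 0) \<and>
            (AE y in Leb 0 1. weak_deriv 1 (u t) y = W 1 y) \<and> sq_integrable 0 1 (weak_deriv 1 (u t)) \<and>
            (AE y in Leb 0 1. Z 0 y + u t y * W 1 y - \<nu> * W 2 y = 0) \<and>
            (\<forall>j\<le>k + 2. (LINT y|Leb 0 1. (W j y)\<^sup>2) \<le> 0) \<and> (\<forall>j\<le>k. (LINT y|Leb 0 1. (Z j y)\<^sup>2) \<le> 0)"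
            using sobolev_chain_zero by (intro exI[of _ "\<lambda>j y. 0"]) simp
        qed
      next
        fix t assume t: "t \<in> {0<..T}"
        then have t': "t \<in> {0..T}" by simp
        have "(LINT y|Leb (x i) (x (Suc i)). (u t y - poly (proj (x i) (x (Suc i)) k (u t)) y)\<^sup>2) = 0" if i: "i \<in> {1..<N}" for i
        proof -
          note el = partition_elem_subset[OF P i]
          have "proj (x i) (x (Suc i)) k (u t) = proj (x i) (x (Suc i)) k (\<lambda>y. 0)"
            by (rule proj_cong) (use u0[OF t'] el in auto)
          then have "proj (x i) (x (Suc i)) k (u t) = 0" using proj_zero[OF el(2)] by simp
          then have "(LINT y|Leb (x i) (x (Suc i)). (u t y - poly (proj (x i) (x (Suc i)) k (u t)) y)\<^sup>2)
            = (LINT y|Leb (x i) (x (Suc i)). 0)"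
            by (intro Bochner_Integration.integral_cong) (use u0[OF t'] el in auto)
          then show ?thesis by simp
        qed
        then show "(\<Sum>i\<in>{1..<N}. LINT y|Leb (x i) (x (Suc i)). (u t y - poly (proj (x i) (x (Suc i)) k (u t)) y)\<^sup>2)
          \<le> 0 * mesh_size N x ^ (2 * (k + 1))" by simp
      qed auto
      then show "(norm_h N x (\<lambda>y. u t y - interior_part (uh t) y))\<^sup>2
        + \<nu> * (LINT s|Leb 0 t. (norm_h N x (\<lambda>y. weak_deriv 1 (u s) y - discrete_weak_deriv N x r (uh s) y))\<^sup>2)
        \<le> 0 * mesh_size N x ^ (2 * (k + 1)) *
           ((sobolev_norm (k + 2 - 1) (u t))\<^sup>2 + (LINT s|Leb 0 t. (sobolev_norm (k + 2) (u s))\<^sup>2))"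
        unfolding r by simp
    qed
  qed
qed

end
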